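(* Let $V\in C^2(\mathbb{R}^d)$ satisfy $mI_d\preccurlyeq\nabla^2V(x)\preccurlyeq LI_d$ for all $x\in\mathbb{R}^d$, with $0<m\le L$. Let $(\mathcal{G},\Gamma)$ be a stochastic gradient approximation of $V$ satisfying the bounded Jacobian variance assumption with constant $C_G\ge0$ (both defined in the context). Let $\gamma\geq\sqrt{8L}$, $a=1/L$, $b=1/\gamma$, let $p\in\{1,2\}$, assume $\sigma_p<\infty$, and let $$0<h<\min\left\{\frac{1}{2\gamma},\frac{7mL}{32C_G\gamma}\right\}$$ (the second term being $+\infty$ if $C_G=0$). Let $\overline{\pi}_h\in\mathcal{P}_2(\mathbb{R}^{2d})$ be the unique invariant measure of the stochastic gradient UBU (SG-UBU) Markov kernel with stepsize $h$ and friction $\gamma$. Then $$W_{p,a,b}(\overline{\pi},\overline{\pi}_h)\le\frac{\gamma Lh}{mL-\frac{32}{7}hC_G\gamma}\left[\frac{24}{7}\sqrt d\left(\sqrt L+\gamma\right)+\frac{4C_G^{1/2}\sqrt d}{\sqrt L}+4\sigma_p+\frac{9\left(\mathbb{E}_{x\sim\pi}W_p^p(\mu_x*\mathsf{g},\mathsf{g})\right)^{1/p}}{h^2\sqrt L}\right],$$ where $\mathsf{g}=\mathcal{N}(0,I_d)$ and, for each $x\in\mathbb{R}^d$, $\mu_x$ is the law of $he^{-h\gamma/2}(\nabla V(x)-\mathcal{G}(x,\omega))$ for $\omega\sim\Gamma$.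
   Context: **Target.** $\overline{\pi}$ is the probability measure on $\mathbb{R}^{2d}$ with density proportional to $\exp(-V(x)-\|v\|^2/2)$, and $\pi$ is its $x$-marginal (density proportional to $e^{-V}$). **Stochastic gradient.** A stochastic gradient approximation of $V$ is a pair $(\mathcal{G},\Gamma)$, where $\Gamma$ is a probability distribution on a Polish space $\Omega$ and $\mathcal{G}:\mathbb{R}^d\times\Omega\to\mathbb{R}^d$ is measurable with $\mathbb{E}_{\omega\sim\Gamma}\,\mathcal{G}(x,\omega)=\nabla V(x)$ for every $x$. The bounded Jacobian variance assumption with constant $C_G$: for $\Gamma$-a.e. $\omega$ the map $x\mapsto\mathcal{G}(x,\omega)$ is $C^1$ on $\mathbb{R}^d$; $\sup_{x}\mathbb{E}_{\omega\sim\Gamma}\|D_x\mathcal{G}(x,\omega)-\nabla^2V(x)\|_{\mathrm{op}}^2\le C_G$; and there is $x_\star\in\mathbb{R}^d$ with $\mathbb{E}_{\omega\sim\Gamma}\|\mathcal{G}(x_\star,\omega)\|^2<\infty$. Also $\sigma_p:=\left(\mathbb{E}_{X\sim\pi,\,\omega\sim\Gamma}\|\mathcal{G}(X,\omega)-\nabla V(X)\|^p\right)^{1/p}$ ($X,\omega$ independent). **SG-UBU kernel.** Let $\eta=e^{-\gamma h/2}$. For $\xi^{(1)},\xi^{(2)}\in\mathbb{R}^d$ set $Z^{(1)}=\sqrt{h/2}\,\xi^{(1)}$ and $$Z^{(2)}=\sqrt{\tfrac{1-\eta^2}{2\gamma}}\left(\sqrt{\tfrac{1-\eta}{1+\eta}\cdot\tfrac{4}{\gamma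 h}}\;\xi^{(1)}+\sqrt{1-\tfrac{1-\eta}{1+\eta}\cdot\tfrac{4}{\gamma h}}\;\xi^{(2)}\right),$$ $$\mathcal{U}(x,v,\xi^{(1)},\xi^{(2)})=\left(x+\tfrac{1-\eta}{\gamma}v+\sqrt{\tfrac2\gamma}\,(Z^{(1)}-Z^{(2)}),\ \eta v+\sqrt{2\gamma}\,Z^{(2)}\right).$$ One SG-UBU step from $(x,v)$: draw independent $\xi^{(1)},\dots,\xi^{(4)}\sim\mathcal{N}(0,I_d)$ and $\omega\sim\Gamma$; put $(y,w)=\mathcal{U}(x,v,\xi^{(1)},\xi^{(2)})$, then $w'=w-h\,\mathcal{G}(y,\omega)$, and output $\mathcal{U}(y,w',\xi^{(3)},\xi^{(4)})$. Under the stated hypotheses this kernel has a unique invariant measure in $\mathcal{P}_2(\mathbb{R}^{2d})$ (probability measures with finite second moment). **Distances.** For $z=(x,v)\in\mathbb{R}^{2d}$, $\|z\|_{a,b}^2=\|x\|^2+2b\langle x,v\rangle+a\|v\|^2$. $W_{p,a,b}$ is the Wasserstein-$p$ distance on $\mathbb{R}^{2d}$ with cost $\|z_1-z_2\|_{a,b}^p$, i.e. $W_{p,a,b}(\mu,\nu)=\left(\inf_{\tau\in\Pi(\mu,\nu)}\int\|z_1-z_2\|_{a,b}^p\,d\tau\right)^{1/p}$; $W_p$ is the usual Euclidean Wasserstein-$p$ distance on $\mathbb{R}^d$. $*$ is convolution. *)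

theory Defs
  imports "HOL-Probability.Probability"
begin

definition gradient :: "('a::real_inner \<Rightarrow> real) \<Rightarrow> 'a \<Rightarrow> 'a" where
  "gradient f x = (THE g. GDERIV f x :> g)"

definition C1_map :: "('a::real_normed_vector \<Rightarrow> 'b::real_normed_vector) \<Rightarrow> bool" where
  "C1_map f \<longleftrightarrow>
    (\<exists>f' :: 'a \<Rightarrow> 'a \<Rightarrow>\<^sub>L 'b.
      (\<forall>x. (f has_derivative blinfun_apply (f' x)) (at x)) \<and> continuous_on UNIV f')"

definition C2_function :: "('a::real_inner \<Rightarrow> real) \<Rightarrow> bool" where
  "C2_function f \<longleftrightarrow> (\<forall>x. f differentiable (at x)) \<and> C1_map (gradient f)"

definition hessian :: "('a::real_inner \<Rightarrow> real) \<Rightarrow> 'a \<Rightarrow> 'a \<Rightarrow> 'a" where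
  "hessian f x = frechet_derivative (gradient f) (at x)"

text \<open>The Loewner order, to be used for self-adjoint operators only (Hessians of \<open>C\<^sup>2\<close> functions
  and multiples of the identity).\<close>

definition loewner_le :: "('a::real_inner \<Rightarrow> 'a) \<Rightarrow> ('a \<Rightarrow> 'a) \<Rightarrow> bool" where
  "loewner_le A B \<longleftrightarrow> (\<forall>u. u \<bullet> A u \<le> u \<bullet> B u)"

definition P2 :: "'a::euclidean_space measure set" where
  "P2 = {\<mu>. prob_space \<mu> \<and> sets \<mu> = sets borel \<and> (\<integral>\<^sup>+ z. ennreal ((norm z)\<^sup>2) \<partial>\<mu>) < \<infinity>}"

text \<open>The probability measure with Lebesgue density proportional to \<open>exp (- U)\<close>;
  meaningful only if \<open>exp (- U)\<close> has a finite integral.\<close>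

definition gibbs :: "('a::euclidean_space \<Rightarrow> real) \<Rightarrow> 'a measure" where
  "gibbs U = density lborel
    (\<lambda>z. ennreal (exp (- U z)) / (\<integral>\<^sup>+ z'. ennreal (exp (- U z')) \<partial>lborel))"

definition std_gaussian :: "(real ^ 'd) measure" where
  "std_gaussian = density lborel
    (\<lambda>x. ennreal (exp (- (norm x)\<^sup>2 / 2) / sqrt ((2 * pi) ^ CARD('d))))"

definition couplings :: "'a measure \<Rightarrow> 'b measure \<Rightarrow> ('a \<times> 'b) measure set" where
  "couplings \<mu> \<nu> =
    {\<tau>. sets \<tau> = sets (\<mu> \<Otimes>\<^sub>M \<nu>) \<and> distr \<tau> \<mu> fst = \<mu> \<and> distr \<tau> \<nu> snd = \<nu>}"

definition ennreal_root :: "nat \<Rightarrow> ennreal \<Rightarrow> ennreal" where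
  "ennreal_root p x = (if x = \<infinity> then \<infinity> else ennreal (root p (enn2real x)))"

text \<open>The Wasserstein-\<open>p\<close> distance for the metric \<open>(z\<^sub>1, z\<^sub>2) \<mapsto> N (z\<^sub>1 - z\<^sub>2)\<close> induced by a norm \<open>N\<close>.\<close>

definition wasserstein ::
    "('a::real_normed_vector \<Rightarrow> real) \<Rightarrow> nat \<Rightarrow> 'a measure \<Rightarrow> 'a measure \<Rightarrow> ennreal" where
  "wasserstein N p \<mu> \<nu> = ennreal_root p
    (INF \<tau>\<in>couplings \<mu> \<nu>. \<integral>\<^sup>+ (z1, z2). ennreal (N (z1 - z2) ^ p) \<partial>\<tau>)"

definition norm_ab :: "real \<Rightarrow> real \<Rightarrow> 'a::real_inner \<times> 'a \<Rightarrow> real" where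
  "norm_ab a b = (\<lambda>(x, v). sqrt ((norm x)\<^sup>2 + 2 * b * (x \<bullet> v) + a * (norm v)\<^sup>2))"

definition target :: "('a::euclidean_space \<Rightarrow> real) \<Rightarrow> ('a \<times> 'a) measure" where
  "target V = gibbs (\<lambda>(x, v). V x + (norm v)\<^sup>2 / 2)"

definition target_marginal :: "('a::euclidean_space \<Rightarrow> real) \<Rightarrow> 'a measure" where
  "target_marginal V = distr (target V) borel fst"

definition stochastic_gradient ::
    "('a::euclidean_space \<Rightarrow> real) \<Rightarrow> ('a \<Rightarrow> 'w::polish_space \<Rightarrow> 'a) \<Rightarrow> 'w measure \<Rightarrow> bool" where
  "stochastic_gradient V G \<Gamma> \<longleftrightarrow>
    prob_space \<Gamma> \<and> sets \<Gamma> = sets borel \<and>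
    (\<lambda>(x, \<omega>). G x \<omega>) \<in> borel_measurable (borel \<Otimes>\<^sub>M \<Gamma>) \<and>
    (\<forall>x. integrable \<Gamma> (G x) \<and> (\<integral>\<omega>. G x \<omega> \<partial>\<Gamma>) = gradient V x)"

text \<open>The Jacobian of \<open>G\<close> is an unspecified function at the points where it does not exist; by the
  first clause this concerns a null set of \<open>\<omega>\<close>, which the integral ignores.\<close>

definition bounded_jacobian_variance ::
    "('a::euclidean_space \<Rightarrow> real) \<Rightarrow> ('a \<Rightarrow> 'w::polish_space \<Rightarrow> 'a) \<Rightarrow> 'w measure \<Rightarrow> real \<Rightarrow> bool"
  where
  "bounded_jacobian_variance V G \<Gamma> C \<longleftrightarrow>
    (AE \<omega> in \<Gamma>. C1_map (\<lambda>x. G x \<omega>)) \<and>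
    (SUP x. \<integral>\<^sup>+ \<omega>. ennreal ((onorm (\<lambda>u.
        frechet_derivative (\<lambda>y. G y \<omega>) (at x) u - hessian V x u))\<^sup>2) \<partial>\<Gamma>) \<le> ennreal C \<and>
    (\<exists>xs. (\<integral>\<^sup>+ \<omega>. ennreal ((norm (G xs \<omega>))\<^sup>2) \<partial>\<Gamma>) < \<infinity>)"

definition gradient_noise ::
    "nat \<Rightarrow> ('a::euclidean_space \<Rightarrow> real) \<Rightarrow> ('a \<Rightarrow> 'w::polish_space \<Rightarrow> 'a) \<Rightarrow> 'w measure \<Rightarrow> ennreal"
  where
  "gradient_noise p V G \<Gamma> = ennreal_root p
    (\<integral>\<^sup>+ (x, \<omega>). ennreal (norm (G x \<omega> - gradient V x) ^ p) \<partial>(target_marginal V \<Otimes>\<^sub>M \<Gamma>))"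

text \<open>With \<open>t = \<gamma> h / 4\<close>, the number \<open>r\<close> below is \<open>tanh t / t\<close>, so \<open>0 < r < 1\<close> for \<open>\<gamma>, h > 0\<close>.\<close>

definition ubu_U ::
    "real \<Rightarrow> real \<Rightarrow> 'a \<times> 'a \<Rightarrow> 'a::euclidean_space \<Rightarrow> 'a \<Rightarrow> 'a \<times> 'a" where
  "ubu_U \<gamma> h = (\<lambda>(x, v) \<xi>1 \<xi>2.
    let \<eta> = exp (- \<gamma> * h / 2);
        r = (1 - \<eta>) / (1 + \<eta>) * (4 / (\<gamma> * h));
        Z1 = sqrt (h / 2) *\<^sub>R \<xi>1;
        Z2 = sqrt ((1 - \<eta>\<^sup>2) / (2 * \<gamma>)) *\<^sub>R (sqrt r *\<^sub>R \<xi>1 + sqrt (1 - r) *\<^sub>R \<xi>2)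
    in (x + ((1 - \<eta>) / \<gamma>) *\<^sub>R v + sqrt (2 / \<gamma>) *\<^sub>R (Z1 - Z2),
        \<eta> *\<^sub>R v + sqrt (2 * \<gamma>) *\<^sub>R Z2))"

definition sg_ubu_step ::
    "real \<Rightarrow> real \<Rightarrow> ('a \<Rightarrow> 'w \<Rightarrow> 'a) \<Rightarrow> 'a \<times> 'a \<Rightarrow>
     'a::euclidean_space \<Rightarrow> 'a \<Rightarrow> 'a \<Rightarrow> 'a \<Rightarrow> 'w \<Rightarrow> 'a \<times> 'a" where
  "sg_ubu_step \<gamma> h G z \<xi>1 \<xi>2 \<xi>3 \<xi>4 \<omega> =
    (let (y, w) = ubu_U \<gamma> h z \<xi>1 \<xi>2 in ubu_U \<gamma> h (y, w - h *\<^sub>R G y \<omega>) \<xi>3 \<xi>4)"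

definition sg_ubu_kernel ::
    "real \<Rightarrow> real \<Rightarrow> (real ^ 'd \<Rightarrow> 'w \<Rightarrow> real ^ 'd) \<Rightarrow> 'w measure \<Rightarrow>
     (real ^ 'd) \<times> (real ^ 'd) \<Rightarrow> ((real ^ 'd) \<times> (real ^ 'd)) measure" where
  "sg_ubu_kernel \<gamma> h G \<Gamma> z =
    distr (std_gaussian \<Otimes>\<^sub>M std_gaussian \<Otimes>\<^sub>M std_gaussian \<Otimes>\<^sub>M std_gaussian \<Otimes>\<^sub>M \<Gamma>) borel
      (\<lambda>(\<xi>1, \<xi>2, \<xi>3, \<xi>4, \<omega>). sg_ubu_step \<gamma> h G z \<xi>1 \<xi>2 \<xi>3 \<xi>4 \<omega>)"

definition invariant_measure :: "('a \<Rightarrow> 'a measure) \<Rightarrow> 'a measure \<Rightarrow> bool" where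
  "invariant_measure K \<mu> \<longleftrightarrow> \<mu> \<bind> K = \<mu>"

definition scaled_noise_law ::
    "real \<Rightarrow> real \<Rightarrow> ('a::euclidean_space \<Rightarrow> real) \<Rightarrow> ('a \<Rightarrow> 'w \<Rightarrow> 'a) \<Rightarrow> 'w measure \<Rightarrow> 'a \<Rightarrow> 'a measure"
  where
  "scaled_noise_law \<gamma> h V G \<Gamma> x =
    distr \<Gamma> borel (\<lambda>\<omega>. (h * exp (- h * \<gamma> / 2)) *\<^sub>R (gradient V x - G x \<omega>))"

end

theory Submission
  imports Defs
begin

text \<open>A coupling \<open>\<tau>\<close> of the target and an invariant measure is improved by one coupled step. The second
  component makes an SG-UBU step. The first moves by a Markov transition that preserves the target:
  the Hamiltonian flow for the time \<open>h1\<close>, where \<open>h1\<^sup>2\<close> is the variance of the Gaussian part of the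
  position increment of the step, started from a velocity read off the same Gaussians. Two SG-UBU
  steps with common noise contract in mean square at a rate \<open>c\<close>, by cocoercivity of the gradient. An
  SG-UBU step and the flow transition from a common point differ by a local error of order \<open>h\<^sup>2\<close>
  once the final Gaussian velocity, perturbed by the gradient noise, is coupled near-optimally with a
  standard Gaussian, which costs \<open>W\<^sub>p (\<mu>\<^sub>x * g, g)\<close>. Hence \<open>W \<le> E + (1 - c) W\<close>, and \<open>W \<le> E / c\<close>. The
  underdamped Langevin diffusion itself does not occur.\<close>

section \<open>Strongly convex potentials with Lipschitz gradient\<close>

text \<open>The gradient noise perturbs the velocity at order h, the order of the contraction rate
  itself, so as a plain error it would not become small with h. Hence it is merged into the final
  Gaussian velocity; what remains of it is a direct contribution of order \<open>h\<^sup>2\<close>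
  to the position, the source of the \<open>\<sigma>\<^sub>p\<close> term. The time
  \<open>h1\<close> is forced: written as \<open>h1\<close> times a standard Gaussian velocity, the
  Gaussian part of the position increment becomes the free motion of the flow. The Gaussian parts
  then match, and only force coefficients are left to compare: \<open>h1\<^sup>2 / 2\<close> with
  \<open>\<kappa> * h\<close> in the position, \<open>c1\<close> with \<open>\<eta> * h\<close> in
  the velocity. Two measure-theoretic obstacles shape the coupling: the partner of the perturbed
  Gaussian must depend measurably on the position, and it must be glued to the other variables of
  the step. Both are met by countable partitions, at the price of an error that is sent to zero.
  Contraction and most errors are estimated in mean square and passed to p = 1 by Cauchy-Schwarz;
  the exponent p survives only in the noise and in the Gaussian mismatch.\<close>

lemma gderiv_gradient:
  fixes f :: "'a::euclidean_space \<Rightarrow> real"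
  assumes "f differentiable (at x)"
  shows "GDERIV f x :> gradient f x"
proof -
  obtain D where D: "(f has_derivative D) (at x)"
    using assms by (auto simp: differentiable_def)
  interpret D: bounded_linear D
    using D by (rule has_derivative_bounded_linear)
  define g where "g = (\<Sum>b\<in>Basis. D b *\<^sub>R b)"
  have "D u = u \<bullet> g" for u
  proof -
    have "D u = D (\<Sum>b\<in>Basis. (u \<bullet> b) *\<^sub>R b)" by (simp add: euclidean_representation)
    also have "\<dots> = u \<bullet> g" by (simp add: g_def D.sum D.scaleR inner_sum_right mult.commute)
    finally show ?thesis .
  qed
  then have "D = (\<lambda>u. u \<bullet> g)" by blast
  then have g: "GDERIV f x :> g" using D by (simp add: gderiv_def)
  \<comment> \<open>\<open>gradient\<close> is a definite description, so uniqueness of the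
    representing vector is needed besides its existence.\<close>
  have "g' = g" if "GDERIV f x :> g'" for g'
  proof -
    have "(\<lambda>u. u \<bullet> g') = (\<lambda>u. u \<bullet> g)"
      using that g unfolding gderiv_def by (rule has_derivative_unique)
    then have "(g' - g) \<bullet> (g' - g) = 0"
      by (metis inner_diff_right right_minus_eq)
    then show ?thesis by simp
  qed
  then show ?thesis unfolding gradient_def using g by (rule theI[where P="\<lambda>g. GDERIV f x :> g", rotated])
qed

lemma has_real_derivative_along_line:
  fixes f :: "'a::real_inner \<Rightarrow> real"
  assumes "\<And>x. GDERIV f x :> g x"
  shows "((\<lambda>s. f (x + s *\<^sub>R u)) has_real_derivative g (x + s *\<^sub>R u) \<bullet> u) (at s)"
proof -
  have "((\<lambda>s. x + s *\<^sub>R u) has_derivative (\<lambda>d. d *\<^sub>R u)) (at s)"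
    by (auto intro!: derivative_eq_intros)
  moreover have "(f has_derivative (\<lambda>d. d \<bullet> g (x + s *\<^sub>R u))) (at (x + s *\<^sub>R u))"
    using assms by (simp add: gderiv_def)
  ultimately have "((\<lambda>s. f (x + s *\<^sub>R u)) has_derivative (\<lambda>d. d *\<^sub>R u \<bullet> g (x + s *\<^sub>R u))) (at s)"
    by (rule has_derivative_compose)
  then show ?thesis
    by (simp add: has_field_derivative_def inner_commute mult.commute[of _ "_ \<bullet> _"])
qed

text \<open>The mean value theorem is applied to a scalar function, the component of
  \<open>g\<close> along the segment, so that the quadratic form of \<open>H\<close> at one
  intermediate point decides.\<close>

lemma gradient_increment_bounds:
  fixes g :: "'a::real_inner \<Rightarrow> 'a"
  assumes g: "\<And>x. (g has_derivative H x) (at x)"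
    and lo: "\<And>x u. m * (u \<bullet> u) \<le> u \<bullet> H x u" and up: "\<And>x u. u \<bullet> H x u \<le> L * (u \<bullet> u)"
  shows "m * (norm (x - y))\<^sup>2 \<le> (g x - g y) \<bullet> (x - y)"
    and "(g x - g y) \<bullet> (x - y) \<le> L * (norm (x - y))\<^sup>2"
proof -
  define u where "u = x - y"
  define \<phi> where "\<phi> = (\<lambda>s. g (y + s *\<^sub>R u) \<bullet> u)"
  have d: "(\<phi> has_real_derivative H (y + s *\<^sub>R u) u \<bullet> u) (at s)" for s
  proof -
    interpret H: bounded_linear "H (y + s *\<^sub>R u)" using g by (rule has_derivative_bounded_linear)
    have "((\<lambda>s. y + s *\<^sub>R u) has_derivative (\<lambda>d. d *\<^sub>R u)) (at s)"
      by (auto intro!: derivative_eq_intros)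
    from has_derivative_compose[OF this g]
    have "((\<lambda>s. g (y + s *\<^sub>R u)) has_derivative (\<lambda>d. H (y + s *\<^sub>R u) (d *\<^sub>R u))) (at s)" .
    from has_derivative_inner_left[OF this, of u]
    have "(\<phi> has_derivative (\<lambda>d. H (y + s *\<^sub>R u) (d *\<^sub>R u) \<bullet> u)) (at s)" by (simp add: \<phi>_def)
    also have "(\<lambda>d. H (y + s *\<^sub>R u) (d *\<^sub>R u) \<bullet> u) = (*) (H (y + s *\<^sub>R u) u \<bullet> u)"
      by (auto simp: H.scaleR)
    finally show ?thesis by (simp add: has_field_derivative_def)
  qed
  obtain z where z: "\<phi> 1 - \<phi> 0 = (1 - 0) * (H (y + z *\<^sub>R u) u \<bullet> u)"
    using MVT2[of 0 1 \<phi> "\<lambda>s. H (y + s *\<^sub>R u) u \<bullet> u"] d by auto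
  then have "(g x - g y) \<bullet> (x - y) = u \<bullet> H (y + z *\<^sub>R u) u"
    by (simp add: \<phi>_def u_def inner_diff_left) (simp add: inner_diff_left inner_diff_right inner_commute)
  then show "m * (norm (x - y))\<^sup>2 \<le> (g x - g y) \<bullet> (x - y)"
    "(g x - g y) \<bullet> (x - y) \<le> L * (norm (x - y))\<^sup>2"
    using lo[of u] up[of u] by (auto simp: u_def dot_square_norm)
qed

text \<open>Along the segment from \<open>x\<close> to \<open>y\<close>, \<open>V\<close> minus its
  linearisation minus a parabola is monotone: increasing for the parabola with \<open>m\<close>,
  decreasing for the one with \<open>L\<close>.\<close>

lemma quadratic_bounds_of_monotone_gradient:
  fixes V :: "'a::real_inner \<Rightarrow> real"
  assumes V: "\<And>x. GDERIV V x :> g x"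
    and lo: "\<And>x y. m * (norm (x - y))\<^sup>2 \<le> (g x - g y) \<bullet> (x - y)"
    and up: "\<And>x y. (g x - g y) \<bullet> (x - y) \<le> L * (norm (x - y))\<^sup>2"
  shows "V x + g x \<bullet> (y - x) + m / 2 * (norm (y - x))\<^sup>2 \<le> V y"
    and "V y \<le> V x + g x \<bullet> (y - x) + L / 2 * (norm (y - x))\<^sup>2"
proof -
  define u where "u = y - x"
  have d: "((\<lambda>s. V (x + s *\<^sub>R u) - s * (g x \<bullet> u) - c / 2 * s\<^sup>2 * (norm u)\<^sup>2) has_real_derivative
      (g (x + s *\<^sub>R u) - g x) \<bullet> u - c * s * (norm u)\<^sup>2) (at s)" for s c
    by (rule derivative_eq_intros has_real_derivative_along_line[OF V] refl)+
       (simp add: inner_diff_left)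
  have lo': "0 \<le> (g (x + s *\<^sub>R u) - g x) \<bullet> u - m * s * (norm u)\<^sup>2" if "0 \<le> s" for s
  proof (cases "s = 0")
    case False
    have "s * (m * s * (norm u)\<^sup>2) \<le> s * ((g (x + s *\<^sub>R u) - g x) \<bullet> u)"
      using lo[of "x + s *\<^sub>R u" x] by (simp add: power_mult_distrib power2_eq_square mult_ac)
    then show ?thesis using False that by simp
  qed auto
  have up': "(g (x + s *\<^sub>R u) - g x) \<bullet> u - L * s * (norm u)\<^sup>2 \<le> 0" if "0 \<le> s" for s
  proof (cases "s = 0")
    case False
    have "s * ((g (x + s *\<^sub>R u) - g x) \<bullet> u) \<le> s * (L * s * (norm u)\<^sup>2)"
      using up[of "x + s *\<^sub>R u" x] by (simp add: power_mult_distrib power2_eq_square mult_ac)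
    then show ?thesis using False that by simp
  qed auto
  have "V (x + 0 *\<^sub>R u) - 0 * (g x \<bullet> u) - m / 2 * 0\<^sup>2 * (norm u)\<^sup>2
      \<le> V (x + 1 *\<^sub>R u) - 1 * (g x \<bullet> u) - m / 2 * 1\<^sup>2 * (norm u)\<^sup>2"
    by (rule DERIV_nonneg_imp_nondecreasing[of 0 1 "\<lambda>s. V (x + s *\<^sub>R u) - s * (g x \<bullet> u) - m / 2 * s\<^sup>2 * (norm u)\<^sup>2"])
       (simp, intro exI conjI, rule d, rule lo')
  then show "V x + g x \<bullet> (y - x) + m / 2 * (norm (y - x))\<^sup>2 \<le> V y" by (simp add: u_def)
  have "V (x + 1 *\<^sub>R u) - 1 * (g x \<bullet> u) - L / 2 * 1\<^sup>2 * (norm u)\<^sup>2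
      \<le> V (x + 0 *\<^sub>R u) - 0 * (g x \<bullet> u) - L / 2 * 0\<^sup>2 * (norm u)\<^sup>2"
    by (rule DERIV_nonpos_imp_nonincreasing[of 0 1 "\<lambda>s. V (x + s *\<^sub>R u) - s * (g x \<bullet> u) - L / 2 * s\<^sup>2 * (norm u)\<^sup>2"])
       (simp, intro exI conjI, rule d, rule up')
  then show "V y \<le> V x + g x \<bullet> (y - x) + L / 2 * (norm (y - x))\<^sup>2" by (simp add: u_def)
qed

text \<open>The Baillon--Haddad argument: one gradient step from \<open>y\<close> towards \<open>x\<close>. It needs no symmetry
  of the derivative of \<open>g\<close>.\<close>

lemma cocoercive_of_quadratic_bounds:
  fixes V :: "'a::real_inner \<Rightarrow> real"
  assumes "0 < L"
    and lo: "\<And>x y. V x + g x \<bullet> (y - x) \<le> V y"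
    and up: "\<And>x y. V y \<le> V x + g x \<bullet> (y - x) + L / 2 * (norm (y - x))\<^sup>2"
  shows "(norm (g x - g y))\<^sup>2 \<le> L * ((g x - g y) \<bullet> (x - y))"
proof -
  have *: "(norm (g y - g x))\<^sup>2 / (2 * L) \<le> V y - V x - g x \<bullet> (y - x)" for x y
  proof -
    define d where "d = g y - g x"
    \<comment> \<open>The minimiser of the upper quadratic model at \<open>y\<close> of
      \<open>V\<close> minus its linearisation at \<open>x\<close>.\<close>
    define w where "w = y - (1 / L) *\<^sub>R d"
    have "V x + g x \<bullet> (w - x) \<le> V y + g y \<bullet> (w - y) + L / 2 * (norm (w - y))\<^sup>2"
      using lo[of x w] up[of w y] by linarith
    moreover have "L / 2 * (norm (w - y))\<^sup>2 = (norm d)\<^sup>2 / (2 * L)"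
      using assms(1) by (simp add: w_def power2_eq_square field_simps)
    moreover have "g y \<bullet> (w - y) - g x \<bullet> (w - x) = - (g x \<bullet> (y - x)) - (norm d)\<^sup>2 / L"
    proof -
      have "g y \<bullet> (w - y) - g x \<bullet> (w - x) = - (d \<bullet> d) / L - g x \<bullet> (y - x)"
        unfolding w_def d_def by (simp add: inner_diff_left inner_diff_right inner_commute diff_divide_distrib add_divide_distrib)
      then show ?thesis by (simp add: power2_norm_eq_inner)
    qed
    moreover have "(norm d)\<^sup>2 / L = 2 * ((norm d)\<^sup>2 / (2 * L))" using assms(1) by simp
    ultimately show ?thesis unfolding d_def by linarith
  qed
  \<comment> \<open>Exchanging \<open>x\<close> and \<open>y\<close> and adding cancels the values
    of \<open>V\<close>.\<close>
  have "(norm (g x - g y))\<^sup>2 / (2 * L) + (norm (g x - g y))\<^sup>2 / (2 * L) \<le> (g x - g y) \<bullet> (x - y)"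
    using *[of x y] *[of y x]
    by (simp add: norm_minus_commute inner_diff_left inner_diff_right)
  then show ?thesis using assms(1) by (simp add: field_simps)
qed

text \<open>The consequences of the Hessian bounds on which the flow, the target and the contraction
  rest. After \<open>convex_potential_of_C2\<close> the Hessian returns only in the Jacobian
  variance.\<close>

locale convex_potential =
  fixes V :: "'a::euclidean_space \<Rightarrow> real" and f :: "'a \<Rightarrow> 'a" and m L :: real
  assumes gderiv: "\<And>x. GDERIV V x :> f x"
    and m_pos: "0 < m" and m_le_L: "m \<le> L"
    and mono: "\<And>x y. m * (norm (x - y))\<^sup>2 \<le> (f x - f y) \<bullet> (x - y)"
    and cocoercive: "\<And>x y. (norm (f x - f y))\<^sup>2 \<le> L * ((f x - f y) \<bullet> (x - y))"
    and lower: "\<And>x y. V x + f x \<bullet> (y - x) + m / 2 * (norm (y - x))\<^sup>2 \<le> V y"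
    and upper: "\<And>x y. V y \<le> V x + f x \<bullet> (y - x) + L / 2 * (norm (y - x))\<^sup>2"
begin

lemma L_pos: "0 < L" using m_pos m_le_L by simp

lemma lipschitz: "norm (f x - f y) \<le> L * norm (x - y)"
proof (cases "f x = f y")
  case False
  have "norm (f x - f y) * norm (f x - f y) \<le> L * (norm (f x - f y) * norm (x - y))"
    using cocoercive[of x y] norm_cauchy_schwarz[of "f x - f y" "x - y"] L_pos
    by (smt (verit) mult_left_mono power2_eq_square)
  then show ?thesis using False by (simp add: mult.left_commute mult_le_cancel_left)
qed (use L_pos in simp)

lemma continuous_f: "continuous_on S f"
  by (rule lipschitz_on_continuous_on[of L], rule lipschitz_onI)
     (use lipschitz L_pos in \<open>auto simp: dist_norm\<close>)

lemma continuous_V: "continuous_on S V"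
proof -
  have "isCont V x" for x
    using gderiv[of x] unfolding gderiv_def by (rule has_derivative_continuous)
  then show ?thesis by (simp add: continuous_at_imp_continuous_on)
qed

end

lemma C2_function_hessian:
  fixes V :: "'a::euclidean_space \<Rightarrow> real"
  assumes "C2_function V"
  shows "(gradient V has_derivative hessian V x) (at x)"
proof -
  obtain f' :: "'a \<Rightarrow> 'a \<Rightarrow>\<^sub>L 'a" where "(gradient V has_derivative blinfun_apply (f' x)) (at x)"
    using assms unfolding C2_function_def C1_map_def by blast
  then show ?thesis unfolding hessian_def by (simp add: frechet_derivative_at[symmetric])
qed

lemma convex_potential_of_C2:
  fixes V :: "'a::euclidean_space \<Rightarrow> real"
  assumes V: "C2_function V" and m: "0 < m" "m \<le> L"
    and lo: "\<And>x. loewner_le (\<lambda>u. m *\<^sub>R u) (hessian V x)"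
    and up: "\<And>x. loewner_le (hessian V x) (\<lambda>u. L *\<^sub>R u)"
  shows "convex_potential V (gradient V) m L"
proof -
  have g: "\<And>x. GDERIV V x :> gradient V x"
    using V by (auto simp: C2_function_def intro: gderiv_gradient)
  have lo': "m * (u \<bullet> u) \<le> u \<bullet> hessian V x u" and up': "u \<bullet> hessian V x u \<le> L * (u \<bullet> u)" for x u
    using lo[of x] up[of x] by (auto simp: loewner_le_def)
  note b = gradient_increment_bounds[OF C2_function_hessian[OF V] lo' up']
  note q = quadratic_bounds_of_monotone_gradient[OF g b]
  have "V x + gradient V x \<bullet> (y - x) \<le> V y" for x y
    using q(1)[of x y] m(1) by (smt (verit) mult_nonneg_nonneg zero_le_power2 half_gt_zero)
  from cocoercive_of_quadratic_bounds[OF _ this q(2)] m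
  have "\<And>x y. (norm (gradient V x - gradient V y))\<^sup>2 \<le> L * ((gradient V x - gradient V y) \<bullet> (x - y))"
    by auto
  then show ?thesis using g m b q by unfold_locales auto
qed

section \<open>Gaussian integrals\<close>

lemma nn_integral_lborel_translate:
  fixes F :: "'a::euclidean_space \<Rightarrow> ennreal"
  assumes [measurable]: "F \<in> borel_measurable borel"
  shows "(\<integral>\<^sup>+ x. F (x + c) \<partial>lborel) = (\<integral>\<^sup>+ x. F x \<partial>lborel)"
proof -
  have "(\<integral>\<^sup>+ x. F x \<partial>lborel) = (\<integral>\<^sup>+ x. F x \<partial>distr lborel borel ((+) c))"
    by (simp add: lborel_distr_plus)
  also have "\<dots> = (\<integral>\<^sup>+ x. F (c + x) \<partial>lborel)"
    by (subst nn_integral_distr) auto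
  finally show ?thesis by (simp add: add.commute)
qed

text \<open>On each fibre a shear is a translation; for the second formula the order of integration
  is exchanged so that the fibres are the right ones.\<close>

lemma nn_integral_lborel_shear:
  fixes F :: "'a::euclidean_space \<Rightarrow> 'a \<Rightarrow> ennreal"
  assumes F: "case_prod F \<in> borel_measurable (borel \<Otimes>\<^sub>M borel)"
  shows "(\<integral>\<^sup>+ u. \<integral>\<^sup>+ v. F u (v + a *\<^sub>R u) \<partial>lborel \<partial>lborel) = (\<integral>\<^sup>+ u. \<integral>\<^sup>+ v. F u v \<partial>lborel \<partial>lborel)"
    and "(\<integral>\<^sup>+ u. \<integral>\<^sup>+ v. F (u + a *\<^sub>R v) v \<partial>lborel \<partial>lborel) = (\<integral>\<^sup>+ u. \<integral>\<^sup>+ v. F u v \<partial>lborel \<partial>lborel)"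
proof -
  have [measurable]: "(\<lambda>z. F (f z) (g z)) \<in> borel_measurable M"
    if [measurable]: "f \<in> borel_measurable M" "g \<in> borel_measurable M" for f g and M :: "'b measure"
    using measurable_compose[OF measurable_Pair[OF that] F] by simp
  show "(\<integral>\<^sup>+ u. \<integral>\<^sup>+ v. F u (v + a *\<^sub>R u) \<partial>lborel \<partial>lborel) = (\<integral>\<^sup>+ u. \<integral>\<^sup>+ v. F u v \<partial>lborel \<partial>lborel)"
    by (intro nn_integral_cong nn_integral_lborel_translate) simp
  have "(\<integral>\<^sup>+ u. \<integral>\<^sup>+ v. F (u + a *\<^sub>R v) v \<partial>lborel \<partial>lborel) = (\<integral>\<^sup>+ v. \<integral>\<^sup>+ u. F (u + a *\<^sub>R v) v \<partial>lborel \<partial>lborel)"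
    by (rule lborel_pair.Fubini'[symmetric]) simp
  also have "\<dots> = (\<integral>\<^sup>+ v. \<integral>\<^sup>+ u. F u v \<partial>lborel \<partial>lborel)"
    by (intro nn_integral_cong nn_integral_lborel_translate) simp
  also have "\<dots> = (\<integral>\<^sup>+ u. \<integral>\<^sup>+ v. F u v \<partial>lborel \<partial>lborel)"
    by (rule lborel_pair.Fubini') simp
  finally show "(\<integral>\<^sup>+ u. \<integral>\<^sup>+ v. F (u + a *\<^sub>R v) v \<partial>lborel \<partial>lborel) = (\<integral>\<^sup>+ u. \<integral>\<^sup>+ v. F u v \<partial>lborel \<partial>lborel)" .
qed

text \<open>A rotation is a product of three shears.\<close>

lemma nn_integral_lborel_rotation:
  fixes F :: "'a::euclidean_space \<Rightarrow> 'a \<Rightarrow> ennreal"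
  assumes F: "case_prod F \<in> borel_measurable (borel \<Otimes>\<^sub>M borel)"
    and cs: "c\<^sup>2 + s\<^sup>2 = 1" "s = 0 \<Longrightarrow> c = 1"
  shows "(\<integral>\<^sup>+ u. \<integral>\<^sup>+ v. F (c *\<^sub>R u + s *\<^sub>R v) (c *\<^sub>R v - s *\<^sub>R u) \<partial>lborel \<partial>lborel)
    = (\<integral>\<^sup>+ u. \<integral>\<^sup>+ v. F u v \<partial>lborel \<partial>lborel)"
proof (cases "s = 0")
  case False
  \<comment> \<open>The tangent of half the rotation angle; the shears have parameters
    \<open>\<alpha>\<close>, \<open>- s\<close>, \<open>\<alpha>\<close>. The half turn
    \<open>c = -1\<close>, where this tangent is infinite, is excluded by the hypothesis on
    \<open>s = 0\<close>.\<close>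
  define \<alpha> where "\<alpha> = (1 - c) / s"
  have m: "(\<lambda>z. F (f z) (g z)) \<in> borel_measurable M"
    if [measurable]: "f \<in> borel_measurable M" "g \<in> borel_measurable M" for f g and M :: "'b measure"
    using measurable_compose[OF measurable_Pair[OF that] F] by simp
  have as: "\<alpha> * s = 1 - c" using False by (simp add: \<alpha>_def)
  have "\<alpha> * (1 + c) = s * (c\<^sup>2 + s\<^sup>2)" using False cs(1)
    by (simp add: \<alpha>_def field_simps power2_eq_square)
  then have ac: "\<alpha> * (1 + c) = s" using cs(1) by simp
  have 1: "c *\<^sub>R u + s *\<^sub>R v = (u + \<alpha> *\<^sub>R v) + \<alpha> *\<^sub>R (v + (- s) *\<^sub>R (u + \<alpha> *\<^sub>R v))" for u v :: 'a
  proof -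
    have "(u + \<alpha> *\<^sub>R v) + \<alpha> *\<^sub>R (v + (- s) *\<^sub>R (u + \<alpha> *\<^sub>R v))
      = (1 - \<alpha> * s) *\<^sub>R u + (\<alpha> + \<alpha> - \<alpha> * (\<alpha> * s)) *\<^sub>R v"
      by (simp only: scaleR_add_left scaleR_diff_left scaleR_add_right scaleR_scaleR) (simp add: algebra_simps)
    also have "\<alpha> + \<alpha> - \<alpha> * (\<alpha> * s) = s" using ac by (simp add: as algebra_simps)
    also have "(1 - \<alpha> * s) *\<^sub>R u + s *\<^sub>R v = c *\<^sub>R u + s *\<^sub>R v" by (simp add: as)
    finally show ?thesis by simp
  qed
  have 2: "c *\<^sub>R v - s *\<^sub>R u = v + (- s) *\<^sub>R (u + \<alpha> *\<^sub>R v)" for u v :: 'a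
  proof -
    have "v + (- s) *\<^sub>R (u + \<alpha> *\<^sub>R v) = (1 - \<alpha> * s) *\<^sub>R v - s *\<^sub>R u" by (simp add: algebra_simps)
    then show ?thesis by (simp add: as)
  qed
  have "(\<integral>\<^sup>+ u. \<integral>\<^sup>+ v. F (c *\<^sub>R u + s *\<^sub>R v) (c *\<^sub>R v - s *\<^sub>R u) \<partial>lborel \<partial>lborel)
    = (\<integral>\<^sup>+ u. \<integral>\<^sup>+ v. F (u + \<alpha> *\<^sub>R (v + (- s) *\<^sub>R u)) (v + (- s) *\<^sub>R u) \<partial>lborel \<partial>lborel)"
    unfolding 1 2
    by (rule nn_integral_lborel_shear(2)[of "\<lambda>u v. F (u + \<alpha> *\<^sub>R (v + (- s) *\<^sub>R u)) (v + (- s) *\<^sub>R u)"])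
       (auto simp: case_prod_beta' intro!: m)
  also have "\<dots> = (\<integral>\<^sup>+ u. \<integral>\<^sup>+ v. F (u + \<alpha> *\<^sub>R v) v \<partial>lborel \<partial>lborel)"
    by (rule nn_integral_lborel_shear(1)[of "\<lambda>u v. F (u + \<alpha> *\<^sub>R v) v"])
       (auto simp: case_prod_beta' intro!: m)
  also have "\<dots> = (\<integral>\<^sup>+ u. \<integral>\<^sup>+ v. F u v \<partial>lborel \<partial>lborel)"
    by (rule nn_integral_lborel_shear(2)[OF F])
  finally show ?thesis .
qed (use cs in simp)

section \<open>Standard Gaussian vectors: moments and rotation invariance\<close>

definition gauss_pdf :: "real ^ 'd \<Rightarrow> real" where
  "gauss_pdf x = exp (- (norm x)\<^sup>2 / 2) / sqrt ((2 * pi) ^ CARD('d))"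

lemma gauss_pdf_nonneg [simp]: "0 \<le> gauss_pdf x"
  by (simp add: gauss_pdf_def)

lemma gauss_pdf_measurable [measurable]: "gauss_pdf \<in> borel_measurable borel"
  unfolding gauss_pdf_def by measurable

lemma std_gaussian_eq: "std_gaussian = density lborel (\<lambda>x. ennreal (gauss_pdf x))"
  by (simp add: std_gaussian_def gauss_pdf_def)

lemma sets_std_gaussian [simp, measurable_cong]: "sets std_gaussian = sets borel"
  by (simp add: std_gaussian_eq)

lemma space_std_gaussian [simp]: "space std_gaussian = UNIV"
  by (simp add: std_gaussian_eq)

lemma norm_sq_eq_sum: "(norm (x :: 'a::euclidean_space))\<^sup>2 = (\<Sum>b\<in>Basis. (x \<bullet> b)\<^sup>2)"
  unfolding power2_norm_eq_inner by (subst euclidean_inner) (simp add: power2_eq_square)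

lemma gauss_pdf_prod: "gauss_pdf (x :: real ^ 'd) = (\<Prod>b\<in>Basis. std_normal_density (x \<bullet> b))"
proof -
  have "(\<Prod>b\<in>Basis. std_normal_density (x \<bullet> b))
      = (1 / sqrt (2 * pi)) ^ CARD('d) * exp (\<Sum>b\<in>Basis. - (x \<bullet> b)\<^sup>2 / 2)"
    by (simp add: std_normal_density_def prod_dividef exp_sum power_one_over)
  also have "(\<Sum>b\<in>Basis. - (x \<bullet> b)\<^sup>2 / 2) = - (norm x)\<^sup>2 / 2"
    unfolding norm_sq_eq_sum by (simp add: sum_negf sum_divide_distrib)
  finally show ?thesis unfolding gauss_pdf_def real_sqrt_power power_one_over by simp
qed

lemma nn_integral_std_gaussian_prod:
  fixes f :: "real ^ 'd \<Rightarrow> real \<Rightarrow> ennreal"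
  assumes [measurable]: "\<And>b. b \<in> Basis \<Longrightarrow> f b \<in> borel_measurable borel"
  shows "(\<integral>\<^sup>+ x. (\<Prod>b\<in>Basis. f b (x \<bullet> b)) \<partial>std_gaussian)
    = (\<Prod>b\<in>Basis. \<integral>\<^sup>+ y. f b y * ennreal (std_normal_density y) \<partial>lborel)"
proof -
  have "(\<integral>\<^sup>+ x. (\<Prod>b\<in>Basis. f b (x \<bullet> b)) \<partial>std_gaussian)
    = (\<integral>\<^sup>+ x. (\<Prod>b\<in>Basis. f b (x \<bullet> b) * ennreal (std_normal_density (x \<bullet> b))) \<partial>lborel)"
    unfolding std_gaussian_eq
    by (subst nn_integral_density) (auto simp: gauss_pdf_prod prod_ennreal[symmetric] prod.distrib mult.commute)
  also have "\<dots> = (\<Prod>b\<in>Basis. \<integral>\<^sup>+ y. f b y * ennreal (std_normal_density y) \<partial>lborel)"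
    by (rule nn_integral_lborel_prod) auto
  finally show ?thesis .
qed

lemma nn_integral_std_normal_density: "(\<integral>\<^sup>+ y. ennreal (std_normal_density y) \<partial>lborel) = 1"
  using prob_space.emeasure_space_1[OF prob_space_normal_density[of 1 0]] by (simp add: emeasure_density)

lemma prob_space_std_gaussian: "prob_space (std_gaussian :: (real ^ 'd) measure)"
proof
  show "emeasure (std_gaussian :: (real ^ 'd) measure) (space std_gaussian) = 1"
    using nn_integral_std_gaussian_prod[of "\<lambda>(_ :: real ^ 'd) _. 1"]
    by (simp add: nn_integral_std_normal_density)
qed

interpretation std_gauss: prob_space "std_gaussian :: (real ^ 'd) measure"
  by (rule prob_space_std_gaussian)

lemma nn_integral_std_gaussian_norm_sq:
  "(\<integral>\<^sup>+ x. ennreal ((norm x)\<^sup>2) \<partial>(std_gaussian :: (real ^ 'd) measure)) = ennreal (CARD('d))"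
proof -
  have 2: "(\<integral>\<^sup>+ y. ennreal (y\<^sup>2) * ennreal (std_normal_density y) \<partial>lborel) = 1"
  proof -
    have "(\<integral>\<^sup>+ y. ennreal (std_normal_density y * y ^ (2 * 1)) \<partial>lborel) = 1"
      using std_normal_moment_even[of 1]
      by (subst nn_integral_eq_integral) (auto simp: has_bochner_integral_iff fact_numeral)
    then show ?thesis by (simp add: ennreal_mult'[symmetric] mult.commute)
  qed
  \<comment> \<open>The square of one coordinate is written as a product over the basis whose other
    factors are 1, so that the product formula applies.\<close>
  have *: "(\<integral>\<^sup>+ x. ennreal ((x \<bullet> i)\<^sup>2) \<partial>(std_gaussian :: (real ^ 'd) measure)) = 1" if i: "i \<in> Basis" for i
  proof -
    have "(\<integral>\<^sup>+ x. ennreal ((x \<bullet> i)\<^sup>2) \<partial>(std_gaussian :: (real ^ 'd) measure))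
      = (\<integral>\<^sup>+ x. (\<Prod>b\<in>Basis. (if b = i then ennreal ((x \<bullet> b)\<^sup>2) else 1)) \<partial>(std_gaussian :: (real ^ 'd) measure))"
      using i by (simp add: prod.If_cases)
    also have "\<dots> = (\<Prod>b\<in>(Basis :: (real ^ 'd) set). \<integral>\<^sup>+ y. (if b = i then ennreal (y\<^sup>2) else 1) * ennreal (std_normal_density y) \<partial>lborel)"
      by (rule nn_integral_std_gaussian_prod[of "\<lambda>b y. if b = i then ennreal (y\<^sup>2) else 1"]) auto
    also have "\<dots> = 1"
    proof (intro prod.neutral ballI)
      fix b
      show "(\<integral>\<^sup>+ y. (if b = i then ennreal (y\<^sup>2) else 1) * ennreal (std_normal_density y) \<partial>lborel) = 1"
        by (cases "b = i") (auto simp: 2 nn_integral_std_normal_density)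
    qed
    finally show ?thesis .
  qed
  have "(\<integral>\<^sup>+ x. ennreal ((norm x)\<^sup>2) \<partial>(std_gaussian :: (real ^ 'd) measure))
      = (\<integral>\<^sup>+ x. (\<Sum>i\<in>Basis. ennreal ((x \<bullet> i)\<^sup>2)) \<partial>(std_gaussian :: (real ^ 'd) measure))"
    by (simp add: norm_sq_eq_sum)
  also have "\<dots> = ennreal (CARD('d))"
    by (subst nn_integral_sum) (auto simp: * ennreal_of_nat_eq_real_of_nat)
  finally show ?thesis .
qed

text \<open>The product density depends only on the sum of the two squared norms, which a rotation
  preserves, and Lebesgue measure is rotation invariant.\<close>

lemma nn_integral_std_gaussian_rotation:
  fixes F :: "real ^ 'd \<Rightarrow> real ^ 'd \<Rightarrow> ennreal"
  assumes F: "case_prod F \<in> borel_measurable (borel \<Otimes>\<^sub>M borel)"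
    and cs: "c\<^sup>2 + s\<^sup>2 = 1" "s = 0 \<Longrightarrow> c = 1"
  shows "(\<integral>\<^sup>+ u. \<integral>\<^sup>+ v. F (c *\<^sub>R u + s *\<^sub>R v) (c *\<^sub>R v - s *\<^sub>R u) \<partial>std_gaussian \<partial>std_gaussian)
    = (\<integral>\<^sup>+ u. \<integral>\<^sup>+ v. F u v \<partial>std_gaussian \<partial>std_gaussian)"
proof -
  have m[measurable]: "(\<lambda>z. F (f z) (g z)) \<in> borel_measurable M"
    if [measurable]: "f \<in> borel_measurable M" "g \<in> borel_measurable M" for f g and M :: "'b measure"
    using measurable_compose[OF measurable_Pair[OF that] F] by simp
  have lb: "(\<integral>\<^sup>+ u. \<integral>\<^sup>+ v. H u v \<partial>std_gaussian \<partial>std_gaussian)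
      = (\<integral>\<^sup>+ u. \<integral>\<^sup>+ v. H u v * ennreal (gauss_pdf u * gauss_pdf v) \<partial>lborel \<partial>lborel)"
    if H[measurable]: "case_prod H \<in> borel_measurable (borel \<Otimes>\<^sub>M borel)" for H :: "real ^ 'd \<Rightarrow> real ^ 'd \<Rightarrow> ennreal"
  proof -
    have [measurable]: "(\<lambda>z. H (f z) (g z)) \<in> borel_measurable M"
      if [measurable]: "f \<in> borel_measurable M" "g \<in> borel_measurable M" for f g and M :: "'b measure"
      using measurable_compose[OF measurable_Pair[OF that] H] by simp
    show ?thesis
      by (simp add: std_gaussian_eq nn_integral_density nn_integral_cmult[symmetric] ennreal_mult' mult_ac)
  qed
  have n: "(norm (c *\<^sub>R u + s *\<^sub>R v))\<^sup>2 + (norm (c *\<^sub>R v - s *\<^sub>R u))\<^sup>2 = (norm u)\<^sup>2 + (norm v)\<^sup>2" for u v :: "real ^ 'd"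
  proof -
    have "(norm (c *\<^sub>R u + s *\<^sub>R v))\<^sup>2 + (norm (c *\<^sub>R v - s *\<^sub>R u))\<^sup>2 = (c\<^sup>2 + s\<^sup>2) * ((norm u)\<^sup>2 + (norm v)\<^sup>2)"
      unfolding power2_norm_eq_inner
      by (simp add: inner_add_left inner_add_right inner_diff_left inner_diff_right inner_commute
          algebra_simps del: dot_square_norm) (simp add: power2_eq_square)
    then show ?thesis using cs by simp
  qed
  have p: "gauss_pdf u * gauss_pdf v = gauss_pdf (c *\<^sub>R u + s *\<^sub>R v) * gauss_pdf (c *\<^sub>R v - s *\<^sub>R u)" for u v :: "real ^ 'd"
  proof -
    have "gauss_pdf x * gauss_pdf y = exp (- ((norm x)\<^sup>2 + (norm y)\<^sup>2) / 2) / (sqrt ((2 * pi) ^ CARD('d)) * sqrt ((2 * pi) ^ CARD('d)))"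
      for x y :: "real ^ 'd"
      unfolding gauss_pdf_def times_divide_times_eq mult_exp_exp add_divide_distrib[symmetric] minus_add_distrib[symmetric]
      by (rule refl)
    then show ?thesis by (simp only: n)
  qed
  have "(\<integral>\<^sup>+ u. \<integral>\<^sup>+ v. F (c *\<^sub>R u + s *\<^sub>R v) (c *\<^sub>R v - s *\<^sub>R u) \<partial>std_gaussian \<partial>std_gaussian)
    = (\<integral>\<^sup>+ u. \<integral>\<^sup>+ v. F (c *\<^sub>R u + s *\<^sub>R v) (c *\<^sub>R v - s *\<^sub>R u)
        * ennreal (gauss_pdf (c *\<^sub>R u + s *\<^sub>R v) * gauss_pdf (c *\<^sub>R v - s *\<^sub>R u)) \<partial>lborel \<partial>lborel)"
    unfolding p[symmetric]
    by (rule lb[of "\<lambda>u v. F (c *\<^sub>R u + s *\<^sub>R v) (c *\<^sub>R v - s *\<^sub>R u)"]) (simp add: case_prod_beta')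
  also have "\<dots> = (\<integral>\<^sup>+ u. \<integral>\<^sup>+ v. F u v * ennreal (gauss_pdf u * gauss_pdf v) \<partial>lborel \<partial>lborel)"
    by (rule nn_integral_lborel_rotation[of "\<lambda>u v. F u v * ennreal (gauss_pdf u * gauss_pdf v)", OF _ cs])
       (simp_all add: case_prod_beta')
  finally show ?thesis unfolding lb[OF F] .
qed

text \<open>One more Gaussian \<open>z\<close> is absorbed into a triangular pair by two rotations.
  The first, in the plane of \<open>u\<close> and \<open>z\<close>, collects the whole first
  combination in \<open>u\<close>; the second, in the plane of \<open>v\<close> and
  \<open>z\<close>, collects in \<open>v\<close> what is left of the second combination. After that
  \<open>z\<close> no longer occurs and integrates to one.\<close>

lemma gaussian_absorb:
  fixes p q r a b :: real
  assumes "0 \<le> p" "0 \<le> r"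
  obtains p' q' r' where "0 \<le> p'" "0 \<le> r'" "p'\<^sup>2 = p\<^sup>2 + a\<^sup>2" "p' * q' = p * q + a * b"
    "q'\<^sup>2 + r'\<^sup>2 = q\<^sup>2 + r\<^sup>2 + b\<^sup>2"
    "\<And>F :: real ^ 'd \<Rightarrow> real ^ 'd \<Rightarrow> ennreal. case_prod F \<in> borel_measurable (borel \<Otimes>\<^sub>M borel) \<Longrightarrow>
      (\<integral>\<^sup>+ z. \<integral>\<^sup>+ u. \<integral>\<^sup>+ v. F (a *\<^sub>R z + p *\<^sub>R u) (b *\<^sub>R z + (q *\<^sub>R u + r *\<^sub>R v)) \<partial>std_gaussian \<partial>std_gaussian \<partial>std_gaussian)
      = (\<integral>\<^sup>+ u. \<integral>\<^sup>+ v. F (p' *\<^sub>R u) (q' *\<^sub>R u + r' *\<^sub>R v) \<partial>std_gaussian \<partial>std_gaussian)"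
proof -
  \<comment> \<open>A unit vector in the direction of \<open>(x, y)\<close>. Nonnegativity of
    \<open>x\<close> excludes the direction \<open>(-1, 0)\<close>, the half turn that the rotation
    lemma does not cover.\<close>
  have dir: "\<exists>c s. c\<^sup>2 + s\<^sup>2 = 1 \<and> (s = 0 \<longrightarrow> c = 1) \<and> sqrt (x\<^sup>2 + y\<^sup>2) * c = x \<and> sqrt (x\<^sup>2 + y\<^sup>2) * s = y"
    if "0 \<le> x" for x y :: real
  proof (cases "x\<^sup>2 + y\<^sup>2 = 0")
    case True
    then show ?thesis by (intro exI[of _ 1] exI[of _ 0]) (auto simp: sum_power2_eq_zero_iff)
  next
    case False
    then have pos: "0 < x\<^sup>2 + y\<^sup>2" by (smt (verit) zero_le_power2)
    let ?n = "sqrt (x\<^sup>2 + y\<^sup>2)"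
    have "(x / ?n)\<^sup>2 + (y / ?n)\<^sup>2 = 1"
      using False by (simp add: power_divide add_divide_distrib[symmetric])
    moreover have "y / ?n = 0 \<longrightarrow> x / ?n = 1"
      using pos that by (cases "y = 0"; cases "x = 0") (auto simp: real_sqrt_abs)
    moreover have "?n \<noteq> 0" using False by simp
    ultimately show ?thesis
      by (intro exI[of _ "x / ?n"] exI[of _ "y / ?n"]) (simp del: real_sqrt_eq_0_iff)
  qed
  obtain c s where cs: "c\<^sup>2 + s\<^sup>2 = 1" "s = 0 \<Longrightarrow> c = 1" and p: "sqrt (p\<^sup>2 + a\<^sup>2) * c = p" "sqrt (p\<^sup>2 + a\<^sup>2) * s = a"
    using dir[OF assms(1)] by metis
  define p' where "p' = sqrt (p\<^sup>2 + a\<^sup>2)"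
  define q' where "q' = q * c + b * s"
  define b' where "b' = b * c - q * s"
  obtain c' s' where cs': "c'\<^sup>2 + s'\<^sup>2 = 1" "s' = 0 \<Longrightarrow> c' = 1" and r: "sqrt (r\<^sup>2 + b'\<^sup>2) * c' = r" "sqrt (r\<^sup>2 + b'\<^sup>2) * s' = b'"
    using dir[OF assms(2)] by metis
  define r' where "r' = sqrt (r\<^sup>2 + b'\<^sup>2)"
  have qb: "q = q' * c - b' * s" "b = q' * s + b' * c"
  proof -
    have "q' * c - b' * s = q * (c\<^sup>2 + s\<^sup>2)" "q' * s + b' * c = b * (c\<^sup>2 + s\<^sup>2)"
      by (simp_all add: q'_def b'_def algebra_simps power2_eq_square)
    then show "q = q' * c - b' * s" "b = q' * s + b' * c" using cs(1) by auto
  qed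
  have "q'\<^sup>2 + b'\<^sup>2 = (q\<^sup>2 + b\<^sup>2) * (c\<^sup>2 + s\<^sup>2)"
    by (simp add: q'_def b'_def algebra_simps power2_eq_square)
  then have q2: "q'\<^sup>2 + b'\<^sup>2 = q\<^sup>2 + b\<^sup>2" using cs(1) by simp
  show ?thesis
  proof (rule that[of p' r' q'])
    show "0 \<le> p'" "0 \<le> r'" "p'\<^sup>2 = p\<^sup>2 + a\<^sup>2" "q'\<^sup>2 + r'\<^sup>2 = q\<^sup>2 + r\<^sup>2 + b\<^sup>2"
      using q2 by (auto simp: p'_def r'_def)
    have "p' * q' = (p' * c) * q + (p' * s) * b" by (simp add: q'_def algebra_simps)
    then show "p' * q' = p * q + a * b" using p by (simp add: p'_def)
    fix F :: "real ^ 'd \<Rightarrow> real ^ 'd \<Rightarrow> ennreal" assume F: "case_prod F \<in> borel_measurable (borel \<Otimes>\<^sub>M borel)"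
    have [measurable]: "(\<lambda>z. F (f z) (g z)) \<in> borel_measurable M"
      if [measurable]: "f \<in> borel_measurable M" "g \<in> borel_measurable M" for f g and M :: "'b measure"
      using measurable_compose[OF measurable_Pair[OF that] F] by simp
    interpret gg: pair_sigma_finite "std_gaussian :: (real ^ 'd) measure" "std_gaussian :: (real ^ 'd) measure" ..
    have "(\<integral>\<^sup>+ z. \<integral>\<^sup>+ u. \<integral>\<^sup>+ v. F (a *\<^sub>R z + p *\<^sub>R u) (b *\<^sub>R z + (q *\<^sub>R u + r *\<^sub>R v)) \<partial>std_gaussian \<partial>std_gaussian \<partial>std_gaussian)
      = (\<integral>\<^sup>+ u. \<integral>\<^sup>+ z. \<integral>\<^sup>+ v. F (a *\<^sub>R z + p *\<^sub>R u) (b *\<^sub>R z + (q *\<^sub>R u + r *\<^sub>R v)) \<partial>std_gaussian \<partial>std_gaussian \<partial>std_gaussian)"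
      by (rule gg.Fubini'[symmetric]) simp
    also have "\<dots> = (\<integral>\<^sup>+ u. \<integral>\<^sup>+ z. \<integral>\<^sup>+ v. F (p' *\<^sub>R (c *\<^sub>R u + s *\<^sub>R z)) (q' *\<^sub>R (c *\<^sub>R u + s *\<^sub>R z) + b' *\<^sub>R (c *\<^sub>R z - s *\<^sub>R u) + r *\<^sub>R v) \<partial>std_gaussian \<partial>std_gaussian \<partial>std_gaussian)"
    proof (intro nn_integral_cong arg_cong2[where f=F])
      fix u z v :: "real ^ 'd"
      show "a *\<^sub>R z + p *\<^sub>R u = p' *\<^sub>R (c *\<^sub>R u + s *\<^sub>R z)"
        using p by (simp add: p'_def scaleR_add_right add.commute)
      show "b *\<^sub>R z + (q *\<^sub>R u + r *\<^sub>R v) = q' *\<^sub>R (c *\<^sub>R u + s *\<^sub>R z) + b' *\<^sub>R (c *\<^sub>R z - s *\<^sub>R u) + r *\<^sub>R v"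
        unfolding qb by (simp add: algebra_simps)
    qed
    also have "\<dots> = (\<integral>\<^sup>+ u. \<integral>\<^sup>+ z. \<integral>\<^sup>+ v. F (p' *\<^sub>R u) (q' *\<^sub>R u + b' *\<^sub>R z + r *\<^sub>R v) \<partial>std_gaussian \<partial>std_gaussian \<partial>std_gaussian)"
      by (rule nn_integral_std_gaussian_rotation[of "\<lambda>u z. \<integral>\<^sup>+ v. F (p' *\<^sub>R u) (q' *\<^sub>R u + b' *\<^sub>R z + r *\<^sub>R v) \<partial>std_gaussian", OF _ cs]) simp
    also have "\<dots> = (\<integral>\<^sup>+ u. \<integral>\<^sup>+ v. \<integral>\<^sup>+ z. F (p' *\<^sub>R u) (q' *\<^sub>R u + b' *\<^sub>R z + r *\<^sub>R v) \<partial>std_gaussian \<partial>std_gaussian \<partial>std_gaussian)"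
      by (intro nn_integral_cong gg.Fubini') simp
    also have "\<dots> = (\<integral>\<^sup>+ u. \<integral>\<^sup>+ v. \<integral>\<^sup>+ z. F (p' *\<^sub>R u) (q' *\<^sub>R u + r' *\<^sub>R (c' *\<^sub>R v + s' *\<^sub>R z)) \<partial>std_gaussian \<partial>std_gaussian \<partial>std_gaussian)"
    proof (intro nn_integral_cong arg_cong2[where f=F])
      fix u z v :: "real ^ 'd"
      show "q' *\<^sub>R u + b' *\<^sub>R z + r *\<^sub>R v = q' *\<^sub>R u + r' *\<^sub>R (c' *\<^sub>R v + s' *\<^sub>R z)"
        using r by (simp add: r'_def scaleR_add_right)
    qed simp
    also have "\<dots> = (\<integral>\<^sup>+ u. \<integral>\<^sup>+ v. \<integral>\<^sup>+ z. F (p' *\<^sub>R u) (q' *\<^sub>R u + r' *\<^sub>R v) \<partial>(std_gaussian :: (real ^ 'd) measure) \<partial>std_gaussian \<partial>std_gaussian)"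
    proof (rule nn_integral_cong)
      fix u :: "real ^ 'd"
      show "(\<integral>\<^sup>+ v. \<integral>\<^sup>+ z. F (p' *\<^sub>R u) (q' *\<^sub>R u + r' *\<^sub>R (c' *\<^sub>R v + s' *\<^sub>R z)) \<partial>std_gaussian \<partial>std_gaussian)
        = (\<integral>\<^sup>+ v. \<integral>\<^sup>+ z. F (p' *\<^sub>R u) (q' *\<^sub>R u + r' *\<^sub>R v) \<partial>(std_gaussian :: (real ^ 'd) measure) \<partial>std_gaussian)"
        by (rule nn_integral_std_gaussian_rotation[of "\<lambda>v z. F (p' *\<^sub>R u) (q' *\<^sub>R u + r' *\<^sub>R v)", OF _ cs']) simp
    qed
    also have "\<dots> = (\<integral>\<^sup>+ u. \<integral>\<^sup>+ v. F (p' *\<^sub>R u) (q' *\<^sub>R u + r' *\<^sub>R v) \<partial>std_gaussian \<partial>std_gaussian)"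
      by (simp add: std_gauss.emeasure_space_1[simplified])
    finally show "(\<integral>\<^sup>+ z. \<integral>\<^sup>+ u. \<integral>\<^sup>+ v. F (a *\<^sub>R z + p *\<^sub>R u) (b *\<^sub>R z + (q *\<^sub>R u + r *\<^sub>R v)) \<partial>std_gaussian \<partial>std_gaussian \<partial>std_gaussian)
      = (\<integral>\<^sup>+ u. \<integral>\<^sup>+ v. F (p' *\<^sub>R u) (q' *\<^sub>R u + r' *\<^sub>R v) \<partial>std_gaussian \<partial>std_gaussian)" .
  qed
qed

text \<open>The list holds, for each independent Gaussian, its coefficients in the two linear
  combinations. Iterated integrals are used because the Gaussians of a step occur in this
  form.\<close>

fun gaussian_pair_integral ::
    "(real \<times> real) list \<Rightarrow> (real ^ 'd \<Rightarrow> real ^ 'd \<Rightarrow> ennreal) \<Rightarrow> real ^ 'd \<Rightarrow> real ^ 'd \<Rightarrow> ennreal" where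
  "gaussian_pair_integral [] F y z = F y z"
| "gaussian_pair_integral ((a, b) # l) F y z
    = (\<integral>\<^sup>+ \<xi>. gaussian_pair_integral l F (y + a *\<^sub>R \<xi>) (z + b *\<^sub>R \<xi>) \<partial>std_gaussian)"

text \<open>Cholesky form of the joint law of two linear combinations of independent Gaussian vectors.\<close>

lemma gaussian_pair_integral_eq:
  fixes l :: "(real \<times> real) list"
  obtains p q r where "0 \<le> p" "0 \<le> r" "p\<^sup>2 = (\<Sum>(a, b)\<leftarrow>l. a\<^sup>2)" "p * q = (\<Sum>(a, b)\<leftarrow>l. a * b)"
    "q\<^sup>2 + r\<^sup>2 = (\<Sum>(a, b)\<leftarrow>l. b\<^sup>2)"
    "\<And>(F :: real ^ 'd \<Rightarrow> real ^ 'd \<Rightarrow> ennreal) y z. case_prod F \<in> borel_measurable (borel \<Otimes>\<^sub>M borel) \<Longrightarrow>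
      gaussian_pair_integral l F y z
      = (\<integral>\<^sup>+ u. \<integral>\<^sup>+ v. F (y + p *\<^sub>R u) (z + (q *\<^sub>R u + r *\<^sub>R v)) \<partial>std_gaussian \<partial>std_gaussian)"
proof (induction l arbitrary: thesis)
  case Nil
  show ?case
    by (rule Nil[of 0 0 0]) (auto simp: std_gauss.emeasure_space_1[simplified])
next
  case (Cons ab l)
  obtain a b where ab: "ab = (a, b)" by force
  obtain p q r where pqr: "0 \<le> p" "0 \<le> r" "p\<^sup>2 = (\<Sum>(a, b)\<leftarrow>l. a\<^sup>2)" "p * q = (\<Sum>(a, b)\<leftarrow>l. a * b)"
    "q\<^sup>2 + r\<^sup>2 = (\<Sum>(a, b)\<leftarrow>l. b\<^sup>2)"
    and F: "\<And>(F :: real ^ 'd \<Rightarrow> real ^ 'd \<Rightarrow> ennreal) y z. case_prod F \<in> borel_measurable (borel \<Otimes>\<^sub>M borel) \<Longrightarrow>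
      gaussian_pair_integral l F y z
      = (\<integral>\<^sup>+ u. \<integral>\<^sup>+ v. F (y + p *\<^sub>R u) (z + (q *\<^sub>R u + r *\<^sub>R v)) \<partial>std_gaussian \<partial>std_gaussian)"
    by (rule Cons.IH) (rule that; assumption)
  obtain p' q' r' where pqr':
    "0 \<le> p'" "0 \<le> r'" "p'\<^sup>2 = p\<^sup>2 + a\<^sup>2" "p' * q' = p * q + a * b" "q'\<^sup>2 + r'\<^sup>2 = q\<^sup>2 + r\<^sup>2 + b\<^sup>2"
    and F': "\<And>F :: real ^ 'd \<Rightarrow> real ^ 'd \<Rightarrow> ennreal. case_prod F \<in> borel_measurable (borel \<Otimes>\<^sub>M borel) \<Longrightarrow>
      (\<integral>\<^sup>+ z. \<integral>\<^sup>+ u. \<integral>\<^sup>+ v. F (a *\<^sub>R z + p *\<^sub>R u) (b *\<^sub>R z + (q *\<^sub>R u + r *\<^sub>R v)) \<partial>std_gaussian \<partial>std_gaussian \<partial>std_gaussian)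
      = (\<integral>\<^sup>+ u. \<integral>\<^sup>+ v. F (p' *\<^sub>R u) (q' *\<^sub>R u + r' *\<^sub>R v) \<partial>std_gaussian \<partial>std_gaussian)"
    by (rule gaussian_absorb[OF pqr(1,2), of a q b, where ?'d='d]) (rule that; assumption)
  show ?case
  proof (rule Cons.prems[of p' r' q'])
    show "0 \<le> p'" by (fact pqr'(1))
    show "0 \<le> r'" by (fact pqr'(2))
    show "p'\<^sup>2 = (\<Sum>(a, b)\<leftarrow>ab # l. a\<^sup>2)" using pqr'(3) unfolding pqr(3) by (simp add: ab)
    show "p' * q' = (\<Sum>(a, b)\<leftarrow>ab # l. a * b)" using pqr'(4) unfolding pqr(4) by (simp add: ab)
    show "q'\<^sup>2 + r'\<^sup>2 = (\<Sum>(a, b)\<leftarrow>ab # l. b\<^sup>2)" using pqr'(5) unfolding pqr(5) by (simp add: ab)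
    fix F :: "real ^ 'd \<Rightarrow> real ^ 'd \<Rightarrow> ennreal" and y z
    assume Fm: "case_prod F \<in> borel_measurable (borel \<Otimes>\<^sub>M borel)"
    have [measurable]: "(\<lambda>z. F (f z) (g z)) \<in> borel_measurable M"
      if [measurable]: "f \<in> borel_measurable M" "g \<in> borel_measurable M" for f g and M :: "'b measure"
      using measurable_compose[OF measurable_Pair[OF that] Fm] by simp
    show "gaussian_pair_integral (ab # l) F y z
      = (\<integral>\<^sup>+ u. \<integral>\<^sup>+ v. F (y + p' *\<^sub>R u) (z + (q' *\<^sub>R u + r' *\<^sub>R v)) \<partial>std_gaussian \<partial>std_gaussian)"
      unfolding ab gaussian_pair_integral.simps F[OF Fm]
      using F'[of "\<lambda>Y Z. F (y + Y) (z + Z)"] by (simp add: add.assoc)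
  qed
qed

section \<open>The Hamiltonian flow\<close>

text \<open>Outer regularity extends the inequality from open to Borel sets; since both total masses
  are 1, passing to complements reverses it.\<close>

lemma prob_measure_eqI_open_le:
  fixes \<mu> \<nu> :: "'a::{second_countable_topology, complete_space} measure"
  assumes \<mu>: "prob_space \<mu>" "sets \<mu> = sets borel" and \<nu>: "prob_space \<nu>" "sets \<nu> = sets borel"
    and le: "\<And>U. open U \<Longrightarrow> emeasure \<nu> U \<le> emeasure \<mu> U"
  shows "\<nu> = \<mu>"
proof -
  interpret \<mu>: prob_space \<mu> by fact
  interpret \<nu>: prob_space \<nu> by fact
  have *: "emeasure \<nu> B \<le> emeasure \<mu> B" if B: "B \<in> sets borel" for B
  proof -
    have "emeasure \<nu> B \<le> (INF U\<in>{U. B \<subseteq> U \<and> open U}. emeasure \<mu> U)"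
    proof (rule INF_greatest)
      fix U assume U: "U \<in> {U. B \<subseteq> U \<and> open U}"
      then have "emeasure \<nu> B \<le> emeasure \<nu> U" using B \<nu>(2) by (intro emeasure_mono) auto
      also have "\<dots> \<le> emeasure \<mu> U" using U le by auto
      finally show "emeasure \<nu> B \<le> emeasure \<mu> U" .
    qed
    also have "\<dots> = emeasure \<mu> B" using outer_regular[OF \<mu>(2) _ B] by simp
    finally show ?thesis .
  qed
  show ?thesis
  proof (rule measure_eqI)
    show "sets \<nu> = sets \<mu>" using \<mu> \<nu> by simp
    fix A assume "A \<in> sets \<nu>"
    then have A: "A \<in> sets borel" using \<nu> by simp
    have s: "space \<mu> = UNIV" "space \<nu> = UNIV" using \<mu>(2) \<nu>(2) by (auto dest: sets_eq_imp_space_eq)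
    have 1: "measure \<nu> A \<le> measure \<mu> A" "measure \<nu> (UNIV - A) \<le> measure \<mu> (UNIV - A)"
      using *[OF A] *[of "UNIV - A"] A by (auto simp: \<mu>.emeasure_eq_measure \<nu>.emeasure_eq_measure)
    then have "measure \<nu> A = measure \<mu> A"
      using \<mu>.prob_compl[of A] \<nu>.prob_compl[of A] A \<mu>(2) \<nu>(2) s by simp
    then show "emeasure \<nu> A = emeasure \<mu> A" by (simp add: \<mu>.emeasure_eq_measure \<nu>.emeasure_eq_measure)
  qed
qed

section \<open>The symplectic Euler scheme and its dyadic limit\<close>

definition norm1 :: "'a::real_normed_vector \<times> 'a \<Rightarrow> real" where
  "norm1 z = norm (fst z) + norm (snd z)"

lemma norm1_nonneg [simp]: "0 \<le> norm1 z"
  by (simp add: norm1_def)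

lemma norm1_zero [simp]: "norm1 0 = 0"
  by (simp add: norm1_def)

lemma norm1_triangle: "norm1 (z - z'') \<le> norm1 (z - z') + norm1 (z' - z'')"
  using norm_triangle_ineq[of "fst z - fst z'" "fst z' - fst z''"]
    norm_triangle_ineq[of "snd z - snd z'" "snd z' - snd z''"]
  by (simp add: norm1_def)

lemma norm_le_norm1: "norm z \<le> norm1 z"
  using norm_Pair_le[of "fst z" "snd z"] by (simp add: norm1_def)

text \<open>Discrete Gronwall inequality: local errors \<open>e\<close> accumulated under the growth
  factor \<open>exp k\<close>.\<close>

lemma prod_exp_bound:
  fixes d :: "nat \<Rightarrow> real"
  assumes "d 0 = 0" "\<And>j. j < n \<Longrightarrow> d (Suc j) \<le> exp k * d j + e" "0 \<le> k" "0 \<le> e" "j \<le> n"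
  shows "d j \<le> real j * e * exp (real j * k)"
  using assms(5)
proof (induction j)
  case (Suc j)
  have "d (Suc j) \<le> exp k * d j + e" using Suc.prems assms(2) by simp
  also have "\<dots> \<le> exp k * (real j * e * exp (real j * k)) + e"
    using Suc by (intro add_right_mono mult_left_mono) auto
  also have "\<dots> = real j * e * exp (real (Suc j) * k) + e * 1"
    by (simp add: exp_add[symmetric] distrib_right)
  also have "\<dots> \<le> real j * e * exp (real (Suc j) * k) + e * exp (real (Suc j) * k)"
    using assms(3,4) by (intro add_left_mono mult_left_mono) auto
  finally show ?case by (simp add: algebra_simps)
qed (use assms in simp)

context convex_potential
begin

definition ham :: "'a \<times> 'a \<Rightarrow> real" where
  "ham = (\<lambda>(x, v). V x + (norm v)\<^sup>2 / 2)"

lemma continuous_ham: "continuous_on S ham"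
proof -
  have "continuous_on S (\<lambda>z. V (fst z) + (norm (snd z))\<^sup>2 / 2)"
    by (intro continuous_intros continuous_on_compose2[OF continuous_V[of UNIV]]) auto
  then show ?thesis by (simp add: ham_def case_prod_beta')
qed

text \<open>Symplectic Euler step: the position moves with the already updated velocity, which makes
  the map a composition of two volume-preserving shears.\<close>

definition euler :: "real \<Rightarrow> 'a \<times> 'a \<Rightarrow> 'a \<times> 'a" where
  "euler \<delta> = (\<lambda>(x, v). (x + \<delta> *\<^sub>R (v - \<delta> *\<^sub>R f x), v - \<delta> *\<^sub>R f x))"

lemma f_growth: "norm (f (fst z)) \<le> (norm (f 0) + L) * (1 + norm1 z)"
proof -
  have "norm (f (fst z)) \<le> norm (f (fst z) - f 0) + norm (f 0)"
    using norm_triangle_ineq[of "f (fst z) - f 0" "f 0"] by simp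
  also have "\<dots> \<le> L * norm (fst z) + norm (f 0)" using lipschitz[of "fst z" 0] by simp
  also have "\<dots> \<le> (norm (f 0) + L) * (1 + norm1 z)"
    using L_pos by (simp add: norm1_def algebra_simps add_increasing add_increasing2)
  finally show ?thesis .
qed

text \<open>A common exponential rate, per unit time, for the growth and for the Lipschitz constant
  of Euler steps of length at most \<open>T\<close>.\<close>

definition flow_rate :: "real \<Rightarrow> real" where
  "flow_rate T = 1 + (norm (f 0) + L) * (1 + T)"

lemma flow_rate_ge: "0 \<le> T \<Longrightarrow> 1 \<le> flow_rate T" "0 \<le> T \<Longrightarrow> 1 + L * (1 + T) \<le> flow_rate T"
  using L_pos by (auto simp: flow_rate_def algebra_simps)

lemma one_plus_le_exp: "1 + \<delta> * flow_rate T \<le> exp (\<delta> * flow_rate T)"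
  by (rule exp_ge_add_one_self)

lemma euler_growth:
  assumes \<delta>: "0 \<le> \<delta>" "\<delta> \<le> T"
  shows "1 + norm1 (euler \<delta> z) \<le> exp (\<delta> * flow_rate T) * (1 + norm1 z)"
proof -
  obtain x v where z: "z = (x, v)" by force
  let ?c = "norm (f 0) + L"
  have c: "norm (f x) \<le> ?c * (1 + norm1 z)" using f_growth[of z] by (simp add: z)
  have v: "norm (v - \<delta> *\<^sub>R f x) \<le> norm v + \<delta> * (?c * (1 + norm1 z))"
    using norm_triangle_ineq4[of v "\<delta> *\<^sub>R f x"] mult_left_mono[OF c \<delta>(1)] \<delta> by simp
  have "norm (x + \<delta> *\<^sub>R (v - \<delta> *\<^sub>R f x)) \<le> norm x + \<delta> * norm (v - \<delta> *\<^sub>R f x)"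
    using norm_triangle_ineq[of x "\<delta> *\<^sub>R (v - \<delta> *\<^sub>R f x)"] \<delta> by simp
  also have "\<dots> \<le> norm x + \<delta> * (norm v + \<delta> * (?c * (1 + norm1 z)))"
    using v \<delta> by (intro add_left_mono mult_left_mono) auto
  also have "\<dots> \<le> norm x + \<delta> * (norm v + T * (?c * (1 + norm1 z)))"
    using \<delta> L_pos by (intro add_left_mono mult_left_mono mult_right_mono) auto
  finally have x: "norm (x + \<delta> *\<^sub>R (v - \<delta> *\<^sub>R f x)) \<le> norm x + \<delta> * (norm v + T * (?c * (1 + norm1 z)))" .
  have "1 + norm1 (euler \<delta> z) \<le> 1 + norm1 z + \<delta> * (norm v + (1 + T) * ?c * (1 + norm1 z))"
    using v x by (simp add: z euler_def norm1_def algebra_simps)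
  also have "\<dots> \<le> 1 + norm1 z + \<delta> * ((1 + norm1 z) + (1 + T) * ?c * (1 + norm1 z))"
    using \<delta> by (intro add_left_mono mult_left_mono add_right_mono) (auto simp: norm1_def z)
  also have "\<dots> = (1 + \<delta> * flow_rate T) * (1 + norm1 z)"
    by (simp add: flow_rate_def algebra_simps)
  also have "\<dots> \<le> exp (\<delta> * flow_rate T) * (1 + norm1 z)"
    by (intro mult_right_mono one_plus_le_exp) (simp add: norm1_def)
  finally show ?thesis .
qed

lemma euler_lipschitz:
  assumes \<delta>: "0 \<le> \<delta>" "\<delta> \<le> T"
  shows "norm1 (euler \<delta> z - euler \<delta> z') \<le> exp (\<delta> * flow_rate T) * norm1 (z - z')"
proof -
  obtain x v x' v' where z: "z = (x, v)" "z' = (x', v')" by (metis surj_pair)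
  let ?w = "(v - v') - \<delta> *\<^sub>R (f x - f x')"
  have w: "norm ?w \<le> norm (v - v') + \<delta> * (L * norm (x - x'))"
    using norm_triangle_ineq4[of "v - v'" "\<delta> *\<^sub>R (f x - f x')"] mult_left_mono[OF lipschitz[of x x'] \<delta>(1)] \<delta> by simp
  have "norm ((x - x') + \<delta> *\<^sub>R ?w) \<le> norm (x - x') + \<delta> * norm ?w"
    using norm_triangle_ineq[of "x - x'" "\<delta> *\<^sub>R ?w"] \<delta> by simp
  also have "\<dots> \<le> norm (x - x') + \<delta> * (norm (v - v') + \<delta> * (L * norm (x - x')))"
    using w \<delta> by (intro add_left_mono mult_left_mono) auto
  also have "\<dots> \<le> norm (x - x') + \<delta> * (norm (v - v') + T * (L * norm (x - x')))"
    using \<delta> L_pos by (intro add_left_mono mult_left_mono mult_right_mono) auto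
  finally have "norm1 (euler \<delta> z - euler \<delta> z') \<le>
      norm1 (z - z') + \<delta> * (norm (v - v') + (1 + T) * L * norm (x - x'))"
    using w by (simp add: z euler_def norm1_def algebra_simps)
  also have "\<dots> \<le> norm1 (z - z') + \<delta> * ((1 + L * (1 + T)) * norm1 (z - z'))"
    using \<delta> L_pos by (intro add_left_mono mult_left_mono) (auto simp: norm1_def z algebra_simps intro!: add_increasing)
  also have "\<dots> \<le> norm1 (z - z') + \<delta> * (flow_rate T * norm1 (z - z'))"
    using \<delta> flow_rate_ge(2)[of T] by (intro add_left_mono mult_left_mono mult_right_mono) auto
  also have "\<dots> = (1 + \<delta> * flow_rate T) * norm1 (z - z')" by (simp add: algebra_simps)
  also have "\<dots> \<le> exp (\<delta> * flow_rate T) * norm1 (z - z')"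
    by (intro mult_right_mono one_plus_le_exp) simp
  finally show ?thesis .
qed

lemma euler_iterate_growth:
  assumes \<delta>: "0 \<le> \<delta>" "\<delta> \<le> T"
  shows "1 + norm1 ((euler \<delta> ^^ j) z) \<le> exp (real j * (\<delta> * flow_rate T)) * (1 + norm1 z)"
proof (induction j)
  case (Suc j)
  have "1 + norm1 ((euler \<delta> ^^ Suc j) z) \<le> exp (\<delta> * flow_rate T) * (1 + norm1 ((euler \<delta> ^^ j) z))"
    using euler_growth[OF \<delta>] by simp
  also have "\<dots> \<le> exp (\<delta> * flow_rate T) * (exp (real j * (\<delta> * flow_rate T)) * (1 + norm1 z))"
    using Suc by (intro mult_left_mono) auto
  finally show ?case by (simp add: exp_add[symmetric] mult.assoc[symmetric] distrib_right add.commute)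
qed simp

text \<open>The local error between consecutive dyadic refinements. The velocities differ by the
  change of force over a half step, itself of order \<open>\<delta>\<close>, times
  \<open>\<delta> / 2\<close>; the positions differ by a multiple of
  \<open>\<delta>\<^sup>2 * f x\<close> and by a further power of that change.\<close>

lemma euler_doubling:
  assumes \<delta>: "0 \<le> \<delta>" "\<delta> \<le> T"
  shows "norm1 (euler (\<delta> / 2) (euler (\<delta> / 2) z) - euler \<delta> z)
    \<le> \<delta>\<^sup>2 * ((norm (f 0) + L + L * (1 + T) * exp (T * flow_rate T)) * (1 + norm1 z))"
proof -
  obtain x v where z: "z = (x, v)" by force
  define v1 where "v1 = v - (\<delta> / 2) *\<^sub>R f x"
  define x1 where "x1 = x + (\<delta> / 2) *\<^sub>R v1"
  let ?c = "norm (f 0) + L" and ?G = "1 + norm1 z" and ?E = "exp (T * flow_rate T)"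
  have T: "0 \<le> T" using \<delta> by simp
  have c: "norm (f x) \<le> ?c * ?G" using f_growth[of z] by (simp add: z)
  have G: "1 \<le> ?G" by simp
  have "norm v1 \<le> 1 + norm1 (euler (\<delta> / 2) z)" by (simp add: z euler_def v1_def norm1_def)
  also have "\<dots> \<le> exp (\<delta> / 2 * flow_rate T) * ?G" by (rule euler_growth) (use \<delta> in auto)
  also have "\<dots> \<le> ?E * ?G"
    using \<delta> flow_rate_ge(1)[OF T] by (intro mult_right_mono) (auto intro!: mult_right_mono)
  finally have v1: "norm v1 \<le> ?E * ?G" .
  have "norm (f x - f x1) \<le> L * norm (x - x1)" by (rule lipschitz)
  also have "\<dots> = L * (\<delta> / 2 * norm v1)" using \<delta> by (simp add: x1_def)
  also have "\<dots> \<le> L * (\<delta> * (?E * ?G))" using \<delta> L_pos v1 by (intro mult_left_mono mult_mono) auto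
  finally have d: "norm (f x - f x1) \<le> L * (\<delta> * (?E * ?G))" .
  define q where "q = \<delta>\<^sup>2 * (L * (?E * ?G))"
  have q: "norm ((\<delta> / 2) *\<^sub>R (f x - f x1)) \<le> q"
  proof -
    have "norm ((\<delta> / 2) *\<^sub>R (f x - f x1)) \<le> \<delta> * (L * (\<delta> * (?E * ?G)))"
      using \<delta> d by (simp only: norm_scaleR) (intro mult_mono; simp)
    then show ?thesis by (simp add: q_def power2_eq_square mult_ac)
  qed
  have q0: "0 \<le> q" using L_pos by (simp add: q_def)
  have e: "euler (\<delta> / 2) (euler (\<delta> / 2) z) - euler \<delta> z =
    ((\<delta> / 2) *\<^sub>R ((\<delta> / 2) *\<^sub>R f x + (\<delta> / 2) *\<^sub>R (f x - f x1)), (\<delta> / 2) *\<^sub>R (f x - f x1))"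
  proof -
    have h: "\<delta> *\<^sub>R y = (\<delta> / 2) *\<^sub>R y + (\<delta> / 2) *\<^sub>R y" for y :: 'a
      by (simp flip: scaleR_add_left)
    have "v1 - (\<delta> / 2) *\<^sub>R f x1 - (v - \<delta> *\<^sub>R f x) = (\<delta> / 2) *\<^sub>R (f x - f x1)"
      unfolding v1_def h[of "f x"] by (simp add: algebra_simps)
    moreover have "x1 + (\<delta> / 2) *\<^sub>R (v1 - (\<delta> / 2) *\<^sub>R f x1) - (x + \<delta> *\<^sub>R (v - \<delta> *\<^sub>R f x))
      = (\<delta> / 2) *\<^sub>R ((\<delta> / 2) *\<^sub>R f x + (\<delta> / 2) *\<^sub>R (f x - f x1))"
      unfolding x1_def v1_def h[of "v - _"] h[of "f x"] by (simp add: algebra_simps)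
    ultimately show ?thesis by (simp add: z euler_def v1_def x1_def)
  qed
  have "norm ((\<delta> / 2) *\<^sub>R ((\<delta> / 2) *\<^sub>R f x + (\<delta> / 2) *\<^sub>R (f x - f x1))) \<le> \<delta> / 2 * (\<delta> / 2 * norm (f x) + q)"
    using norm_triangle_ineq[of "(\<delta> / 2) *\<^sub>R f x" "(\<delta> / 2) *\<^sub>R (f x - f x1)"] q \<delta>
    by (simp only: norm_scaleR) (intro mult_mono; simp)
  also have "\<dots> \<le> \<delta> * (\<delta> * (?c * ?G)) + T * q"
  proof -
    have "\<delta> / 2 * (\<delta> / 2 * norm (f x) + q) = (\<delta> * (\<delta> * norm (f x))) / 4 + (\<delta> * q) / 2"
      by (simp add: field_simps)
    moreover have "\<delta> * (\<delta> * norm (f x)) \<le> \<delta> * (\<delta> * (?c * ?G))"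
      by (intro mult_left_mono c \<delta>(1))
    moreover have "0 \<le> \<delta> * (\<delta> * norm (f x))" "0 \<le> \<delta> * q" using \<delta> q0 by auto
    moreover have "\<delta> * q \<le> T * q" using \<delta> q0 by (intro mult_right_mono)
    ultimately show ?thesis by linarith
  qed
  finally have "norm1 (euler (\<delta> / 2) (euler (\<delta> / 2) z) - euler \<delta> z) \<le> \<delta> * (\<delta> * (?c * ?G)) + T * q + q"
    unfolding e norm1_def using q by simp
  also have "\<dots> = \<delta>\<^sup>2 * ((?c + L * (1 + T) * ?E) * ?G)"
    by (simp add: q_def power2_eq_square algebra_simps)
  finally show ?thesis .
qed

text \<open>Dyadic step sizes are chosen so that passing from \<open>k\<close> to
  \<open>Suc k\<close> replaces every step by two half steps, which is what
  \<open>euler_doubling\<close> compares.\<close>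

definition leap :: "real \<Rightarrow> nat \<Rightarrow> 'a \<times> 'a \<Rightarrow> 'a \<times> 'a" where
  "leap T k = euler (T / 2 ^ k) ^^ (2 ^ k)"

text \<open>Local errors of order \<open>(T / 2 ^ k)\<^sup>2\<close> are summed over
  \<open>2 ^ k\<close> steps: \<open>euler_lipschitz\<close> propagates them,
  \<open>euler_iterate_growth\<close> bounds the points where they arise. The total is of order
  \<open>T\<^sup>2 / 2 ^ k\<close>, hence summable in \<open>k\<close>.\<close>

lemma leap_Suc_dist:
  assumes T: "0 \<le> T"
  shows "\<exists>C. \<forall>k. norm1 (leap T (Suc k) z - leap T k z) \<le> C * (1 / 2) ^ k"
proof -
  let ?K = "flow_rate T" and ?G = "1 + norm1 z"
  let ?D = "norm (f 0) + L + L * (1 + T) * exp (T * ?K)"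
  have K: "1 \<le> ?K" using flow_rate_ge T by auto
  have D: "0 \<le> ?D" using L_pos T by auto
  have "norm1 (leap T (Suc k) z - leap T k z) \<le> (T * T * (?D * (exp (T * ?K) * ?G)) * exp (T * ?K)) * (1 / 2) ^ k" for k
  proof -
    define \<delta> where "\<delta> = T / 2 ^ k"
    define e where "e = \<delta>\<^sup>2 * (?D * (exp (T * ?K) * ?G))"
    have \<delta>: "0 \<le> \<delta>" "\<delta> \<le> T" "2 ^ k * \<delta> = T"
      using T by (auto simp: \<delta>_def field_simps mult_le_cancel_left1)
    let ?S = "euler (\<delta> / 2)"
    define d where "d j = norm1 (((?S \<circ> ?S) ^^ j) z - (euler \<delta> ^^ j) z)" for j
    have e0: "0 \<le> e" using D by (simp add: e_def)
    have "d (Suc j) \<le> exp (\<delta> * ?K) * d j + e" if j: "j < 2 ^ k" for j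
    proof -
      let ?a = "((?S \<circ> ?S) ^^ j) z" and ?b = "(euler \<delta> ^^ j) z"
      have "norm1 (?S (?S ?a) - ?S (?S ?b)) \<le> exp (\<delta> / 2 * ?K) * norm1 (?S ?a - ?S ?b)"
        by (rule euler_lipschitz) (use \<delta> in auto)
      also have "\<dots> \<le> exp (\<delta> / 2 * ?K) * (exp (\<delta> / 2 * ?K) * norm1 (?a - ?b))"
        by (intro mult_left_mono euler_lipschitz) (use \<delta> in auto)
      also have "\<dots> = exp (\<delta> * ?K) * d j" by (simp add: d_def exp_add[symmetric] mult.assoc[symmetric])
      finally have 1: "norm1 (?S (?S ?a) - ?S (?S ?b)) \<le> exp (\<delta> * ?K) * d j" .
      have "real j \<le> 2 ^ k" using j by (metis less_imp_le of_nat_le_iff of_nat_numeral of_nat_power)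
      then have "real j * \<delta> \<le> T" using \<delta> by (metis mult_right_mono)
      then have "real j * (\<delta> * ?K) \<le> T * ?K" using K by (simp add: mult.assoc[symmetric])
      then have "1 + norm1 ?b \<le> exp (T * ?K) * ?G"
        using euler_iterate_growth[OF \<delta>(1,2), of j z] by (smt (verit) exp_le_cancel_iff mult_right_mono norm1_nonneg)
      then have 2: "norm1 (?S (?S ?b) - euler \<delta> ?b) \<le> e"
        using euler_doubling[OF \<delta>(1,2), of ?b] D unfolding e_def
        by (meson mult_left_mono order_trans zero_le_power2)
      show ?thesis
        using norm1_triangle[of "?S (?S ?a)" "euler \<delta> ?b" "?S (?S ?b)"] 1 2 by (simp add: d_def)
    qed
    from prod_exp_bound[where d=d and n="2 ^ k" and j="2 ^ k", OF _ this]
    have "d (2 ^ k) \<le> 2 ^ k * e * exp (2 ^ k * (\<delta> * ?K))"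
      using \<delta> K e0 by (simp add: d_def)
    also have "2 ^ k * (\<delta> * ?K) = T * ?K" using \<delta>(3) by (simp add: mult.assoc[symmetric])
    also have "2 ^ k * e = T * \<delta> * (?D * (exp (T * ?K) * ?G))"
      unfolding e_def \<delta>(3)[symmetric] by (simp add: power2_eq_square)
    also have "\<dots> = T * T * (?D * (exp (T * ?K) * ?G)) * (1 / 2) ^ k"
      by (simp add: \<delta>_def power_one_over)
    finally have "d (2 ^ k) \<le> T * T * (?D * (exp (T * ?K) * ?G)) * exp (T * ?K) * (1 / 2) ^ k"
      by (simp add: mult_ac)
    moreover have "(?S \<circ> ?S) ^^ (2 ^ k) = ?S ^^ (2 * 2 ^ k)"
    proof -
      have "?S \<circ> ?S = ?S ^^ 2" by (simp add: numeral_2_eq_2)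
      then show ?thesis by (simp only: funpow_mult mult.commute)
    qed
    ultimately show ?thesis by (simp add: leap_def d_def \<delta>_def mult.commute)
  qed
  then show ?thesis by blast
qed

definition flow :: "real \<Rightarrow> 'a \<times> 'a \<Rightarrow> 'a \<times> 'a" where
  "flow T z = lim (\<lambda>k. leap T k z)"

lemma leap_tendsto_flow:
  assumes T: "0 \<le> T"
  shows "(\<lambda>k. leap T k z) \<longlonglongrightarrow> flow T z"
proof -
  obtain C where C: "\<And>k. norm1 (leap T (Suc k) z - leap T k z) \<le> C * (1 / 2) ^ k"
    using leap_Suc_dist[OF T] by blast
  have "summable (\<lambda>k. leap T (Suc k) z - leap T k z)"
    by (rule summable_comparison_test'[where g="\<lambda>k. C * (1 / 2) ^ k"])
       (auto intro!: summable_mult summable_geometric order_trans[OF norm_le_norm1 C])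
  then have "convergent (\<lambda>n. \<Sum>k<n. leap T (Suc k) z - leap T k z)"
    by (simp add: summable_iff_convergent)
  then have "convergent (\<lambda>n. leap T n z - leap T 0 z)"
    by (simp only: sum_lessThan_telescope[of "\<lambda>k. leap T k z"])
  then have "convergent (\<lambda>n. (leap T n z - leap T 0 z) + leap T 0 z)"
    by (intro convergent_add convergent_const)
  then show ?thesis by (simp add: flow_def convergent_LIMSEQ_iff)
qed

text \<open>The first-order change of \<open>V\<close>, expanded with the updated velocity, cancels
  against the first-order change of the kinetic energy. Convexity and smoothness of \<open>V\<close>
  bound the rest at order \<open>\<delta>\<^sup>2\<close>.\<close>

lemma euler_energy:
  assumes \<delta>: "0 \<le> \<delta>" "\<delta> \<le> T"
  shows "\<bar>ham (euler \<delta> z) - ham z\<bar> \<le> \<delta>\<^sup>2 * (((norm (f 0) + L)\<^sup>2 + L * (exp (T * flow_rate T))\<^sup>2) * (1 + norm1 z)\<^sup>2)"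
proof -
  obtain x v where z: "z = (x, v)" by force
  define v1 where "v1 = v - \<delta> *\<^sub>R f x"
  let ?c = "norm (f 0) + L" and ?G = "1 + norm1 z" and ?E = "exp (T * flow_rate T)"
  have T: "0 \<le> T" using \<delta> by simp
  have c: "norm (f x) \<le> ?c * ?G" using f_growth[of z] by (simp add: z)
  have "norm v1 \<le> 1 + norm1 (euler \<delta> z)" by (simp add: z euler_def v1_def norm1_def)
  also have "\<dots> \<le> exp (\<delta> * flow_rate T) * ?G" by (rule euler_growth) (use \<delta> in auto)
  also have "\<dots> \<le> ?E * ?G"
    using \<delta> flow_rate_ge(1)[OF T] by (intro mult_right_mono) (auto intro!: mult_right_mono)
  finally have v1: "norm v1 \<le> ?E * ?G" .
  \<comment> \<open>Expanding around the new velocity \<open>v1\<close> produces the cross term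
    \<open>f x \<bullet> v1\<close>, the one that also occurs in the expansion of \<open>V\<close>
    at the new position.\<close>
  have v: "(norm v)\<^sup>2 = (norm v1)\<^sup>2 + 2 * \<delta> * (f x \<bullet> v1) + \<delta>\<^sup>2 * (norm (f x))\<^sup>2"
  proof -
    have "v = v1 + \<delta> *\<^sub>R f x" by (simp add: v1_def)
    then show ?thesis unfolding power2_norm_eq_inner
      by (simp add: inner_add_left inner_add_right inner_commute power2_eq_square)
  qed
  have lo: "V x + \<delta> * (f x \<bullet> v1) \<le> V (x + \<delta> *\<^sub>R v1)"
  proof -
    have "0 \<le> m / 2 * (norm (x + \<delta> *\<^sub>R v1 - x))\<^sup>2" using m_pos by simp
    then show ?thesis using lower[of x "x + \<delta> *\<^sub>R v1"] by simp
  qed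
  have up: "V (x + \<delta> *\<^sub>R v1) \<le> V x + \<delta> * (f x \<bullet> v1) + L / 2 * (\<delta>\<^sup>2 * (norm v1)\<^sup>2)"
    using upper[of "x + \<delta> *\<^sub>R v1" x] by (simp add: power_mult_distrib)
  have "\<bar>ham (euler \<delta> z) - ham z\<bar> \<le> \<delta>\<^sup>2 * ((norm (f x))\<^sup>2 + L * (norm v1)\<^sup>2)"
  proof -
    have "ham (euler \<delta> z) - ham z = V (x + \<delta> *\<^sub>R v1) - V x - \<delta> * (f x \<bullet> v1) - \<delta>\<^sup>2 * (norm (f x))\<^sup>2 / 2"
    proof -
      have "(norm v)\<^sup>2 / 2 = (norm v1)\<^sup>2 / 2 + \<delta> * (f x \<bullet> v1) + \<delta>\<^sup>2 * (norm (f x))\<^sup>2 / 2"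
        by (simp add: v add_divide_distrib)
      moreover have "ham (euler \<delta> z) - ham z = V (x + \<delta> *\<^sub>R v1) + (norm v1)\<^sup>2 / 2 - (V x + (norm v)\<^sup>2 / 2)"
        by (simp add: ham_def euler_def z v1_def[symmetric])
      ultimately show ?thesis by linarith
    qed
    moreover have "0 \<le> \<delta>\<^sup>2 * (norm (f x))\<^sup>2" "0 \<le> L * (\<delta>\<^sup>2 * (norm v1)\<^sup>2)" using L_pos by auto
    moreover have "\<delta>\<^sup>2 * ((norm (f x))\<^sup>2 + L * (norm v1)\<^sup>2) = \<delta>\<^sup>2 * (norm (f x))\<^sup>2 + L * (\<delta>\<^sup>2 * (norm v1)\<^sup>2)"
      by (simp add: algebra_simps)
    ultimately show ?thesis using lo up by linarith
  qed
  also have "\<dots> \<le> \<delta>\<^sup>2 * ((?c * ?G)\<^sup>2 + L * (?E * ?G)\<^sup>2)"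
    using c v1 L_pos by (intro mult_left_mono add_mono power_mono) auto
  also have "\<dots> = \<delta>\<^sup>2 * ((?c\<^sup>2 + L * ?E\<^sup>2) * ?G\<^sup>2)"
    unfolding power_mult_distrib by (simp only: distrib_right mult.assoc)
  finally show ?thesis .
qed

text \<open>The \<open>2 ^ k\<close> energy defects of order \<open>(T / 2 ^ k)\<^sup>2\<close> sum
  to a quantity that vanishes in the limit.\<close>

lemma ham_flow:
  assumes T: "0 \<le> T"
  shows "ham (flow T z) = ham z"
proof -
  let ?K = "flow_rate T"
  let ?C = "((norm (f 0) + L)\<^sup>2 + L * (exp (T * ?K))\<^sup>2) * (exp (T * ?K) * (1 + norm1 z))\<^sup>2"
  have K: "1 \<le> ?K" using flow_rate_ge T by auto
  have *: "norm (ham (leap T k z) - ham z) \<le> T\<^sup>2 * ?C * (1 / 2) ^ k" for k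
  proof -
    define \<delta> where "\<delta> = T / 2 ^ k"
    have \<delta>: "0 \<le> \<delta>" "\<delta> \<le> T" "2 ^ k * \<delta> = T"
      using T by (auto simp: \<delta>_def field_simps mult_le_cancel_left1)
    have "\<bar>ham ((euler \<delta> ^^ j) z) - ham z\<bar> \<le> real j * (\<delta>\<^sup>2 * ?C)" if "j \<le> 2 ^ k" for j
      using that
    proof (induction j)
      case (Suc j)
      let ?b = "(euler \<delta> ^^ j) z"
      have "real j \<le> 2 ^ k" using Suc.prems by (metis Suc_leD of_nat_le_iff of_nat_numeral of_nat_power)
      then have "real j * \<delta> \<le> T" using \<delta> by (metis mult_right_mono)
      then have "real j * (\<delta> * ?K) \<le> T * ?K" using K by (simp add: mult.assoc[symmetric])
      then have "1 + norm1 ?b \<le> exp (T * ?K) * (1 + norm1 z)"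
        using euler_iterate_growth[OF \<delta>(1,2), of j z] by (smt (verit) exp_le_cancel_iff mult_right_mono norm1_nonneg)
      then have g: "(1 + norm1 ?b)\<^sup>2 \<le> (exp (T * ?K) * (1 + norm1 z))\<^sup>2" by (intro power_mono) auto
      have "\<bar>ham (euler \<delta> ?b) - ham ?b\<bar> \<le> \<delta>\<^sup>2 * ?C"
        by (rule order_trans[OF euler_energy[OF \<delta>(1,2)]]) (use g L_pos in \<open>intro mult_left_mono; auto\<close>)
      then show ?case using Suc by (simp add: distrib_right)
    qed simp
    from this[of "2 ^ k"] have "\<bar>ham (leap T k z) - ham z\<bar> \<le> 2 ^ k * (\<delta>\<^sup>2 * ?C)"
      by (simp add: leap_def \<delta>_def)
    also have "2 ^ k * (\<delta>\<^sup>2 * ?C) = T\<^sup>2 * ?C * (1 / 2) ^ k"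
      by (simp add: \<delta>_def power2_eq_square power_one_over field_simps)
    finally show ?thesis by simp
  qed
  have "(\<lambda>k. T\<^sup>2 * ?C * (1 / 2) ^ k) \<longlonglongrightarrow> T\<^sup>2 * ?C * 0"
    by (intro tendsto_mult tendsto_const LIMSEQ_power_zero) simp
  then have "(\<lambda>k. ham (leap T k z) - ham z) \<longlonglongrightarrow> 0"
    by (intro Lim_null_comparison[OF always_eventually[OF allI[OF *]]]) simp
  then have "(\<lambda>k. ham (leap T k z)) \<longlonglongrightarrow> ham z" by (simp add: LIM_zero_iff)
  moreover have "(\<lambda>k. ham (leap T k z)) \<longlonglongrightarrow> ham (flow T z)"
    by (rule continuous_on_tendsto_compose[OF continuous_ham[of UNIV] leap_tendsto_flow[OF T]]) auto
  ultimately show ?thesis by (metis LIMSEQ_unique)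
qed


section \<open>Invariance of the target and short-time expansion of the flow\<close>

lemma euler_measurable [measurable]: "euler \<delta> \<in> borel_measurable borel"
proof -
  have "continuous_on UNIV (\<lambda>z. (fst z + \<delta> *\<^sub>R (snd z - \<delta> *\<^sub>R f (fst z)), snd z - \<delta> *\<^sub>R f (fst z)))"
    by (intro continuous_intros continuous_on_compose2[OF continuous_f[of UNIV]]) auto
  then have "(\<lambda>z. (fst z + \<delta> *\<^sub>R (snd z - \<delta> *\<^sub>R f (fst z)), snd z - \<delta> *\<^sub>R f (fst z))) \<in> borel_measurable borel"
    by (rule borel_measurable_continuous_onI)
  then show ?thesis by (simp add: euler_def case_prod_beta')
qed

lemma leap_measurable [measurable]: "leap T k \<in> borel_measurable borel"
proof -
  have "(euler \<delta> ^^ n) \<in> borel_measurable borel" for \<delta> n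
    by (induction n) (auto simp: measurable_comp)
  then show ?thesis by (simp add: leap_def)
qed

lemma flow_measurable [measurable]: "0 \<le> T \<Longrightarrow> flow T \<in> borel_measurable borel"
  by (rule borel_measurable_LIMSEQ_metric[OF leap_measurable leap_tendsto_flow])

text \<open>For a fixed position the velocity update is a translation, and the position update that
  follows is a shear.\<close>

lemma nn_integral_euler:
  fixes F :: "'a \<times> 'a \<Rightarrow> ennreal"
  assumes F: "F \<in> borel_measurable borel"
  shows "(\<integral>\<^sup>+ z. F (euler \<delta> z) \<partial>lborel) = (\<integral>\<^sup>+ z. F z \<partial>lborel)"
proof -
  have F': "F \<in> borel_measurable (borel \<Otimes>\<^sub>M borel)" using F by (simp add: borel_prod)
  have [measurable]: "(\<lambda>z. F (g z, h z)) \<in> borel_measurable M"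
    if [measurable]: "g \<in> borel_measurable M" "h \<in> borel_measurable M" for g h and M :: "'b measure"
    using measurable_compose[OF measurable_Pair[OF that] F'] by simp
  have [measurable]: "f \<in> borel_measurable borel"
    by (rule borel_measurable_continuous_onI[OF continuous_f])
  have it: "(\<integral>\<^sup>+ z. H z \<partial>lborel) = (\<integral>\<^sup>+ x. \<integral>\<^sup>+ v. H (x, v) \<partial>lborel \<partial>lborel)"
    if "H \<in> borel_measurable borel" for H :: "'a \<times> 'a \<Rightarrow> ennreal"
    using lborel.nn_integral_fst[of H lborel] that by (simp add: lborel_prod borel_prod)
  have "(\<integral>\<^sup>+ z. F (euler \<delta> z) \<partial>lborel)
    = (\<integral>\<^sup>+ x. \<integral>\<^sup>+ v. F (x + \<delta> *\<^sub>R (v + (- \<delta> *\<^sub>R f x)), v + (- \<delta> *\<^sub>R f x)) \<partial>lborel \<partial>lborel)"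
    by (subst it[OF measurable_compose[OF euler_measurable F]]) (simp add: euler_def)
  also have "\<dots> = (\<integral>\<^sup>+ x. \<integral>\<^sup>+ v. F (x + \<delta> *\<^sub>R v, v) \<partial>lborel \<partial>lborel)"
    by (intro nn_integral_cong nn_integral_lborel_translate) simp
  also have "\<dots> = (\<integral>\<^sup>+ x. \<integral>\<^sup>+ v. F (x, v) \<partial>lborel \<partial>lborel)"
    using F' by (intro nn_integral_lborel_shear(2)[of "\<lambda>x v. F (x, v)"]) simp
  also have "\<dots> = (\<integral>\<^sup>+ z. F z \<partial>lborel)" using F by (simp add: it)
  finally show ?thesis .
qed

lemma nn_integral_leap:
  fixes F :: "'a \<times> 'a \<Rightarrow> ennreal"
  assumes [measurable]: "F \<in> borel_measurable borel"
  shows "(\<integral>\<^sup>+ z. F (leap T k z) \<partial>lborel) = (\<integral>\<^sup>+ z. F z \<partial>lborel)"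
proof -
  have m: "(euler \<delta> ^^ n) \<in> borel_measurable borel" for \<delta> n
    by (induction n) (auto simp: measurable_comp)
  have "(\<integral>\<^sup>+ z. F ((euler \<delta> ^^ n) z) \<partial>lborel) = (\<integral>\<^sup>+ z. F z \<partial>lborel)" for \<delta> n
  proof (induction n)
    case (Suc n)
    have "(\<integral>\<^sup>+ z. F ((euler \<delta> ^^ Suc n) z) \<partial>lborel) = (\<integral>\<^sup>+ z. F ((euler \<delta> ^^ n) (euler \<delta> z)) \<partial>lborel)"
      by (simp only: funpow_Suc_right comp_def)
    also have "\<dots> = (\<integral>\<^sup>+ z. F ((euler \<delta> ^^ n) z) \<partial>lborel)"
      by (rule nn_integral_euler[of "\<lambda>z. F ((euler \<delta> ^^ n) z)"]) (rule measurable_compose[OF m assms])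
    finally show ?case using Suc by simp
  qed simp
  then show ?thesis by (simp add: leap_def)
qed

lemma ham_measurable [measurable]: "ham \<in> borel_measurable borel"
  by (rule borel_measurable_continuous_onI[OF continuous_ham])

lemma target_eq: "target V = gibbs ham"
  by (simp add: target_def ham_def)

text \<open>The splitting scheme preserves Lebesgue measure, so Fatou's lemma bounds the image of an open
  set; for probability measures this one-sided bound suffices.\<close>

lemma target_flow_invariant:
  assumes T: "0 \<le> T" and P: "prob_space (target V)"
  shows "distr (target V) borel (flow T) = target V"
proof -
  have s: "sets (target V) = sets borel" by (simp add: target_def gibbs_def)
  have [measurable]: "flow T \<in> borel_measurable borel" using T by simp
  let ?Z = "\<integral>\<^sup>+ z'. ennreal (exp (- ham z')) \<partial>lborel"
  have em: "emeasure (target V) A = (\<integral>\<^sup>+ z. indicator A z * ennreal (exp (- ham z)) \<partial>lborel) / ?Z"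
    if [measurable]: "A \<in> sets borel" for A
  proof -
    have "emeasure (target V) A = (\<integral>\<^sup>+ z. ennreal (exp (- ham z)) / ?Z * indicator A z \<partial>lborel)"
      unfolding target_eq gibbs_def by (subst emeasure_density) auto
    also have "\<dots> = (\<integral>\<^sup>+ z. (indicator A z * ennreal (exp (- ham z))) / ?Z \<partial>lborel)"
      by (intro nn_integral_cong) (simp add: divide_ennreal_def mult_ac)
    finally show ?thesis by (simp add: nn_integral_divide)
  qed
  show ?thesis
  proof (rule prob_measure_eqI_open_le[OF P s])
    show "prob_space (distr (target V) borel (flow T))"
      by (rule prob_space.prob_space_distr[OF P]) (simp add: measurable_cong_sets[OF s refl])
    fix U :: "('a \<times> 'a) set" assume U: "open U"
    have [measurable]: "U \<in> sets borel" using U by simp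
    have "emeasure (distr (target V) borel (flow T)) U = emeasure (target V) (flow T -` U)"
      by (subst emeasure_distr) (auto simp: measurable_cong_sets[OF s refl] sets_eq_imp_space_eq[OF s])
    \<comment> \<open>Conservation of energy replaces the density at \<open>z\<close> by the density
      at the flowed point, so that the integrand becomes a function of \<open>flow T z\<close>
      alone.\<close>
    also have "\<dots> = (\<integral>\<^sup>+ z. indicator U (flow T z) * ennreal (exp (- ham (flow T z))) \<partial>lborel) / ?Z"
      by (subst em) (auto simp: ham_flow[OF T] indicator_def vimage_def intro!: arg_cong2[where f="(/)"] nn_integral_cong measurable_sets_borel)
    also have "\<dots> \<le> (\<integral>\<^sup>+ z. indicator U z * ennreal (exp (- ham z)) \<partial>lborel) / ?Z"
    proof (rule divide_right_mono_ennreal)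
      have "(\<integral>\<^sup>+ z. indicator U (flow T z) * ennreal (exp (- ham (flow T z))) \<partial>lborel)
        \<le> (\<integral>\<^sup>+ z. liminf (\<lambda>k. indicator U (leap T k z) * ennreal (exp (- ham (leap T k z)))) \<partial>lborel)"
      proof (rule nn_integral_mono)
        fix z
        show "indicator U (flow T z) * ennreal (exp (- ham (flow T z)))
          \<le> liminf (\<lambda>k. indicator U (leap T k z) * ennreal (exp (- ham (leap T k z))))"
        proof (cases "flow T z \<in> U")
          case True
          have l: "(\<lambda>k. ennreal (exp (- ham (leap T k z)))) \<longlonglongrightarrow> ennreal (exp (- ham (flow T z)))"
            by (intro tendsto_ennrealI tendsto_exp tendsto_minus
                continuous_on_tendsto_compose[OF continuous_ham[of UNIV] leap_tendsto_flow[OF T]]) auto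
          \<comment> \<open>Openness of \<open>U\<close> makes its indicator lower semicontinuous
            along the approximations, which is the direction that Fatou's lemma requires.\<close>
          have "eventually (\<lambda>k. leap T k z \<in> U) sequentially"
            using leap_tendsto_flow[OF T] U True by (rule topological_tendstoD)
          then have "(\<lambda>k. indicator U (leap T k z) * ennreal (exp (- ham (leap T k z)))) \<longlonglongrightarrow> ennreal (exp (- ham (flow T z)))"
            by (intro Lim_transform_eventually[OF l]) (auto elim: eventually_mono)
          then show ?thesis using True by (simp add: lim_imp_Liminf)
        qed simp
      qed
      also have "\<dots> \<le> liminf (\<lambda>k. \<integral>\<^sup>+ z. indicator U (leap T k z) * ennreal (exp (- ham (leap T k z))) \<partial>lborel)"
        by (rule nn_integral_liminf) measurable
      also have "\<dots> = (\<integral>\<^sup>+ z. indicator U z * ennreal (exp (- ham z)) \<partial>lborel)"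
        by (subst nn_integral_leap) (simp_all add: Liminf_const)
      finally show "(\<integral>\<^sup>+ z. indicator U (flow T z) * ennreal (exp (- ham (flow T z))) \<partial>lborel)
        \<le> (\<integral>\<^sup>+ z. indicator U z * ennreal (exp (- ham z)) \<partial>lborel)" .
    qed
    also have "\<dots> = emeasure (target V) U" by (simp add: em)
    finally show "emeasure (distr (target V) borel (flow T)) U \<le> emeasure (target V) U" .
  qed simp
qed

text \<open>\<open>W\<close> is an a priori bound of the speed; its defining inequality is what lets
  the induction reproduce the bound. The path up to time t then stays within \<open>t W\<close> of
  \<open>x\<close>, the force changes by at most \<open>L t W\<close>, and summing once and twice
  gives the remainders of velocity and position. The coefficient \<open>j (j + 1) / 2\<close> sums
  the step indices \<open>1, ..., j\<close> and is the discrete form of half the squared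
  time.\<close>

lemma euler_iterate_bounds:
  fixes x v :: 'a
  assumes \<delta>: "0 \<le> \<delta>" and T: "real n * \<delta> = T" and j: "j \<le> n"
    and W: "norm v + T * norm (f x) + L * T\<^sup>2 / 2 * W \<le> W" and W0: "0 \<le> W"
  shows "norm (snd ((euler \<delta> ^^ j) (x, v)) - v + (real j * \<delta>) *\<^sub>R f x) \<le> L * W * (real j * \<delta>)\<^sup>2 / 2"
    and "norm (fst ((euler \<delta> ^^ j) (x, v)) - x) \<le> real j * \<delta> * W"
    and "norm (fst ((euler \<delta> ^^ j) (x, v)) - x - (real j * \<delta>) *\<^sub>R v + (real j * (real j + 1) / 2 * \<delta>\<^sup>2) *\<^sub>R f x)
      \<le> real j * \<delta> * (L * T\<^sup>2 / 2 * W)"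
proof -
  let ?B = "L * T\<^sup>2 / 2 * W"
  define X where "X j = fst ((euler \<delta> ^^ j) (x, v))" for j
  define Y where "Y j = snd ((euler \<delta> ^^ j) (x, v))" for j
  have XY0: "X 0 = x" "Y 0 = v" by (auto simp: X_def Y_def)
  have Y: "Y (Suc j) = Y j - \<delta> *\<^sub>R f (X j)" and X: "X (Suc j) = X j + \<delta> *\<^sub>R Y (Suc j)" for j
    by (simp_all add: X_def Y_def euler_def case_prod_beta)
  have "norm (Y j - v + (real j * \<delta>) *\<^sub>R f x) \<le> L * W * (real j * \<delta>)\<^sup>2 / 2 \<and>
    norm (X j - x) \<le> real j * \<delta> * W \<and>
    norm (X j - x - (real j * \<delta>) *\<^sub>R v + (real j * (real j + 1) / 2 * \<delta>\<^sup>2) *\<^sub>R f x) \<le> real j * \<delta> * ?B"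
    using j
  proof (induction j)
    case (Suc j)
    then have IH: "norm (Y j - v + (real j * \<delta>) *\<^sub>R f x) \<le> L * W * (real j * \<delta>)\<^sup>2 / 2"
      "norm (X j - x) \<le> real j * \<delta> * W"
      "norm (X j - x - (real j * \<delta>) *\<^sub>R v + (real j * (real j + 1) / 2 * \<delta>\<^sup>2) *\<^sub>R f x) \<le> real j * \<delta> * ?B"
      by simp_all
    let ?t = "real (Suc j) * \<delta>"
    have t: "0 \<le> ?t" "?t \<le> T" using Suc.prems \<delta> by (auto simp: T[symmetric] intro!: mult_right_mono)
    have e: "Y (Suc j) - v + ?t *\<^sub>R f x = (Y j - v + (real j * \<delta>) *\<^sub>R f x) + \<delta> *\<^sub>R (f x - f (X j))"
      by (simp add: Y algebra_simps)
    have "norm (Y (Suc j) - v + ?t *\<^sub>R f x) \<le> L * W * (real j * \<delta>)\<^sup>2 / 2 + \<delta> * norm (f x - f (X j))"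
      unfolding e
      using norm_triangle_ineq[of "Y j - v + (real j * \<delta>) *\<^sub>R f x" "\<delta> *\<^sub>R (f x - f (X j))"] IH(1) \<delta> by simp
    also have "\<dots> \<le> L * W * (real j * \<delta>)\<^sup>2 / 2 + \<delta> * (L * (real j * \<delta> * W))"
      using lipschitz[of x "X j"] IH(2) L_pos \<delta> by (intro add_left_mono mult_left_mono) 
        (auto simp: norm_minus_commute intro: order_trans mult_left_mono)
    also have "\<dots> = L * W * ((real j * \<delta>)\<^sup>2 + 2 * (\<delta> * (real j * \<delta>))) / 2"
      by (simp add: algebra_simps)
    also have "\<dots> \<le> L * W * ?t\<^sup>2 / 2"
      using L_pos W0 by (intro divide_right_mono mult_left_mono) (auto simp: power2_eq_square algebra_simps)
    finally have 1: "norm (Y (Suc j) - v + ?t *\<^sub>R f x) \<le> L * W * ?t\<^sup>2 / 2" .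
    also have "\<dots> \<le> L * W * T\<^sup>2 / 2"
      using t L_pos W0 by (intro divide_right_mono mult_left_mono power_mono) auto
    finally have y1: "norm (Y (Suc j) - v + ?t *\<^sub>R f x) \<le> ?B" by (simp add: mult_ac)
    have "norm (Y (Suc j)) \<le> norm v + ?t * norm (f x) + ?B"
      using norm_triangle_ineq[of "Y (Suc j) - v + ?t *\<^sub>R f x" "v - ?t *\<^sub>R f x"]
        norm_triangle_ineq4[of v "?t *\<^sub>R f x"] y1 t by simp
    also have "\<dots> \<le> norm v + T * norm (f x) + ?B" using t by (intro add_right_mono add_left_mono mult_right_mono) auto
    also have "\<dots> \<le> W" by (rule W)
    finally have w: "norm (Y (Suc j)) \<le> W" .
    have "norm (X (Suc j) - x) \<le> norm (X j - x) + \<delta> * norm (Y (Suc j))"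
      using norm_triangle_ineq[of "X j - x" "\<delta> *\<^sub>R Y (Suc j)"] \<delta> by (simp add: X algebra_simps)
    also have "\<dots> \<le> real j * \<delta> * W + \<delta> * W" using IH(2) w \<delta> by (intro add_mono mult_left_mono)
    finally have 2: "norm (X (Suc j) - x) \<le> ?t * W" by (simp add: algebra_simps)
    have e3: "X (Suc j) - x - ?t *\<^sub>R v + (real (Suc j) * (real (Suc j) + 1) / 2 * \<delta>\<^sup>2) *\<^sub>R f x
      = (X j - x - (real j * \<delta>) *\<^sub>R v + (real j * (real j + 1) / 2 * \<delta>\<^sup>2) *\<^sub>R f x) + \<delta> *\<^sub>R (Y (Suc j) - v + ?t *\<^sub>R f x)"
    proof -
      have c: "real (Suc j) * (real (Suc j) + 1) / 2 * \<delta>\<^sup>2 = real j * (real j + 1) / 2 * \<delta>\<^sup>2 + \<delta> * ?t"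
        by (simp add: field_simps power2_eq_square)
      show ?thesis unfolding c X[of j] scaleR_add_left scaleR_add_right scaleR_diff_right scaleR_scaleR
        by (simp add: algebra_simps)
    qed
    have "norm (X (Suc j) - x - ?t *\<^sub>R v + (real (Suc j) * (real (Suc j) + 1) / 2 * \<delta>\<^sup>2) *\<^sub>R f x)
      \<le> real j * \<delta> * ?B + \<delta> * ?B"
      unfolding e3
      using norm_triangle_ineq[of "X j - x - (real j * \<delta>) *\<^sub>R v + (real j * (real j + 1) / 2 * \<delta>\<^sup>2) *\<^sub>R f x"
          "\<delta> *\<^sub>R (Y (Suc j) - v + ?t *\<^sub>R f x)"] IH(3) mult_left_mono[OF y1 \<delta>] \<delta> by simp
    then have 3: "norm (X (Suc j) - x - ?t *\<^sub>R v + (real (Suc j) * (real (Suc j) + 1) / 2 * \<delta>\<^sup>2) *\<^sub>R f x) \<le> ?t * ?B"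
      by (simp add: algebra_simps)
    show ?case using 1 2 3 by blast
  next
    case 0
    show ?case by (simp add: XY0)
  qed
  then show "norm (snd ((euler \<delta> ^^ j) (x, v)) - v + (real j * \<delta>) *\<^sub>R f x) \<le> L * W * (real j * \<delta>)\<^sup>2 / 2"
    "norm (fst ((euler \<delta> ^^ j) (x, v)) - x) \<le> real j * \<delta> * W"
    "norm (fst ((euler \<delta> ^^ j) (x, v)) - x - (real j * \<delta>) *\<^sub>R v + (real j * (real j + 1) / 2 * \<delta>\<^sup>2) *\<^sub>R f x)
      \<le> real j * \<delta> * ?B"
    by (auto simp: X_def Y_def)
qed

lemma flow_bounds:
  fixes x v :: 'a
  assumes T: "0 \<le> T" and W: "norm v + T * norm (f x) + L * T\<^sup>2 / 2 * W \<le> W" and W0: "0 \<le> W"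
  shows "norm (snd (flow T (x, v)) - v + T *\<^sub>R f x) \<le> L * T\<^sup>2 / 2 * W"
    and "norm (fst (flow T (x, v)) - x - T *\<^sub>R v + (T\<^sup>2 / 2) *\<^sub>R f x) \<le> T * (L * T\<^sup>2 / 2 * W)"
proof -
  have r: "real (2 ^ k) * (T / 2 ^ k) = T" for k by simp
  have d: "0 \<le> T / 2 ^ k" for k using T by simp
  note b = euler_iterate_bounds[OF d r order_refl W W0, folded leap_def]
  note lim = leap_tendsto_flow[OF T, of "(x, v)"]
  have "(\<lambda>k. norm (snd (leap T k (x, v)) - v + T *\<^sub>R f x)) \<longlonglongrightarrow> norm (snd (flow T (x, v)) - v + T *\<^sub>R f x)"
    by (intro tendsto_intros lim)
  then show "norm (snd (flow T (x, v)) - v + T *\<^sub>R f x) \<le> L * T\<^sup>2 / 2 * W"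
    by (rule LIMSEQ_le_const2) (use b(1) in \<open>auto simp: mult_ac\<close>)
  have "(\<lambda>k. T\<^sup>2 / 2 * (1 + (1 / 2) ^ k)) \<longlonglongrightarrow> T\<^sup>2 / 2 * (1 + 0)"
    by (intro tendsto_intros LIMSEQ_power_zero) simp
  then have c: "(\<lambda>k. T\<^sup>2 / 2 * (1 + (1 / 2) ^ k)) \<longlonglongrightarrow> T\<^sup>2 / 2" by simp
  \<comment> \<open>The discrete coefficient of the force at the final step; it tends to
    \<open>T\<^sup>2 / 2\<close>.\<close>
  have e: "real (2 ^ k) * (real (2 ^ k) + 1) / 2 * (T / 2 ^ k)\<^sup>2 = T\<^sup>2 / 2 * (1 + (1 / 2) ^ k)" for k
    by (simp add: power2_eq_square power_one_over field_simps)
  have "(\<lambda>k. norm (fst (leap T k (x, v)) - x - T *\<^sub>R v + (T\<^sup>2 / 2 * (1 + (1 / 2) ^ k)) *\<^sub>R f x))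
      \<longlonglongrightarrow> norm (fst (flow T (x, v)) - x - T *\<^sub>R v + (T\<^sup>2 / 2) *\<^sub>R f x)"
    by (intro tendsto_intros lim c)
  then show "norm (fst (flow T (x, v)) - x - T *\<^sub>R v + (T\<^sup>2 / 2) *\<^sub>R f x) \<le> T * (L * T\<^sup>2 / 2 * W)"
    by (rule LIMSEQ_le_const2) (use b(3)[unfolded e r] in blast)
qed

end

section \<open>Couplings and Wasserstein distances\<close>

lemma ennreal_power_le_iff: 
  assumes "0 < p" shows "x ^ p \<le> y ^ p \<longleftrightarrow> x \<le> (y :: ennreal)"
proof -
  have top: "(\<top> :: ennreal) ^ p = \<top>" using assms by (simp add: power_eq_top_ennreal)
  show ?thesis
  proof (cases x)
    case (real a)
    show ?thesis
    proof (cases y)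
      case (real b)
      then show ?thesis using \<open>x = ennreal a\<close> \<open>0 \<le> a\<close> assms by (simp add: ennreal_power power_mono_iff)
    next
      case top' : top
      then show ?thesis by (simp add: top)
    qed
  next
    case top' : top
    have "y ^ p = \<top> \<longleftrightarrow> y = \<top>" using assms by (simp add: power_eq_top_ennreal)
    then show ?thesis by (simp add: top' top top_unique)
  qed
qed

lemma ennreal_root_power [simp]: assumes "0 < p" shows "ennreal_root p x ^ p = x"
proof (cases x)
  case (real r)
  then show ?thesis using assms by (simp add: ennreal_root_def ennreal_power)
next
  case top
  then show ?thesis using assms by (simp add: ennreal_root_def power_eq_top_ennreal)
qed
lemma ennreal_root_le_iff: "0 < p \<Longrightarrow> ennreal_root p x \<le> y \<longleftrightarrow> x \<le> y ^ p"
  using ennreal_power_le_iff[of p "ennreal_root p x" y] by simp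

lemma le_ennreal_root_iff: "0 < p \<Longrightarrow> y \<le> ennreal_root p x \<longleftrightarrow> y ^ p \<le> x"
  using ennreal_power_le_iff[of p y "ennreal_root p x"] by simp

lemma ennreal_root_less_iff: "0 < p \<Longrightarrow> ennreal_root p x < y \<longleftrightarrow> x < y ^ p"
  using le_ennreal_root_iff[of p y x] linorder_not_le by blast

lemma ennreal_root_power_cancel [simp]: "0 < p \<Longrightarrow> ennreal_root p (x ^ p) = x"
  by (intro antisym) (simp_all add: ennreal_root_le_iff le_ennreal_root_iff)

text \<open>Values in \<open>ennreal\<close> let monotonicity and Minkowski's inequality hold
  without integrability conditions, also where a Wasserstein distance may be infinite.\<close>

definition lp_norm :: "nat \<Rightarrow> 'a measure \<Rightarrow> ('a \<Rightarrow> ennreal) \<Rightarrow> ennreal" where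
  "lp_norm p M f = ennreal_root p (\<integral>\<^sup>+ x. f x ^ p \<partial>M)"

lemma lp_norm_power: "0 < p \<Longrightarrow> lp_norm p M f ^ p = (\<integral>\<^sup>+ x. f x ^ p \<partial>M)"
  by (simp add: lp_norm_def)

lemma lp_norm_le_iff: "0 < p \<Longrightarrow> lp_norm p M f \<le> y \<longleftrightarrow> (\<integral>\<^sup>+ x. f x ^ p \<partial>M) \<le> y ^ p"
  by (simp add: lp_norm_def ennreal_root_le_iff)

lemma lp_norm_mono_AE:
  assumes "0 < p" "AE x in M. f x \<le> g x"
  shows "lp_norm p M f \<le> lp_norm p M g"
  unfolding lp_norm_le_iff[OF assms(1)] lp_norm_power[OF assms(1)]
  by (rule nn_integral_mono_AE, rule eventually_mono[OF assms(2)])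
     (simp add: ennreal_power_le_iff[OF assms(1)])

lemma lp_norm_mono:
  assumes "0 < p" "\<And>x. x \<in> space M \<Longrightarrow> f x \<le> g x"
  shows "lp_norm p M f \<le> lp_norm p M g"
  using assms by (intro lp_norm_mono_AE) auto

lemma lp_norm_cmult:
  assumes p: "0 < p" and [measurable]: "f \<in> borel_measurable M"
  shows "lp_norm p M (\<lambda>x. c * f x) = c * lp_norm p M f"
proof -
  have "lp_norm p M (\<lambda>x. c * f x) ^ p = (c * lp_norm p M f) ^ p"
    using p by (simp add: lp_norm_power power_mult_distrib nn_integral_cmult)
  then have "ennreal_root p (lp_norm p M (\<lambda>x. c * f x) ^ p) = ennreal_root p ((c * lp_norm p M f) ^ p)"
    by (rule arg_cong)
  then show ?thesis by (simp only: ennreal_root_power_cancel[OF p])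
qed

lemma lp_norm_distr:
  assumes [measurable]: "T \<in> measurable M N" "f \<in> borel_measurable N"
  shows "lp_norm p (distr M N T) f = lp_norm p M (\<lambda>x. f (T x))"
  by (simp add: lp_norm_def nn_integral_distr)

lemma (in prob_space) lp_norm_const: "0 < p \<Longrightarrow> lp_norm p M (\<lambda>_. c) = c"
  by (simp add: lp_norm_def emeasure_space_1)

text \<open>Minkowski's inequality for the two exponents of the theorem: additivity of the integral
  for 1, expansion of the square and Cauchy-Schwarz for 2.\<close>

lemma lp_norm_add:
  assumes p: "p \<in> {1, 2}" and [measurable]: "f \<in> borel_measurable M" "g \<in> borel_measurable M"
  shows "lp_norm p M (\<lambda>x. f x + g x) \<le> lp_norm p M f + lp_norm p M g"
proof (cases "p = 1")
  case True
  then show ?thesis using lp_norm_power[of 1 M] by (simp add: nn_integral_add)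
next
  case False
  then have p2: "p = 2" using p by simp
  let ?A = "lp_norm 2 M f" and ?B = "lp_norm 2 M g"
  have "(\<integral>\<^sup>+ x. f x * g x \<partial>M)\<^sup>2 \<le> (?A * ?B)\<^sup>2"
    using Cauchy_Schwarz_nn_integral[of f M g] by (simp add: lp_norm_power power_mult_distrib)
  then have fg: "(\<integral>\<^sup>+ x. f x * g x \<partial>M) \<le> ?A * ?B" by (simp add: ennreal_power_le_iff)
  have "(\<integral>\<^sup>+ x. (f x + g x)\<^sup>2 \<partial>M) = (\<integral>\<^sup>+ x. (f x)\<^sup>2 + (2 * (f x * g x) + (g x)\<^sup>2) \<partial>M)"
    by (intro nn_integral_cong) (simp only: mult_2, simp only: power2_eq_square distrib_left distrib_right ac_simps)
  also have "\<dots> = ?A\<^sup>2 + (2 * (\<integral>\<^sup>+ x. f x * g x \<partial>M) + ?B\<^sup>2)"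
    by (simp add: nn_integral_add nn_integral_cmult lp_norm_power)
  also have "\<dots> \<le> ?A\<^sup>2 + (2 * (?A * ?B) + ?B\<^sup>2)"
    using fg by (intro add_mono mult_left_mono) auto
  also have "\<dots> = (?A + ?B)\<^sup>2"
    by (simp only: mult_2, simp only: power2_eq_square distrib_left distrib_right ac_simps)
  finally show ?thesis by (simp add: p2 lp_norm_le_iff)
qed

text \<open>Cauchy-Schwarz against the constant 1; mean-square estimates thereby serve both
  exponents.\<close>

lemma (in prob_space) lp_norm_le_lp_norm_2:
  assumes p: "p \<in> {1, 2}" and [measurable]: "f \<in> borel_measurable M"
  shows "lp_norm p M f \<le> lp_norm 2 M f"
proof (cases "p = 1")
  case True
  have "(\<integral>\<^sup>+ x. f x * 1 \<partial>M)\<^sup>2 \<le> lp_norm 2 M f ^ 2"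
    using Cauchy_Schwarz_nn_integral[of f M "\<lambda>_. 1"] by (simp add: lp_norm_power emeasure_space_1)
  then show ?thesis using True by (simp add: lp_norm_le_iff ennreal_power_le_iff)
qed (use p in auto)

section \<open>Couplings and their transport costs\<close>

lemma sets_couplings: "\<tau> \<in> couplings \<mu> \<nu> \<Longrightarrow> sets \<tau> = sets (\<mu> \<Otimes>\<^sub>M \<nu>)"
  by (simp add: couplings_def)

lemma prob_space_couplings:
  assumes "\<tau> \<in> couplings \<mu> \<nu>" "prob_space \<mu>"
  shows "prob_space \<tau>"
proof
  have [measurable_cong]: "sets \<tau> = sets (\<mu> \<Otimes>\<^sub>M \<nu>)" and d: "distr \<tau> \<mu> fst = \<mu>"
    using assms by (auto simp: couplings_def)
  have "emeasure \<tau> (space \<tau>) = emeasure (distr \<tau> \<mu> fst) (space \<mu>)"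
    by (subst emeasure_distr) (auto simp: sets_eq_imp_space_eq[OF sets_couplings[OF assms(1)]] space_pair_measure intro!: arg_cong[where f="emeasure \<tau>"])
  then show "emeasure \<tau> (space \<tau>) = 1" unfolding d using assms(2) by (simp add: prob_space.emeasure_space_1)
qed

lemma nn_integral_couplings:
  assumes \<tau>: "\<tau> \<in> couplings \<mu> \<nu>"
  shows "F \<in> borel_measurable \<mu> \<Longrightarrow> (\<integral>\<^sup>+ z. F (fst z) \<partial>\<tau>) = (\<integral>\<^sup>+ x. F x \<partial>\<mu>)"
    and "G \<in> borel_measurable \<nu> \<Longrightarrow> (\<integral>\<^sup>+ z. G (snd z) \<partial>\<tau>) = (\<integral>\<^sup>+ x. G x \<partial>\<nu>)"
proof -
  have [measurable_cong]: "sets \<tau> = sets (\<mu> \<Otimes>\<^sub>M \<nu>)" and d: "distr \<tau> \<mu> fst = \<mu>" "distr \<tau> \<nu> snd = \<nu>"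
    using \<tau> by (auto simp: couplings_def)
  show "(\<integral>\<^sup>+ z. F (fst z) \<partial>\<tau>) = (\<integral>\<^sup>+ x. F x \<partial>\<mu>)" if [measurable]: "F \<in> borel_measurable \<mu>"
  proof -
    have "(\<integral>\<^sup>+ x. F x \<partial>\<mu>) = (\<integral>\<^sup>+ x. F x \<partial>distr \<tau> \<mu> fst)" by (simp only: d)
    then show ?thesis by (subst (asm) nn_integral_distr) simp_all
  qed
  show "(\<integral>\<^sup>+ z. G (snd z) \<partial>\<tau>) = (\<integral>\<^sup>+ x. G x \<partial>\<nu>)" if [measurable]: "G \<in> borel_measurable \<nu>"
  proof -
    have "(\<integral>\<^sup>+ x. G x \<partial>\<nu>) = (\<integral>\<^sup>+ x. G x \<partial>distr \<tau> \<nu> snd)" by (simp only: d)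
    then show ?thesis by (subst (asm) nn_integral_distr) simp_all
  qed
qed

lemma pair_measure_in_couplings:
  assumes "prob_space \<mu>" "prob_space \<nu>"
  shows "\<mu> \<Otimes>\<^sub>M \<nu> \<in> couplings \<mu> \<nu>"
proof -
  interpret \<mu>: prob_space \<mu> by fact
  interpret \<nu>: prob_space \<nu> by fact
  interpret pair_prob_space \<mu> \<nu> ..
  have "distr (\<mu> \<Otimes>\<^sub>M \<nu>) \<nu> snd = distr (distr (\<nu> \<Otimes>\<^sub>M \<mu>) (\<mu> \<Otimes>\<^sub>M \<nu>) (\<lambda>(x, y). (y, x))) \<nu> snd"
    by (subst distr_pair_swap) simp
  also have "\<dots> = distr (\<nu> \<Otimes>\<^sub>M \<mu>) \<nu> fst"
    by (subst distr_distr) (auto simp: comp_def case_prod_beta' measurable_split_conv)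
  finally show ?thesis
    by (simp add: couplings_def \<mu>.distr_pair_fst \<nu>.distr_pair_fst)
qed

lemma distr_in_couplings:
  assumes "sets \<mu> = sets borel" "sets \<nu> = sets borel"
    and X[measurable]: "X \<in> borel_measurable M" and Y[measurable]: "Y \<in> borel_measurable M"
    and "distr M borel X = \<mu>" "distr M borel Y = \<nu>"
  shows "distr M (borel \<Otimes>\<^sub>M borel) (\<lambda>w. (X w, Y w)) \<in> couplings \<mu> \<nu>"
proof -
  have "distr (distr M (borel \<Otimes>\<^sub>M borel) (\<lambda>w. (X w, Y w))) \<mu> fst = distr M borel X"
    "distr (distr M (borel \<Otimes>\<^sub>M borel) (\<lambda>w. (X w, Y w))) \<nu> snd = distr M borel Y"
    using assms(1,2) by (auto simp: distr_distr comp_def measurable_cong_sets[OF refl assms(1)]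
        measurable_cong_sets[OF refl assms(2)] intro!: distr_cong)
  then show ?thesis using assms by (simp add: couplings_def cong: sets_pair_measure_cong)
qed

lemma wasserstein_eq: 
  assumes "\<And>z. 0 \<le> N z"
  shows "wasserstein N p \<mu> \<nu>
    = ennreal_root p (INF \<tau>\<in>couplings \<mu> \<nu>. \<integral>\<^sup>+ z. ennreal (N (fst z - snd z)) ^ p \<partial>\<tau>)"
  unfolding wasserstein_def using assms by (simp add: ennreal_power case_prod_beta')

lemma wasserstein_le:
  assumes "\<And>z. 0 \<le> N z" "0 < p" "\<tau> \<in> couplings \<mu> \<nu>"
  shows "wasserstein N p \<mu> \<nu> \<le> lp_norm p \<tau> (\<lambda>z. ennreal (N (fst z - snd z)))"
  unfolding wasserstein_eq[of N, OF assms(1)] ennreal_root_le_iff[OF assms(2)] lp_norm_power[OF assms(2)]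
  using assms(3) by (rule INF_lower)

lemma wasserstein_less:
  assumes "\<And>z. 0 \<le> N z" "0 < p" "wasserstein N p \<mu> \<nu> < c"
  obtains \<tau> where "\<tau> \<in> couplings \<mu> \<nu>" "lp_norm p \<tau> (\<lambda>z. ennreal (N (fst z - snd z))) < c"
proof -
  have "(INF \<tau>\<in>couplings \<mu> \<nu>. \<integral>\<^sup>+ z. ennreal (N (fst z - snd z)) ^ p \<partial>\<tau>) < c ^ p"
    using assms by (simp add: wasserstein_eq ennreal_root_less_iff)
  then show ?thesis using that assms(2) by (auto simp: INF_less_iff lp_norm_def ennreal_root_less_iff)
qed

text \<open>A perturbative fixed-point argument: improving every coupling of \<open>\<mu>\<close> and \<open>\<nu>\<close> bounds
  their distance, without any triangle inequality for the Wasserstein distance.\<close>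

lemma wasserstein_le_of_improvement:
  assumes N: "\<And>z. 0 \<le> N z" and p: "0 < p" and c: "0 < c" "c \<le> 1"
    and fin: "wasserstein N p \<mu> \<nu> < \<infinity>"
    and imp: "\<And>\<tau> \<epsilon>. \<tau> \<in> couplings \<mu> \<nu> \<Longrightarrow> 0 < \<epsilon> \<Longrightarrow>
      wasserstein N p \<mu> \<nu> \<le> E + ennreal \<epsilon> + ennreal (1 - c) * lp_norm p \<tau> (\<lambda>z. ennreal (N (fst z - snd z)))"
  shows "wasserstein N p \<mu> \<nu> \<le> E / ennreal c"
proof (cases "E = \<infinity>")
  case True
  then show ?thesis using c by (simp add: ennreal_divide_eq_top_iff ennreal_top_divide)
next
  case False
  then obtain e where e: "E = ennreal e" "0 \<le> e" by (cases E) auto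
  \<comment> \<open>Finiteness of the distance is what permits absorbing \<open>(1 - c) * w\<close>
    into the left-hand side at the end.\<close>
  obtain w where w: "wasserstein N p \<mu> \<nu> = ennreal w" "0 \<le> w"
    using fin by (cases "wasserstein N p \<mu> \<nu>") auto
  have "w \<le> e + (1 - c) * w + \<epsilon>" if \<epsilon>: "0 < \<epsilon>" for \<epsilon>
  proof -
    have "wasserstein N p \<mu> \<nu> < ennreal (w + \<epsilon> / 2)" using w \<epsilon> by (simp add: ennreal_less_iff)
    from wasserstein_less[OF N p this] obtain \<tau> where \<tau>: "\<tau> \<in> couplings \<mu> \<nu>"
      "lp_norm p \<tau> (\<lambda>z. ennreal (N (fst z - snd z))) < ennreal (w + \<epsilon> / 2)" by blast
    have "ennreal w \<le> E + ennreal (\<epsilon> / 2) + ennreal (1 - c) * lp_norm p \<tau> (\<lambda>z. ennreal (N (fst z - snd z)))"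
      using imp[OF \<tau>(1), of "\<epsilon> / 2"] \<epsilon> w by simp
    also have "\<dots> \<le> E + ennreal (\<epsilon> / 2) + ennreal (1 - c) * ennreal (w + \<epsilon> / 2)"
      using \<tau>(2) by (intro add_left_mono mult_left_mono) auto
    also have "\<dots> = ennreal (e + \<epsilon> / 2 + (1 - c) * (w + \<epsilon> / 2))"
    proof -
      have "0 \<le> w + \<epsilon> / 2" "0 \<le> 1 - c" using w c \<epsilon> by auto
      then show ?thesis using e(2) \<epsilon> unfolding e(1)
        by (simp only: ennreal_mult[symmetric] ennreal_plus[symmetric] mult_nonneg_nonneg add_nonneg_nonneg less_imp_le half_gt_zero)
    qed
    finally have "w \<le> e + \<epsilon> / 2 + (1 - c) * (w + \<epsilon> / 2)"
      using e w c \<epsilon> by (subst (asm) ennreal_le_iff) auto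
    also have "(1 - c) * (w + \<epsilon> / 2) \<le> (1 - c) * w + \<epsilon> / 2"
      using c \<epsilon> by (simp add: algebra_simps)
    finally show ?thesis by simp
  qed
  then have "w \<le> e + (1 - c) * w" by (rule field_le_epsilon)
  then have "w \<le> e / c" using c by (simp add: field_simps)
  then show ?thesis using e w c by (simp add: divide_ennreal ennreal_leI)
qed

section \<open>Approximate gluing along countable partitions\<close>

lemma obtain_cells:
  fixes \<delta> :: real
  assumes "0 < \<delta>"
  obtains k :: "'a::euclidean_space \<Rightarrow> nat" where "k \<in> measurable borel (count_space UNIV)"
    "\<And>x y. k x = k y \<Longrightarrow> dist x y < \<delta>"
proof -
  obtain D :: "'a set" where D: "countable D" "\<And>X. open X \<Longrightarrow> X \<noteq> {} \<Longrightarrow> \<exists>d\<in>D. d \<in> X"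
    by (rule countable_dense_setE) blast
  have "D \<noteq> {}" using D(2)[of UNIV] by auto
  define d where "d = from_nat_into D"
  \<comment> \<open>The index of the first point of a dense sequence within
    \<open>\<delta> / 2\<close>; two points with the same index are then within
    \<open>\<delta>\<close> of each other.\<close>
  define k where "k x = (LEAST n. dist x (d n) < \<delta> / 2)" for x
  have k: "dist x (d (k x)) < \<delta> / 2" for x
  proof -
    obtain y where "y \<in> D" "y \<in> ball x (\<delta> / 2)" using D(2)[of "ball x (\<delta> / 2)"] assms by auto
    then have "dist x (d (to_nat_on D y)) < \<delta> / 2" using D(1) by (simp add: d_def)
    then show ?thesis unfolding k_def by (rule LeastI)
  qed
  show ?thesis
  proof (rule that[of k])
    show "k \<in> measurable borel (count_space UNIV)"
      unfolding k_def by (intro measurable_Least) simp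
    fix x y assume "k x = k y"
    then show "dist x y < \<delta>" using k[of x] k[of y] dist_triangle2[of x y "d (k x)"] by simp
  qed
qed

text \<open>Gluing without disintegration: the second coordinate is redrawn from its law conditioned on
  the cell of the first coordinate, at the price of the cell diameter.\<close>

definition cell_kernel :: "('a::euclidean_space \<times> 'a) measure \<Rightarrow> ('a \<Rightarrow> nat) \<Rightarrow> 'a measure \<Rightarrow> nat \<Rightarrow> 'a measure" where
  "cell_kernel \<tau> k \<nu> j = (if emeasure \<tau> {z. k (fst z) = j} = 0 then \<nu>
    else distr (density \<tau> (\<lambda>z. indicator {z. k (fst z) = j} z / emeasure \<tau> {z. k (fst z) = j})) borel snd)"

locale cell_coupling =
  fixes \<mu> \<nu> :: "'a::euclidean_space measure" and \<tau> and k :: "'a \<Rightarrow> nat" and \<delta> :: real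
  assumes \<mu>: "prob_space \<mu>" "sets \<mu> = sets borel" and \<nu>: "prob_space \<nu>" "sets \<nu> = sets borel"
    and \<tau>: "\<tau> \<in> couplings \<mu> \<nu>"
    and k[measurable]: "k \<in> measurable borel (count_space UNIV)"
    and cell: "\<And>x y. k x = k y \<Longrightarrow> dist x y < \<delta>"
begin

lemma sets_\<tau> [measurable_cong]: "sets \<tau> = sets (borel \<Otimes>\<^sub>M borel)"
  using \<tau> \<mu> \<nu> by (simp add: couplings_def cong: sets_pair_measure_cong)

lemma space_\<tau>: "space \<tau> = UNIV"
  using sets_eq_imp_space_eq[OF sets_\<tau>] by (simp add: space_pair_measure)

declare \<mu>(2) [measurable_cong] \<nu>(2) [measurable_cong]

sublocale \<tau>: prob_space \<tau>
  using prob_space_couplings[OF \<tau> \<mu>(1)] .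

abbreviation cell_mass :: "nat \<Rightarrow> ennreal" where
  "cell_mass j \<equiv> emeasure \<tau> {z. k (fst z) = j}"

lemma cell_set [measurable]: "{z. k (fst z) = j} \<in> sets \<tau>"
proof -
  have "{z \<in> space \<tau>. k (fst z) = j} \<in> sets \<tau>" by measurable
  then show ?thesis by (simp add: space_\<tau>)
qed

lemma measurable_of_cell:
  fixes H :: "nat \<Rightarrow> ennreal"
  shows "(\<lambda>s. H (k s)) \<in> borel_measurable borel" "(\<lambda>z. H (k (fst z))) \<in> borel_measurable (borel \<Otimes>\<^sub>M borel)"
proof -
  show "(\<lambda>s. H (k s)) \<in> borel_measurable borel" by (rule measurable_compose[OF k]) simp
  then show "(\<lambda>z. H (k (fst z))) \<in> borel_measurable (borel \<Otimes>\<^sub>M borel)" by (rule measurable_compose[OF measurable_fst])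
qed

text \<open>The law of total expectation over countably many cells: the mean of
  \<open>\<Phi>\<close> conditioned on the cell of \<open>s\<close> is averaged over
  \<open>s\<close>. Cells of mass zero contribute nothing to either side.\<close>

lemma nn_integral_cell_average:
  fixes \<Phi> :: "'a \<times> 'a \<Rightarrow> ennreal"
  assumes [measurable]: "\<Phi> \<in> borel_measurable (borel \<Otimes>\<^sub>M borel)"
  shows "(\<integral>\<^sup>+ s. (\<integral>\<^sup>+ z. indicator {z. k (fst z) = k s} z * \<Phi> z \<partial>\<tau>) / cell_mass (k s) \<partial>\<mu>) = (\<integral>\<^sup>+ z. \<Phi> z \<partial>\<tau>)"
proof -
  define I where "I j = (\<integral>\<^sup>+ z. indicator {z. k (fst z) = j} z * \<Phi> z \<partial>\<tau>)" for j
  have one: "(\<Sum>j. indicator {z. k (fst z) = j} z * c) = c" for z :: "'a \<times> 'a" and c :: ennreal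
  proof -
    have "(\<Sum>j. indicator {z. k (fst z) = j} z * c) = (\<Sum>j\<in>{k (fst z)}. indicator {z. k (fst z) = j} z * c)"
      by (rule suminf_finite) (auto simp: indicator_def)
    then show ?thesis by simp
  qed
  have split: "(\<integral>\<^sup>+ z. H z \<partial>\<tau>) = (\<Sum>j. \<integral>\<^sup>+ z. indicator {z. k (fst z) = j} z * H z \<partial>\<tau>)"
    if [measurable]: "H \<in> borel_measurable (borel \<Otimes>\<^sub>M borel)" for H :: "'a \<times> 'a \<Rightarrow> ennreal"
  proof -
    have "(\<integral>\<^sup>+ z. H z \<partial>\<tau>) = (\<integral>\<^sup>+ z. (\<Sum>j. indicator {z. k (fst z) = j} z * H z) \<partial>\<tau>)"
      by (simp only: one)
    also have "\<dots> = (\<Sum>j. \<integral>\<^sup>+ z. indicator {z. k (fst z) = j} z * H z \<partial>\<tau>)"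
      by (rule nn_integral_suminf) measurable
    finally show ?thesis .
  qed
  have "(\<integral>\<^sup>+ s. I (k s) / cell_mass (k s) \<partial>\<mu>) = (\<integral>\<^sup>+ z. I (k (fst z)) / cell_mass (k (fst z)) \<partial>\<tau>)"
    by (rule nn_integral_couplings(1)[OF \<tau>, symmetric])
       (simp only: measurable_of_cell(1)[of "\<lambda>j. I j / cell_mass j"] measurable_cong_sets[OF \<mu>(2) refl])
  also have "\<dots> = (\<Sum>j. \<integral>\<^sup>+ z. indicator {z. k (fst z) = j} z * (I (k (fst z)) / cell_mass (k (fst z))) \<partial>\<tau>)"
    by (rule split) (rule measurable_of_cell(2)[of "\<lambda>j. I j / cell_mass j"])
  also have "\<dots> = (\<Sum>j. \<integral>\<^sup>+ z. (I j / cell_mass j) * indicator {z. k (fst z) = j} z \<partial>\<tau>)"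
    by (rule suminf_cong, rule nn_integral_cong) (simp add: indicator_def)
  also have "\<dots> = (\<Sum>j. (I j / cell_mass j) * cell_mass j)"
    by (simp add: nn_integral_cmult_indicator)
  also have "\<dots> = (\<Sum>j. I j)"
  proof (rule suminf_cong)
    fix j
    show "(I j / cell_mass j) * cell_mass j = I j"
    proof (cases "cell_mass j = 0")
      case True
      then have "AE z in \<tau>. z \<notin> {z. k (fst z) = j}" by (intro AE_not_in) (simp add: null_setsI)
      then have "I j = (\<integral>\<^sup>+ z. 0 \<partial>\<tau>)" unfolding I_def
        by (intro nn_integral_cong_AE) (auto elim!: eventually_mono)
      then show ?thesis using True by simp
    next
      case False
      then show ?thesis unfolding ennreal_divide_times
        by (simp add: ennreal_divide_self \<tau>.emeasure_finite less_top[symmetric])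
    qed
  qed
  also have "\<dots> = (\<integral>\<^sup>+ z. \<Phi> z \<partial>\<tau>)" unfolding I_def by (rule split[symmetric]) measurable
  finally show ?thesis by (simp add: I_def)
qed

abbreviation kernel :: "nat \<Rightarrow> 'a measure" where
  "kernel \<equiv> cell_kernel \<tau> k \<nu>"

lemma sets_kernel [simp, measurable_cong]: "sets (kernel j) = sets borel"
  using \<nu> by (simp add: cell_kernel_def)

lemma nn_integral_kernel:
  assumes [measurable]: "F \<in> borel_measurable borel" and j: "cell_mass j \<noteq> 0"
  shows "(\<integral>\<^sup>+ v. F v \<partial>kernel j) = (\<integral>\<^sup>+ z. indicator {z. k (fst z) = j} z * F (snd z) \<partial>\<tau>) / cell_mass j"
proof -
  have "(\<integral>\<^sup>+ v. F v \<partial>kernel j) = (\<integral>\<^sup>+ z. indicator {z. k (fst z) = j} z / cell_mass j * F (snd z) \<partial>\<tau>)"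
    using j by (simp add: cell_kernel_def nn_integral_distr nn_integral_density)
  also have "\<dots> = (\<integral>\<^sup>+ z. indicator {z. k (fst z) = j} z * F (snd z) / cell_mass j \<partial>\<tau>)"
    by (intro nn_integral_cong) (simp add: divide_ennreal_def mult_ac)
  finally show ?thesis by (simp add: nn_integral_divide)
qed

text \<open>On a cell of mass zero the default \<open>\<nu>\<close> in \<open>cell_kernel\<close> is
  what keeps this true; by \<open>AE_cell_mass\<close> such cells are almost surely not met.\<close>

lemma prob_space_kernel: "prob_space (kernel j)"
proof (cases "cell_mass j = 0")
  case False
  have "(\<integral>\<^sup>+ v. 1 \<partial>kernel j) = 1"
    using False by (subst nn_integral_kernel) (auto simp: \<tau>.emeasure_finite less_top[symmetric] intro!: ennreal_divide_self)
  then have "emeasure (kernel j) (space (kernel j)) = 1" by (simp only: nn_integral_const mult_1)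
  then show ?thesis by (rule prob_spaceI)
qed (simp add: cell_kernel_def \<nu>)

lemma AE_cell_mass: "AE s in \<mu>. cell_mass (k s) \<noteq> 0"
proof -
  let ?H = "\<lambda>s. if cell_mass (k s) = 0 then 1 else 0 :: ennreal"
  have "(\<integral>\<^sup>+ z. ?H (fst z) \<partial>\<tau>) = (\<integral>\<^sup>+ s. (\<integral>\<^sup>+ z. indicator {z. k (fst z) = k s} z * ?H (fst z) \<partial>\<tau>) / cell_mass (k s) \<partial>\<mu>)"
    by (rule nn_integral_cell_average[symmetric]) measurable
  also have "\<dots> = (\<integral>\<^sup>+ s. 0 \<partial>\<mu>)"
  proof (intro nn_integral_cong)
    fix s
    have "(\<integral>\<^sup>+ z. indicator {z. k (fst z) = k s} z * ?H (fst z) \<partial>\<tau>) = (\<integral>\<^sup>+ z. ?H s * indicator {z. k (fst z) = k s} z \<partial>\<tau>)"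
      by (intro nn_integral_cong) (auto simp: indicator_def)
    also have "\<dots> = ?H s * cell_mass (k s)" by (rule nn_integral_cmult_indicator) simp
    also have "\<dots> = 0" by simp
    finally show "(\<integral>\<^sup>+ z. indicator {z. k (fst z) = k s} z * ?H (fst z) \<partial>\<tau>) / cell_mass (k s) = 0" by simp
  qed
  finally have "(\<integral>\<^sup>+ s. ?H s \<partial>\<mu>) = 0"
    using nn_integral_couplings(1)[OF \<tau>, of ?H] by simp
  then have "AE s in \<mu>. ?H s = 0" by (subst (asm) nn_integral_0_iff_AE) auto
  then show ?thesis by (auto elim!: eventually_mono split: if_splits)
qed

text \<open>Redrawing within a cell leaves the second marginal exact; the discretisation affects
  only the cost.\<close>

lemma kernel_marginal:
  assumes F[measurable]: "F \<in> borel_measurable borel"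
  shows "(\<integral>\<^sup>+ s. \<integral>\<^sup>+ v. F v \<partial>kernel (k s) \<partial>\<mu>) = (\<integral>\<^sup>+ v. F v \<partial>\<nu>)"
proof -
  have "(\<integral>\<^sup>+ s. \<integral>\<^sup>+ v. F v \<partial>kernel (k s) \<partial>\<mu>)
    = (\<integral>\<^sup>+ s. (\<integral>\<^sup>+ z. indicator {z. k (fst z) = k s} z * F (snd z) \<partial>\<tau>) / cell_mass (k s) \<partial>\<mu>)"
    using AE_cell_mass by (intro nn_integral_cong_AE) (auto elim!: eventually_mono simp: nn_integral_kernel)
  also have "\<dots> = (\<integral>\<^sup>+ z. F (snd z) \<partial>\<tau>)" by (rule nn_integral_cell_average) measurable
  also have "\<dots> = (\<integral>\<^sup>+ v. F v \<partial>\<nu>)" by (rule nn_integral_couplings(2)[OF \<tau>]) measurable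
  finally show ?thesis .
qed

text \<open>The redrawn point is paired with \<open>s\<close> instead of the first coordinate with
  which it was coupled, but both lie in one cell, so the distance grows by at most
  \<open>\<delta>\<close>.\<close>

lemma kernel_cost:
  assumes p: "0 < p" and \<delta>: "0 < \<delta>"
  shows "(\<integral>\<^sup>+ s. \<integral>\<^sup>+ v. ennreal (norm (s - v)) ^ p \<partial>kernel (k s) \<partial>\<mu>)
    \<le> (\<integral>\<^sup>+ z. (ennreal \<delta> + ennreal (norm (fst z - snd z))) ^ p \<partial>\<tau>)"
proof -
  let ?\<Phi> = "\<lambda>z. (ennreal \<delta> + ennreal (norm (fst z - snd z :: 'a))) ^ p"
  have "(\<integral>\<^sup>+ s. \<integral>\<^sup>+ v. ennreal (norm (s - v)) ^ p \<partial>kernel (k s) \<partial>\<mu>)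
    \<le> (\<integral>\<^sup>+ s. (\<integral>\<^sup>+ z. indicator {z. k (fst z) = k s} z * ?\<Phi> z \<partial>\<tau>) / cell_mass (k s) \<partial>\<mu>)"
  proof (rule nn_integral_mono_AE, use AE_cell_mass in \<open>rule eventually_mono\<close>)
    fix s assume s: "cell_mass (k s) \<noteq> 0"
    have "(\<integral>\<^sup>+ v. ennreal (norm (s - v)) ^ p \<partial>kernel (k s))
      = (\<integral>\<^sup>+ z. indicator {z. k (fst z) = k s} z * ennreal (norm (s - snd z)) ^ p \<partial>\<tau>) / cell_mass (k s)"
      by (rule nn_integral_kernel[OF _ s]) measurable
    also have "\<dots> \<le> (\<integral>\<^sup>+ z. indicator {z. k (fst z) = k s} z * ?\<Phi> z \<partial>\<tau>) / cell_mass (k s)"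
    proof (intro divide_right_mono_ennreal nn_integral_mono)
      fix z
      show "indicator {z. k (fst z) = k s} z * ennreal (norm (s - snd z)) ^ p \<le> indicator {z. k (fst z) = k s} z * ?\<Phi> z"
      proof (cases "k (fst z) = k s")
        case True
        then have "norm (s - snd z) \<le> \<delta> + norm (fst z - snd z)"
          using cell[of s "fst z"] norm_triangle_ineq[of "s - fst z" "fst z - snd z"] by (simp add: dist_norm)
        then have "ennreal (norm (s - snd z)) \<le> ennreal \<delta> + ennreal (norm (fst z - snd z))"
          using \<delta> by (simp add: ennreal_plus[symmetric] del: ennreal_plus)
        then show ?thesis using p True by (simp add: ennreal_power_le_iff)
      qed simp
    qed
    finally show "(\<integral>\<^sup>+ v. ennreal (norm (s - v)) ^ p \<partial>kernel (k s))
      \<le> (\<integral>\<^sup>+ z. indicator {z. k (fst z) = k s} z * ?\<Phi> z \<partial>\<tau>) / cell_mass (k s)" .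
  qed
  also have "\<dots> = (\<integral>\<^sup>+ z. ?\<Phi> z \<partial>\<tau>)" by (rule nn_integral_cell_average) measurable
  finally show ?thesis .
qed

end

section \<open>Lipschitz bound from the Jacobian variance\<close>

text \<open>Fundamental theorem of calculus, then Cauchy-Schwarz on the unit interval.\<close>

lemma norm_increment_sq_le_nn_integral:
  fixes g :: "real \<Rightarrow> 'a::euclidean_space"
  assumes g: "\<And>t. (g has_vector_derivative g' t) (at t)" and c: "continuous_on {0..1} g'"
  shows "ennreal ((norm (g 1 - g 0))\<^sup>2) \<le> (\<integral>\<^sup>+ t. indicator {0..1} t * ennreal ((norm (g' t))\<^sup>2) \<partial>lborel)"
proof -
  let ?k = "\<lambda>t. indicator {0..1} t *\<^sub>R g' t"
  have i: "integrable lborel ?k"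
    using borel_integrable_atLeastAtMost'[OF c] by (simp add: set_integrable_def)
  then have [measurable]: "?k \<in> borel_measurable borel" by simp
  have [measurable]: "(\<lambda>t. indicator {0..1} t * ennreal (norm (g' t))) \<in> borel_measurable borel"
  proof -
    have "(\<lambda>t. indicator {0..1} t * ennreal (norm (g' t))) = (\<lambda>t. ennreal (norm (?k t)))"
      by (auto simp: indicator_def)
    then show ?thesis by (simp only:) measurable
  qed
  have "g 1 - g 0 = (\<integral>t. ?k t \<partial>lborel)"
    by (rule integral_FTC_atLeastAtMost[symmetric]) (use g c in \<open>auto intro: has_vector_derivative_at_within\<close>)
  then have "ennreal (norm (g 1 - g 0)) \<le> (\<integral>\<^sup>+ t. ennreal (norm (?k t)) \<partial>lborel)"
    using integral_norm_bound_ennreal[OF i] by simp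
  also have "\<dots> = (\<integral>\<^sup>+ t. (indicator {0..1} t * ennreal (norm (g' t))) * indicator {0..1} t \<partial>lborel)"
    by (intro nn_integral_cong) (auto simp: indicator_def)
  finally have "(ennreal (norm (g 1 - g 0)))\<^sup>2 \<le> (\<integral>\<^sup>+ t. (indicator {0..1} t * ennreal (norm (g' t))) * indicator {0..1} t \<partial>lborel)\<^sup>2"
    by (rule power_mono) simp
  also have "\<dots> \<le> (\<integral>\<^sup>+ t. (indicator {0..1} t * ennreal (norm (g' t)))\<^sup>2 \<partial>lborel) * (\<integral>\<^sup>+ t. (indicator {0..1} t)\<^sup>2 \<partial>(lborel :: real measure))"
    by (rule Cauchy_Schwarz_nn_integral) simp_all
  also have "(\<integral>\<^sup>+ t. (indicator {0..1} t)\<^sup>2 \<partial>(lborel :: real measure)) = (\<integral>\<^sup>+ t. indicator {0..1} t \<partial>(lborel :: real measure))"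
    by (intro nn_integral_cong) (auto simp: indicator_def)
  also have "\<dots> = 1" by simp
  also have "(\<integral>\<^sup>+ t. (indicator {0..1} t * ennreal (norm (g' t)))\<^sup>2 \<partial>lborel) = (\<integral>\<^sup>+ t. indicator {0..1} t * ennreal ((norm (g' t))\<^sup>2) \<partial>lborel)"
    by (intro nn_integral_cong) (auto simp: indicator_def ennreal_power)
  finally show ?thesis by (simp add: ennreal_power)
qed

lemma C1_map_line:
  fixes F :: "'a::real_normed_vector \<Rightarrow> 'b::real_normed_vector"
  assumes "C1_map F"
  shows "((\<lambda>t. F (x + t *\<^sub>R u)) has_vector_derivative frechet_derivative F (at (x + t *\<^sub>R u)) u) (at t)"
    and "continuous_on S (\<lambda>t. frechet_derivative F (at (x + t *\<^sub>R u)) u)"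
    and "bounded_linear (frechet_derivative F (at y))"
proof -
  obtain f' :: "'a \<Rightarrow> 'a \<Rightarrow>\<^sub>L 'b" where f': "\<And>x. (F has_derivative blinfun_apply (f' x)) (at x)"
    and c: "continuous_on UNIV f'" using assms unfolding C1_map_def by blast
  have e: "frechet_derivative F (at y) = blinfun_apply (f' y)" for y
    using frechet_derivative_at[OF f'] by simp
  show "bounded_linear (frechet_derivative F (at y))" unfolding e by (rule blinfun.bounded_linear_right)
  have "((\<lambda>t. x + t *\<^sub>R u) has_derivative (\<lambda>d. d *\<^sub>R u)) (at t)"
    by (auto intro!: derivative_eq_intros)
  from has_derivative_compose[OF this f']
  show "((\<lambda>t. F (x + t *\<^sub>R u)) has_vector_derivative frechet_derivative F (at (x + t *\<^sub>R u)) u) (at t)"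
    by (simp add: e has_vector_derivative_def blinfun.scaleR_right)
  have "continuous_on S (\<lambda>t. f' (x + t *\<^sub>R u))"
    by (rule continuous_on_compose2[OF c]) (auto intro!: continuous_intros)
  then show "continuous_on S (\<lambda>t. frechet_derivative F (at (x + t *\<^sub>R u)) u)"
    unfolding e by (intro continuous_intros)
qed

text \<open>A sequence of increments suffices, so the derivative becomes a countable limit of
  functions whose measurability is known.\<close>

lemma has_vector_derivative_difference_quotient:
  assumes "(g has_vector_derivative d) (at t)"
  shows "(\<lambda>n. real (Suc n) *\<^sub>R (g (t + 1 / real (Suc n)) - g t)) \<longlonglongrightarrow> d"
proof -
  have lim: "((\<lambda>h. (g (t + h) - g t - h *\<^sub>R d) /\<^sub>R norm h) \<longlongrightarrow> 0) (at 0)"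
    by (rule tendsto_norm_zero_cancel)
       (use assms in \<open>simp add: has_vector_derivative_def has_derivative_at divide_inverse mult.commute\<close>)
  have f: "filterlim (\<lambda>n. 1 / real (Suc n)) (at 0) sequentially"
    unfolding filterlim_at using lim_inverse_n' [THEN LIMSEQ_Suc] by (auto intro!: always_eventually)
  have "(\<lambda>n. (g (t + 1 / real (Suc n)) - g t - (1 / real (Suc n)) *\<^sub>R d) /\<^sub>R norm (1 / real (Suc n))) \<longlonglongrightarrow> 0"
    by (rule filterlim_compose[OF lim f])
  also have "(\<lambda>n. (g (t + 1 / real (Suc n)) - g t - (1 / real (Suc n)) *\<^sub>R d) /\<^sub>R norm (1 / real (Suc n)))
    = (\<lambda>n. real (Suc n) *\<^sub>R (g (t + 1 / real (Suc n)) - g t) - d)"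
    by (rule ext) (simp add: scaleR_diff_right)
  finally show ?thesis by (rule LIM_zero_cancel)
qed

text \<open>The Jacobian of the noise is integrated along the segment from \<open>x\<close> to
  \<open>y\<close>, and after Cauchy-Schwarz and Tonelli each parameter t contributes at most
  \<open>C\<close> times the squared length. The difficulty is measurability: the derivative exists
  only for almost every \<omega>, and \<open>frechet_derivative\<close> is arbitrary
  elsewhere.\<close>

lemma jacobian_variance_lipschitz:
  fixes V :: "'a::euclidean_space \<Rightarrow> real" and G :: "'a \<Rightarrow> 'w::polish_space \<Rightarrow> 'a"
  assumes V: "C2_function V" and G: "stochastic_gradient V G \<Gamma>"
    and C: "0 \<le> C" "bounded_jacobian_variance V G \<Gamma> C"
  shows "(\<integral>\<^sup>+ \<omega>. ennreal ((norm ((gradient V y - G y \<omega>) - (gradient V x - G x \<omega>)))\<^sup>2) \<partial>\<Gamma>) \<le> ennreal (C * (norm (y - x))\<^sup>2)"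
proof -
  interpret \<Gamma>: prob_space \<Gamma> using G by (simp add: stochastic_gradient_def)
  define u where "u = y - x"
  define F where "F z \<omega> = G z \<omega> - gradient V z" for z \<omega>
  have sV: "C1_map (gradient V)" using V by (simp add: C2_function_def)
  then have cV: "continuous_on UNIV (gradient V)"
    using C2_function_hessian[OF V] by (intro continuous_at_imp_continuous_on ballI has_derivative_continuous)
  have [measurable]: "gradient V \<in> borel_measurable borel" by (rule borel_measurable_continuous_onI[OF cV])
  have Gm: "(\<lambda>(x, \<omega>). G x \<omega>) \<in> borel_measurable (borel \<Otimes>\<^sub>M \<Gamma>)" using G by (simp add: stochastic_gradient_def)
  have [measurable]: "(\<lambda>z. G (f z) (g z)) \<in> borel_measurable M"
    if [measurable]: "f \<in> borel_measurable M" "g \<in> measurable M \<Gamma>" for f g and M :: "'b measure"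
    using measurable_compose[OF measurable_Pair[OF that] Gm] by simp
  \<comment> \<open>A lower limit of difference quotients is jointly measurable for all t and
    \<omega>, and equals the squared derivative of the noise along the segment wherever the noise is
    differentiable.\<close>
  define J where "J t \<omega> = liminf (\<lambda>n. ennreal ((norm (real (Suc n) *\<^sub>R (F (x + (t + 1 / real (Suc n)) *\<^sub>R u) \<omega> - F (x + t *\<^sub>R u) \<omega>)))\<^sup>2))" for t \<omega>
  have J[measurable]: "(\<lambda>(t, \<omega>). J t \<omega>) \<in> borel_measurable (lborel \<Otimes>\<^sub>M \<Gamma>)"
    unfolding J_def F_def case_prod_beta' by measurable
  have good: "AE \<omega> in \<Gamma>. C1_map (\<lambda>x. G x \<omega>)" using C by (simp add: bounded_jacobian_variance_def)
  define D where "D t \<omega> = frechet_derivative (\<lambda>z. G z \<omega>) (at (x + t *\<^sub>R u)) u - hessian V (x + t *\<^sub>R u) u" for t \<omega>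
  have vd: "((\<lambda>t. F (x + t *\<^sub>R u) \<omega>) has_vector_derivative D t \<omega>) (at t)"
    and cd: "continuous_on {0..1} (\<lambda>t. D t \<omega>)" if "C1_map (\<lambda>x. G x \<omega>)" for t \<omega>
    unfolding F_def D_def hessian_def
    by (intro has_vector_derivative_diff C1_map_line(1)[OF that] C1_map_line(1)[OF sV])
       (intro continuous_on_diff C1_map_line(2)[OF that] C1_map_line(2)[OF sV])
  have JD: "J t \<omega> = ennreal ((norm (D t \<omega>))\<^sup>2)" if "C1_map (\<lambda>x. G x \<omega>)" for t \<omega>
  proof -
    have "(\<lambda>n. ennreal ((norm (real (Suc n) *\<^sub>R (F (x + (t + 1 / real (Suc n)) *\<^sub>R u) \<omega> - F (x + t *\<^sub>R u) \<omega>)))\<^sup>2)) \<longlonglongrightarrow> ennreal ((norm (D t \<omega>))\<^sup>2)"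
      by (intro tendsto_intros tendsto_ennrealI has_vector_derivative_difference_quotient[OF vd[OF that]])
    then show ?thesis unfolding J_def by (intro lim_imp_Liminf) auto
  qed
  have "(\<integral>\<^sup>+ \<omega>. ennreal ((norm (F y \<omega> - F x \<omega>))\<^sup>2) \<partial>\<Gamma>) \<le> (\<integral>\<^sup>+ \<omega>. \<integral>\<^sup>+ t. indicator {0..1} t * J t \<omega> \<partial>lborel \<partial>\<Gamma>)"
  proof (rule nn_integral_mono_AE, use good in \<open>rule eventually_mono\<close>)
    fix \<omega> assume g: "C1_map (\<lambda>x. G x \<omega>)"
    show "ennreal ((norm (F y \<omega> - F x \<omega>))\<^sup>2) \<le> (\<integral>\<^sup>+ t. indicator {0..1} t * J t \<omega> \<partial>lborel)"
      using norm_increment_sq_le_nn_integral[OF vd[OF g] cd[OF g]] by (simp add: JD[OF g] u_def)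
  qed
  also have "\<dots> = (\<integral>\<^sup>+ t. \<integral>\<^sup>+ \<omega>. indicator {0..1} t * J t \<omega> \<partial>\<Gamma> \<partial>lborel)"
  proof -
    interpret pair_sigma_finite lborel \<Gamma> ..
    show ?thesis by (rule Fubini') measurable
  qed
  also have "\<dots> \<le> (\<integral>\<^sup>+ t. ennreal (C * (norm u)\<^sup>2) * indicator {0..1::real} t \<partial>lborel)"
  proof (rule nn_integral_mono)
    fix t :: real
    let ?N = "\<lambda>\<omega>. ennreal ((onorm (\<lambda>w. frechet_derivative (\<lambda>z. G z \<omega>) (at (x + t *\<^sub>R u)) w - hessian V (x + t *\<^sub>R u) w))\<^sup>2)"
    have N: "(\<integral>\<^sup>+ \<omega>. ?N \<omega> \<partial>\<Gamma>) \<le> ennreal C"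
      using C(2) unfolding bounded_jacobian_variance_def by (meson SUP_upper UNIV_I order_trans)
    have J_le: "J t \<omega> \<le> ennreal ((norm u)\<^sup>2) * ?N \<omega>" if g: "C1_map (\<lambda>x. G x \<omega>)" for \<omega>
    proof -
      have "bounded_linear (\<lambda>w. frechet_derivative (\<lambda>z. G z \<omega>) (at (x + t *\<^sub>R u)) w - hessian V (x + t *\<^sub>R u) w)"
        unfolding hessian_def by (intro bounded_linear_sub C1_map_line(3) g sV)
      from onorm[OF this, of u] have "(norm (D t \<omega>))\<^sup>2 \<le> (onorm (\<lambda>w. frechet_derivative (\<lambda>z. G z \<omega>) (at (x + t *\<^sub>R u)) w - hessian V (x + t *\<^sub>R u) w) * norm u)\<^sup>2"
        unfolding D_def by (rule power_mono) simp
      then show ?thesis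
        unfolding JD[OF g] by (simp add: power_mult_distrib ennreal_mult[symmetric] mult.commute)
    qed
    have Jt: "(\<lambda>\<omega>. J t \<omega>) \<in> borel_measurable \<Gamma>" using measurable_compose_Pair1[OF _ J, of t] by simp
    have *: "(\<integral>\<^sup>+ \<omega>. J t \<omega> \<partial>\<Gamma>) \<le> ennreal ((norm u)\<^sup>2) * ennreal C"
    proof (cases "u = 0")
      case True
      then have "(\<integral>\<^sup>+ \<omega>. J t \<omega> \<partial>\<Gamma>) \<le> (\<integral>\<^sup>+ \<omega>. 0 \<partial>\<Gamma>)"
        using good J_le by (intro nn_integral_mono_AE) (auto elim!: eventually_mono)
      then show ?thesis by simp
    next
      case False
      define c where "c = ennreal ((norm u)\<^sup>2)"
      have c: "c \<noteq> 0" "c \<noteq> \<top>" using False by (auto simp: c_def)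
      \<comment> \<open>Pulling the factor \<open>c\<close> out of the integral of \<open>?N\<close>
        would require measurability of \<open>?N\<close>. Dividing the measurable \<open>J t\<close>
        by \<open>c\<close> needs only monotonicity; hence the separate case
        \<open>u = 0\<close>.\<close>
      have "(\<integral>\<^sup>+ \<omega>. J t \<omega> / c \<partial>\<Gamma>) \<le> (\<integral>\<^sup>+ \<omega>. ?N \<omega> \<partial>\<Gamma>)"
      proof (rule nn_integral_mono_AE, use good in \<open>rule eventually_mono\<close>)
        fix \<omega> assume g: "C1_map (\<lambda>x. G x \<omega>)"
        have "J t \<omega> / c \<le> (?N \<omega> * c) / c"
          using J_le[OF g] by (intro divide_right_mono_ennreal) (simp add: c_def mult.commute)
        then show "J t \<omega> / c \<le> ?N \<omega>" using c by (simp add: mult_divide_eq_ennreal)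
      qed
      then have "(\<integral>\<^sup>+ \<omega>. J t \<omega> \<partial>\<Gamma>) / c \<le> ennreal C"
        using N Jt by (simp add: nn_integral_divide order_trans)
      then have "(\<integral>\<^sup>+ \<omega>. J t \<omega> \<partial>\<Gamma>) / c * c \<le> ennreal C * c" by (rule mult_right_mono) simp
      moreover have "(\<integral>\<^sup>+ \<omega>. J t \<omega> \<partial>\<Gamma>) / c * c = (\<integral>\<^sup>+ \<omega>. J t \<omega> \<partial>\<Gamma>)"
        unfolding ennreal_divide_times using c by (simp add: less_top[symmetric])
      ultimately show ?thesis by (simp add: c_def mult.commute)
    qed
    have "(\<integral>\<^sup>+ \<omega>. indicator {0..1} t * J t \<omega> \<partial>\<Gamma>) = indicator {0..1} t * (\<integral>\<^sup>+ \<omega>. J t \<omega> \<partial>\<Gamma>)"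
      using Jt by (rule nn_integral_cmult)
    also have "\<dots> \<le> indicator {0..1} t * (ennreal ((norm u)\<^sup>2) * ennreal C)"
      by (rule mult_left_mono[OF *]) simp
    also have "\<dots> = ennreal (C * (norm u)\<^sup>2) * indicator {0..1} t"
      using C(1) by (simp add: ennreal_mult mult_ac)
    finally show "(\<integral>\<^sup>+ \<omega>. indicator {0..1} t * J t \<omega> \<partial>\<Gamma>) \<le> ennreal (C * (norm u)\<^sup>2) * indicator {0..1} t" .
  qed
  also have "\<dots> = ennreal (C * (norm u)\<^sup>2)" by (subst nn_integral_cmult_indicator) auto
  finally show ?thesis by (simp add: F_def u_def norm_minus_commute algebra_simps)
qed

section \<open>Coefficients of a UBU step\<close>

text \<open>Each Taylor bound is obtained by integrating the previous one from 0, with alternating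
  sign.\<close>

lemma exp_neg_bounds:
  fixes t :: real
  assumes "0 \<le> t"
  shows "1 - t \<le> exp (- t)" "exp (- t) \<le> 1 - t + t\<^sup>2 / 2"
    "1 - t + t\<^sup>2 / 2 - t ^ 3 / 6 \<le> exp (- t)" "exp (- t) \<le> 1 - t + t\<^sup>2 / 2 - t ^ 3 / 6 + t ^ 4 / 24"
proof -
  have 0: "0 \<le> 1 - exp (- s)" if "0 \<le> s" for s :: real using that by simp
  have step: "0 \<le> F t" if F: "\<And>s. 0 \<le> s \<Longrightarrow> (F has_real_derivative f s) (at s)" "F 0 = 0" and f: "\<And>s. 0 \<le> s \<Longrightarrow> 0 \<le> f s" and t: "0 \<le> t"
    for F f :: "real \<Rightarrow> real" and t :: real
  proof -
    have "F 0 \<le> F t"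
      by (rule DERIV_nonneg_imp_nondecreasing[OF t]) (use F f in blast)
    then show ?thesis using F by simp
  qed
  have 1: "0 \<le> exp (- s) - (1 - s)" if "0 \<le> s" for s :: real
    by (rule step[OF _ _ 0 that]) (auto intro!: derivative_eq_intros)
  have 2: "0 \<le> 1 - s + s\<^sup>2 / 2 - exp (- s)" if "0 \<le> s" for s :: real
    by (rule step[OF _ _ 1 that]) (auto intro!: derivative_eq_intros)
  have 3: "0 \<le> exp (- s) - (1 - s + s\<^sup>2 / 2 - s ^ 3 / 6)" if "0 \<le> s" for s :: real
    by (rule step[OF _ _ 2 that]) (auto intro!: derivative_eq_intros simp: power2_eq_square)
  have 4: "0 \<le> 1 - s + s\<^sup>2 / 2 - s ^ 3 / 6 + s ^ 4 / 24 - exp (- s)" if "0 \<le> s" for s :: real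
    by (rule step[OF _ _ 3 that]) (auto intro!: derivative_eq_intros simp: power2_eq_square power3_eq_cube)
  show "1 - t \<le> exp (- t)" "exp (- t) \<le> 1 - t + t\<^sup>2 / 2"
    "1 - t + t\<^sup>2 / 2 - t ^ 3 / 6 \<le> exp (- t)" "exp (- t) \<le> 1 - t + t\<^sup>2 / 2 - t ^ 3 / 6 + t ^ 4 / 24"
    using 1[OF assms] 2[OF assms] 3[OF assms] 4[OF assms] by auto
qed

lemma small_powers:
  fixes t :: real
  assumes "0 \<le> t" "t \<le> 1 / 4"
  shows "t ^ 3 \<le> t\<^sup>2 / 4" "0 \<le> t ^ 3" "t ^ 4 \<le> t\<^sup>2 / 16" "0 \<le> t ^ 4"
proof -
  have "t ^ 3 = t\<^sup>2 * t" "t ^ 4 = t\<^sup>2 * (t * t)" by (simp_all add: power2_eq_square power3_eq_cube power4_eq_xxxx)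
  moreover have "t\<^sup>2 * t \<le> t\<^sup>2 * (1 / 4)" "t\<^sup>2 * (t * t) \<le> t\<^sup>2 * (1 / 4 * (1 / 4))"
    using assms by (intro mult_left_mono mult_mono; simp)+
  ultimately show "t ^ 3 \<le> t\<^sup>2 / 4" "t ^ 4 \<le> t\<^sup>2 / 16" by auto
  show "0 \<le> t ^ 3" "0 \<le> t ^ 4" using assms by auto
qed

text \<open>The derivative is twice a square. With \<open>s = \<gamma> * h\<close> this is the
  strict inequality \<open>c1\<^sup>2 < h1\<^sup>2\<close>: the position increment is not a multiple
  of the final velocity.\<close>

lemma exp_neg_remainder_pos:
  fixes s :: real
  assumes "0 < s"
  shows "0 < 2 * s - 3 + 4 * exp (- s) - (exp (- s))\<^sup>2"
proof -
  define F where "F s = 2 * s - 3 + 4 * exp (- s) - (exp (- s))\<^sup>2" for s :: real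
  have "(F has_real_derivative 2 * (1 - exp (- u))\<^sup>2) (at u)" for u
    unfolding F_def by (auto intro!: derivative_eq_intros simp: power2_eq_square algebra_simps)
  then have "F 0 < F s"
    using assms by (intro DERIV_pos_imp_increasing_open[of 0 s F])
      (auto intro!: exI simp: F_def continuous_intros)
  then show ?thesis by (simp add: F_def)
qed

text \<open>This is \<open>tanh x <= x\<close> at half the argument; it makes
  \<open>1 - ratio\<close> nonnegative, so that the square roots in a step have the intended
  squares.\<close>

lemma tanh_ratio_le_one:
  fixes t :: real
  assumes "0 < t"
  shows "(1 - exp (- t)) / (1 + exp (- t)) * (2 / t) \<le> 1"
proof -
  have "0 \<le> t * (1 + exp (- t)) - 2 * (1 - exp (- t))"
  proof -
    let ?F = "\<lambda>t :: real. t * (1 + exp (- t)) - 2 * (1 - exp (- t))"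
    have "?F 0 \<le> ?F t"
    proof (rule DERIV_nonneg_imp_nondecreasing[of 0 t ?F])
      fix s :: real assume s: "0 \<le> s"
      have "1 + s \<le> exp s" by (rule exp_ge_add_one_self)
      then have "exp (- s) * (1 + s) \<le> exp (- s) * exp s" by (intro mult_left_mono) auto
      then have "exp (- s) * (1 + s) \<le> 1" by (simp add: exp_minus)
      then have "0 \<le> 1 - exp (- s) - s * exp (- s)" by (simp add: algebra_simps)
      moreover have "(?F has_real_derivative 1 - exp (- s) - s * exp (- s)) (at s)"
        by (auto intro!: derivative_eq_intros)
      ultimately show "\<exists>y. (?F has_real_derivative y) (at s) \<and> 0 \<le> y" by blast
    qed (use assms in simp)
    then show ?thesis by simp
  qed
  then show ?thesis using assms by (simp add: divide_simps add_pos_pos) (simp add: algebra_simps)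
qed

text \<open>With \<open>\<gamma> = 2 t / h\<close>: \<open>\<kappa>\<close> is the weight of the velocity in the position update of a half step,
  \<open>c1\<close> and \<open>h1\<^sup>2\<close> are the covariance with the final velocity and the variance of the Gaussian part of
  the position increment over a full step.\<close>

locale ubu_params =
  fixes \<gamma> h :: real
  assumes \<gamma>: "0 < \<gamma>" and h: "0 < h" and h_le: "h * \<gamma> \<le> 1 / 2"
begin

definition \<eta> :: real where "\<eta> = exp (- \<gamma> * h / 2)"
definition \<kappa> :: real where "\<kappa> = (1 - \<eta>) / \<gamma>"
definition c1 :: real where "c1 = (1 - \<eta>\<^sup>2) / \<gamma>"
definition h1 :: real where "h1 = sqrt (2 / \<gamma>\<^sup>2 * (\<gamma> * h - 1 + \<eta>\<^sup>2))"
definition ratio :: real where "ratio = (1 - \<eta>) / (1 + \<eta>) * (4 / (\<gamma> * h))"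

abbreviation (input) t :: real where "t \<equiv> \<gamma> * h / 2"

lemma t: "0 < t" "t \<le> 1 / 4" using \<gamma> h h_le by (auto simp: mult.commute)

lemma \<eta>_eq: "\<eta> = exp (- t)"
  by (simp add: \<eta>_def)

lemma \<eta>_sq: "\<eta>\<^sup>2 = exp (- (2 * t))"
  by (simp add: \<eta>_def exp_double[symmetric])

lemma \<eta>_bounds: "0 < \<eta>" "\<eta> < 1" "3 / 4 \<le> \<eta>" "\<eta>\<^sup>2 < 1"
proof -
  show 1: "0 < \<eta>" "\<eta> < 1" "3 / 4 \<le> \<eta>"
    using t exp_neg_bounds(1)[of t] \<gamma> h by (auto simp: \<eta>_eq)
  then have "\<eta> * \<eta> < 1 * 1" by (intro mult_strict_mono) auto
  then show "\<eta>\<^sup>2 < 1" by (simp add: power2_eq_square)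
qed

lemma ratio_bounds: "0 \<le> ratio" "ratio \<le> 1"
proof -
  show "0 \<le> ratio" using \<eta>_bounds \<gamma> h by (simp add: ratio_def)
  have "4 / (\<gamma> * h) = 2 / t" by simp
  then show "ratio \<le> 1" unfolding ratio_def using tanh_ratio_le_one[OF t(1)] by (simp only: \<eta>_eq)
qed

lemma \<kappa>_bounds: "0 \<le> \<kappa>" "\<kappa> \<le> h / 2"
proof -
  show "0 \<le> \<kappa>" using \<eta>_bounds \<gamma> by (simp add: \<kappa>_def)
  have "1 - \<eta> \<le> t" using exp_neg_bounds(1)[of t] t by (simp add: \<eta>_eq)
  then show "\<kappa> \<le> h / 2" using \<gamma> by (simp add: \<kappa>_def field_simps)
qed

lemma c1_eq: "c1 = \<kappa> * (1 + \<eta>)"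
  by (simp add: c1_def \<kappa>_def power2_eq_square algebra_simps)

lemma c1_bounds: "0 < c1" "c1 \<le> h"
proof -
  show "0 < c1" using \<eta>_bounds \<gamma> by (simp add: c1_def)
  have "1 - \<eta>\<^sup>2 \<le> 2 * t" using exp_neg_bounds(1)[of "2 * t"] t by (simp add: \<eta>_sq)
  then show "c1 \<le> h" using \<gamma> by (simp add: c1_def field_simps)
qed

lemma h1_sq: "h1\<^sup>2 = 2 / \<gamma>\<^sup>2 * (\<gamma> * h - 1 + \<eta>\<^sup>2)"
proof -
  have "0 \<le> \<gamma> * h - 1 + \<eta>\<^sup>2" using exp_neg_bounds(1)[of "2 * t"] t by (simp add: \<eta>_sq)
  then show ?thesis using \<gamma> by (simp add: h1_def)
qed

lemma h1_bounds: "c1 < h1" "h1 \<le> h"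
proof -
  have q: "exp (- (\<gamma> * h)) = \<eta>\<^sup>2" by (simp add: \<eta>_sq)
  have "0 < 2 * (\<gamma> * h) - 3 + 4 * \<eta>\<^sup>2 - (\<eta>\<^sup>2)\<^sup>2"
    using exp_neg_remainder_pos[of "\<gamma> * h"] \<gamma> h by (simp add: q)
  then have "(1 - \<eta>\<^sup>2)\<^sup>2 < 2 * (\<gamma> * h - 1 + \<eta>\<^sup>2)" by (simp add: power2_eq_square algebra_simps)
  then have "c1\<^sup>2 < h1\<^sup>2" unfolding h1_sq c1_def power_divide using \<gamma> by (simp add: divide_strict_right_mono)
  moreover have "0 \<le> h1" unfolding h1_def by (rule real_sqrt_ge_zero)
    (use exp_neg_bounds(1)[of "2 * t"] t \<gamma> in \<open>simp add: \<eta>_sq\<close>)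
  ultimately show "c1 < h1" by (metis power2_less_imp_less)
  have "\<gamma> * h - 1 + \<eta>\<^sup>2 \<le> (\<gamma> * h)\<^sup>2 / 2"
    using exp_neg_bounds(2)[of "\<gamma> * h"] \<gamma> h by (simp add: q)
  then have "h1\<^sup>2 \<le> 2 / \<gamma>\<^sup>2 * ((\<gamma> * h)\<^sup>2 / 2)" unfolding h1_sq using \<gamma> by (intro mult_left_mono) auto
  also have "\<dots> = h\<^sup>2" using \<gamma> by (simp add: power_mult_distrib)
  finally show "h1 \<le> h" using h by (meson less_imp_le power2_le_imp_le)
qed

text \<open>The gap between the weights of the force in the final velocity, \<open>c1\<close> after
  the flow and \<open>\<eta> * h\<close> in the step. The expansion in \<open>t\<close> cancels
  through order two, and a factor \<open>t <= 1 / 4\<close> of the cubic remainder is spent.\<close>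

lemma c1_mismatch: "\<bar>c1 - \<eta> * h\<bar> \<le> \<gamma> * h\<^sup>2 / 32"
proof -
  have t0: "0 \<le> t" "0 \<le> 2 * t" using t by auto
  note b = exp_neg_bounds[OF t0(1)] exp_neg_bounds[OF t0(2)]
  have c: "c1 - \<eta> * h = ((1 - exp (- (2 * t))) - 2 * t * exp (- t)) / \<gamma>"
    using \<gamma> unfolding c1_def \<eta>_sq unfolding \<eta>_eq by (simp add: field_simps)
  note t3 = small_powers[OF t0(1) t(2)]
  have m: "2 * t * (1 - t + t\<^sup>2 / 2 - t ^ 3 / 6) \<le> 2 * t * exp (- t)"
     "2 * t * exp (- t) \<le> 2 * t * (1 - t + t\<^sup>2 / 2)"
    using b t0 by (intro mult_left_mono; simp)+
  have e: "2 * t * (1 - t + t\<^sup>2 / 2 - t ^ 3 / 6) = 2 * t - 2 * t\<^sup>2 + t ^ 3 - t ^ 4 / 3"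
    "2 * t * (1 - t + t\<^sup>2 / 2) = 2 * t - 2 * t\<^sup>2 + t ^ 3"
    "(2 * t)\<^sup>2 = 4 * t\<^sup>2" "(2 * t) ^ 3 = 8 * t ^ 3" "(2 * t) ^ 4 = 16 * t ^ 4"
    by (auto simp: algebra_simps power2_eq_square power3_eq_cube power4_eq_xxxx)
  have a: "\<bar>(1 - exp (- (2 * t))) - 2 * t * exp (- t)\<bar> \<le> t\<^sup>2 / 8"
    using b(3,4,7,8) m t3 unfolding e by linarith
  have "\<bar>c1 - \<eta> * h\<bar> \<le> t\<^sup>2 / 8 / \<gamma>"
    unfolding c abs_divide abs_of_pos[OF \<gamma>] by (rule divide_right_mono[OF a]) (use \<gamma> in simp)
  also have "\<dots> = \<gamma> * h\<^sup>2 / 32" using \<gamma> by (simp add: power2_eq_square)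
  finally show ?thesis .
qed

text \<open>The gap between the weights of the force in the position, \<open>h1\<^sup>2 / 2\<close>
  after the flow and \<open>\<kappa> * h\<close> in the step. Again the expansion in
  \<open>t\<close> cancels through order two.\<close>

lemma h1_mismatch: "\<bar>h1\<^sup>2 / 2 - \<kappa> * h\<bar> \<le> h\<^sup>2 / 12"
proof -
  have t0: "0 \<le> t" "0 \<le> 2 * t" using t by auto
  note b = exp_neg_bounds[OF t0(1)] exp_neg_bounds[OF t0(2)]
  have c: "h1\<^sup>2 / 2 - \<kappa> * h = (2 * t - 1 + exp (- (2 * t)) - 2 * t * (1 - exp (- t))) / \<gamma>\<^sup>2"
  proof -
    have q: "exp (- (\<gamma> * h / 2)) * exp (- (\<gamma> * h / 2)) = exp (- (\<gamma> * h))" by (simp add: mult_exp_exp)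
    show ?thesis using \<gamma> unfolding h1_sq \<kappa>_def \<eta>_sq unfolding \<eta>_eq
      by (simp add: field_simps power2_eq_square q)
  qed
  note t3 = small_powers[OF t0(1) t(2)]
  have m: "2 * t * (1 - t) \<le> 2 * t * exp (- t)" "2 * t * exp (- t) \<le> 2 * t * (1 - t + t\<^sup>2 / 2)"
    using b t0 by (intro mult_left_mono; simp)+
  have e: "2 * t * (1 - t) = 2 * t - 2 * t\<^sup>2" "2 * t * (1 - t + t\<^sup>2 / 2) = 2 * t - 2 * t\<^sup>2 + t ^ 3"
    "(2 * t)\<^sup>2 = 4 * t\<^sup>2" "(2 * t) ^ 3 = 8 * t ^ 3" "2 * t * (1 - exp (- t)) = 2 * t - 2 * t * exp (- t)"
    by (auto simp: algebra_simps power2_eq_square power3_eq_cube)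
  have a: "\<bar>2 * t - 1 + exp (- (2 * t)) - 2 * t * (1 - exp (- t))\<bar> \<le> t\<^sup>2 / 3"
    using b(6,7) m t3 unfolding e by linarith
  have "\<bar>h1\<^sup>2 / 2 - \<kappa> * h\<bar> \<le> t\<^sup>2 / 3 / \<gamma>\<^sup>2"
    unfolding c abs_divide abs_power2 by (rule divide_right_mono[OF a]) simp
  also have "\<dots> = h\<^sup>2 / 12" using \<gamma> by (simp add: power2_eq_square)
  finally show ?thesis .
qed

text \<open>The gradient noise reaches the position directly, with weight
  \<open>\<kappa> * h\<close>, and through its share in the perturbed Gaussian, with weight
  \<open>c1 * \<eta> * h\<close>; this is what is left.\<close>

lemma noise_weight: "\<bar>\<kappa> * h - c1 * \<eta> * h\<bar> \<le> h\<^sup>2 / 2"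
proof -
  have "\<bar>1 - (1 + \<eta>) * \<eta>\<bar> \<le> 1"
  proof -
    have "0 \<le> (1 + \<eta>) * \<eta>" "(1 + \<eta>) * \<eta> \<le> 2 * 1"
      using \<eta>_bounds mult_mono[of "1 + \<eta>" 2 \<eta> 1] by auto
    then show ?thesis by (simp add: abs_le_iff)
  qed
  then have "\<kappa> * h * \<bar>1 - (1 + \<eta>) * \<eta>\<bar> \<le> h / 2 * h * 1"
    using \<kappa>_bounds h by (intro mult_mono) auto
  moreover have "\<kappa> * h - c1 * \<eta> * h = \<kappa> * h * (1 - (1 + \<eta>) * \<eta>)"
    by (simp add: c1_eq algebra_simps)
  ultimately show ?thesis using \<kappa>_bounds h by (simp add: abs_mult power2_eq_square)
qed

text \<open>The left-hand side is the variance per coordinate of the force-free position increment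
  of a half step from a standard Gaussian velocity, see
  \<open>gauss_coefficient_sums\<close>.\<close>

lemma half_variance: "2 / \<gamma>\<^sup>2 * (t - 1 + \<eta>) \<le> h\<^sup>2 / 4"
proof -
  have "t - 1 + \<eta> \<le> t\<^sup>2 / 2" using exp_neg_bounds(2)[of t] t by (simp add: \<eta>_eq)
  then have "2 / \<gamma>\<^sup>2 * (t - 1 + \<eta>) \<le> 2 / \<gamma>\<^sup>2 * (t\<^sup>2 / 2)" using \<gamma> by (intro mult_left_mono) auto
  also have "\<dots> = h\<^sup>2 / 4" using \<gamma> by (simp add: power2_eq_square)
  finally show ?thesis .
qed

end

section \<open>Mean-square contraction of one step\<close>

lemma inner_young:
  fixes x y :: "'a::real_inner"
  assumes "0 < c"
  shows "- (2 * (x \<bullet> y)) \<le> c * (norm x)\<^sup>2 + (norm y)\<^sup>2 / c"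
    and "2 * (x \<bullet> y) \<le> c * (norm x)\<^sup>2 + (norm y)\<^sup>2 / c"
proof -
  have *: "- (2 * (x \<bullet> y)) \<le> c * (norm x)\<^sup>2 + (norm y)\<^sup>2 / c" for x y :: 'a
  proof -
    have "0 \<le> (norm (c *\<^sub>R x + y))\<^sup>2" by simp
    also have "\<dots> = c * (c * (norm x)\<^sup>2 + 2 * (x \<bullet> y) + (norm y)\<^sup>2 / c)"
      unfolding power2_norm_eq_inner using assms
      by (simp add: inner_add_left inner_add_right inner_commute distrib_left del: dot_square_norm)
    finally show ?thesis using assms by (simp add: zero_le_mult_iff)
  qed
  show "- (2 * (x \<bullet> y)) \<le> c * (norm x)\<^sup>2 + (norm y)\<^sup>2 / c" by (rule *)
  show "2 * (x \<bullet> y) \<le> c * (norm x)\<^sup>2 + (norm y)\<^sup>2 / c" using *[of x "- y"] by simp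
qed

locale ubu_contraction = ubu_params +
  fixes m L :: real
  assumes m_pos: "0 < m" and m_le_L: "m \<le> L" and friction: "8 * L \<le> \<gamma>\<^sup>2"
begin

lemma L_pos: "0 < L" using m_pos m_le_L by simp

text \<open>What is left of the coefficient of the squared velocity once the square is completed in
  \<open>nab_quadratic\<close>; the friction bound keeps it positive.\<close>

definition \<alpha> :: real where "\<alpha> = 1 / L - 1 / \<gamma>\<^sup>2"

lemma inv_\<gamma>_sq: "1 / \<gamma>\<^sup>2 \<le> 1 / (8 * L)"
  using friction \<gamma> L_pos by (intro divide_left_mono) auto

lemma \<alpha>_bounds: "7 / (8 * L) \<le> \<alpha>" "\<alpha> \<le> 1 / L" "0 < \<alpha>"
proof -
  have e: "1 / L = 1 / (8 * L) + 7 / (8 * L)" using L_pos by (simp add: field_simps)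
  show 1: "7 / (8 * L) \<le> \<alpha>" using inv_\<gamma>_sq unfolding \<alpha>_def e by linarith
  show "\<alpha> \<le> 1 / L" using \<gamma> by (simp add: \<alpha>_def)
  have "0 < 7 / (8 * L)" using L_pos by simp
  then show "0 < \<alpha>" using 1 by linarith
qed

definition nab :: "'a::real_inner \<times> 'a \<Rightarrow> real" where
  "nab = norm_ab (1 / L) (1 / \<gamma>)"

lemma nab_quadratic:
  "(norm x)\<^sup>2 + 2 * (1 / \<gamma>) * (x \<bullet> v) + (1 / L) * (norm v)\<^sup>2 = (norm (x + (1 / \<gamma>) *\<^sub>R v))\<^sup>2 + \<alpha> * (norm v)\<^sup>2"
proof -
  have "(norm (x + (1 / \<gamma>) *\<^sub>R v))\<^sup>2 = (norm x)\<^sup>2 + 2 * (1 / \<gamma>) * (x \<bullet> v) + (1 / \<gamma>\<^sup>2) * (norm v)\<^sup>2"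
    unfolding power2_norm_eq_inner
    by (simp add: inner_add_left inner_add_right inner_commute power2_eq_square)
  then show ?thesis by (simp add: \<alpha>_def algebra_simps)
qed

lemma nab_sq: "(nab (x, v))\<^sup>2 = (norm (x + (1 / \<gamma>) *\<^sub>R v))\<^sup>2 + \<alpha> * (norm v)\<^sup>2"
  unfolding nab_def norm_ab_def prod.case nab_quadratic using \<alpha>_bounds by simp

text \<open>As the Euclidean norm of a linear image, \<open>nab\<close> inherits the triangle
  inequality and continuity.\<close>

lemma nab_eq_norm: "nab z = norm (fst z + (1 / \<gamma>) *\<^sub>R snd z, sqrt \<alpha> *\<^sub>R snd z)"
proof -
  obtain x v where z: "z = (x, v)" by force
  show ?thesis
    unfolding z nab_def norm_ab_def prod.case nab_quadratic using \<alpha>_bounds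
    by (simp add: norm_Pair power_mult_distrib)
qed

lemma nab_nonneg [simp]: "0 \<le> nab z"
  by (simp add: nab_eq_norm)

lemma nab_triangle: "nab (z + z') \<le> nab z + nab z'"
proof -
  have "(fst (z + z') + (1 / \<gamma>) *\<^sub>R snd (z + z'), sqrt \<alpha> *\<^sub>R snd (z + z'))
    = (fst z + (1 / \<gamma>) *\<^sub>R snd z, sqrt \<alpha> *\<^sub>R snd z) + (fst z' + (1 / \<gamma>) *\<^sub>R snd z', sqrt \<alpha> *\<^sub>R snd z')"
    by (simp add: algebra_simps)
  then show ?thesis unfolding nab_eq_norm by (simp only: norm_triangle_ineq)
qed

lemma nab_le: "nab (x, v) \<le> norm x + norm v / sqrt L"
proof -
  have "nab (x, 0) = norm x" by (simp add: nab_def norm_ab_def)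
  moreover have "nab (0, v) = norm v / sqrt L"
    by (simp add: nab_def norm_ab_def real_sqrt_mult real_sqrt_divide)
  ultimately show ?thesis using nab_triangle[of "(x, 0)" "(0, v)"] by simp
qed

lemma continuous_nab: "continuous_on S nab"
  unfolding nab_eq_norm[abs_def] by (intro continuous_intros)

lemma nab_measurable [measurable]:
  "(nab :: 'a::euclidean_space \<times> 'a \<Rightarrow> real) \<in> borel_measurable borel"
  by (rule borel_measurable_continuous_onI[OF continuous_nab])

text \<open>The square is completed in the velocity. This uses up the share
  \<open>L / \<gamma>\<^sup>2 <= 1 / 8\<close> of the squared position, and the remaining 7/8 give
  the constant.\<close>

lemma position_le_nab: "(norm x)\<^sup>2 \<le> 8 / 7 * (nab (x, v))\<^sup>2"
proof -
  have "0 \<le> (norm ((sqrt L / \<gamma>) *\<^sub>R x + (1 / sqrt L) *\<^sub>R v))\<^sup>2" by simp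
  also have "\<dots> = L / \<gamma>\<^sup>2 * (norm x)\<^sup>2 + 2 * (1 / \<gamma>) * (x \<bullet> v) + (1 / L) * (norm v)\<^sup>2"
    unfolding power2_norm_eq_inner using L_pos \<gamma>
    by (simp add: inner_add_left inner_add_right inner_commute power2_eq_square field_simps)
  finally have 1: "0 \<le> L / \<gamma>\<^sup>2 * (norm x)\<^sup>2 + 2 * (1 / \<gamma>) * (x \<bullet> v) + (1 / L) * (norm v)\<^sup>2" .
  have "L / \<gamma>\<^sup>2 \<le> 1 / 8" using friction \<gamma> by (simp add: field_simps)
  then have "L / \<gamma>\<^sup>2 * (norm x)\<^sup>2 \<le> 1 / 8 * (norm x)\<^sup>2" by (rule mult_right_mono) simp
  then have "7 / 8 * (norm x)\<^sup>2 \<le> (norm x)\<^sup>2 + 2 * (1 / \<gamma>) * (x \<bullet> v) + (1 / L) * (norm v)\<^sup>2" using 1 by linarith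
  then have "7 / 8 * (norm x)\<^sup>2 \<le> (nab (x, v))\<^sup>2" unfolding nab_sq nab_quadratic .
  then show ?thesis by simp
qed

text \<open>In the coordinates \<open>(x + v / \<gamma>, v)\<close> a half step \<open>\<U>\<close> fixes the first component and multiplies
  the second by \<open>\<eta>\<close>.\<close>

lemma full_step_sq:
  fixes x v D :: "'a::real_inner"
  defines "y \<equiv> x + \<kappa> *\<^sub>R v" and "w \<equiv> \<eta> *\<^sub>R v"
  shows "(nab (y + \<kappa> *\<^sub>R (w - h *\<^sub>R D), \<eta> *\<^sub>R (w - h *\<^sub>R D)))\<^sup>2
    = (norm ((y + (1 / \<gamma>) *\<^sub>R w) - (h / \<gamma>) *\<^sub>R D))\<^sup>2 + \<alpha> * \<eta>\<^sup>2 * (norm (w - h *\<^sub>R D))\<^sup>2"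
    and "y + (1 / \<gamma>) *\<^sub>R w = x + (1 / \<gamma>) *\<^sub>R v"
proof -
  have k: "\<kappa> + \<eta> / \<gamma> = 1 / \<gamma>" by (simp add: \<kappa>_def diff_divide_distrib)
  have "y + \<kappa> *\<^sub>R (w - h *\<^sub>R D) + (1 / \<gamma>) *\<^sub>R (\<eta> *\<^sub>R (w - h *\<^sub>R D)) = y + (\<kappa> + \<eta> / \<gamma>) *\<^sub>R (w - h *\<^sub>R D)"
    by (simp add: scaleR_add_left)
  also have "\<dots> = (y + (1 / \<gamma>) *\<^sub>R w) - (h / \<gamma>) *\<^sub>R D"
    unfolding k by (simp add: scaleR_diff_right)
  finally have e: "y + \<kappa> *\<^sub>R (w - h *\<^sub>R D) + (1 / \<gamma>) *\<^sub>R (\<eta> *\<^sub>R (w - h *\<^sub>R D)) = (y + (1 / \<gamma>) *\<^sub>R w) - (h / \<gamma>) *\<^sub>R D" .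
  show "(nab (y + \<kappa> *\<^sub>R (w - h *\<^sub>R D), \<eta> *\<^sub>R (w - h *\<^sub>R D)))\<^sup>2
    = (norm ((y + (1 / \<gamma>) *\<^sub>R w) - (h / \<gamma>) *\<^sub>R D))\<^sup>2 + \<alpha> * \<eta>\<^sup>2 * (norm (w - h *\<^sub>R D))\<^sup>2"
    unfolding nab_sq e by (simp add: power_mult_distrib)
  have "y + (1 / \<gamma>) *\<^sub>R w = x + (\<kappa> + \<eta> / \<gamma>) *\<^sub>R v"
    by (simp add: y_def w_def scaleR_add_left)
  then show "y + (1 / \<gamma>) *\<^sub>R w = x + (1 / \<gamma>) *\<^sub>R v" unfolding k .
qed

text \<open>\<open>h\<^sup>2 * \<beta>\<close> is the total coefficient of the squared norm of
  \<open>D\<close> in \<open>full_step_sq\<close>.\<close>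

definition \<beta> :: real where "\<beta> = 1 / \<gamma>\<^sup>2 + \<alpha> * \<eta>\<^sup>2"

lemma \<beta>_bounds: "0 \<le> \<beta>" "\<beta> \<le> 1 / L"
proof -
  show "0 \<le> \<beta>" using \<alpha>_bounds by (simp add: \<beta>_def)
  have "\<alpha> * \<eta>\<^sup>2 \<le> \<alpha> * 1" using \<alpha>_bounds \<eta>_bounds by (intro mult_left_mono) auto
  then show "\<beta> \<le> 1 / L" by (simp add: \<beta>_def \<alpha>_def)
qed

lemma \<eta>_inverse_bounds: "7 / 4 * (\<gamma> * h) \<le> 1 / \<eta>\<^sup>2 - \<eta>\<^sup>2" "1 / \<eta>\<^sup>2 \<le> 16 / 9"
proof -
  have "exp (2 * t) * \<eta>\<^sup>2 = 1" unfolding \<eta>_sq mult_exp_exp by simp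
  then have i: "1 / \<eta>\<^sup>2 = exp (2 * t)" using \<eta>_bounds(1) by (simp add: divide_eq_eq)
  have "1 + 2 * t \<le> 1 / \<eta>\<^sup>2" unfolding i by (rule exp_ge_add_one_self)
  moreover have "\<eta>\<^sup>2 \<le> 1 - 2 * t + (2 * t)\<^sup>2 / 2" unfolding \<eta>_sq using t by (intro exp_neg_bounds) auto
  moreover have "(2 * t)\<^sup>2 / 2 \<le> t / 2"
  proof -
    have "t * t \<le> t * (1 / 4)" using t by (intro mult_left_mono) auto
    then show ?thesis by (simp add: power2_eq_square)
  qed
  ultimately show "7 / 4 * (\<gamma> * h) \<le> 1 / \<eta>\<^sup>2 - \<eta>\<^sup>2" by simp
  have "(3 / 4)\<^sup>2 \<le> \<eta>\<^sup>2" using \<eta>_bounds by (intro power_mono) auto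
  then have "1 / \<eta>\<^sup>2 \<le> 1 / (3 / 4)\<^sup>2" using \<eta>_bounds(1) by (intro divide_left_mono mult_pos_pos) auto
  then show "1 / \<eta>\<^sup>2 \<le> 16 / 9" by (simp add: power2_eq_square)
qed

text \<open>Two terms reduce the squared norm: the damping of the velocity by the two factors
  \<open>\<eta>\<close>, and the coercive term \<open>q \<bullet> y\<close>. The indefinite term
  \<open>w \<bullet> q\<close> is absorbed by Young's inequality, and cocoercivity turns each
  squared norm of \<open>q\<close> into \<open>q \<bullet> y\<close>.\<close>

lemma contraction_gradient:
  fixes x v q :: "'a::real_inner"
  defines "y \<equiv> x + \<kappa> *\<^sub>R v" and "w \<equiv> \<eta> *\<^sub>R v"
  assumes mono: "m * (norm y)\<^sup>2 \<le> q \<bullet> y" and coco: "(norm q)\<^sup>2 \<le> L * (q \<bullet> y)"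
  shows "(nab (y + \<kappa> *\<^sub>R (w - h *\<^sub>R q), \<eta> *\<^sub>R (w - h *\<^sub>R q)))\<^sup>2 \<le> (1 - m * h / (2 * \<gamma>)) * (nab (x, v))\<^sup>2"
proof -
  define W where "W = (norm w)\<^sup>2"
  define Y where "Y = q \<bullet> y"
  define Q where "Q = (norm q)\<^sup>2"
  define s where "s = y + (1 / \<gamma>) *\<^sub>R w"
  have nn: "0 \<le> W" "0 \<le> Q" by (auto simp: W_def Q_def)
  have QY: "Q \<le> L * Y" and Y0: "0 \<le> Y" 
    using coco mono m_pos by (auto simp: Q_def Y_def intro: order_trans[of 0 "m * (norm y)\<^sup>2"])
  have vW: "(norm v)\<^sup>2 = 1 / \<eta>\<^sup>2 * W" using \<eta>_bounds by (simp add: W_def w_def power_mult_distrib)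
  have N0: "(nab (x, v))\<^sup>2 = (norm s)\<^sup>2 + \<alpha> * (1 / \<eta>\<^sup>2) * W"
    unfolding nab_sq s_def full_step_sq(2)[of x v, folded y_def w_def] vW by simp
  have N1: "(nab (y + \<kappa> *\<^sub>R (w - h *\<^sub>R q), \<eta> *\<^sub>R (w - h *\<^sub>R q)))\<^sup>2
    = (norm s)\<^sup>2 - 2 * (h / \<gamma>) * (Y + (w \<bullet> q) / \<gamma>) + (h / \<gamma>)\<^sup>2 * Q
      + \<alpha> * \<eta>\<^sup>2 * (W - 2 * h * (w \<bullet> q) + h\<^sup>2 * Q)"
  proof -
    have 1: "(norm (s - (h / \<gamma>) *\<^sub>R q))\<^sup>2 = (norm s)\<^sup>2 - 2 * (h / \<gamma>) * (s \<bullet> q) + (h / \<gamma>)\<^sup>2 * Q"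
      "(norm (w - h *\<^sub>R q))\<^sup>2 = W - 2 * h * (w \<bullet> q) + h\<^sup>2 * Q"
      unfolding power2_norm_eq_inner Q_def W_def
      by (simp_all add: inner_diff_left inner_diff_right inner_commute power2_eq_square algebra_simps)
    have 2: "s \<bullet> q = Y + (w \<bullet> q) / \<gamma>" by (simp add: s_def Y_def inner_add_left inner_commute[of q y])
    show ?thesis unfolding full_step_sq(1)[of x v q, folded y_def w_def, folded s_def] 1 2 ..
  qed
  have diff: "(nab (x, v))\<^sup>2 - (nab (y + \<kappa> *\<^sub>R (w - h *\<^sub>R q), \<eta> *\<^sub>R (w - h *\<^sub>R q)))\<^sup>2
    = \<alpha> * (1 / \<eta>\<^sup>2 - \<eta>\<^sup>2) * W + 2 * (h / \<gamma>) * Y + 2 * h * \<beta> * (w \<bullet> q) - h\<^sup>2 * \<beta> * Q"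
  proof -
    have "2 * h * \<beta> * (w \<bullet> q) - h\<^sup>2 * \<beta> * Q = 2 * (h / \<gamma>) * ((w \<bullet> q) / \<gamma>) + 2 * h * (\<alpha> * \<eta>\<^sup>2) * (w \<bullet> q)
        - (h / \<gamma>)\<^sup>2 * Q - h\<^sup>2 * (\<alpha> * \<eta>\<^sup>2) * Q"
      by (simp add: \<beta>_def distrib_left distrib_right power2_eq_square)
    then show ?thesis unfolding N0 N1 by (simp add: distrib_left right_diff_distrib left_diff_distrib)
  qed
  have b1: "7 / (8 * L) * (7 / 4 * (\<gamma> * h)) * W \<le> \<alpha> * (1 / \<eta>\<^sup>2 - \<eta>\<^sup>2) * W"
    using \<alpha>_bounds \<eta>_inverse_bounds \<gamma> h nn by (intro mult_right_mono mult_mono) auto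
  \<comment> \<open>Of the 49/32 units of \<open>\<gamma> * h / L * W\<close> in \<open>b1\<close>
    this weight spends 40/32 and leaves 9/32. Of the 2 units of \<open>h / \<gamma> * Y\<close>, 4/5
    are spent here and 1/2 in \<open>b3\<close>, which leaves 7/10.\<close>
  have young: "- (2 * (w \<bullet> q)) \<le> 5 / 4 * \<gamma> * W + 4 / 5 / \<gamma> * Q"
    using inner_young(1)[of "5 / 4 * \<gamma>" w q] \<gamma> by (simp add: W_def Q_def)
  have b2: "- (2 * h * \<beta> * (w \<bullet> q)) \<le> h / L * (5 / 4 * \<gamma> * W) + h / L * (4 / 5 / \<gamma> * (L * Y))"
  proof -
    have "h * \<beta> * (- (2 * (w \<bullet> q))) \<le> h * \<beta> * (5 / 4 * \<gamma> * W + 4 / 5 / \<gamma> * Q)"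
      using young h \<beta>_bounds by (intro mult_left_mono) auto
    also have "\<dots> \<le> h * (1 / L) * (5 / 4 * \<gamma> * W + 4 / 5 / \<gamma> * (L * Y))"
      using h \<beta>_bounds nn \<gamma> QY L_pos by (intro mult_mono add_mono mult_left_mono mult_nonneg_nonneg add_nonneg_nonneg) auto
    finally show ?thesis by (simp add: algebra_simps)
  qed
  have b3: "h\<^sup>2 * \<beta> * Q \<le> h / (2 * \<gamma>) * Y"
  proof -
    have "h\<^sup>2 * \<beta> * Q \<le> h\<^sup>2 * (1 / L) * (L * Y)"
      using \<beta>_bounds QY nn L_pos by (intro mult_mono mult_left_mono) auto
    also have "\<dots> = h * h * Y" using L_pos by (simp add: power2_eq_square)
    also have "\<dots> \<le> h * (1 / (2 * \<gamma>)) * Y"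
      using h h_le \<gamma> Y0 by (intro mult_right_mono mult_left_mono) (auto simp: field_simps)
    finally show ?thesis by simp
  qed
  have low: "9 / 32 * (\<gamma> * h / L) * W + 7 / 10 * (h / \<gamma>) * Y
    \<le> (nab (x, v))\<^sup>2 - (nab (y + \<kappa> *\<^sub>R (w - h *\<^sub>R q), \<eta> *\<^sub>R (w - h *\<^sub>R q)))\<^sup>2"
  proof -
    have e: "7 / (8 * L) * (7 / 4 * (\<gamma> * h)) * W = 49 / 32 * (\<gamma> * h / L * W)"
      "h / L * (5 / 4 * \<gamma> * W) = 5 / 4 * (\<gamma> * h / L * W)"
      "h / L * (4 / 5 / \<gamma> * (L * Y)) = 4 / 5 * (h / \<gamma> * Y)"
      "h / (2 * \<gamma>) * Y = 1 / 2 * (h / \<gamma> * Y)"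
      "9 / 32 * (\<gamma> * h / L) * W = 9 / 32 * (\<gamma> * h / L * W)"
      "7 / 10 * (h / \<gamma>) * Y = 7 / 10 * (h / \<gamma> * Y)"
      "2 * (h / \<gamma>) * Y = 2 * (h / \<gamma> * Y)"
      using L_pos by (auto simp: field_simps)
    have "9 / 32 * g + 7 / 10 * y \<le> A + 2 * y + B - c"
      if "49 / 32 * g \<le> A" "- B \<le> 5 / 4 * g + 4 / 5 * y" "c \<le> 1 / 2 * y" for A B c g y :: real
      using that by linarith
    from this[OF b1[unfolded e] b2[unfolded e] b3[unfolded e]] show ?thesis unfolding diff e .
  qed
  have up: "m * h / (2 * \<gamma>) * (nab (x, v))\<^sup>2 \<le> 9 / 32 * (\<gamma> * h / L) * W + 7 / 10 * (h / \<gamma>) * Y"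
  proof -
    \<comment> \<open>The Young weight 2/5 gives the factor 7/5, which after multiplication by
      \<open>h / (2 * \<gamma>)\<close> matches the 7/10 left in \<open>low\<close>.\<close>
    have s: "(norm s)\<^sup>2 \<le> 7 / 5 * (norm y)\<^sup>2 + 7 / 2 * (1 / \<gamma>\<^sup>2) * W"
    proof -
      define z where "z = (1 / \<gamma>) *\<^sub>R w"
      have "2 * (y \<bullet> z) \<le> 2 / 5 * (norm y)\<^sup>2 + 5 / 2 * (norm z)\<^sup>2"
        using inner_young(2)[of "2 / 5" y z] by simp
      moreover have "(norm s)\<^sup>2 = (norm y)\<^sup>2 + 2 * (y \<bullet> z) + (norm z)\<^sup>2"
        unfolding s_def z_def[symmetric] power2_norm_eq_inner by (simp add: inner_add_left inner_add_right inner_commute)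
      moreover have "(norm z)\<^sup>2 = 1 / \<gamma>\<^sup>2 * W" by (simp add: z_def W_def power_mult_distrib power_divide)
      ultimately show ?thesis by simp
    qed
    have "m * (nab (x, v))\<^sup>2 \<le> m * ((7 / 5 * (norm y)\<^sup>2 + 7 / 2 * (1 / \<gamma>\<^sup>2) * W) + 1 / L * (16 / 9) * W)"
      unfolding N0 using s \<alpha>_bounds \<eta>_inverse_bounds nn m_pos L_pos
      by (intro mult_left_mono add_mono mult_right_mono mult_mono) auto
    also have "\<dots> = 7 / 5 * (m * (norm y)\<^sup>2) + (7 / 2 * (m / \<gamma>\<^sup>2) + 16 / 9 * (m / L)) * W"
      by (simp add: algebra_simps)
    also have "\<dots> \<le> 7 / 5 * Y + (7 / 2 * (1 / 8) + 16 / 9 * 1) * W"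
    proof -
      have "m / \<gamma>\<^sup>2 \<le> 1 / 8" "m / L \<le> 1" using friction \<gamma> m_le_L L_pos by (auto simp: field_simps)
      then show ?thesis using mono nn unfolding Y_def[symmetric]
        by (intro add_mono mult_right_mono mult_left_mono) auto
    qed
    also have "\<dots> \<le> 7 / 5 * Y + 9 / 16 * (\<gamma>\<^sup>2 / L) * W"
    proof -
      have "8 \<le> \<gamma>\<^sup>2 / L" using friction L_pos by (simp add: field_simps)
      then show ?thesis using nn by (intro add_left_mono mult_right_mono) auto
    qed
    finally have "h / (2 * \<gamma>) * (m * (nab (x, v))\<^sup>2) \<le> h / (2 * \<gamma>) * (7 / 5 * Y + 9 / 16 * (\<gamma>\<^sup>2 / L) * W)"
      using h \<gamma> by (intro mult_left_mono) auto
    also have "\<dots> = 9 / 32 * (\<gamma> * h / L) * W + 7 / 10 * (h / \<gamma>) * Y"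
      using \<gamma> L_pos by (simp add: field_simps power2_eq_square)
    finally show ?thesis by (simp add: mult_ac)
  qed
  show ?thesis using low up by (simp add: algebra_simps)
qed

text \<open>Half the loss of the mean squared norm in one step,
  \<open>m * h / (2 * \<gamma>)\<close> from the gradient minus
  \<open>8 / 7 * (h\<^sup>2 * C / L)\<close> from the noise. Halving passes from the square to the
  norm, by \<open>1 - 2 r <= (1 - r)\<^sup>2\<close>.\<close>

definition rate :: "real \<Rightarrow> real" where
  "rate C = m * h / (4 * \<gamma>) - 4 / 7 * (h\<^sup>2 * C / L)"

lemma rate_le: "0 \<le> C \<Longrightarrow> rate C \<le> 1 / 64"
proof -
  assume C: "0 \<le> C"
  have "m * h / (4 * \<gamma>) = (m / \<gamma>\<^sup>2) * (h * \<gamma>) / 4" using \<gamma> by (simp add: power2_eq_square)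
  also have "\<dots> \<le> (1 / 8) * (1 / 2) / 4"
    using friction m_le_L \<gamma> h h_le m_pos by (intro divide_right_mono mult_mono) (auto simp: field_simps)
  finally have "m * h / (4 * \<gamma>) \<le> 1 / 64" by simp
  moreover have "0 \<le> 4 / 7 * (h\<^sup>2 * C / L)" using C L_pos by simp
  ultimately show ?thesis unfolding rate_def by linarith
qed

text \<open>With \<open>D = q + d\<close> and \<open>d\<close> centred, the squared norm is a
  constant, a linear term that integrates to zero, and \<open>h\<^sup>2 * \<beta>\<close> times the
  squared norm of \<open>d\<close>. The constant is the deterministic case; the variance is paid by
  the position part of the norm.\<close>

lemma contraction_noise:
  fixes x v :: "'a::euclidean_space" and D :: "'w \<Rightarrow> 'a"
  defines "y \<equiv> x + \<kappa> *\<^sub>R v" and "w \<equiv> \<eta> *\<^sub>R v"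
  assumes P: "prob_space \<Gamma>" and D: "integrable \<Gamma> D" "(\<integral>\<omega>. D \<omega> \<partial>\<Gamma>) = q"
    and var: "(\<integral>\<^sup>+ \<omega>. ennreal ((norm (D \<omega> - q))\<^sup>2) \<partial>\<Gamma>) \<le> ennreal (C * (norm y)\<^sup>2)" and C: "0 \<le> C"
    and mono: "m * (norm y)\<^sup>2 \<le> q \<bullet> y" and coco: "(norm q)\<^sup>2 \<le> L * (q \<bullet> y)"
  shows "(\<integral>\<^sup>+ \<omega>. ennreal ((nab (y + \<kappa> *\<^sub>R (w - h *\<^sub>R D \<omega>), \<eta> *\<^sub>R (w - h *\<^sub>R D \<omega>)))\<^sup>2) \<partial>\<Gamma>)
    \<le> ennreal (((1 - rate C) * nab (x, v))\<^sup>2)"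
proof -
  interpret prob_space \<Gamma> by fact
  define s where "s = y + (1 / \<gamma>) *\<^sub>R w"
  define d where "d \<omega> = D \<omega> - q" for \<omega>
  define l where "l = (- (h / \<gamma>)) *\<^sub>R (s - (h / \<gamma>) *\<^sub>R q) - (\<alpha> * \<eta>\<^sup>2 * h) *\<^sub>R (w - h *\<^sub>R q)"
  define N1 where "N1 = (nab (y + \<kappa> *\<^sub>R (w - h *\<^sub>R q), \<eta> *\<^sub>R (w - h *\<^sub>R q)))\<^sup>2"
  have [measurable]: "D \<in> borel_measurable \<Gamma>" using D by auto
  have di: "integrable \<Gamma> d" "(\<integral>\<omega>. d \<omega> \<partial>\<Gamma>) = 0" using D by (auto simp: d_def[abs_def] prob_space)
  have fin: "(\<integral>\<^sup>+ \<omega>. ennreal ((norm (d \<omega>))\<^sup>2) \<partial>\<Gamma>) \<le> ennreal (C * (norm y)\<^sup>2)" using var by (simp add: d_def)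
  have d2: "integrable \<Gamma> (\<lambda>\<omega>. (norm (d \<omega>))\<^sup>2)"
    by (rule integrableI_bounded) (use fin in \<open>auto simp: d_def intro: le_less_trans\<close>)
  have var': "(\<integral>\<omega>. (norm (d \<omega>))\<^sup>2 \<partial>\<Gamma>) \<le> C * (norm y)\<^sup>2"
    using fin C nn_integral_eq_integral[OF d2] by (simp add: ennreal_le_iff)
  have e: "(nab (y + \<kappa> *\<^sub>R (w - h *\<^sub>R D \<omega>), \<eta> *\<^sub>R (w - h *\<^sub>R D \<omega>)))\<^sup>2
    = N1 + 2 * (l \<bullet> d \<omega>) + h\<^sup>2 * \<beta> * (norm (d \<omega>))\<^sup>2" for \<omega>
  proof -
    have D': "D \<omega> = q + d \<omega>" by (simp add: d_def)
    have 1: "(norm (s - (h / \<gamma>) *\<^sub>R (q + d \<omega>)))\<^sup>2 = (norm (s - (h / \<gamma>) *\<^sub>R q))\<^sup>2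
      - 2 * (h / \<gamma>) * ((s - (h / \<gamma>) *\<^sub>R q) \<bullet> d \<omega>) + (h / \<gamma>)\<^sup>2 * (norm (d \<omega>))\<^sup>2"
      and 2: "(norm (w - h *\<^sub>R (q + d \<omega>)))\<^sup>2 = (norm (w - h *\<^sub>R q))\<^sup>2
      - 2 * h * ((w - h *\<^sub>R q) \<bullet> d \<omega>) + h\<^sup>2 * (norm (d \<omega>))\<^sup>2"
      unfolding power2_norm_eq_inner
      by (simp_all add: inner_add_left inner_add_right inner_diff_left inner_diff_right inner_commute power2_eq_square algebra_simps)
    have 3: "l \<bullet> d \<omega> = - (h / \<gamma>) * ((s - (h / \<gamma>) *\<^sub>R q) \<bullet> d \<omega>) - \<alpha> * \<eta>\<^sup>2 * h * ((w - h *\<^sub>R q) \<bullet> d \<omega>)"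
      unfolding l_def inner_diff_left[of "_ *\<^sub>R _" "_ *\<^sub>R _"] inner_scaleR_left ..
    show ?thesis
      unfolding N1_def D' full_step_sq(1)[of x v, folded y_def w_def, folded s_def] 1 2 3 \<beta>_def
      by (simp add: algebra_simps power_divide)
  qed
  have i: "integrable \<Gamma> (\<lambda>\<omega>. N1 + 2 * (l \<bullet> d \<omega>) + h\<^sup>2 * \<beta> * (norm (d \<omega>))\<^sup>2)"
    using di d2 by auto
  have "(\<integral>\<^sup>+ \<omega>. ennreal ((nab (y + \<kappa> *\<^sub>R (w - h *\<^sub>R D \<omega>), \<eta> *\<^sub>R (w - h *\<^sub>R D \<omega>)))\<^sup>2) \<partial>\<Gamma>)
    = ennreal (\<integral>\<omega>. N1 + 2 * (l \<bullet> d \<omega>) + h\<^sup>2 * \<beta> * (norm (d \<omega>))\<^sup>2 \<partial>\<Gamma>)"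
    unfolding e by (rule nn_integral_eq_integral[OF i]) (simp flip: e)
  also have "(\<integral>\<omega>. N1 + 2 * (l \<bullet> d \<omega>) + h\<^sup>2 * \<beta> * (norm (d \<omega>))\<^sup>2 \<partial>\<Gamma>)
    = N1 + h\<^sup>2 * \<beta> * (\<integral>\<omega>. (norm (d \<omega>))\<^sup>2 \<partial>\<Gamma>)"
    using di d2 by (simp add: prob_space)
  also have "ennreal \<dots> \<le> ennreal (((1 - rate C) * nab (x, v))\<^sup>2)"
  proof (rule ennreal_leI)
    have "h\<^sup>2 * \<beta> * (\<integral>\<omega>. (norm (d \<omega>))\<^sup>2 \<partial>\<Gamma>) \<le> h\<^sup>2 * (1 / L) * (C * (norm y)\<^sup>2)"
      using \<beta>_bounds var' L_pos by (intro mult_mono mult_left_mono) auto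
    also have "\<dots> \<le> h\<^sup>2 * (1 / L) * (C * (8 / 7 * (nab (x, v))\<^sup>2))"
    proof -
      have "(norm y)\<^sup>2 \<le> 8 / 7 * (nab (y, w))\<^sup>2" by (rule position_le_nab)
      \<comment> \<open>The half step fixes \<open>x + v / \<gamma>\<close> and shrinks the
        velocity, so it cannot increase the norm.\<close>
      also have "(nab (y, w))\<^sup>2 \<le> (nab (x, v))\<^sup>2"
      proof -
        have "\<eta>\<^sup>2 * (norm v)\<^sup>2 \<le> 1 * (norm v)\<^sup>2" using \<eta>_bounds by (intro mult_right_mono) auto
        then show ?thesis
          unfolding nab_sq full_step_sq(2)[of x v, folded y_def w_def] unfolding w_def
          using \<alpha>_bounds by (simp add: power_mult_distrib)
      qed
      finally show ?thesis using C L_pos by (intro mult_left_mono) auto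
    qed
    finally have "N1 + h\<^sup>2 * \<beta> * (\<integral>\<omega>. (norm (d \<omega>))\<^sup>2 \<partial>\<Gamma>)
      \<le> (1 - m * h / (2 * \<gamma>)) * (nab (x, v))\<^sup>2 + h\<^sup>2 * (1 / L) * (C * (8 / 7 * (nab (x, v))\<^sup>2))"
      using contraction_gradient[of x v q] mono coco unfolding N1_def y_def w_def by linarith
    also have "\<dots> = (1 - 2 * rate C) * (nab (x, v))\<^sup>2"
      by (simp add: rate_def algebra_simps)
    also have "\<dots> \<le> (1 - rate C)\<^sup>2 * (nab (x, v))\<^sup>2"
      by (intro mult_right_mono) (auto simp: power2_eq_square algebra_simps)
    finally show "N1 + h\<^sup>2 * \<beta> * (\<integral>\<omega>. (norm (d \<omega>))\<^sup>2 \<partial>\<Gamma>) \<le> ((1 - rate C) * nab (x, v))\<^sup>2"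
      by (simp add: power_mult_distrib)
  qed
  finally show ?thesis .
qed

end

section \<open>The target measure\<close>

lemma fst_borel_measurable [measurable]:
  "(fst :: 'a::topological_space \<times> 'b::topological_space \<Rightarrow> 'a) \<in> borel_measurable borel"
  by (rule borel_measurable_continuous_onI) (intro continuous_intros)

lemma snd_borel_measurable [measurable]:
  "(snd :: 'a::topological_space \<times> 'b::topological_space \<Rightarrow> 'b) \<in> borel_measurable borel"
  by (rule borel_measurable_continuous_onI) (intro continuous_intros)

lemma nn_integral_exp_neg_sq_finite:
  assumes c: "0 < c"
  shows "(\<integral>\<^sup>+ x. ennreal (exp (- c * (norm x)\<^sup>2)) \<partial>(lborel :: 'a::euclidean_space measure)) < \<infinity>"
proof -
  define \<sigma> where "\<sigma> = sqrt (1 / (2 * c))"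
  have \<sigma>: "0 < \<sigma>" "\<sigma>\<^sup>2 = 1 / (2 * c)" using c by (auto simp: \<sigma>_def)
  have one: "(\<integral>\<^sup>+ y. ennreal (exp (- c * y\<^sup>2)) \<partial>lborel) < \<infinity>"
  proof -
    define K where "K = sqrt (2 * pi * \<sigma>\<^sup>2)"
    have K: "0 < K" using \<sigma>(1) by (simp add: K_def)
    have "exp (- c * y\<^sup>2) = K * normal_density 0 \<sigma> y" for y
    proof -
      have "- (y - 0)\<^sup>2 / (2 * \<sigma>\<^sup>2) = - c * y\<^sup>2" unfolding \<sigma>(2) using c by (simp add: field_simps)
      then show ?thesis unfolding normal_density_def K_def[symmetric] using K by simp
    qed
    then have "(\<integral>\<^sup>+ y. ennreal (exp (- c * y\<^sup>2)) \<partial>lborel) = (\<integral>\<^sup>+ y. ennreal K * ennreal (normal_density 0 \<sigma> y) \<partial>lborel)"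
      using K by (simp add: ennreal_mult)
    also have "\<dots> = ennreal K * (\<integral>\<^sup>+ y. ennreal (normal_density 0 \<sigma> y) \<partial>lborel)"
      by (rule nn_integral_cmult) simp
    also have "(\<integral>\<^sup>+ y. ennreal (normal_density 0 \<sigma> y) \<partial>lborel) = 1"
      using prob_space.emeasure_space_1[OF prob_space_normal_density[OF \<sigma>(1), of 0]] by (simp add: emeasure_density)
    finally show ?thesis by simp
  qed
  have "(\<integral>\<^sup>+ x. ennreal (exp (- c * (norm x)\<^sup>2)) \<partial>(lborel :: 'a measure))
    = (\<integral>\<^sup>+ x. (\<Prod>b\<in>Basis. ennreal (exp (- c * (x \<bullet> b)\<^sup>2))) \<partial>(lborel :: 'a measure))"
    by (intro nn_integral_cong) (simp add: norm_sq_eq_sum sum_distrib_left sum_negf[symmetric] exp_sum prod_ennreal)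
  also have "\<dots> = (\<Prod>b\<in>(Basis :: 'a set). \<integral>\<^sup>+ y. ennreal (exp (- c * y\<^sup>2)) \<partial>lborel)"
    by (rule nn_integral_lborel_prod) auto
  also have "\<dots> < \<infinity>" using one by (simp add: power_less_top_ennreal)
  finally show ?thesis .
qed

context convex_potential
begin

section \<open>Normalisation and second moment of the position marginal\<close>

lemma V_measurable [measurable]: "V \<in> borel_measurable borel"
  by (rule borel_measurable_continuous_onI[OF continuous_V])

lemma f_measurable [measurable]: "f \<in> borel_measurable borel"
  by (rule borel_measurable_continuous_onI[OF continuous_f])

definition partition_fn :: ennreal where
  "partition_fn = (\<integral>\<^sup>+ x. ennreal (exp (- V x)) \<partial>lborel)"

text \<open>Half of the quadratic lower bound at 0 absorbs the linear term
  \<open>f 0 \<bullet> x\<close>, by completing the square.\<close>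

lemma V_lower_quadratic: "V 0 - (norm (f 0))\<^sup>2 / m + m / 4 * (norm x)\<^sup>2 \<le> V x"
proof -
  have "0 \<le> (norm ((m / 2) *\<^sub>R x + f 0))\<^sup>2 / m" using m_pos by simp
  also have "(norm ((m / 2) *\<^sub>R x + f 0))\<^sup>2 = (m / 2)\<^sup>2 * (norm x)\<^sup>2 + m * (f 0 \<bullet> x) + (norm (f 0))\<^sup>2"
    unfolding power2_norm_eq_inner
    by (simp add: inner_add_left inner_add_right inner_commute power2_eq_square)
  also have "\<dots> / m = m / 4 * (norm x)\<^sup>2 + f 0 \<bullet> x + (norm (f 0))\<^sup>2 / m"
    using m_pos by (simp add: field_simps power2_eq_square)
  finally show ?thesis using lower[of 0 x] by simp
qed

text \<open>Half of the quadratic exponent dominates the polynomial factor; the other half is a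
  Gaussian integral.\<close>

lemma second_moment_finite:
  "(\<integral>\<^sup>+ x. ennreal ((1 + (norm x)\<^sup>2) * exp (- V x)) \<partial>lborel) < \<infinity>"
proof -
  define K where "K = (1 + 8 / m) * exp (- (V 0 - (norm (f 0))\<^sup>2 / m))"
  have "(1 + (norm x)\<^sup>2) * exp (- V x) \<le> K * exp (- (m / 8) * (norm x)\<^sup>2)" for x
  proof -
    let ?u = "m / 8 * (norm x)\<^sup>2"
    have u0: "0 \<le> ?u" using m_pos by simp
    have "(norm x)\<^sup>2 = 8 / m * ?u" using m_pos by simp
    also have "\<dots> \<le> 8 / m * exp ?u"
    proof (rule mult_left_mono)
      show "?u \<le> exp ?u" using exp_ge_add_one_self[of ?u] by linarith
    qed (use m_pos in simp)
    finally have "1 + (norm x)\<^sup>2 \<le> 1 * exp ?u + 8 / m * exp ?u" using u0 by (intro add_mono) auto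
    then have 1: "1 + (norm x)\<^sup>2 \<le> (1 + 8 / m) * exp ?u" by (simp only: distrib_right)
    have "exp (- V x) \<le> exp (- (V 0 - (norm (f 0))\<^sup>2 / m) + - (2 * ?u))"
      using V_lower_quadratic[of x] by simp
    then have 2: "exp (- V x) \<le> exp (- (V 0 - (norm (f 0))\<^sup>2 / m)) * exp (- (2 * ?u))" by (simp only: exp_add)
    have "(1 + (norm x)\<^sup>2) * exp (- V x) \<le> ((1 + 8 / m) * exp ?u) * (exp (- (V 0 - (norm (f 0))\<^sup>2 / m)) * exp (- (2 * ?u)))"
      using 1 2 m_pos by (intro mult_mono) (auto intro!: mult_nonneg_nonneg add_nonneg_nonneg)
    also have "\<dots> = K * (exp ?u * exp (- (2 * ?u)))" by (simp add: K_def mult_ac)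
    also have "exp ?u * exp (- (2 * ?u)) = exp (- (m / 8) * (norm x)\<^sup>2)" by (simp add: mult_exp_exp)
    finally show ?thesis .
  qed
  then have "(\<integral>\<^sup>+ x. ennreal ((1 + (norm x)\<^sup>2) * exp (- V x)) \<partial>lborel)
      \<le> (\<integral>\<^sup>+ x. ennreal K * ennreal (exp (- (m / 8) * (norm x)\<^sup>2)) \<partial>(lborel :: 'a measure))"
    using m_pos by (intro nn_integral_mono) (simp add: ennreal_mult[symmetric] K_def)
  also have "\<dots> = ennreal K * (\<integral>\<^sup>+ x. ennreal (exp (- (m / 8) * (norm x)\<^sup>2)) \<partial>(lborel :: 'a measure))"
    by (rule nn_integral_cmult) simp
  also have "\<dots> < \<infinity>" using nn_integral_exp_neg_sq_finite[of "m / 8", where 'a='a] m_pos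
    by (simp add: ennreal_mult_less_top)
  finally show ?thesis .
qed

lemma partition_fn: "0 < partition_fn" "partition_fn < \<infinity>"
proof -
  have "partition_fn \<le> (\<integral>\<^sup>+ x. ennreal ((1 + (norm x)\<^sup>2) * exp (- V x)) \<partial>lborel)"
    unfolding partition_fn_def by (intro nn_integral_mono ennreal_leI) (simp add: distrib_right)
  then show "partition_fn < \<infinity>" using second_moment_finite by (rule le_less_trans)
  have "partition_fn \<noteq> 0"
  proof
    assume "partition_fn = 0"
    then have "AE x in lborel. ennreal (exp (- V x)) = 0"
      unfolding partition_fn_def by (subst (asm) nn_integral_0_iff_AE) auto
    then have "AE x in (lborel :: 'a measure). False" by simp
    then have "emeasure (lborel :: 'a measure) UNIV = 0"
      using AE_iff_measurable[of UNIV "lborel :: 'a measure" "\<lambda>_. False"] by simp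
    then show False by (simp add: emeasure_lborel_UNIV)
  qed
  then show "0 < partition_fn" by (simp add: zero_less_iff_neq_zero)
qed

lemma prob_space_gibbs: "prob_space (gibbs V)"
proof
  have "emeasure (gibbs V) (space (gibbs V)) = (\<integral>\<^sup>+ x. ennreal (exp (- V x)) / partition_fn \<partial>lborel)"
    unfolding gibbs_def partition_fn_def[symmetric] by (simp add: emeasure_density)
  also have "\<dots> = partition_fn / partition_fn"
    unfolding partition_fn_def by (rule nn_integral_divide) simp
  finally show "emeasure (gibbs V) (space (gibbs V)) = 1" using partition_fn by simp
qed

lemma sets_gibbs [simp, measurable_cong]: "sets (gibbs V) = sets borel"
  by (simp add: gibbs_def)

lemma gibbs_second_moment: "(\<integral>\<^sup>+ x. ennreal ((norm x)\<^sup>2) \<partial>gibbs V) < \<infinity>"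
proof -
  have "(\<integral>\<^sup>+ x. ennreal ((norm x)\<^sup>2) \<partial>gibbs V)
    = (\<integral>\<^sup>+ x. ennreal (exp (- V x)) / partition_fn * ennreal ((norm x)\<^sup>2) \<partial>lborel)"
    unfolding gibbs_def partition_fn_def[symmetric] by (rule nn_integral_density) auto
  also have "\<dots> = (\<integral>\<^sup>+ x. ennreal ((norm x)\<^sup>2 * exp (- V x)) / partition_fn \<partial>lborel)"
    by (intro nn_integral_cong) (simp add: divide_ennreal_def ennreal_mult mult_ac)
  also have "\<dots> = (\<integral>\<^sup>+ x. ennreal ((norm x)\<^sup>2 * exp (- V x)) \<partial>lborel) / partition_fn"
    by (rule nn_integral_divide) simp
  also have "\<dots> \<le> (\<integral>\<^sup>+ x. ennreal ((1 + (norm x)\<^sup>2) * exp (- V x)) \<partial>lborel) / partition_fn"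
    by (intro divide_right_mono_ennreal nn_integral_mono ennreal_leI mult_right_mono) auto
  also have "\<dots> < \<infinity>" using second_moment_finite partition_fn
    by (simp add: ennreal_divide_eq_top_iff less_top[symmetric] zero_less_iff_neq_zero)
  finally show ?thesis .
qed

end

section \<open>Product structure of the target and moments of velocity and force\<close>

locale gaussian_target = convex_potential V f m L
  for V :: "real ^ 'd \<Rightarrow> real" and f m L
begin

lemma target_eq_pair: "target V = gibbs V \<Otimes>\<^sub>M std_gaussian"
proof -
  obtain z where z: "partition_fn = ennreal z" "0 < z"
    using partition_fn by (cases partition_fn) (auto simp: ennreal_zero_less_top less_le)
  define c where "c = sqrt ((2 * pi) ^ CARD('d))"
  have c: "0 < c" by (simp add: c_def)
  have g: "exp (- ((norm v)\<^sup>2 / 2)) = c * gauss_pdf v" for v :: "real ^ 'd"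
    using c by (simp add: gauss_pdf_def c_def)
  have h: "exp (- (V x + (norm v)\<^sup>2 / 2)) = exp (- V x) * (c * gauss_pdf v)" for x and v :: "real ^ 'd"
    by (simp only: minus_add_distrib exp_add g)
  have ex: "ennreal (exp (- (V x + (norm v)\<^sup>2 / 2))) = ennreal (exp (- V x)) * (ennreal c * ennreal (gauss_pdf v))"
    for x and v :: "real ^ 'd"
    using c unfolding h by (simp add: ennreal_mult)
  have Z: "(\<integral>\<^sup>+ z'. ennreal (exp (- (case z' of (x, v) \<Rightarrow> V x + (norm v)\<^sup>2 / 2)))
      \<partial>(lborel :: ((real^'d) \<times> (real^'d)) measure)) = ennreal (z * c)"
  proof -
    have "(\<integral>\<^sup>+ z'. ennreal (exp (- (case z' of (x, v) \<Rightarrow> V x + (norm v)\<^sup>2 / 2))) \<partial>(lborel :: ((real^'d) \<times> (real^'d)) measure))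
      = (\<integral>\<^sup>+ x. \<integral>\<^sup>+ v. ennreal (exp (- V x)) * (ennreal c * ennreal (gauss_pdf v)) \<partial>(lborel :: (real^'d) measure) \<partial>lborel)"
      unfolding lborel_prod[symmetric]
      by (subst lborel.nn_integral_fst[symmetric], simp add: case_prod_beta', simp only: prod.case ex)
    also have "\<dots> = (\<integral>\<^sup>+ x. ennreal (exp (- V x)) * ennreal c \<partial>lborel)"
    proof (rule nn_integral_cong)
      fix x
      have "(\<integral>\<^sup>+ v. ennreal (gauss_pdf v) \<partial>(lborel :: (real^'d) measure)) = 1"
        using std_gauss.emeasure_space_1[where 'd='d] unfolding std_gaussian_eq by (simp add: emeasure_density)
      then show "(\<integral>\<^sup>+ v. ennreal (exp (- V x)) * (ennreal c * ennreal (gauss_pdf v)) \<partial>(lborel :: (real^'d) measure))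
        = ennreal (exp (- V x)) * ennreal c"
        by (simp add: nn_integral_cmult)
    qed
    also have "\<dots> = partition_fn * ennreal c" by (simp add: nn_integral_multc partition_fn_def)
    finally show ?thesis using z c by (simp add: ennreal_mult)
  qed
  have s: "sigma_finite_measure (density lborel (\<lambda>v. ennreal (gauss_pdf (v :: real ^ 'd))))"
    unfolding std_gaussian_eq[symmetric] by (rule prob_space_imp_sigma_finite[OF prob_space_std_gaussian])
  have "gibbs V \<Otimes>\<^sub>M (std_gaussian :: (real ^ 'd) measure)
    = density (lborel \<Otimes>\<^sub>M lborel) (\<lambda>(x, v). (ennreal (exp (- V x)) / partition_fn) * ennreal (gauss_pdf (v :: real ^ 'd)))"
    unfolding gibbs_def std_gaussian_eq partition_fn_def[symmetric]
    by (rule pair_measure_density) (use s sigma_finite_lborel in auto)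
  also have "\<dots> = density lborel (\<lambda>z'. ennreal (exp (- (case z' of (x, v) \<Rightarrow> V x + (norm v)\<^sup>2 / 2))) / ennreal (z * c))"
    unfolding lborel_prod
  proof (rule density_cong)
    show "(\<lambda>(x, v). ennreal (exp (- V x)) / partition_fn * ennreal (gauss_pdf (v :: real ^ 'd))) \<in> borel_measurable lborel"
      by (simp add: lborel_prod[symmetric] case_prod_beta')
    show "(\<lambda>z'. ennreal (exp (- (case z' of (x, v) \<Rightarrow> V x + (norm (v :: real ^ 'd))\<^sup>2 / 2))) / ennreal (z * c)) \<in> borel_measurable lborel"
      by (simp add: lborel_prod[symmetric] case_prod_beta')
    show "AE z' in lborel. (case z' of (x, v) \<Rightarrow> ennreal (exp (- V x)) / partition_fn * ennreal (gauss_pdf (v :: real ^ 'd)))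
      = ennreal (exp (- (case z' of (x, v) \<Rightarrow> V x + (norm v)\<^sup>2 / 2))) / ennreal (z * c)"
    proof (rule AE_I2, clarify)
      fix x and v :: "real ^ 'd"
      have "exp (- V x) / z * gauss_pdf v = exp (- (V x + (norm v)\<^sup>2 / 2)) / (z * c)"
        using z c unfolding h by simp
      then show "ennreal (exp (- V x)) / partition_fn * ennreal (gauss_pdf v) = ennreal (exp (- (V x + (norm v)\<^sup>2 / 2))) / ennreal (z * c)"
        using z c by (simp add: divide_ennreal ennreal_mult[symmetric])
    qed
  qed
  also have "\<dots> = target V" unfolding target_def gibbs_def Z ..
  finally show ?thesis ..
qed

sublocale \<pi>: prob_space "gibbs V" by (rule prob_space_gibbs)

sublocale pair_prob_space "gibbs V" "std_gaussian :: (real ^ 'd) measure" ..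

lemma prob_space_target: "prob_space (target V)"
  unfolding target_eq_pair by unfold_locales

lemma sets_target [simp, measurable_cong]: "sets (target V) = sets borel"
  by (simp add: target_def gibbs_def)

lemma target_marginal_eq: "target_marginal V = gibbs V"
proof -
  have "target_marginal V = distr (gibbs V \<Otimes>\<^sub>M (std_gaussian :: (real ^ 'd) measure)) (gibbs V) fst"
    unfolding target_marginal_def target_eq_pair by (rule distr_cong) auto
  also have "\<dots> = gibbs V" by (rule std_gauss.distr_pair_fst)
  finally show ?thesis .
qed

lemma nn_integral_target:
  assumes "F \<in> borel_measurable borel"
  shows "(\<integral>\<^sup>+ z. F z \<partial>target V) = (\<integral>\<^sup>+ x. \<integral>\<^sup>+ v. F (x, v) \<partial>std_gaussian \<partial>gibbs V)"
proof -
  have s: "sets (gibbs V \<Otimes>\<^sub>M (std_gaussian :: (real ^ 'd) measure)) = sets borel"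
    by (metis borel_prod sets_gibbs sets_std_gaussian sets_pair_measure_cong)
  have "F \<in> borel_measurable (gibbs V \<Otimes>\<^sub>M (std_gaussian :: (real ^ 'd) measure))"
    using assms by (simp only: measurable_cong_sets[OF s refl])
  then show ?thesis unfolding target_eq_pair by (rule std_gauss.nn_integral_fst[symmetric])
qed

lemma target_P2: "target V \<in> P2"
proof -
  have "(\<integral>\<^sup>+ z. ennreal ((norm z)\<^sup>2) \<partial>target V)
    = (\<integral>\<^sup>+ x. \<integral>\<^sup>+ v. ennreal ((norm x)\<^sup>2) + ennreal ((norm v)\<^sup>2) \<partial>(std_gaussian :: (real ^ 'd) measure) \<partial>gibbs V)"
    by (subst nn_integral_target) (auto simp: norm_Pair)
  also have "\<dots> = (\<integral>\<^sup>+ x. ennreal ((norm x)\<^sup>2) \<partial>gibbs V) + ennreal (CARD('d))"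
    by (simp add: nn_integral_add nn_integral_std_gaussian_norm_sq std_gauss.emeasure_space_1[simplified] \<pi>.emeasure_space_1)
  also have "\<dots> < \<infinity>" using gibbs_second_moment by simp
  finally show ?thesis by (simp add: P2_def prob_space_target)
qed

lemma lp2_velocity: "lp_norm 2 (target V) (\<lambda>z. ennreal (norm (snd z))) = ennreal (sqrt (CARD('d)))"
proof -
  have "lp_norm 2 (target V) (\<lambda>z. ennreal (norm (snd z))) ^ 2 = (\<integral>\<^sup>+ z. ennreal ((norm (snd z))\<^sup>2) \<partial>target V)"
    by (simp add: lp_norm_power ennreal_power)
  also have "\<dots> = (\<integral>\<^sup>+ x. \<integral>\<^sup>+ v. ennreal ((norm v)\<^sup>2) \<partial>(std_gaussian :: (real ^ 'd) measure) \<partial>gibbs V)"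
    by (subst nn_integral_target) simp_all
  also have "\<dots> = ennreal (sqrt (CARD('d))) ^ 2"
    by (simp add: nn_integral_std_gaussian_norm_sq \<pi>.emeasure_space_1 ennreal_power)
  finally have "ennreal_root 2 (lp_norm 2 (target V) (\<lambda>z. ennreal (norm (snd z))) ^ 2) = ennreal_root 2 (ennreal (sqrt (CARD('d))) ^ 2)"
    by (rule arg_cong)
  then show ?thesis by (simp only: ennreal_root_power_cancel[OF zero_less_numeral])
qed

text \<open>The flow over the time \<open>1 / (2 \<surd>L)\<close> turns the known law of the velocity into a bound on the
  force; this replaces an integration by parts.\<close>

lemma lp2_gradient:
  "lp_norm 2 (target V) (\<lambda>z. ennreal (norm (f (fst z)))) \<le> ennreal (5 * sqrt L * sqrt (CARD('d)))"
proof -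
  define T where "T = 1 / (2 * sqrt L)"
  have T: "0 < T" "L * T\<^sup>2 = 1 / 4" "1 / T = 2 * sqrt L" using L_pos by (auto simp: T_def power_divide power_mult_distrib)
  have [measurable]: "flow T \<in> borel_measurable borel" using T by simp
  have pt: "norm (f x) \<le> sqrt L * (7 / 3 * norm (snd (flow T (x, v))) + 8 / 3 * norm v)" for x v
  proof -
    \<comment> \<open>Since \<open>L * T\<^sup>2 / 2 = 1 / 8\<close>, the factor 8/7 satisfies the
      speed condition of \<open>flow_bounds\<close> with equality.\<close>
    define W where "W = 8 / 7 * (norm v + T * norm (f x))"
    have W: "norm v + T * norm (f x) + L * T\<^sup>2 / 2 * W \<le> W" unfolding T(2) by (simp add: W_def)
    have W0: "0 \<le> W" using T by (simp add: W_def)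
    let ?Y = "snd (flow T (x, v))"
    have "T * norm (f x) = norm (T *\<^sub>R f x)" using T(1) by simp
    also have "T *\<^sub>R f x = (?Y - v + T *\<^sub>R f x) - (?Y - v)" by simp
    also have "norm \<dots> \<le> norm (?Y - v + T *\<^sub>R f x) + norm (?Y - v)" by (rule norm_triangle_ineq4)
    also have "\<dots> \<le> norm (?Y - v + T *\<^sub>R f x) + (norm ?Y + norm v)" by (intro add_left_mono norm_triangle_ineq4)
    finally have "T * norm (f x) \<le> norm (?Y - v + T *\<^sub>R f x) + norm ?Y + norm v" by simp
    moreover have "norm (?Y - v + T *\<^sub>R f x) \<le> 1 / 8 * W"
      using flow_bounds(1)[OF less_imp_le[OF T(1)] W W0] unfolding T(2) by simp
    moreover have "1 / 8 * W = 1 / 7 * norm v + 1 / 7 * (T * norm (f x))" by (simp add: W_def algebra_simps)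
    ultimately have "T * norm (f x) \<le> 7 / 6 * norm ?Y + 4 / 3 * norm v" by linarith
    then have "1 / T * (T * norm (f x)) \<le> 1 / T * (7 / 6 * norm ?Y + 4 / 3 * norm v)" using T(1) by (intro mult_left_mono) auto
    then have "norm (f x) \<le> 1 / T * (7 / 6 * norm ?Y + 4 / 3 * norm v)" using T(1) by simp
    then show ?thesis unfolding T(3) by (simp add: algebra_simps)
  qed
  let ?N = "lp_norm 2 (target V)"
  have "?N (\<lambda>z. ennreal (norm (f (fst z)))) \<le> ?N (\<lambda>z. ennreal (7 / 3 * sqrt L) * ennreal (norm (snd (flow T z))) + ennreal (8 / 3 * sqrt L) * ennreal (norm (snd z)))"
  proof (rule lp_norm_mono)
    fix z :: "(real ^ 'd) \<times> (real ^ 'd)"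
    have "norm (f (fst z)) \<le> 7 / 3 * sqrt L * norm (snd (flow T z)) + 8 / 3 * sqrt L * norm (snd z)"
      using pt[of "fst z" "snd z"] by (simp add: algebra_simps)
    then show "ennreal (norm (f (fst z))) \<le> ennreal (7 / 3 * sqrt L) * ennreal (norm (snd (flow T z))) + ennreal (8 / 3 * sqrt L) * ennreal (norm (snd z))"
      using L_pos by (simp add: ennreal_mult[symmetric] ennreal_plus[symmetric] ennreal_leI del: ennreal_plus)
  qed simp
  also have "\<dots> \<le> ?N (\<lambda>z. ennreal (7 / 3 * sqrt L) * ennreal (norm (snd (flow T z)))) + ?N (\<lambda>z. ennreal (8 / 3 * sqrt L) * ennreal (norm (snd z)))"
    by (rule lp_norm_add) (auto simp: measurable_cong_sets[OF sets_target refl])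
  also have "\<dots> = ennreal (7 / 3 * sqrt L) * ?N (\<lambda>z. ennreal (norm (snd (flow T z)))) + ennreal (8 / 3 * sqrt L) * ?N (\<lambda>z. ennreal (norm (snd z)))"
    by (subst (1 2) lp_norm_cmult) (auto simp: measurable_cong_sets[OF sets_target refl])
  also have "?N (\<lambda>z. ennreal (norm (snd (flow T z)))) = lp_norm 2 (distr (target V) borel (flow T)) (\<lambda>z. ennreal (norm (snd z)))"
    by (rule lp_norm_distr[symmetric]) (auto simp: measurable_cong_sets[OF sets_target refl])
  \<comment> \<open>By invariance the flowed velocity has the same mean square as the initial one,
    so the constants add up to 7/3 + 8/3 = 5.\<close>
  also have "distr (target V) borel (flow T) = target V"
    using T by (intro target_flow_invariant prob_space_target) auto
  also have "ennreal (7 / 3 * sqrt L) * ?N (\<lambda>z. ennreal (norm (snd z))) + ennreal (8 / 3 * sqrt L) * ?N (\<lambda>z. ennreal (norm (snd z)))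
    = ennreal (7 / 3 * sqrt L * sqrt (CARD('d)) + 8 / 3 * sqrt L * sqrt (CARD('d)))"
    using L_pos by (simp add: lp2_velocity ennreal_mult[symmetric] ennreal_plus[symmetric] del: ennreal_plus)
  also have "7 / 3 * sqrt L * sqrt (CARD('d)) + 8 / 3 * sqrt L * sqrt (CARD('d)) = 5 * sqrt L * sqrt (CARD('d))" by simp
  finally show ?thesis .
qed

end

section \<open>Gaussian increments of a UBU step\<close>

context ubu_params
begin

text \<open>Coefficients of the two Gaussians of a half step: \<open>e1\<close>, \<open>e2\<close>
  in the velocity and \<open>b1\<close>, \<open>b2\<close> in the position. The number
  \<open>r0\<close> is the coefficient with which the first summand \<open>Z1\<close> alone enters
  the position.\<close>

definition r0 :: real where "r0 = sqrt (h / \<gamma>)"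
definition e1 :: real where "e1 = sqrt (2 * \<gamma>) * (sqrt ((1 - \<eta>\<^sup>2) / (2 * \<gamma>)) * sqrt ratio)"
definition e2 :: real where "e2 = sqrt (2 * \<gamma>) * (sqrt ((1 - \<eta>\<^sup>2) / (2 * \<gamma>)) * sqrt (1 - ratio))"
definition b1 :: real where "b1 = r0 - e1 / \<gamma>"
definition b2 :: real where "b2 = - e2 / \<gamma>"

lemma e_sq: "e1\<^sup>2 = (1 - \<eta>\<^sup>2) * ratio" "e2\<^sup>2 = (1 - \<eta>\<^sup>2) * (1 - ratio)"
  using ratio_bounds \<eta>_bounds \<gamma> by (simp_all add: e1_def e2_def power_mult_distrib)

lemma e_sum: "e1\<^sup>2 + e2\<^sup>2 = 1 - \<eta>\<^sup>2"
  unfolding e_sq by (simp add: algebra_simps)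

lemma r0_sq: "r0\<^sup>2 = h / \<gamma>"
  using h \<gamma> by (simp add: r0_def)

text \<open>The correlation \<open>ratio\<close> is tuned to remove the square roots from this
  product. With it, \<open>r0_sq\<close> and \<open>e_sum\<close>, all variances and covariances of
  a step become polynomial in \<open>\<eta>\<close>, \<open>h\<close> and the inverse of
  \<open>\<gamma>\<close>.\<close>

lemma r0_e1: "r0 * e1 = 2 * (1 - \<eta>) / \<gamma>"
proof -
  have f: "1 - \<eta>\<^sup>2 = (1 - \<eta>) * (1 + \<eta>)" by (simp add: power2_eq_square algebra_simps)
  have "(r0 * e1)\<^sup>2 = (2 * (1 - \<eta>) / \<gamma>)\<^sup>2"
  proof -
    have k: "(1 - \<eta>) * (1 + \<eta>) * ((1 - \<eta>) / (1 + \<eta>) * (4 / (\<gamma> * h))) = (1 - \<eta>) * (1 - \<eta>) * (4 / (\<gamma> * h))"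
      using \<eta>_bounds by simp
    show ?thesis unfolding power_mult_distrib[of r0] r0_sq e_sq f ratio_def k using h \<gamma>
      by (simp add: field_simps power2_eq_square)
  qed
  moreover have "0 \<le> r0 * e1" using h \<gamma> \<eta>_bounds ratio_bounds by (simp add: r0_def e1_def)
  moreover have "0 \<le> 2 * (1 - \<eta>) / \<gamma>" using \<gamma> \<eta>_bounds by simp
  ultimately show ?thesis by (rule power2_eq_imp_eq)
qed

lemma ubu_U_eq:
  "ubu_U \<gamma> h (x, v) \<xi>1 \<xi>2 = (x + \<kappa> *\<^sub>R v + b1 *\<^sub>R \<xi>1 + b2 *\<^sub>R \<xi>2, \<eta> *\<^sub>R v + e1 *\<^sub>R \<xi>1 + e2 *\<^sub>R \<xi>2)"
proof -
  define \<zeta> where "\<zeta> = sqrt ((1 - \<eta>\<^sup>2) / (2 * \<gamma>))"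
  have s: "sqrt (2 / \<gamma>) = sqrt (2 * \<gamma>) / \<gamma>"
    using \<gamma> by (simp add: real_sqrt_divide real_sqrt_mult field_simps)
  have r0: "sqrt (2 / \<gamma>) * sqrt (h / 2) = r0"
    unfolding r0_def real_sqrt_mult[symmetric] by simp
  have b: "sqrt (2 / \<gamma>) * (\<zeta> * sqrt ratio) = e1 / \<gamma>" "sqrt (2 / \<gamma>) * (\<zeta> * sqrt (1 - ratio)) = e2 / \<gamma>"
    unfolding s by (simp_all add: e1_def e2_def \<zeta>_def)
  have "ubu_U \<gamma> h (x, v) \<xi>1 \<xi>2 =
     (x + \<kappa> *\<^sub>R v + sqrt (2 / \<gamma>) *\<^sub>R (sqrt (h / 2) *\<^sub>R \<xi>1 - \<zeta> *\<^sub>R (sqrt ratio *\<^sub>R \<xi>1 + sqrt (1 - ratio) *\<^sub>R \<xi>2)),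
      \<eta> *\<^sub>R v + sqrt (2 * \<gamma>) *\<^sub>R (\<zeta> *\<^sub>R (sqrt ratio *\<^sub>R \<xi>1 + sqrt (1 - ratio) *\<^sub>R \<xi>2)))"
    unfolding ubu_U_def \<eta>_def[symmetric] Let_def prod.case ratio_def[symmetric] \<kappa>_def[symmetric] \<zeta>_def[symmetric] ..
  also have "sqrt (2 / \<gamma>) *\<^sub>R (sqrt (h / 2) *\<^sub>R \<xi>1 - \<zeta> *\<^sub>R (sqrt ratio *\<^sub>R \<xi>1 + sqrt (1 - ratio) *\<^sub>R \<xi>2))
    = (sqrt (2 / \<gamma>) * sqrt (h / 2)) *\<^sub>R \<xi>1 - (sqrt (2 / \<gamma>) * (\<zeta> * sqrt ratio)) *\<^sub>R \<xi>1 - (sqrt (2 / \<gamma>) * (\<zeta> * sqrt (1 - ratio))) *\<^sub>R \<xi>2"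
    by (simp only: scaleR_diff_right scaleR_add_right scaleR_scaleR diff_diff_eq mult.assoc)
  also have "\<dots> = b1 *\<^sub>R \<xi>1 + b2 *\<^sub>R \<xi>2"
    unfolding r0 b by (simp add: b1_def b2_def scaleR_diff_left)
  also have "sqrt (2 * \<gamma>) *\<^sub>R (\<zeta> *\<^sub>R (sqrt ratio *\<^sub>R \<xi>1 + sqrt (1 - ratio) *\<^sub>R \<xi>2)) = e1 *\<^sub>R \<xi>1 + e2 *\<^sub>R \<xi>2"
    by (simp add: e1_def e2_def \<zeta>_def scaleR_add_right)
  finally show ?thesis by (simp only: add.assoc)
qed

text \<open>The final velocity of a step without force. It is linear in the initial velocity and the
  four Gaussians, and standard Gaussian when the initial velocity is.\<close>

definition final_gauss :: "'a::real_vector \<Rightarrow> 'a \<Rightarrow> 'a \<Rightarrow> 'a \<Rightarrow> 'a \<Rightarrow> 'a" where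
  "final_gauss v \<xi>1 \<xi>2 \<xi>3 \<xi>4 = \<eta>\<^sup>2 *\<^sub>R v + (\<eta> * e1) *\<^sub>R \<xi>1 + (\<eta> * e2) *\<^sub>R \<xi>2 + e1 *\<^sub>R \<xi>3 + e2 *\<^sub>R \<xi>4"

text \<open>The regression residual of the force-free position increment on the final velocity:
  \<open>c1\<close> times \<open>final_gauss\<close> is subtracted, which leaves a part uncorrelated
  with it.\<close>

definition residual_gauss :: "'a::real_vector \<Rightarrow> 'a \<Rightarrow> 'a \<Rightarrow> 'a \<Rightarrow> 'a \<Rightarrow> 'a" where
  "residual_gauss v \<xi>1 \<xi>2 \<xi>3 \<xi>4 = (c1 - c1 * \<eta>\<^sup>2) *\<^sub>R v + (b1 + \<kappa> * e1 - c1 * (\<eta> * e1)) *\<^sub>R \<xi>1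
    + (b2 + \<kappa> * e2 - c1 * (\<eta> * e2)) *\<^sub>R \<xi>2 + (b1 - c1 * e1) *\<^sub>R \<xi>3 + (b2 - c1 * e2) *\<^sub>R \<xi>4"

definition half_gauss :: "'a::real_vector \<Rightarrow> 'a \<Rightarrow> 'a \<Rightarrow> 'a" where
  "half_gauss v \<xi>1 \<xi>2 = \<kappa> *\<^sub>R v + b1 *\<^sub>R \<xi>1 + b2 *\<^sub>R \<xi>2"

lemma sg_ubu_step_eq:
  fixes x v \<xi>1 \<xi>2 :: "'a::euclidean_space"
  defines "y \<equiv> x + half_gauss v \<xi>1 \<xi>2"
  shows "sg_ubu_step \<gamma> h G (x, v) \<xi>1 \<xi>2 \<xi>3 \<xi>4 \<omega>
    = (x + c1 *\<^sub>R final_gauss v \<xi>1 \<xi>2 \<xi>3 \<xi>4 + residual_gauss v \<xi>1 \<xi>2 \<xi>3 \<xi>4 - (\<kappa> * h) *\<^sub>R G y \<omega>,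
       final_gauss v \<xi>1 \<xi>2 \<xi>3 \<xi>4 - (\<eta> * h) *\<^sub>R G y \<omega>)"
proof -
  have y: "x + \<kappa> *\<^sub>R v + b1 *\<^sub>R \<xi>1 + b2 *\<^sub>R \<xi>2 = y" by (simp add: y_def half_gauss_def add.assoc)
  have c: "c1 *\<^sub>R v = \<kappa> *\<^sub>R v + (\<kappa> * \<eta>) *\<^sub>R v" unfolding c1_eq by (simp add: distrib_left scaleR_add_left)
  show ?thesis
    unfolding sg_ubu_step_def ubu_U_eq Let_def prod.case y
    unfolding y_def half_gauss_def final_gauss_def residual_gauss_def
    by (simp add: algebra_simps power2_eq_square c)
qed

lemma sg_ubu_step_diff:
  fixes x v x' v' \<xi>1 \<xi>2 :: "'a::euclidean_space"
  defines "Y \<equiv> x + half_gauss v \<xi>1 \<xi>2" and "Y' \<equiv> x' + half_gauss v' \<xi>1 \<xi>2"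
    and "w \<equiv> \<eta> *\<^sub>R (v - v')"
  shows "Y - Y' = (x - x') + \<kappa> *\<^sub>R (v - v')"
    and "sg_ubu_step \<gamma> h G (x, v) \<xi>1 \<xi>2 \<xi>3 \<xi>4 \<omega> - sg_ubu_step \<gamma> h G (x', v') \<xi>1 \<xi>2 \<xi>3 \<xi>4 \<omega>
      = ((Y - Y') + \<kappa> *\<^sub>R (w - h *\<^sub>R (G Y \<omega> - G Y' \<omega>)), \<eta> *\<^sub>R (w - h *\<^sub>R (G Y \<omega> - G Y' \<omega>)))"
proof -
  show "Y - Y' = (x - x') + \<kappa> *\<^sub>R (v - v')"
    by (simp add: Y_def Y'_def half_gauss_def algebra_simps)
  have "x + \<kappa> *\<^sub>R v + b1 *\<^sub>R \<xi>1 + b2 *\<^sub>R \<xi>2 = Y" "x' + \<kappa> *\<^sub>R v' + b1 *\<^sub>R \<xi>1 + b2 *\<^sub>R \<xi>2 = Y'"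
    by (simp_all add: Y_def Y'_def half_gauss_def add.assoc)
  then show "sg_ubu_step \<gamma> h G (x, v) \<xi>1 \<xi>2 \<xi>3 \<xi>4 \<omega> - sg_ubu_step \<gamma> h G (x', v') \<xi>1 \<xi>2 \<xi>3 \<xi>4 \<omega>
      = ((Y - Y') + \<kappa> *\<^sub>R (w - h *\<^sub>R (G Y \<omega> - G Y' \<omega>)), \<eta> *\<^sub>R (w - h *\<^sub>R (G Y \<omega> - G Y' \<omega>)))"
    unfolding sg_ubu_step_def ubu_U_eq Let_def prod.case w_def
    by (simp add: algebra_simps)
qed

text \<open>In turn: the variance of the final velocity, its covariance with the residual, the
  variance of the residual, and the variance of the half-step position increment. With
  \<open>u\<close> the inverse of \<open>\<gamma>\<close>, these are polynomial identities modulo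
  the relations for \<open>e1\<close>, \<open>e2\<close> and \<open>r0\<close>.\<close>

lemma gauss_coefficient_sums:
  shows "(\<eta>\<^sup>2)\<^sup>2 + (\<eta> * e1)\<^sup>2 + (\<eta> * e2)\<^sup>2 + e1\<^sup>2 + e2\<^sup>2 = 1"
    and "\<eta>\<^sup>2 * (c1 - c1 * \<eta>\<^sup>2) + \<eta> * e1 * (b1 + \<kappa> * e1 - c1 * (\<eta> * e1)) + \<eta> * e2 * (b2 + \<kappa> * e2 - c1 * (\<eta> * e2))
      + e1 * (b1 - c1 * e1) + e2 * (b2 - c1 * e2) = 0"
    and "(c1 - c1 * \<eta>\<^sup>2)\<^sup>2 + (b1 + \<kappa> * e1 - c1 * (\<eta> * e1))\<^sup>2 + (b2 + \<kappa> * e2 - c1 * (\<eta> * e2))\<^sup>2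
      + (b1 - c1 * e1)\<^sup>2 + (b2 - c1 * e2)\<^sup>2 = h1\<^sup>2 - c1\<^sup>2"
    and "\<kappa>\<^sup>2 + b1\<^sup>2 + b2\<^sup>2 = 2 / \<gamma>\<^sup>2 * (t - 1 + \<eta>)"
proof -
  define u where "u = 1 / \<gamma>"
  have u: "\<gamma> * u = 1" using \<gamma> by (simp add: u_def)
  have k: "\<kappa> = (1 - \<eta>) * u" "c1 = (1 - \<eta> * \<eta>) * u" "b1 = r0 - u * e1" "b2 = - (u * e2)"
    by (simp_all add: \<kappa>_def c1_def b1_def b2_def u_def power2_eq_square)
  have e: "e1 * e1 + e2 * e2 = 1 - \<eta> * \<eta>" using e_sum by (simp add: power2_eq_square)
  have r: "r0 * r0 = h * u" "r0 * e1 = 2 * (1 - \<eta>) * u"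
    using r0_sq r0_e1 by (simp_all add: u_def power2_eq_square)
  have h1: "h1 * h1 = 2 * h * u - 2 * (u * u) + 2 * (u * u) * (\<eta> * \<eta>)"
  proof -
    have "h1\<^sup>2 = 2 * (u * u) * (\<gamma> * h - 1 + \<eta>\<^sup>2)" unfolding h1_sq u_def by (simp add: power2_eq_square)
    also have "\<dots> = 2 * (u * (\<gamma> * u) * h) - 2 * (u * u) + 2 * (u * u) * (\<eta> * \<eta>)"
      by (simp add: algebra_simps power2_eq_square)
    finally show ?thesis unfolding u by (simp add: power2_eq_square mult_ac)
  qed
  show "(\<eta>\<^sup>2)\<^sup>2 + (\<eta> * e1)\<^sup>2 + (\<eta> * e2)\<^sup>2 + e1\<^sup>2 + e2\<^sup>2 = 1"
    unfolding power2_eq_square using e by algebra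
  show "\<eta>\<^sup>2 * (c1 - c1 * \<eta>\<^sup>2) + \<eta> * e1 * (b1 + \<kappa> * e1 - c1 * (\<eta> * e1)) + \<eta> * e2 * (b2 + \<kappa> * e2 - c1 * (\<eta> * e2))
      + e1 * (b1 - c1 * e1) + e2 * (b2 - c1 * e2) = 0"
    unfolding power2_eq_square k using e r by algebra
  show "(c1 - c1 * \<eta>\<^sup>2)\<^sup>2 + (b1 + \<kappa> * e1 - c1 * (\<eta> * e1))\<^sup>2 + (b2 + \<kappa> * e2 - c1 * (\<eta> * e2))\<^sup>2
      + (b1 - c1 * e1)\<^sup>2 + (b2 - c1 * e2)\<^sup>2 = h1\<^sup>2 - c1\<^sup>2"
    unfolding power2_eq_square k h1 using e r by algebra
  have "2 / \<gamma>\<^sup>2 * (t - 1 + \<eta>) = 2 * (u * u) * (\<gamma> * h / 2 - 1 + \<eta>)" by (simp add: u_def power2_eq_square)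
  also have "\<dots> = u * (\<gamma> * u) * h - 2 * (u * u) * (1 - \<eta>)" by (simp add: algebra_simps)
  also have "\<dots> = u * h - 2 * (u * u) * (1 - \<eta>)" unfolding u by simp
  finally have t: "2 / \<gamma>\<^sup>2 * (t - 1 + \<eta>) = u * h - 2 * (u * u) * (1 - \<eta>)" .
  show "\<kappa>\<^sup>2 + b1\<^sup>2 + b2\<^sup>2 = 2 / \<gamma>\<^sup>2 * (t - 1 + \<eta>)"
    unfolding t unfolding power2_eq_square k using e r by algebra
qed

definition sR :: real where "sR = sqrt (h1\<^sup>2 - c1\<^sup>2)"

lemma sR: "0 < sR" "sR\<^sup>2 = h1\<^sup>2 - c1\<^sup>2" "(c1 / h1)\<^sup>2 + (sR / h1)\<^sup>2 = 1"
proof -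
  have "c1\<^sup>2 < h1\<^sup>2" using h1_bounds c1_bounds by (intro power_strict_mono) auto
  then show "0 < sR" "sR\<^sup>2 = h1\<^sup>2 - c1\<^sup>2" by (auto simp: sR_def)
  then show "(c1 / h1)\<^sup>2 + (sR / h1)\<^sup>2 = 1" using h1_bounds c1_bounds
    by (simp add: power_divide add_divide_distrib[symmetric])
qed

text \<open>Uncorrelated Gaussian combinations are independent: the Cholesky entries are
  \<open>p = 1\<close>, \<open>q = 0\<close> and \<open>r = sR\<close>.\<close>

lemma nn_integral_step_gaussians:
  fixes F :: "real ^ 'd \<Rightarrow> real ^ 'd \<Rightarrow> ennreal"
  assumes F: "case_prod F \<in> borel_measurable (borel \<Otimes>\<^sub>M borel)"
  shows "(\<integral>\<^sup>+ v. \<integral>\<^sup>+ \<xi>1. \<integral>\<^sup>+ \<xi>2. \<integral>\<^sup>+ \<xi>3. \<integral>\<^sup>+ \<xi>4. F (final_gauss v \<xi>1 \<xi>2 \<xi>3 \<xi>4) (residual_gauss v \<xi>1 \<xi>2 \<xi>3 \<xi>4)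
      \<partial>std_gaussian \<partial>std_gaussian \<partial>std_gaussian \<partial>std_gaussian \<partial>std_gaussian)
    = (\<integral>\<^sup>+ u. \<integral>\<^sup>+ v. F u (sR *\<^sub>R v) \<partial>std_gaussian \<partial>std_gaussian)"
proof -
  define l where "l = [(\<eta>\<^sup>2, c1 - c1 * \<eta>\<^sup>2), (\<eta> * e1, b1 + \<kappa> * e1 - c1 * (\<eta> * e1)),
    (\<eta> * e2, b2 + \<kappa> * e2 - c1 * (\<eta> * e2)), (e1, b1 - c1 * e1), (e2, b2 - c1 * e2)]"
  have s: "(\<Sum>(a, b)\<leftarrow>l. a\<^sup>2) = 1" "(\<Sum>(a, b)\<leftarrow>l. a * b) = 0" "(\<Sum>(a, b)\<leftarrow>l. b\<^sup>2) = h1\<^sup>2 - c1\<^sup>2"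
    using gauss_coefficient_sums(1,2,3) by (simp_all add: l_def add.assoc del: power2_eq_square)
  show ?thesis
  proof (rule gaussian_pair_integral_eq[of l, where ?'d='d])
    fix p q r
    assume pqr: "0 \<le> p" "0 \<le> r" "p\<^sup>2 = (\<Sum>(a, b)\<leftarrow>l. a\<^sup>2)" "p * q = (\<Sum>(a, b)\<leftarrow>l. a * b)"
      "q\<^sup>2 + r\<^sup>2 = (\<Sum>(a, b)\<leftarrow>l. b\<^sup>2)"
      and I: "\<And>(F :: real ^ 'd \<Rightarrow> real ^ 'd \<Rightarrow> ennreal) y z. case_prod F \<in> borel_measurable (borel \<Otimes>\<^sub>M borel) \<Longrightarrow>
      gaussian_pair_integral l F y z
      = (\<integral>\<^sup>+ u. \<integral>\<^sup>+ v. F (y + p *\<^sub>R u) (z + (q *\<^sub>R u + r *\<^sub>R v)) \<partial>std_gaussian \<partial>std_gaussian)"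
    have p: "p = 1" using pqr(1,3) unfolding s by (simp add: power2_eq_1_iff)
    have q: "q = 0" using pqr(4) p unfolding s by simp
    have r: "r = sR" using pqr(2,5) unfolding s q sR_def by (simp add: real_sqrt_unique)
    show ?thesis
      using I[OF F, of 0 0] unfolding l_def p q r
      by (simp only: gaussian_pair_integral.simps final_gauss_def residual_gauss_def add_0 scaleR_one scaleR_zero_left)
  qed
qed

lemma nn_integral_half_gauss:
  "(\<integral>\<^sup>+ v. \<integral>\<^sup>+ \<xi>1. \<integral>\<^sup>+ \<xi>2. ennreal ((norm (half_gauss v \<xi>1 \<xi>2 :: real ^ 'd))\<^sup>2) \<partial>std_gaussian \<partial>std_gaussian \<partial>std_gaussian)
    \<le> ennreal ((h / 2)\<^sup>2 * CARD('d))"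
proof -
  define l where "l = [(\<kappa>, 0 :: real), (b1, 0), (b2, 0)]"
  have s: "(\<Sum>(a, b)\<leftarrow>l. a\<^sup>2) = 2 / \<gamma>\<^sup>2 * (t - 1 + \<eta>)"
    using gauss_coefficient_sums(4) by (simp only: l_def list.map prod.case sum_list.Cons sum_list.Nil add.assoc add_0_right)
  let ?F = "\<lambda>a b :: real ^ 'd. ennreal ((norm a)\<^sup>2)"
  show ?thesis
  proof (rule gaussian_pair_integral_eq[of l, where ?'d='d])
    fix p q r
    assume p: "p\<^sup>2 = (\<Sum>(a, b)\<leftarrow>l. a\<^sup>2)"
      and I: "\<And>(F :: real ^ 'd \<Rightarrow> real ^ 'd \<Rightarrow> ennreal) y z. case_prod F \<in> borel_measurable (borel \<Otimes>\<^sub>M borel) \<Longrightarrow>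
      gaussian_pair_integral l F y z
      = (\<integral>\<^sup>+ u. \<integral>\<^sup>+ v. F (y + p *\<^sub>R u) (z + (q *\<^sub>R u + r *\<^sub>R v)) \<partial>std_gaussian \<partial>std_gaussian)"
    have "(\<integral>\<^sup>+ v. \<integral>\<^sup>+ \<xi>1. \<integral>\<^sup>+ \<xi>2. ennreal ((norm (half_gauss v \<xi>1 \<xi>2 :: real ^ 'd))\<^sup>2) \<partial>std_gaussian \<partial>std_gaussian \<partial>std_gaussian)
      = gaussian_pair_integral l ?F 0 0"
      by (simp only: l_def gaussian_pair_integral.simps half_gauss_def add_0)
    also have "\<dots> = (\<integral>\<^sup>+ u. \<integral>\<^sup>+ v. ennreal ((norm (p *\<^sub>R u))\<^sup>2) \<partial>(std_gaussian :: (real ^ 'd) measure) \<partial>(std_gaussian :: (real ^ 'd) measure))"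
      by (subst I) simp_all
    also have "\<dots> = (\<integral>\<^sup>+ u. ennreal (p\<^sup>2) * ennreal ((norm u)\<^sup>2) \<partial>(std_gaussian :: (real ^ 'd) measure))"
      by (simp add: std_gauss.emeasure_space_1[simplified] power_mult_distrib ennreal_mult)
    also have "\<dots> = ennreal (p\<^sup>2) * ennreal (CARD('d))"
      by (simp add: nn_integral_cmult nn_integral_std_gaussian_norm_sq)
    also have "\<dots> = ennreal (p\<^sup>2 * CARD('d))" by (simp add: ennreal_mult)
    also have "\<dots> \<le> ennreal ((h / 2)\<^sup>2 * CARD('d))"
      using half_variance unfolding p s by (intro ennreal_leI mult_right_mono) (auto simp: power_divide)
    finally show ?thesis .
  qed
qed

text \<open>The rotation with cosine \<open>\<rho>\<close> and sine \<open>\<sigma>\<close> takes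
  \<open>u\<close> and \<open>v\<close> to the normalised position increment \<open>a\<close>, from
  which the flow starts, and an independent \<open>b\<close>; its inverse recovers
  \<open>u\<close>.\<close>

lemma nn_integral_resample:
  fixes F :: "real ^ 'd \<Rightarrow> real ^ 'd \<Rightarrow> ennreal"
  assumes F: "case_prod F \<in> borel_measurable (borel \<Otimes>\<^sub>M borel)"
  defines "\<rho> \<equiv> c1 / h1" and "\<sigma> \<equiv> sR / h1"
  shows "(\<integral>\<^sup>+ u. \<integral>\<^sup>+ v. F u ((1 / h1) *\<^sub>R (c1 *\<^sub>R u + sR *\<^sub>R v)) \<partial>std_gaussian \<partial>std_gaussian)
    = (\<integral>\<^sup>+ a. \<integral>\<^sup>+ b. F (\<rho> *\<^sub>R a - \<sigma> *\<^sub>R b) a \<partial>std_gaussian \<partial>std_gaussian)"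
proof -
  have [measurable]: "(\<lambda>z. F (f z) (g z)) \<in> borel_measurable M"
    if [measurable]: "f \<in> borel_measurable M" "g \<in> borel_measurable M" for f g and M :: "'b measure"
    using measurable_compose[OF measurable_Pair[OF that] F] by simp
  have cs: "\<rho>\<^sup>2 + \<sigma>\<^sup>2 = 1" and s0: "\<sigma> \<noteq> 0" using sR h1_bounds c1_bounds by (auto simp: \<rho>_def \<sigma>_def)
  have "(\<integral>\<^sup>+ a. \<integral>\<^sup>+ b. F (\<rho> *\<^sub>R a - \<sigma> *\<^sub>R b) a \<partial>std_gaussian \<partial>std_gaussian)
    = (\<integral>\<^sup>+ u. \<integral>\<^sup>+ v. F (\<rho> *\<^sub>R (\<rho> *\<^sub>R u + \<sigma> *\<^sub>R v) - \<sigma> *\<^sub>R (\<rho> *\<^sub>R v - \<sigma> *\<^sub>R u)) (\<rho> *\<^sub>R u + \<sigma> *\<^sub>R v) \<partial>std_gaussian \<partial>std_gaussian)"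
    by (rule nn_integral_std_gaussian_rotation[symmetric, of "\<lambda>a b. F (\<rho> *\<^sub>R a - \<sigma> *\<^sub>R b) a", OF _ cs]) (use s0 in auto)
  also have "\<dots> = (\<integral>\<^sup>+ u. \<integral>\<^sup>+ v. F u ((1 / h1) *\<^sub>R (c1 *\<^sub>R u + sR *\<^sub>R v)) \<partial>std_gaussian \<partial>std_gaussian)"
  proof (intro nn_integral_cong arg_cong2[where f=F])
    fix u v :: "real ^ 'd"
    have "\<rho> *\<^sub>R (\<rho> *\<^sub>R u + \<sigma> *\<^sub>R v) - \<sigma> *\<^sub>R (\<rho> *\<^sub>R v - \<sigma> *\<^sub>R u) = (\<rho>\<^sup>2 + \<sigma>\<^sup>2) *\<^sub>R u"
      by (simp add: algebra_simps power2_eq_square)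
    then show "\<rho> *\<^sub>R (\<rho> *\<^sub>R u + \<sigma> *\<^sub>R v) - \<sigma> *\<^sub>R (\<rho> *\<^sub>R v - \<sigma> *\<^sub>R u) = u" unfolding cs by simp
    show "\<rho> *\<^sub>R u + \<sigma> *\<^sub>R v = (1 / h1) *\<^sub>R (c1 *\<^sub>R u + sR *\<^sub>R v)"
      by (simp add: \<rho>_def \<sigma>_def scaleR_add_right)
  qed
  finally show ?thesis ..
qed

end

section \<open>The SG-UBU chain\<close>

lemma nn_integral_pair:
  assumes "prob_space N" "F \<in> borel_measurable (M \<Otimes>\<^sub>M N)"
  shows "(\<integral>\<^sup>+ z. F z \<partial>(M \<Otimes>\<^sub>M N)) = (\<integral>\<^sup>+ x. \<integral>\<^sup>+ y. F (x, y) \<partial>N \<partial>M)"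
  by (rule sigma_finite_measure.nn_integral_fst[OF prob_space_imp_sigma_finite[OF assms(1)] assms(2), symmetric])

lemma nn_integral_PiM_component:
  fixes K :: "nat \<Rightarrow> 'a measure"
  assumes K: "\<And>i. prob_space (K i)" and [measurable]: "F \<in> borel_measurable (K i)"
  shows "(\<integral>\<^sup>+ Y. F (Y i) \<partial>(\<Pi>\<^sub>M i\<in>UNIV. K i)) = (\<integral>\<^sup>+ y. F y \<partial>K i)"
proof -
  have "(\<integral>\<^sup>+ y. F y \<partial>K i) = (\<integral>\<^sup>+ y. F y \<partial>distr (\<Pi>\<^sub>M i\<in>UNIV. K i) (K i) (\<lambda>\<omega>. \<omega> i))"
    by (subst distr_PiM_component) (auto simp: K)
  then show ?thesis by (subst (asm) nn_integral_distr) auto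
qed

locale sg_ubu = pot: gaussian_target V "gradient V" m L + ubu_contraction \<gamma> h m L
  for V :: "real ^ 'd \<Rightarrow> real" and m L \<gamma> h +
  fixes G :: "real ^ 'd \<Rightarrow> 'w::polish_space \<Rightarrow> real ^ 'd" and \<Gamma> :: "'w measure" and C :: real and p :: nat
  assumes C2: "C2_function V" and sg: "stochastic_gradient V G \<Gamma>"
    and C: "0 \<le> C" and jac: "bounded_jacobian_variance V G \<Gamma> C" and p: "p \<in> {1, 2}"
begin

lemma p_pos: "0 < p" using p by auto

sublocale \<Gamma>: prob_space \<Gamma> using sg by (simp add: stochastic_gradient_def)

lemma sets_\<Gamma> [simp, measurable_cong]: "sets \<Gamma> = sets borel" using sg by (simp add: stochastic_gradient_def)

lemma G_measurable [measurable]: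
  assumes [measurable]: "g \<in> borel_measurable M" "w \<in> measurable M \<Gamma>"
  shows "(\<lambda>z. G (g z) (w z)) \<in> borel_measurable M"
proof -
  have "(\<lambda>(x, \<omega>). G x \<omega>) \<in> borel_measurable (borel \<Otimes>\<^sub>M \<Gamma>)" using sg by (simp add: stochastic_gradient_def)
  from measurable_compose[OF measurable_Pair[OF assms] this] show ?thesis by simp
qed

lemma grad_measurable [measurable]: "gradient V \<in> borel_measurable borel"
  by (rule pot.f_measurable)

definition \<nu> :: "real ^ 'd \<Rightarrow> 'w \<Rightarrow> real ^ 'd" where
  "\<nu> x \<omega> = gradient V x - G x \<omega>"

lemma \<nu>_measurable [measurable]:
  assumes [measurable]: "g \<in> borel_measurable M" "w \<in> measurable M \<Gamma>"
  shows "(\<lambda>z. \<nu> (g z) (w z)) \<in> borel_measurable M"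
  unfolding \<nu>_def by measurable

abbreviation gauss :: "(real ^ 'd) measure" where "gauss \<equiv> std_gaussian"

definition noise :: "((real ^ 'd) \<times> (real ^ 'd) \<times> (real ^ 'd) \<times> (real ^ 'd) \<times> 'w) measure" where
  "noise = gauss \<Otimes>\<^sub>M gauss \<Otimes>\<^sub>M gauss \<Otimes>\<^sub>M gauss \<Otimes>\<^sub>M \<Gamma>"

lemma sets_noise [measurable_cong]: "sets noise = sets (borel \<Otimes>\<^sub>M borel \<Otimes>\<^sub>M borel \<Otimes>\<^sub>M borel \<Otimes>\<^sub>M \<Gamma>)"
  unfolding noise_def by (intro sets_pair_measure_cong) auto

lemma prob_space_noise: "prob_space noise"
  unfolding noise_def by (intro prob_space_pair prob_space_std_gaussian \<Gamma>.prob_space_axioms)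

lemma nn_integral_noise:
  assumes F: "F \<in> borel_measurable noise"
  shows "(\<integral>\<^sup>+ n. F n \<partial>noise) = (\<integral>\<^sup>+ \<xi>1. \<integral>\<^sup>+ \<xi>2. \<integral>\<^sup>+ \<xi>3. \<integral>\<^sup>+ \<xi>4. \<integral>\<^sup>+ \<omega>. F (\<xi>1, \<xi>2, \<xi>3, \<xi>4, \<omega>) \<partial>\<Gamma> \<partial>gauss \<partial>gauss \<partial>gauss \<partial>gauss)"
proof -
  note [measurable] = F[unfolded noise_def]
  have P: "prob_space (gauss \<Otimes>\<^sub>M \<Gamma>)" "prob_space (gauss \<Otimes>\<^sub>M gauss \<Otimes>\<^sub>M \<Gamma>)" "prob_space (gauss \<Otimes>\<^sub>M gauss \<Otimes>\<^sub>M gauss \<Otimes>\<^sub>M \<Gamma>)"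
    by (intro prob_space_pair prob_space_std_gaussian \<Gamma>.prob_space_axioms)+
  show ?thesis
    unfolding noise_def
    by (subst nn_integral_pair[OF P(3)], simp, intro nn_integral_cong,
        subst nn_integral_pair[OF P(2)], simp, intro nn_integral_cong,
        subst nn_integral_pair[OF P(1)], simp, intro nn_integral_cong,
        subst nn_integral_pair[OF \<Gamma>.prob_space_axioms], simp, rule refl)
qed

definition step :: "(real ^ 'd) \<times> (real ^ 'd) \<Rightarrow> (real ^ 'd) \<times> (real ^ 'd) \<times> (real ^ 'd) \<times> (real ^ 'd) \<times> 'w \<Rightarrow> (real ^ 'd) \<times> (real ^ 'd)" where
  "step z n = (case n of (\<xi>1, \<xi>2, \<xi>3, \<xi>4, \<omega>) \<Rightarrow> sg_ubu_step \<gamma> h G z \<xi>1 \<xi>2 \<xi>3 \<xi>4 \<omega>)"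

lemma step_eq:
  "step z n = (let \<xi>1 = fst n; \<xi>2 = fst (snd n); \<xi>3 = fst (snd (snd n)); \<xi>4 = fst (snd (snd (snd n)));
      \<omega> = snd (snd (snd (snd n))); v = snd z; y = fst z + half_gauss v \<xi>1 \<xi>2
    in (fst z + c1 *\<^sub>R final_gauss v \<xi>1 \<xi>2 \<xi>3 \<xi>4 + residual_gauss v \<xi>1 \<xi>2 \<xi>3 \<xi>4 - (\<kappa> * h) *\<^sub>R G y \<omega>,
       final_gauss v \<xi>1 \<xi>2 \<xi>3 \<xi>4 - (\<eta> * h) *\<^sub>R G y \<omega>))"
  by (cases z; cases n) (simp add: step_def Let_def sg_ubu_step_eq)

lemma gauss_comb_measurable [measurable]:
  assumes [measurable]: "a \<in> borel_measurable M" "b \<in> borel_measurable M" "c \<in> borel_measurable M" "d \<in> borel_measurable M" "e \<in> borel_measurable M"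
  shows "(\<lambda>w. final_gauss (a w) (b w) (c w) (d w) (e w) :: real ^ 'd) \<in> borel_measurable M"
    "(\<lambda>w. residual_gauss (a w) (b w) (c w) (d w) (e w) :: real ^ 'd) \<in> borel_measurable M"
    "(\<lambda>w. half_gauss (a w) (b w) (c w) :: real ^ 'd) \<in> borel_measurable M"
  unfolding final_gauss_def residual_gauss_def half_gauss_def by measurable

lemma step_measurable [measurable]:
  assumes [measurable]: "z \<in> borel_measurable M" "n \<in> measurable M noise"
  shows "(\<lambda>w. step (z w) (n w)) \<in> borel_measurable M"
proof -
  have [measurable]: "n \<in> measurable M (borel \<Otimes>\<^sub>M borel \<Otimes>\<^sub>M borel \<Otimes>\<^sub>M borel \<Otimes>\<^sub>M \<Gamma>)"
    using assms(2) by (simp only: measurable_cong_sets[OF refl sets_noise])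
  have [measurable]: "(\<lambda>w. fst (n w)) \<in> borel_measurable M" "(\<lambda>w. fst (snd (n w))) \<in> borel_measurable M"
    "(\<lambda>w. fst (snd (snd (n w)))) \<in> borel_measurable M" "(\<lambda>w. fst (snd (snd (snd (n w))))) \<in> borel_measurable M"
    "(\<lambda>w. snd (snd (snd (snd (n w))))) \<in> measurable M \<Gamma>"
    by measurable
  define y where "y w = fst (z w) + half_gauss (snd (z w)) (fst (n w)) (fst (snd (n w)))" for w
  define g where "g w = final_gauss (snd (z w)) (fst (n w)) (fst (snd (n w))) (fst (snd (snd (n w)))) (fst (snd (snd (snd (n w)))))" for w
  define r where "r w = residual_gauss (snd (z w)) (fst (n w)) (fst (snd (n w))) (fst (snd (snd (n w)))) (fst (snd (snd (snd (n w)))))" for w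
  have [measurable]: "y \<in> borel_measurable M" "g \<in> borel_measurable M" "r \<in> borel_measurable M"
    unfolding y_def g_def r_def by measurable
  have "step (z w) (n w) = (fst (z w) + c1 *\<^sub>R g w + r w - (\<kappa> * h) *\<^sub>R G (y w) (snd (snd (snd (snd (n w))))),
      g w - (\<eta> * h) *\<^sub>R G (y w) (snd (snd (snd (snd (n w))))))" for w
    unfolding step_eq Let_def y_def g_def r_def ..
  then show ?thesis by simp
qed

lemma kernel_eq: "sg_ubu_kernel \<gamma> h G \<Gamma> z = distr noise borel (step z)"
  unfolding sg_ubu_kernel_def noise_def step_def[abs_def] ..

lemma kernel_measurable: "sg_ubu_kernel \<gamma> h G \<Gamma> \<in> measurable borel (subprob_algebra borel)"
proof -
  have "(\<lambda>z. distr noise borel (step z)) \<in> measurable borel (subprob_algebra borel)"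
  proof (rule measurable_distr2[where M=noise])
    show "(\<lambda>(z, n). step z n) \<in> borel_measurable (borel \<Otimes>\<^sub>M noise)"
      unfolding case_prod_beta' by measurable
    show "(\<lambda>z. noise) \<in> measurable borel (subprob_algebra noise)"
      by (intro measurable_const) (simp add: space_subprob_algebra prob_space_noise prob_space_imp_subprob_space)
  qed
  then show ?thesis by (simp only: kernel_eq[abs_def])
qed

lemma nn_integral_invariant:
  assumes inv: "invariant_measure (sg_ubu_kernel \<gamma> h G \<Gamma>) \<mu>" and s: "sets \<mu> = sets borel"
    and F: "F \<in> borel_measurable borel"
  shows "(\<integral>\<^sup>+ z. \<integral>\<^sup>+ n. F (step z n) \<partial>noise \<partial>\<mu>) = (\<integral>\<^sup>+ z. F z \<partial>\<mu>)"
proof -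
  have K: "sg_ubu_kernel \<gamma> h G \<Gamma> \<in> measurable \<mu> (subprob_algebra borel)"
    using kernel_measurable by (simp only: measurable_cong_sets[OF s refl])
  have [measurable]: "step z \<in> borel_measurable noise" for z by measurable
  have "(\<integral>\<^sup>+ z. F z \<partial>\<mu>) = (\<integral>\<^sup>+ z. F z \<partial>(\<mu> \<bind> sg_ubu_kernel \<gamma> h G \<Gamma>))"
    using inv by (simp add: invariant_measure_def)
  also have "\<dots> = (\<integral>\<^sup>+ z. \<integral>\<^sup>+ y. F y \<partial>sg_ubu_kernel \<gamma> h G \<Gamma> z \<partial>\<mu>)"
    by (rule nn_integral_bind[OF F K])
  also have "\<dots> = (\<integral>\<^sup>+ z. \<integral>\<^sup>+ n. F (step z n) \<partial>noise \<partial>\<mu>)"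
    unfolding kernel_eq using F by (intro nn_integral_cong nn_integral_distr) measurable
  finally show ?thesis ..
qed

abbreviation perturbed :: "real ^ 'd \<Rightarrow> (real ^ 'd) measure" where
  "perturbed x \<equiv> convolution (scaled_noise_law \<gamma> h V G \<Gamma> x) gauss"

text \<open>The scale in \<open>scaled_noise_law\<close> is \<open>\<eta> * h\<close>, the weight of
  the gradient in the final velocity. The convolution is therefore the law of a standard Gaussian
  final velocity shifted by the gradient noise at \<open>x\<close>.\<close>

lemma nn_integral_perturbed:
  assumes F[measurable]: "F \<in> borel_measurable borel"
  shows "(\<integral>\<^sup>+ s. F s \<partial>perturbed x) = (\<integral>\<^sup>+ u. \<integral>\<^sup>+ \<omega>. F (u + (\<eta> * h) *\<^sub>R \<nu> x \<omega>) \<partial>\<Gamma> \<partial>gauss)"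
proof -
  let ?n = "\<lambda>\<omega>. (\<eta> * h) *\<^sub>R \<nu> x \<omega>"
  have law: "scaled_noise_law \<gamma> h V G \<Gamma> x = distr \<Gamma> borel ?n"
    unfolding scaled_noise_law_def \<nu>_def \<eta>_def by (simp add: mult.commute)
  have [measurable]: "?n \<in> borel_measurable \<Gamma>" by measurable
  interpret pair_sigma_finite \<Gamma> gauss ..
  have "(\<integral>\<^sup>+ s. F s \<partial>perturbed x) = (\<integral>\<^sup>+ z. F (fst z + snd z) \<partial>(distr \<Gamma> borel ?n \<Otimes>\<^sub>M gauss))"
    unfolding convolution_def law by (subst nn_integral_distr) (auto simp: case_prod_beta')
  also have "\<dots> = (\<integral>\<^sup>+ a. \<integral>\<^sup>+ u. F (a + u) \<partial>gauss \<partial>distr \<Gamma> borel ?n)"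
    by (subst nn_integral_pair[OF prob_space_std_gaussian]) (auto simp: case_prod_beta')
  also have "\<dots> = (\<integral>\<^sup>+ \<omega>. \<integral>\<^sup>+ u. F (?n \<omega> + u) \<partial>gauss \<partial>\<Gamma>)"
    by (rule nn_integral_distr) auto
  also have "\<dots> = (\<integral>\<^sup>+ u. \<integral>\<^sup>+ \<omega>. F (?n \<omega> + u) \<partial>\<Gamma> \<partial>gauss)"
    by (rule Fubini'[symmetric]) measurable
  finally show ?thesis by (simp add: add.commute)
qed

lemma prob_space_perturbed: "prob_space (perturbed x)"
proof (rule prob_spaceI)
  have "(\<integral>\<^sup>+ s. 1 \<partial>perturbed x) = 1"
    by (subst nn_integral_perturbed) (auto simp: \<Gamma>.emeasure_space_1 std_gauss.emeasure_space_1[simplified])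
  then show "emeasure (perturbed x) (space (perturbed x)) = 1" by simp
qed

lemma sets_perturbed: "sets (perturbed x) = sets borel"
  by (simp add: convolution_def)

end

section \<open>One coupled step\<close>

text \<open>The positions \<open>x\<close> are discretised by \<open>kx\<close>, with representatives \<open>xr\<close>, and the perturbed Gaussians
  by \<open>ks\<close>. This reduces the choice of the partner of a perturbed Gaussian to countably many couplings
  \<open>cpl\<close>, so that no measurable selection of optimal couplings is needed.\<close>

locale sg_coupling = sg_ubu V m L \<gamma> h G \<Gamma> C p
  for V :: "real ^ 'd \<Rightarrow> real" and m L \<gamma> h and G :: "real ^ 'd \<Rightarrow> 'w::polish_space \<Rightarrow> real ^ 'd" and \<Gamma> C p +
  fixes \<pi>h :: "((real ^ 'd) \<times> (real ^ 'd)) measure" and \<tau> and \<delta> :: real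
    and kx ks :: "real ^ 'd \<Rightarrow> nat" and xr :: "nat \<Rightarrow> real ^ 'd"
    and cpl :: "nat \<Rightarrow> ((real ^ 'd) \<times> (real ^ 'd)) measure"
  assumes \<pi>h: "prob_space \<pi>h" "sets \<pi>h = sets borel" "invariant_measure (sg_ubu_kernel \<gamma> h G \<Gamma>) \<pi>h"
    and \<tau>: "\<tau> \<in> couplings (target V) \<pi>h" and \<delta>: "0 < \<delta>"
    and kx[measurable]: "kx \<in> measurable borel (count_space UNIV)"
    and ks[measurable]: "ks \<in> measurable borel (count_space UNIV)"
    and ks_cell: "\<And>x y. ks x = ks y \<Longrightarrow> dist x y < \<delta>"
    and xr: "\<And>x. dist x (xr (kx x)) < \<delta>"
    and cpl: "\<And>i. cpl i \<in> couplings (perturbed (xr i)) gauss"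
begin

lemma cell: "cell_coupling (perturbed (xr i)) gauss (cpl i) ks \<delta>"
  by (rule cell_coupling.intro[OF prob_space_perturbed sets_perturbed prob_space_std_gaussian
        sets_std_gaussian cpl ks ks_cell])

abbreviation kern :: "nat \<Rightarrow> nat \<Rightarrow> (real ^ 'd) measure" where
  "kern i j \<equiv> cell_kernel (cpl i) ks gauss j"

lemma prob_space_kern: "prob_space (kern i j)"
  by (rule cell_coupling.prob_space_kernel[OF cell])

lemma sets_kern [simp, measurable_cong]: "sets (kern i j) = sets borel"
  by (rule cell_coupling.sets_kernel[OF cell])

text \<open>A pair of cells is encoded as one number, so that the independent draws form a product
  over the naturals.\<close>

definition K :: "nat \<Rightarrow> (real ^ 'd) measure" where
  "K n = kern (fst (prod_decode n)) (snd (prod_decode n))"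

lemma K_encode: "K (prod_encode (i, j)) = kern i j" by (simp add: K_def)

lemma prob_space_K: "prob_space (K n)" by (simp add: K_def prob_space_kern)

lemma sets_K [simp, measurable_cong]: "sets (K n) = sets borel" by (simp add: K_def)

text \<open>One independent draw for every pair of cells; the partner is the draw \<open>ix\<close> of the pair that occurs.\<close>

definition PY :: "(nat \<Rightarrow> real ^ 'd) measure" where "PY = (\<Pi>\<^sub>M n\<in>UNIV. K n)"

lemma prob_space_PY: "prob_space PY" unfolding PY_def by (intro prob_space_PiM prob_space_K)

definition M where "M = \<tau> \<Otimes>\<^sub>M (noise \<Otimes>\<^sub>M PY)"

lemma sets_\<tau> [measurable_cong]: "sets \<tau> = sets (borel \<Otimes>\<^sub>M borel)"
  using sets_couplings[OF \<tau>] \<pi>h pot.sets_target by (simp cong: sets_pair_measure_cong)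

lemma prob_space_\<tau>: "prob_space \<tau>" by (rule prob_space_couplings[OF \<tau> pot.prob_space_target])

lemma prob_space_M: "prob_space M"
  unfolding M_def by (intro prob_space_pair prob_space_\<tau> prob_space_noise prob_space_PY)

sublocale M: prob_space M by (rule prob_space_M)

lemma M_measurable [measurable]:
  "(\<lambda>w. fst (fst w)) \<in> borel_measurable M" "(\<lambda>w. snd (fst w)) \<in> borel_measurable M"
  "(\<lambda>w. fst (snd w)) \<in> measurable M noise" "(\<lambda>w. snd (snd w)) \<in> measurable M PY"
  unfolding M_def by measurable

definition om :: "(real ^ 'd) \<times> (real ^ 'd) \<times> (real ^ 'd) \<times> (real ^ 'd) \<times> 'w \<Rightarrow> 'w" where
  "om n = snd (snd (snd (snd n)))"
definition gS where "gS z n = final_gauss (snd z) (fst n) (fst (snd n)) (fst (snd (snd n))) (fst (snd (snd (snd n))))"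
definition gR where "gR z n = residual_gauss (snd z) (fst n) (fst (snd n)) (fst (snd (snd n))) (fst (snd (snd (snd n))))"
definition gA where "gA z n = half_gauss (snd z) (fst n) (fst (snd n))"
text \<open>The noise is taken at the representative of the cell, the only points for which the
  couplings \<open>cpl\<close> are fixed; \<open>lp2_noise_cell\<close> bounds the price.\<close>

definition S where "S z n = gS z n + (\<eta> * h) *\<^sub>R \<nu> (xr (kx (fst z))) (om n)"
definition ix where "ix z n = prod_encode (kx (fst z), ks (S z n))"

lemma step_rv: "step z n = (fst z + c1 *\<^sub>R gS z n + gR z n - (\<kappa> * h) *\<^sub>R G (fst z + gA z n) (om n),
    gS z n - (\<eta> * h) *\<^sub>R G (fst z + gA z n) (om n))"
  unfolding step_eq Let_def gS_def gR_def gA_def om_def ..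

lemma rv_measurable [measurable]:
  assumes [measurable]: "z \<in> borel_measurable N" and n: "n \<in> measurable N noise"
  shows "(\<lambda>w. om (n w)) \<in> measurable N \<Gamma>"
    "(\<lambda>w. gS (z w) (n w) :: real ^ 'd) \<in> borel_measurable N"
    "(\<lambda>w. gR (z w) (n w) :: real ^ 'd) \<in> borel_measurable N"
    "(\<lambda>w. gA (z w) (n w) :: real ^ 'd) \<in> borel_measurable N"
proof -
  have [measurable]: "n \<in> measurable N (borel \<Otimes>\<^sub>M borel \<Otimes>\<^sub>M borel \<Otimes>\<^sub>M borel \<Otimes>\<^sub>M \<Gamma>)"
    using n by (simp only: measurable_cong_sets[OF refl sets_noise])
  show "(\<lambda>w. om (n w)) \<in> measurable N \<Gamma>"
    "(\<lambda>w. gS (z w) (n w) :: real ^ 'd) \<in> borel_measurable N"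
    "(\<lambda>w. gR (z w) (n w) :: real ^ 'd) \<in> borel_measurable N"
    "(\<lambda>w. gA (z w) (n w) :: real ^ 'd) \<in> borel_measurable N"
    unfolding om_def gS_def gR_def gA_def by measurable
qed

lemma xr_measurable [measurable]:
  assumes "x \<in> borel_measurable N"
  shows "(\<lambda>w. xr (kx (x w))) \<in> borel_measurable N"
proof -
  have "(\<lambda>w. kx (x w)) \<in> measurable N (count_space UNIV)" by (rule measurable_compose[OF assms kx])
  then show ?thesis by (rule measurable_compose) simp
qed

lemma encode_measurable [measurable]:
  assumes x: "x \<in> borel_measurable N" and s: "s \<in> borel_measurable N"
  shows "(\<lambda>w. prod_encode (kx (x w), ks (s w))) \<in> measurable N (count_space UNIV)"
proof -
  have a: "(\<lambda>w. kx (x w)) \<in> measurable N (count_space UNIV)" by (rule measurable_compose[OF x kx])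
  have b: "(\<lambda>w. ks (s w)) \<in> measurable N (count_space UNIV)" by (rule measurable_compose[OF s ks])
  show ?thesis
    by (rule measurable_compose_countable[OF _ a]) (rule measurable_compose[OF b], simp)
qed

lemma S_measurable [measurable]:
  assumes [measurable]: "z \<in> borel_measurable N" "n \<in> measurable N noise"
  shows "(\<lambda>w. S (z w) (n w)) \<in> borel_measurable N" "(\<lambda>w. ix (z w) (n w)) \<in> measurable N (count_space UNIV)"
  unfolding S_def ix_def by measurable

definition Vs where "Vs w = snd (snd w) (ix (fst (fst w)) (fst (snd w)))"

lemma Vs_measurable [measurable]: "Vs \<in> borel_measurable M"
proof -
  have "(\<lambda>w. snd (snd w) i) \<in> borel_measurable M" for i
  proof -
    have "(\<lambda>Y. Y i) \<in> borel_measurable PY"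
      unfolding PY_def using measurable_component_singleton[of i UNIV K]
      by (simp add: measurable_cong_sets[OF refl sets_K])
    then show ?thesis by (rule measurable_compose[rotated]) measurable
  qed
  then show ?thesis unfolding Vs_def[abs_def]
    by (rule measurable_compose_countable[where f="\<lambda>i w. snd (snd w) i"]) measurable
qed

text \<open>The index \<open>ix\<close> is determined by the start point and the noise, which are
  independent of the family of draws; given these, the selected draw has law \<open>K\<close> at
  that index.\<close>

lemma nn_integral_M:
  assumes F: "F \<in> borel_measurable (borel \<Otimes>\<^sub>M noise \<Otimes>\<^sub>M borel)"
  shows "(\<integral>\<^sup>+ w. F (fst w, fst (snd w), Vs w) \<partial>M) = (\<integral>\<^sup>+ zz. \<integral>\<^sup>+ n. \<integral>\<^sup>+ v. F (zz, n, v) \<partial>K (ix (fst zz) n) \<partial>noise \<partial>\<tau>)"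
proof -
  have s: "sets \<tau> = sets borel" by (rule trans[OF sets_\<tau> arg_cong[where f=sets, OF borel_prod]])
  have [measurable]: "(\<lambda>w. fst w) \<in> borel_measurable M"
    unfolding M_def by (simp add: measurable_cong_sets[OF refl s, symmetric])
  have m: "(\<lambda>w. F (fst w, fst (snd w), Vs w)) \<in> borel_measurable M"
    by (rule measurable_compose[OF _ F]) measurable
  have "(\<integral>\<^sup>+ w. F (fst w, fst (snd w), Vs w) \<partial>M) = (\<integral>\<^sup>+ zz. \<integral>\<^sup>+ n. \<integral>\<^sup>+ Y. F (zz, n, Y (ix (fst zz) n)) \<partial>PY \<partial>noise \<partial>\<tau>)"
  proof -
    have 1: "(\<integral>\<^sup>+ w. F (fst w, fst (snd w), Vs w) \<partial>M) = (\<integral>\<^sup>+ zz. \<integral>\<^sup>+ q. F (zz, fst q, Vs (zz, q)) \<partial>(noise \<Otimes>\<^sub>M PY) \<partial>\<tau>)"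
      using m unfolding M_def
      by (subst nn_integral_pair[OF prob_space_pair[OF prob_space_noise prob_space_PY]]) simp_all
    also have "\<dots> = (\<integral>\<^sup>+ zz. \<integral>\<^sup>+ n. \<integral>\<^sup>+ Y. F (zz, n, Y (ix (fst zz) n)) \<partial>PY \<partial>noise \<partial>\<tau>)"
    proof (rule nn_integral_cong)
      fix zz assume zz: "zz \<in> space \<tau>"
      have "(\<lambda>q. F (zz, fst q, Vs (zz, q))) \<in> borel_measurable (noise \<Otimes>\<^sub>M PY)"
        using measurable_compose[OF measurable_Pair1'[OF zz] m[unfolded M_def]] by simp
      then show "(\<integral>\<^sup>+ q. F (zz, fst q, Vs (zz, q)) \<partial>(noise \<Otimes>\<^sub>M PY)) = (\<integral>\<^sup>+ n. \<integral>\<^sup>+ Y. F (zz, n, Y (ix (fst zz) n)) \<partial>PY \<partial>noise)"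
        by (subst nn_integral_pair[OF prob_space_PY]) (simp_all add: Vs_def)
    qed
    finally show ?thesis .
  qed
  also have "\<dots> = (\<integral>\<^sup>+ zz. \<integral>\<^sup>+ n. \<integral>\<^sup>+ v. F (zz, n, v) \<partial>K (ix (fst zz) n) \<partial>noise \<partial>\<tau>)"
  proof (intro nn_integral_cong)
    fix zz n assume n: "n \<in> space noise"
    have "(\<lambda>v. F (zz, n, v)) \<in> borel_measurable borel"
      using n by (intro measurable_compose[OF _ F]) (auto simp: space_borel intro!: measurable_Pair)
    then have "(\<lambda>v. F (zz, n, v)) \<in> borel_measurable (K i)" for i
      by (simp add: measurable_cong_sets[OF sets_K refl])
    then show "(\<integral>\<^sup>+ Y. F (zz, n, Y (ix (fst zz) n)) \<partial>PY) = (\<integral>\<^sup>+ v. F (zz, n, v) \<partial>K (ix (fst zz) n))"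
      unfolding PY_def by (rule nn_integral_PiM_component[OF prob_space_K])
  qed
  finally show ?thesis .
qed

lemma nn_integral_M_noise:
  assumes F: "F \<in> borel_measurable (borel \<Otimes>\<^sub>M noise)"
  shows "(\<integral>\<^sup>+ w. F (fst w, fst (snd w)) \<partial>M) = (\<integral>\<^sup>+ zz. \<integral>\<^sup>+ n. F (zz, n) \<partial>noise \<partial>\<tau>)"
proof -
  have "(\<lambda>q. F (fst q, fst (snd q))) \<in> borel_measurable (borel \<Otimes>\<^sub>M noise \<Otimes>\<^sub>M (borel :: (real ^ 'd) measure))"
    by (rule measurable_compose[OF _ F]) measurable
  from nn_integral_M[OF this] show ?thesis
    by (simp add: prob_space.emeasure_space_1[OF prob_space_K])
qed

lemma borel_noise_section:
  assumes F: "F \<in> borel_measurable (borel \<Otimes>\<^sub>M noise)"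
  shows "(\<lambda>z. \<integral>\<^sup>+ n. F (z, n) \<partial>noise) \<in> borel_measurable borel"
proof -
  interpret noise: prob_space noise by (rule prob_space_noise)
  show ?thesis by (rule noise.borel_measurable_nn_integral) (use F in simp)
qed

lemma nn_integral_M_first:
  assumes F: "F \<in> borel_measurable (borel \<Otimes>\<^sub>M noise)"
  shows "(\<integral>\<^sup>+ w. F (fst (fst w), fst (snd w)) \<partial>M) = (\<integral>\<^sup>+ x. \<integral>\<^sup>+ v. \<integral>\<^sup>+ n. F ((x, v), n) \<partial>noise \<partial>gauss \<partial>gibbs V)"
proof -
  have "(\<lambda>q. F (fst (fst q), snd q)) \<in> borel_measurable ((borel :: (((real ^ 'd) \<times> (real ^ 'd)) \<times> (real ^ 'd) \<times> (real ^ 'd)) measure) \<Otimes>\<^sub>M noise)"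
    by (rule measurable_compose[OF _ F]) measurable
  from nn_integral_M_noise[OF this]
  have "(\<integral>\<^sup>+ w. F (fst (fst w), fst (snd w)) \<partial>M) = (\<integral>\<^sup>+ zz. \<integral>\<^sup>+ n. F (fst zz, n) \<partial>noise \<partial>\<tau>)" by simp
  also have "\<dots> = (\<integral>\<^sup>+ z. \<integral>\<^sup>+ n. F (z, n) \<partial>noise \<partial>target V)"
    using borel_noise_section[OF F]
    by (intro nn_integral_couplings(1)[OF \<tau>]) (simp only: measurable_cong_sets[OF pot.sets_target refl])
  also have "\<dots> = (\<integral>\<^sup>+ x. \<integral>\<^sup>+ v. \<integral>\<^sup>+ n. F ((x, v), n) \<partial>noise \<partial>gauss \<partial>gibbs V)"
    by (rule pot.nn_integral_target[OF borel_noise_section[OF F]])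
  finally show ?thesis .
qed

lemma nn_integral_M_second:
  assumes F: "F \<in> borel_measurable borel"
  shows "(\<integral>\<^sup>+ w. F (step (snd (fst w)) (fst (snd w))) \<partial>M) = (\<integral>\<^sup>+ z. F z \<partial>\<pi>h)"
proof -
  have F': "(\<lambda>q. F (step (fst q) (snd q))) \<in> borel_measurable (borel \<Otimes>\<^sub>M noise)"
    by (rule measurable_compose[OF _ F]) measurable
  have "(\<lambda>q. F (step (snd (fst q)) (snd q))) \<in> borel_measurable ((borel :: (((real ^ 'd) \<times> (real ^ 'd)) \<times> (real ^ 'd) \<times> (real ^ 'd)) measure) \<Otimes>\<^sub>M noise)"
    by (rule measurable_compose[OF _ F]) measurable
  from nn_integral_M_noise[OF this]
  have "(\<integral>\<^sup>+ w. F (step (snd (fst w)) (fst (snd w))) \<partial>M) = (\<integral>\<^sup>+ zz. \<integral>\<^sup>+ n. F (step (snd zz) n) \<partial>noise \<partial>\<tau>)" by simp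
  also have "\<dots> = (\<integral>\<^sup>+ z. \<integral>\<^sup>+ n. F (step z n) \<partial>noise \<partial>\<pi>h)"
    using borel_noise_section[OF F']
    by (intro nn_integral_couplings(2)[OF \<tau>]) (simp only: measurable_cong_sets[OF \<pi>h(2) refl] fst_conv snd_conv)
  also have "\<dots> = (\<integral>\<^sup>+ z. F z \<partial>\<pi>h)" by (rule nn_integral_invariant[OF \<pi>h(3,2) F])
  finally show ?thesis .
qed

text \<open>The joint law of the starting position, the perturbed Gaussian \<open>S\<close>, its partner \<open>Vs\<close> and the
  residual \<open>gR\<close>: the residual is independent of the rest given the position.\<close>

lemma nn_integral_M_joint:
  assumes H: "H \<in> borel_measurable (borel \<Otimes>\<^sub>M borel \<Otimes>\<^sub>M borel \<Otimes>\<^sub>M borel)"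
  shows "(\<integral>\<^sup>+ w. H (fst (fst (fst w)), S (fst (fst w)) (fst (snd w)), Vs w, gR (fst (fst w)) (fst (snd w))) \<partial>M)
    = (\<integral>\<^sup>+ x. \<integral>\<^sup>+ r. \<integral>\<^sup>+ s. \<integral>\<^sup>+ v. H (x, s, v, sR *\<^sub>R r) \<partial>kern (kx x) (ks s) \<partial>perturbed (xr (kx x)) \<partial>gauss \<partial>gibbs V)"
proof -
  have Hm[measurable]: "(\<lambda>w. H (a w, b w, c w, d w)) \<in> borel_measurable N"
    if [measurable]: "a \<in> borel_measurable N" "b \<in> borel_measurable N" "c \<in> borel_measurable N" "d \<in> borel_measurable N"
    for a b c d and N :: "'z measure"
    by (rule measurable_compose[OF _ H]) measurable
  define HH where "HH x s r = (\<integral>\<^sup>+ v. H (x, s, v, r) \<partial>K (prod_encode (kx x, ks s)))" for x s r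
  have HH[measurable]: "(\<lambda>w. HH (a w) (b w) (d w)) \<in> borel_measurable N"
    if [measurable]: "a \<in> borel_measurable N" "b \<in> borel_measurable N" "d \<in> borel_measurable N"
    for a b d and N :: "'z measure"
    unfolding HH_def
  proof (rule measurable_compose_countable[where f="\<lambda>i w. \<integral>\<^sup>+ v. H (a w, b w, v, d w) \<partial>K i"])
    fix i
    interpret Ki: prob_space "K i" by (rule prob_space_K)
    show "(\<lambda>w. \<integral>\<^sup>+ v. H (a w, b w, v, d w) \<partial>K i) \<in> borel_measurable N"
      by (rule Ki.borel_measurable_nn_integral) measurable
  qed measurable
  let ?F = "\<lambda>q. H (fst (fst (fst q)), S (fst (fst q)) (fst (snd q)), snd (snd q), gR (fst (fst q)) (fst (snd q)))"
  have F: "?F \<in> borel_measurable ((borel :: (((real ^ 'd) \<times> (real ^ 'd)) \<times> (real ^ 'd) \<times> (real ^ 'd)) measure) \<Otimes>\<^sub>M noise \<Otimes>\<^sub>M borel)"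
    by measurable
  have "(\<integral>\<^sup>+ w. H (fst (fst (fst w)), S (fst (fst w)) (fst (snd w)), Vs w, gR (fst (fst w)) (fst (snd w))) \<partial>M)
    = (\<integral>\<^sup>+ zz. \<integral>\<^sup>+ n. HH (fst (fst zz)) (S (fst zz) n) (gR (fst zz) n) \<partial>noise \<partial>\<tau>)"
    using nn_integral_M[OF F] by (simp add: HH_def ix_def)
  also have "\<dots> = (\<integral>\<^sup>+ x. \<integral>\<^sup>+ v. \<integral>\<^sup>+ n. HH x (S (x, v) n) (gR (x, v) n) \<partial>noise \<partial>gauss \<partial>gibbs V)"
  proof -
    let ?Q = "\<lambda>q. HH (fst (fst q)) (S (fst q) (snd q)) (gR (fst q) (snd q))"
    have Q: "?Q \<in> borel_measurable (borel \<Otimes>\<^sub>M noise)" by measurable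
    have Q': "(\<lambda>q. ?Q (fst (fst q), snd q)) \<in> borel_measurable ((borel :: (((real ^ 'd) \<times> (real ^ 'd)) \<times> (real ^ 'd) \<times> (real ^ 'd)) measure) \<Otimes>\<^sub>M noise)"
      by (rule measurable_compose[OF _ Q]) measurable
    show ?thesis using nn_integral_M_first[OF Q] nn_integral_M_noise[OF Q'] by simp
  qed
  also have "\<dots> = (\<integral>\<^sup>+ x. \<integral>\<^sup>+ r. \<integral>\<^sup>+ s. HH x s (sR *\<^sub>R r) \<partial>perturbed (xr (kx x)) \<partial>gauss \<partial>gibbs V)"
  proof (rule nn_integral_cong)
    fix x
    define n where "n \<omega> = (\<eta> * h) *\<^sub>R \<nu> (xr (kx x)) \<omega>" for \<omega>
    have [measurable]: "n \<in> borel_measurable \<Gamma>" unfolding n_def by measurable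
    \<comment> \<open>Integrating \<omega> first leaves a function of the final velocity and the
      residual only, whose joint law is known. Undoing this at the end turns
      \<open>u + n \<omega>\<close> into a sample of the perturbed law.\<close>
    define F where "F u r = (\<integral>\<^sup>+ \<omega>. HH x (u + n \<omega>) r \<partial>\<Gamma>)" for u r
    have Fm[measurable]: "case_prod F \<in> borel_measurable (borel \<Otimes>\<^sub>M borel)"
      unfolding F_def case_prod_beta' by measurable
    have [measurable]: "(\<lambda>z. F (f z) (g z)) \<in> borel_measurable N"
      if [measurable]: "f \<in> borel_measurable N" "g \<in> borel_measurable N" for f g and N :: "'z measure"
      using measurable_compose[OF measurable_Pair[OF that] Fm] by simp
    interpret gg: pair_sigma_finite gauss gauss ..
    have "(\<integral>\<^sup>+ v. \<integral>\<^sup>+ q. HH x (S (x, v) q) (gR (x, v) q) \<partial>noise \<partial>gauss)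
      = (\<integral>\<^sup>+ v. \<integral>\<^sup>+ \<xi>1. \<integral>\<^sup>+ \<xi>2. \<integral>\<^sup>+ \<xi>3. \<integral>\<^sup>+ \<xi>4. F (final_gauss v \<xi>1 \<xi>2 \<xi>3 \<xi>4) (residual_gauss v \<xi>1 \<xi>2 \<xi>3 \<xi>4)
        \<partial>gauss \<partial>gauss \<partial>gauss \<partial>gauss \<partial>gauss)"
      by (rule nn_integral_cong, subst nn_integral_noise, measurable)
         (simp add: F_def S_def gS_def gR_def om_def n_def)
    also have "\<dots> = (\<integral>\<^sup>+ u. \<integral>\<^sup>+ r. F u (sR *\<^sub>R r) \<partial>gauss \<partial>gauss)"
      by (rule nn_integral_step_gaussians[OF Fm])
    also have "\<dots> = (\<integral>\<^sup>+ r. \<integral>\<^sup>+ u. F u (sR *\<^sub>R r) \<partial>gauss \<partial>gauss)"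
      by (rule gg.Fubini') measurable
    also have "\<dots> = (\<integral>\<^sup>+ r. \<integral>\<^sup>+ s. HH x s (sR *\<^sub>R r) \<partial>perturbed (xr (kx x)) \<partial>gauss)"
      unfolding F_def n_def by (intro nn_integral_cong nn_integral_perturbed[symmetric]) measurable
    finally show "(\<integral>\<^sup>+ v. \<integral>\<^sup>+ q. HH x (S (x, v) q) (gR (x, v) q) \<partial>noise \<partial>gauss)
      = (\<integral>\<^sup>+ r. \<integral>\<^sup>+ s. HH x s (sR *\<^sub>R r) \<partial>perturbed (xr (kx x)) \<partial>gauss)" .
  qed
  finally show ?thesis by (simp only: HH_def K_encode)
qed

text \<open>Averaged over the perturbed Gaussian, the partner is exactly standard Gaussian and
  independent of the start position and the residual; this makes the law of \<open>refresh\<close>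
  exact in spite of the discretisation.\<close>

lemma nn_integral_M_marginal:
  assumes H: "H \<in> borel_measurable (borel \<Otimes>\<^sub>M borel \<Otimes>\<^sub>M borel)"
  shows "(\<integral>\<^sup>+ w. H (fst (fst (fst w)), Vs w, gR (fst (fst w)) (fst (snd w))) \<partial>M)
    = (\<integral>\<^sup>+ x. \<integral>\<^sup>+ u. \<integral>\<^sup>+ r. H (x, u, sR *\<^sub>R r) \<partial>gauss \<partial>gauss \<partial>gibbs V)"
proof -
  have Hm[measurable]: "(\<lambda>w. H (a w, c w, d w)) \<in> borel_measurable N"
    if [measurable]: "a \<in> borel_measurable N" "c \<in> borel_measurable N" "d \<in> borel_measurable N"
    for a c d and N :: "'z measure"
    by (rule measurable_compose[OF _ H]) measurable
  interpret gg: pair_sigma_finite gauss gauss ..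
  have "(\<lambda>q. H (fst q, fst (snd (snd q)), snd (snd (snd q)))) \<in> borel_measurable (borel \<Otimes>\<^sub>M (borel :: (real ^ 'd) measure) \<Otimes>\<^sub>M borel \<Otimes>\<^sub>M borel)"
    by measurable
  from nn_integral_M_joint[OF this]
  have "(\<integral>\<^sup>+ w. H (fst (fst (fst w)), Vs w, gR (fst (fst w)) (fst (snd w))) \<partial>M)
    = (\<integral>\<^sup>+ x. \<integral>\<^sup>+ r. \<integral>\<^sup>+ s. \<integral>\<^sup>+ v. H (x, v, sR *\<^sub>R r) \<partial>kern (kx x) (ks s) \<partial>perturbed (xr (kx x)) \<partial>gauss \<partial>gibbs V)"
    by simp
  also have "\<dots> = (\<integral>\<^sup>+ x. \<integral>\<^sup>+ r. \<integral>\<^sup>+ u. H (x, u, sR *\<^sub>R r) \<partial>gauss \<partial>gauss \<partial>gibbs V)"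
    by (intro nn_integral_cong cell_coupling.kernel_marginal[OF cell]) measurable
  also have "\<dots> = (\<integral>\<^sup>+ x. \<integral>\<^sup>+ u. \<integral>\<^sup>+ r. H (x, u, sR *\<^sub>R r) \<partial>gauss \<partial>gauss \<partial>gibbs V)"
    by (intro nn_integral_cong gg.Fubini') measurable
  finally show ?thesis .
qed

end

section \<open>Local error\<close>

context sg_ubu
begin

text \<open>Friction and \<open>h * \<gamma> <= 1 / 2\<close> give
  \<open>8 * L * h\<^sup>2 <= 1 / 4\<close>; the fractions 9/50 and 9/25 are rational upper bounds
  of 1 / sqrt 32 and 1 / sqrt 8.\<close>

lemma hL_bounds: "h * sqrt L \<le> 9 / 50" "L * h\<^sup>2 \<le> 1 / 32" "sqrt L \<le> 9 / 25 * \<gamma>"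
proof -
  have "(h * \<gamma>)\<^sup>2 \<le> (1 / 2)\<^sup>2" using h_le h \<gamma> by (intro power_mono) auto
  moreover have "8 * (L * h\<^sup>2) \<le> (h * \<gamma>)\<^sup>2"
    using mult_right_mono[OF friction, of "h\<^sup>2"] by (simp add: power_mult_distrib mult_ac)
  ultimately show 1: "L * h\<^sup>2 \<le> 1 / 32" by (simp add: power2_eq_square)
  have "(h * sqrt L)\<^sup>2 \<le> (9 / 50)\<^sup>2" using 1 L_pos by (simp add: power_mult_distrib mult.commute) (simp add: power2_eq_square)
  then show "h * sqrt L \<le> 9 / 50" by (rule power2_le_imp_le) simp
  have "(sqrt L)\<^sup>2 \<le> (9 / 25 * \<gamma>)\<^sup>2" using friction L_pos by (simp add: power_mult_distrib) (simp add: power2_eq_square)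
  then show "sqrt L \<le> 9 / 25 * \<gamma>" by (rule power2_le_imp_le) (use \<gamma> in simp)
qed

text \<open>The a priori speed for \<open>flow_bounds\<close> at times up to \<open>h\<close>: since
  \<open>L * h\<^sup>2 / 2 <= 1 / 64\<close>, the factor 64/63 meets its condition.\<close>

definition speed :: "real ^ 'd \<Rightarrow> real ^ 'd \<Rightarrow> real" where
  "speed x v = 64 / 63 * (norm v + h * norm (gradient V x))"

lemma flow_h1_bounds:
  fixes x v :: "real ^ 'd"
  shows "norm (snd (pot.flow h1 (x, v)) - v + h1 *\<^sub>R gradient V x) \<le> L * h\<^sup>2 / 2 * speed x v"
    and "norm (fst (pot.flow h1 (x, v)) - x - h1 *\<^sub>R v + (h1\<^sup>2 / 2) *\<^sub>R gradient V x) \<le> h * (L * h\<^sup>2 / 2 * speed x v)"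
proof -
  let ?W = "speed x v"
  have h1: "0 \<le> h1" "h1 \<le> h" using h1_bounds c1_bounds by auto
  have W0: "0 \<le> ?W" using h by (simp add: speed_def)
  have sq: "h1\<^sup>2 \<le> h\<^sup>2" using h1 by (intro power_mono) auto
  have a: "L * h1\<^sup>2 / 2 * ?W \<le> L * h\<^sup>2 / 2 * ?W"
    using sq L_pos W0 by (intro mult_right_mono divide_right_mono mult_left_mono) auto
  have "L * h\<^sup>2 / 2 * ?W \<le> 1 / 64 * ?W" using hL_bounds(2) W0 by (intro mult_right_mono) auto
  moreover have "h1 * norm (gradient V x) \<le> h * norm (gradient V x)" using h1 by (intro mult_right_mono) auto
  moreover have "norm v + h * norm (gradient V x) = 63 / 64 * ?W" by (simp add: speed_def)
  ultimately have W: "norm v + h1 * norm (gradient V x) + L * h1\<^sup>2 / 2 * ?W \<le> ?W" using a by linarith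
  have f: "norm (snd (pot.flow h1 (x, v)) - v + h1 *\<^sub>R gradient V x) \<le> L * h1\<^sup>2 / 2 * ?W"
    "norm (fst (pot.flow h1 (x, v)) - x - h1 *\<^sub>R v + (h1\<^sup>2 / 2) *\<^sub>R gradient V x) \<le> h1 * (L * h1\<^sup>2 / 2 * ?W)"
    using pot.flow_bounds[OF h1(1) W W0] by auto
  show "norm (snd (pot.flow h1 (x, v)) - v + h1 *\<^sub>R gradient V x) \<le> L * h\<^sup>2 / 2 * ?W"
    using f(1) a by linarith
  have "h1 * (L * h1\<^sup>2 / 2 * ?W) \<le> h * (L * h\<^sup>2 / 2 * ?W)"
    using h1 a L_pos W0 h by (intro mult_mono) auto
  then show "norm (fst (pot.flow h1 (x, v)) - x - h1 *\<^sub>R v + (h1\<^sup>2 / 2) *\<^sub>R gradient V x) \<le> h * (L * h\<^sup>2 / 2 * ?W)"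
    using f(2) by linarith
qed

lemma norm_add7:
  fixes x1 :: "'b::real_normed_vector"
  shows "norm (x1 + x2 + x3 + x4 + x5 + x6 + x7) \<le> norm x1 + norm x2 + norm x3 + norm x4 + norm x5 + norm x6 + norm x7"
  using norm_triangle_ineq[of x1 x2] norm_triangle_ineq[of "x1 + x2" x3] norm_triangle_ineq[of "x1 + x2 + x3" x4]
    norm_triangle_ineq[of "x1 + x2 + x3 + x4" x5] norm_triangle_ineq[of "x1 + x2 + x3 + x4 + x5" x6]
    norm_triangle_ineq[of "x1 + x2 + x3 + x4 + x5 + x6" x7] by linarith

text \<open>For independent Gaussian \<open>u\<close> and \<open>r\<close> the remainder \<open>u - (c1 / h1) v\<close> is independent of the
  standard Gaussian \<open>v\<close>; replacing \<open>v\<close> in it by the flowed velocity therefore preserves the target.\<close>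

definition refresh :: "real ^ 'd \<Rightarrow> real ^ 'd \<Rightarrow> real ^ 'd \<Rightarrow> (real ^ 'd) \<times> (real ^ 'd)" where
  "refresh x u r = (let v = (1 / h1) *\<^sub>R (c1 *\<^sub>R u + r); z = pot.flow h1 (x, v)
    in (fst z, u + (c1 / h1) *\<^sub>R (snd z - v)))"

text \<open>Here \<open>gs\<close> is the Gaussian final velocity, \<open>r\<close> the residual,
  \<open>A\<close> the half-step position increment and \<open>u\<close> the partner of the
  perturbed Gaussian \<open>s\<close>. By the choice of \<open>v\<close> the free motion
  \<open>h1 *\<^sub>R v\<close> is \<open>c1 *\<^sub>R u + r\<close>, so the Gaussian parts differ
  only through \<open>s - u\<close>. The rest is gradient noise, mismatched force weights, the
  change of force over the half step, and the flow remainder.\<close>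

lemma local_error:
  fixes x u gs r A xr :: "real ^ 'd" and \<omega> :: 'w
  defines "y \<equiv> x + A" and "s \<equiv> gs + (\<eta> * h) *\<^sub>R \<nu> xr \<omega>" and "v \<equiv> (1 / h1) *\<^sub>R (c1 *\<^sub>R u + r)"
  shows "nab (refresh x u r - (x + c1 *\<^sub>R gs + r - (\<kappa> * h) *\<^sub>R G y \<omega>, gs - (\<eta> * h) *\<^sub>R G y \<omega>))
    \<le> (h + 1 / sqrt L) * norm (s - u) + h\<^sup>2 / 2 * norm (\<nu> x \<omega>)
      + (h\<^sup>2 + h / sqrt L) * norm (\<nu> xr \<omega> - \<nu> x \<omega>) + (h\<^sup>2 / 2 + h / sqrt L) * norm (\<nu> y \<omega> - \<nu> x \<omega>)
      + (h\<^sup>2 / 12 + \<gamma> * h\<^sup>2 / 32 / sqrt L) * norm (gradient V x)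
      + (h\<^sup>2 / 2 * L + h * sqrt L) * norm A + (h * (L * h\<^sup>2 / 2) + sqrt L * h\<^sup>2 / 2) * speed x v"
proof -
  let ?f = "gradient V"
  define X where "X = fst (pot.flow h1 (x, v))"
  define Y where "Y = snd (pot.flow h1 (x, v))"
  define err1 where "err1 = X - x - h1 *\<^sub>R v + (h1\<^sup>2 / 2) *\<^sub>R ?f x"
  define err2 where "err2 = Y - v + h1 *\<^sub>R ?f x"
  define B where "B = L * h\<^sup>2 / 2 * speed x v"
  have h1: "0 < h1" "c1 / h1 \<le> 1" "0 \<le> c1 / h1" using h1_bounds c1_bounds by auto
  have err: "norm err1 \<le> h * B" "norm err2 \<le> B"
    unfolding err1_def err2_def X_def Y_def B_def by (rule flow_h1_bounds)+
  have B0: "0 \<le> B" using err(2) norm_ge_zero order_trans by blast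
  have fA: "norm (?f y - ?f x) \<le> L * norm A" using pot.lipschitz[of y x] by (simp add: y_def)
  have sL: "0 < sqrt L" using L_pos by simp
  have hv: "h1 *\<^sub>R v = c1 *\<^sub>R u + r" using h1 by (simp add: v_def)
  have Gy: "G y \<omega> = ?f y - \<nu> y \<omega>" by (simp add: \<nu>_def)
  have cv: "(c1 / h1) *\<^sub>R (h1 *\<^sub>R ?f x) = c1 *\<^sub>R ?f x" using h1 by simp
  define dx where "dx = X - (x + c1 *\<^sub>R gs + r - (\<kappa> * h) *\<^sub>R G y \<omega>)"
  define dv where "dv = u + (c1 / h1) *\<^sub>R (Y - v) - (gs - (\<eta> * h) *\<^sub>R G y \<omega>)"
  \<comment> \<open>The noise enters the position directly with weight \<open>\<kappa> * h\<close>
    and through \<open>s\<close> with weight \<open>c1 * \<eta> * h\<close>, with opposite signs;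
    \<open>noise_weight\<close> bounds the coefficient of \<open>\<nu> x \<omega>\<close> that
    survives.\<close>
  have dx: "dx = err1 + c1 *\<^sub>R (u - s) + (c1 * \<eta> * h - \<kappa> * h) *\<^sub>R \<nu> x \<omega> + (c1 * \<eta> * h) *\<^sub>R (\<nu> xr \<omega> - \<nu> x \<omega>)
      + (- (\<kappa> * h)) *\<^sub>R (\<nu> y \<omega> - \<nu> x \<omega>) + (\<kappa> * h - h1\<^sup>2 / 2) *\<^sub>R ?f x + (\<kappa> * h) *\<^sub>R (?f y - ?f x)"
  proof -
    have "X = err1 + x + (c1 *\<^sub>R u + r) - (h1\<^sup>2 / 2) *\<^sub>R ?f x" by (simp add: err1_def hv)
    then show ?thesis unfolding dx_def s_def Gy by (simp add: algebra_simps)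
  qed
  \<comment> \<open>The term \<open>\<nu> x \<omega>\<close> cancels completely, because
    \<open>s\<close> already carries it: of the noise, only its increments keep weight
    \<open>\<eta> * h\<close> in the velocity. The final 0 pads the sum to the seven terms of
    \<open>norm_add7\<close>.\<close>
  have dv: "dv = (c1 / h1) *\<^sub>R err2 + (u - s) + (\<eta> * h) *\<^sub>R (\<nu> xr \<omega> - \<nu> x \<omega>) + (- (\<eta> * h)) *\<^sub>R (\<nu> y \<omega> - \<nu> x \<omega>)
      + (\<eta> * h - c1) *\<^sub>R ?f x + (\<eta> * h) *\<^sub>R (?f y - ?f x) + 0"
  proof -
    have "(c1 / h1) *\<^sub>R (Y - v) = (c1 / h1) *\<^sub>R err2 - c1 *\<^sub>R ?f x"
      unfolding err2_def scaleR_add_right cv by simp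
    then show ?thesis unfolding dv_def s_def Gy by (simp add: algebra_simps)
  qed
  have k: "\<bar>c1 * \<eta> * h - \<kappa> * h\<bar> \<le> h\<^sup>2 / 2" "\<bar>\<kappa> * h - h1\<^sup>2 / 2\<bar> \<le> h\<^sup>2 / 12" "\<bar>\<eta> * h - c1\<bar> \<le> \<gamma> * h\<^sup>2 / 32"
    using noise_weight h1_mismatch c1_mismatch by (auto simp: abs_minus_commute)
  have k2: "\<bar>c1\<bar> \<le> h" "\<bar>c1 * \<eta> * h\<bar> \<le> h\<^sup>2" "\<bar>\<kappa> * h\<bar> \<le> h\<^sup>2 / 2" "\<bar>\<eta> * h\<bar> \<le> h"
  proof -
    show c: "\<bar>c1\<bar> \<le> h" using c1_bounds by simp
    show e: "\<bar>\<eta> * h\<bar> \<le> h" using \<eta>_bounds h by simp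
    have "c1 * (\<eta> * h) \<le> h * h" using c1_bounds \<eta>_bounds h by (intro mult_mono) auto
    then show "\<bar>c1 * \<eta> * h\<bar> \<le> h\<^sup>2" using c1_bounds \<eta>_bounds h by (simp add: power2_eq_square mult.assoc)
    have "\<kappa> * h \<le> h / 2 * h" using \<kappa>_bounds h by (intro mult_right_mono) auto
    then show "\<bar>\<kappa> * h\<bar> \<le> h\<^sup>2 / 2" using \<kappa>_bounds h by (simp add: power2_eq_square)
  qed
  have us: "norm (u - s) = norm (s - u)" by (rule norm_minus_commute)
  have "norm dx \<le> norm err1 + \<bar>c1\<bar> * norm (s - u) + \<bar>c1 * \<eta> * h - \<kappa> * h\<bar> * norm (\<nu> x \<omega>)
      + \<bar>c1 * \<eta> * h\<bar> * norm (\<nu> xr \<omega> - \<nu> x \<omega>) + \<bar>\<kappa> * h\<bar> * norm (\<nu> y \<omega> - \<nu> x \<omega>)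
      + \<bar>\<kappa> * h - h1\<^sup>2 / 2\<bar> * norm (?f x) + \<bar>\<kappa> * h\<bar> * norm (?f y - ?f x)"
    unfolding dx by (rule order_trans[OF norm_add7]) (simp add: us)
  also have "\<dots> \<le> h * B + h * norm (s - u) + h\<^sup>2 / 2 * norm (\<nu> x \<omega>) + h\<^sup>2 * norm (\<nu> xr \<omega> - \<nu> x \<omega>)
      + h\<^sup>2 / 2 * norm (\<nu> y \<omega> - \<nu> x \<omega>) + h\<^sup>2 / 12 * norm (?f x) + h\<^sup>2 / 2 * (L * norm A)"
    using err fA k k2 by (intro add_mono mult_right_mono mult_mono) auto
  finally have ndx: "norm dx \<le> h * B + h * norm (s - u) + h\<^sup>2 / 2 * norm (\<nu> x \<omega>) + h\<^sup>2 * norm (\<nu> xr \<omega> - \<nu> x \<omega>)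
      + h\<^sup>2 / 2 * norm (\<nu> y \<omega> - \<nu> x \<omega>) + h\<^sup>2 / 12 * norm (?f x) + h\<^sup>2 / 2 * (L * norm A)" .
  have "norm dv \<le> c1 / h1 * norm err2 + norm (s - u) + \<bar>\<eta> * h\<bar> * norm (\<nu> xr \<omega> - \<nu> x \<omega>)
      + \<bar>\<eta> * h\<bar> * norm (\<nu> y \<omega> - \<nu> x \<omega>) + \<bar>\<eta> * h - c1\<bar> * norm (?f x) + \<bar>\<eta> * h\<bar> * norm (?f y - ?f x) + 0"
    unfolding dv using h1 c1_bounds by (intro order_trans[OF norm_add7]) (simp add: us)
  also have "\<dots> \<le> 1 * B + norm (s - u) + h * norm (\<nu> xr \<omega> - \<nu> x \<omega>)
      + h * norm (\<nu> y \<omega> - \<nu> x \<omega>) + \<gamma> * h\<^sup>2 / 32 * norm (?f x) + h * (L * norm A) + 0"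
  proof -
    have "c1 / h1 * norm err2 \<le> 1 * B" by (intro mult_mono h1 err B0 norm_ge_zero) simp
    moreover have "\<bar>\<eta> * h\<bar> * norm (\<nu> xr \<omega> - \<nu> x \<omega>) \<le> h * norm (\<nu> xr \<omega> - \<nu> x \<omega>)"
      "\<bar>\<eta> * h\<bar> * norm (\<nu> y \<omega> - \<nu> x \<omega>) \<le> h * norm (\<nu> y \<omega> - \<nu> x \<omega>)"
      by (intro mult_right_mono k2 norm_ge_zero)+
    moreover have "\<bar>\<eta> * h - c1\<bar> * norm (?f x) \<le> \<gamma> * h\<^sup>2 / 32 * norm (?f x)"
      by (intro mult_right_mono k norm_ge_zero)
    moreover have "\<bar>\<eta> * h\<bar> * norm (?f y - ?f x) \<le> h * (L * norm A)"
      using h by (intro mult_mono k2 fA norm_ge_zero) simp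
    ultimately show ?thesis by linarith
  qed
  finally have ndv: "norm dv \<le> B + norm (s - u) + h * norm (\<nu> xr \<omega> - \<nu> x \<omega>)
      + h * norm (\<nu> y \<omega> - \<nu> x \<omega>) + \<gamma> * h\<^sup>2 / 32 * norm (?f x) + h * (L * norm A)" by simp
  have "refresh x u r - (x + c1 *\<^sub>R gs + r - (\<kappa> * h) *\<^sub>R G y \<omega>, gs - (\<eta> * h) *\<^sub>R G y \<omega>) = (dx, dv)"
    by (simp add: refresh_def Let_def v_def[symmetric] dx_def dv_def X_def Y_def)
  then have "nab (refresh x u r - (x + c1 *\<^sub>R gs + r - (\<kappa> * h) *\<^sub>R G y \<omega>, gs - (\<eta> * h) *\<^sub>R G y \<omega>)) \<le> norm dx + norm dv / sqrt L"
    using nab_le[of dx dv] by simp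
  also have "\<dots> \<le> (h * B + h * norm (s - u) + h\<^sup>2 / 2 * norm (\<nu> x \<omega>) + h\<^sup>2 * norm (\<nu> xr \<omega> - \<nu> x \<omega>)
      + h\<^sup>2 / 2 * norm (\<nu> y \<omega> - \<nu> x \<omega>) + h\<^sup>2 / 12 * norm (?f x) + h\<^sup>2 / 2 * (L * norm A))
      + (B + norm (s - u) + h * norm (\<nu> xr \<omega> - \<nu> x \<omega>)
      + h * norm (\<nu> y \<omega> - \<nu> x \<omega>) + \<gamma> * h\<^sup>2 / 32 * norm (?f x) + h * (L * norm A)) / sqrt L"
    using ndx ndv sL by (intro add_mono divide_right_mono) auto
  also have "\<dots> = (h + 1 / sqrt L) * norm (s - u) + h\<^sup>2 / 2 * norm (\<nu> x \<omega>)
      + (h\<^sup>2 + h / sqrt L) * norm (\<nu> xr \<omega> - \<nu> x \<omega>) + (h\<^sup>2 / 2 + h / sqrt L) * norm (\<nu> y \<omega> - \<nu> x \<omega>)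
      + (h\<^sup>2 / 12 + \<gamma> * h\<^sup>2 / 32 / sqrt L) * norm (?f x)
      + (h\<^sup>2 / 2 * L + h * (L / sqrt L)) * norm A + (h + 1 / sqrt L) * B"
    by (simp add: add_divide_distrib distrib_right)
  also have "L / sqrt L = sqrt L" using L_pos by (simp add: real_div_sqrt)
  also have "(h + 1 / sqrt L) * B = (h * (L * h\<^sup>2 / 2) + (L / sqrt L) * h\<^sup>2 / 2) * speed x v"
    by (simp add: B_def distrib_right)
  also have "L / sqrt L = sqrt L" using L_pos by (simp add: real_div_sqrt)
  finally show ?thesis .
qed

end

context sg_coupling
begin

abbreviation zA where "zA w \<equiv> fst (fst w)"
abbreviation zB where "zB w \<equiv> snd (fst w)"
abbreviation nn where "nn w \<equiv> fst (snd w)"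

section \<open>The improved first component has the target law\<close>

lemma flow_h1_measurable [measurable]: "pot.flow h1 \<in> borel_measurable borel"
  using h1_bounds c1_bounds by (intro pot.flow_measurable) auto

lemma refresh_measurable [measurable]:
  assumes [measurable]: "a \<in> borel_measurable N" "b \<in> borel_measurable N" "c \<in> borel_measurable N"
  shows "(\<lambda>w. refresh (a w) (b w) (c w)) \<in> borel_measurable N"
proof -
  define v where "v w = (1 / h1) *\<^sub>R (c1 *\<^sub>R b w + c w)" for w
  have [measurable]: "v \<in> borel_measurable N" unfolding v_def by measurable
  define z where "z w = pot.flow h1 (a w, v w)" for w
  have [measurable]: "z \<in> borel_measurable N" unfolding z_def by (rule measurable_compose[OF _ flow_h1_measurable]) measurable
  have "refresh (a w) (b w) (c w) = (fst (z w), b w + (c1 / h1) *\<^sub>R (snd (z w) - v w))" for w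
    by (simp add: refresh_def Let_def z_def v_def)
  then show ?thesis by simp
qed

definition Z1 where "Z1 w = refresh (fst (zA w)) (Vs w) (gR (zA w) (nn w))"

lemma Z1_measurable [measurable]: "Z1 \<in> borel_measurable M"
  unfolding Z1_def by measurable

text \<open>The partner and the residual are resampled into \<open>a\<close> and \<open>b\<close>,
  the flow moves the start position together with \<open>a\<close> and preserves the target, and the
  inverse resampling returns a standard Gaussian velocity independent of the new position.\<close>

lemma nn_integral_Z1:
  assumes F[measurable]: "F \<in> borel_measurable borel"
  shows "(\<integral>\<^sup>+ w. F (Z1 w) \<partial>M) = (\<integral>\<^sup>+ z. F z \<partial>target V)"
proof -
  define \<rho> where "\<rho> = c1 / h1"
  define \<sigma> where "\<sigma> = sR / h1"
  have "(\<lambda>q. F (refresh (fst q) (fst (snd q)) (snd (snd q)))) \<in> borel_measurable (borel \<Otimes>\<^sub>M borel \<Otimes>\<^sub>M borel)"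
    by (rule measurable_compose[OF _ F]) measurable
  from nn_integral_M_marginal[OF this]
  have "(\<integral>\<^sup>+ w. F (Z1 w) \<partial>M) = (\<integral>\<^sup>+ x. \<integral>\<^sup>+ u. \<integral>\<^sup>+ r. F (refresh x u (sR *\<^sub>R r)) \<partial>gauss \<partial>gauss \<partial>gibbs V)"
    by (simp add: Z1_def)
  also have "\<dots> = (\<integral>\<^sup>+ x. \<integral>\<^sup>+ a. \<integral>\<^sup>+ b. F (fst (pot.flow h1 (x, a)), \<rho> *\<^sub>R snd (pot.flow h1 (x, a)) - \<sigma> *\<^sub>R b) \<partial>gauss \<partial>gauss \<partial>gibbs V)"
  proof (rule nn_integral_cong)
    fix x
    define Q where "Q u a = F (fst (pot.flow h1 (x, a)), u + \<rho> *\<^sub>R (snd (pot.flow h1 (x, a)) - a))" for u a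
    have [measurable]: "(\<lambda>w. pot.flow h1 (x, f w)) \<in> borel_measurable N" if [measurable]: "f \<in> borel_measurable N" for f and N :: "'z measure"
      by (rule measurable_compose[OF _ flow_h1_measurable]) measurable
    have Q: "case_prod Q \<in> borel_measurable (borel \<Otimes>\<^sub>M borel)"
      unfolding Q_def case_prod_beta' by (rule measurable_compose[OF _ F]) measurable
    have "(\<integral>\<^sup>+ u. \<integral>\<^sup>+ r. F (refresh x u (sR *\<^sub>R r)) \<partial>gauss \<partial>gauss)
      = (\<integral>\<^sup>+ u. \<integral>\<^sup>+ r. Q u ((1 / h1) *\<^sub>R (c1 *\<^sub>R u + sR *\<^sub>R r)) \<partial>gauss \<partial>gauss)"
      by (simp add: Q_def refresh_def Let_def \<rho>_def)
    also have "\<dots> = (\<integral>\<^sup>+ a. \<integral>\<^sup>+ b. Q (\<rho> *\<^sub>R a - \<sigma> *\<^sub>R b) a \<partial>gauss \<partial>gauss)"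
      unfolding \<rho>_def \<sigma>_def by (rule nn_integral_resample[OF Q])
    also have "\<dots> = (\<integral>\<^sup>+ a. \<integral>\<^sup>+ b. F (fst (pot.flow h1 (x, a)), \<rho> *\<^sub>R snd (pot.flow h1 (x, a)) - \<sigma> *\<^sub>R b) \<partial>gauss \<partial>gauss)"
      by (simp add: Q_def algebra_simps)
    finally show "(\<integral>\<^sup>+ u. \<integral>\<^sup>+ r. F (refresh x u (sR *\<^sub>R r)) \<partial>gauss \<partial>gauss)
      = (\<integral>\<^sup>+ a. \<integral>\<^sup>+ b. F (fst (pot.flow h1 (x, a)), \<rho> *\<^sub>R snd (pot.flow h1 (x, a)) - \<sigma> *\<^sub>R b) \<partial>gauss \<partial>gauss)" .
  qed
  also have "\<dots> = (\<integral>\<^sup>+ z. \<integral>\<^sup>+ b. F (fst (pot.flow h1 z), \<rho> *\<^sub>R snd (pot.flow h1 z) - \<sigma> *\<^sub>R b) \<partial>gauss \<partial>target V)"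
  proof -
    have "(\<lambda>z. \<integral>\<^sup>+ b. F (fst (pot.flow h1 z), \<rho> *\<^sub>R snd (pot.flow h1 z) - \<sigma> *\<^sub>R b) \<partial>gauss) \<in> borel_measurable borel"
      by (intro std_gauss.borel_measurable_nn_integral) (unfold case_prod_beta', rule measurable_compose[OF _ F], measurable)
    from pot.nn_integral_target[OF this] show ?thesis by simp
  qed
  also have "\<dots> = (\<integral>\<^sup>+ z. \<integral>\<^sup>+ b. F (fst z, \<rho> *\<^sub>R snd z - \<sigma> *\<^sub>R b) \<partial>gauss \<partial>distr (target V) borel (pot.flow h1))"
  proof -
    have 1: "(\<lambda>z. \<integral>\<^sup>+ b. F (fst z, \<rho> *\<^sub>R snd z - \<sigma> *\<^sub>R b) \<partial>gauss) \<in> borel_measurable borel"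
      by (intro std_gauss.borel_measurable_nn_integral) (unfold case_prod_beta', rule measurable_compose[OF _ F], measurable)
    have "pot.flow h1 \<in> measurable (target V) borel" by (simp add: measurable_cong_sets[OF pot.sets_target refl])
    then show ?thesis using 1 by (subst nn_integral_distr) simp_all
  qed
  also have "distr (target V) borel (pot.flow h1) = target V"
    using h1_bounds c1_bounds by (intro pot.target_flow_invariant pot.prob_space_target) auto
  also have "(\<integral>\<^sup>+ z. \<integral>\<^sup>+ b. F (fst z, \<rho> *\<^sub>R snd z - \<sigma> *\<^sub>R b) \<partial>gauss \<partial>target V)
    = (\<integral>\<^sup>+ x. \<integral>\<^sup>+ a. \<integral>\<^sup>+ b. F (x, \<rho> *\<^sub>R a - \<sigma> *\<^sub>R b) \<partial>gauss \<partial>gauss \<partial>gibbs V)"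
  proof -
    have "(\<lambda>z. \<integral>\<^sup>+ b. F (fst z, \<rho> *\<^sub>R snd z - \<sigma> *\<^sub>R b) \<partial>gauss) \<in> borel_measurable borel"
      by (intro std_gauss.borel_measurable_nn_integral) (unfold case_prod_beta', rule measurable_compose[OF _ F], measurable)
    from pot.nn_integral_target[OF this] show ?thesis by simp
  qed
  also have "\<dots> = (\<integral>\<^sup>+ x. \<integral>\<^sup>+ u. F (x, u) \<partial>gauss \<partial>gibbs V)"
  proof (rule nn_integral_cong)
    fix x
    have "case_prod (\<lambda>u a :: real ^ 'd. F (x, u)) \<in> borel_measurable (borel \<Otimes>\<^sub>M borel)"
      unfolding case_prod_beta' by (rule measurable_compose[OF _ F]) measurable
    from nn_integral_resample[OF this] show "(\<integral>\<^sup>+ a. \<integral>\<^sup>+ b. F (x, \<rho> *\<^sub>R a - \<sigma> *\<^sub>R b) \<partial>gauss \<partial>gauss) = (\<integral>\<^sup>+ u. F (x, u) \<partial>gauss)"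
      unfolding \<rho>_def \<sigma>_def by (simp add: std_gauss.emeasure_space_1[simplified])
  qed
  also have "\<dots> = (\<integral>\<^sup>+ z. F z \<partial>target V)" by (rule pot.nn_integral_target[symmetric, OF F])
  finally show ?thesis .
qed

end

section \<open>Moment bounds along the coupling\<close>

lemma lp_norm_add_le:
  assumes "p \<in> {1, 2}" "f \<in> borel_measurable M" "g \<in> borel_measurable M" "lp_norm p M f \<le> A" "lp_norm p M g \<le> B"
  shows "lp_norm p M (\<lambda>x. f x + g x) \<le> A + B"
  using lp_norm_add[OF assms(1-3)] assms(4,5) by (meson add_mono order_trans)

lemma lp_norm_cmult_le:
  assumes "p \<in> {1, 2}" "f \<in> borel_measurable M" "lp_norm p M f \<le> A"
  shows "lp_norm p M (\<lambda>x. c * f x) \<le> c * A"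
proof -
  have "0 < p" using assms by auto
  then show ?thesis using lp_norm_cmult[OF _ assms(2)] assms(3) by (simp add: mult_left_mono)
qed

context sg_coupling
begin

lemma nn_integral_M_start:
  assumes F: "F \<in> borel_measurable borel"
  shows "(\<integral>\<^sup>+ w. F (zA w) \<partial>M) = (\<integral>\<^sup>+ z. F z \<partial>target V)"
proof -
  have "(\<lambda>q. F (fst q)) \<in> borel_measurable (borel \<Otimes>\<^sub>M noise)"
    by (rule measurable_compose[OF _ F]) measurable
  from nn_integral_M_first[OF this] show ?thesis
    by (simp add: prob_space.emeasure_space_1[OF prob_space_noise] pot.nn_integral_target[OF F])
qed

lemma lp_norm_start: "F \<in> borel_measurable borel \<Longrightarrow> lp_norm q M (\<lambda>w. F (zA w)) = lp_norm q (target V) F"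
  using nn_integral_M_start[of "\<lambda>z. F z ^ q"] by (simp add: lp_norm_def)

lemma lp2_force: "lp_norm 2 M (\<lambda>w. ennreal (norm (gradient V (fst (zA w))))) \<le> ennreal (5 * sqrt L * sqrt (CARD('d)))"
proof -
  have "lp_norm 2 M (\<lambda>w. ennreal (norm (gradient V (fst (zA w))))) = lp_norm 2 (target V) (\<lambda>z. ennreal (norm (gradient V (fst z))))"
    by (rule lp_norm_start[of "\<lambda>z. ennreal (norm (gradient V (fst z)))"]) measurable
  then show ?thesis using pot.lp2_gradient by simp
qed

text \<open>The velocity from which \<open>refresh\<close> starts the flow, named so that the speed
  bound in the local error can be integrated.\<close>

definition Vp where "Vp w = (1 / h1) *\<^sub>R (c1 *\<^sub>R Vs w + gR (zA w) (nn w))"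

lemma Vp_measurable [measurable]: "Vp \<in> borel_measurable M"
  unfolding Vp_def by measurable

lemma lp2_Vp: "lp_norm 2 M (\<lambda>w. ennreal (norm (Vp w))) \<le> ennreal (sqrt (CARD('d)))"
proof -
  have "(\<lambda>q. ennreal ((norm ((1 / h1) *\<^sub>R (c1 *\<^sub>R fst (snd q) + snd (snd q)))) ^ 2)) \<in> borel_measurable ((borel :: (real ^ 'd) measure) \<Otimes>\<^sub>M borel \<Otimes>\<^sub>M (borel :: (real ^ 'd) measure))"
    by measurable
  from nn_integral_M_marginal[OF this]
  have "(\<integral>\<^sup>+ w. ennreal ((norm (Vp w))\<^sup>2) \<partial>M) = (\<integral>\<^sup>+ x. \<integral>\<^sup>+ u. \<integral>\<^sup>+ r. ennreal ((norm ((1 / h1) *\<^sub>R (c1 *\<^sub>R u + sR *\<^sub>R r)))\<^sup>2) \<partial>gauss \<partial>gauss \<partial>gibbs V)"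
    by (simp only: Vp_def fst_conv snd_conv)
  also have "\<dots> = (\<integral>\<^sup>+ x. \<integral>\<^sup>+ a. \<integral>\<^sup>+ b. ennreal ((norm a)\<^sup>2) \<partial>gauss \<partial>gauss \<partial>gibbs V)"
  proof (rule nn_integral_cong)
    fix x
    have "case_prod (\<lambda>u a :: real ^ 'd. ennreal ((norm a)\<^sup>2)) \<in> borel_measurable ((borel :: (real ^ 'd) measure) \<Otimes>\<^sub>M borel)" by measurable
    from nn_integral_resample[OF this]
    show "(\<integral>\<^sup>+ u. \<integral>\<^sup>+ r. ennreal ((norm ((1 / h1) *\<^sub>R (c1 *\<^sub>R u + sR *\<^sub>R r)))\<^sup>2) \<partial>gauss \<partial>gauss)
      = (\<integral>\<^sup>+ a. \<integral>\<^sup>+ b. ennreal ((norm a)\<^sup>2) \<partial>gauss \<partial>gauss)" .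
  qed
  also have "\<dots> = ennreal (CARD('d))"
    by (simp add: std_gauss.emeasure_space_1[simplified] nn_integral_std_gaussian_norm_sq pot.\<pi>.emeasure_space_1)
  finally have "(\<integral>\<^sup>+ w. ennreal (norm (Vp w)) ^ 2 \<partial>M) \<le> ennreal (sqrt (CARD('d))) ^ 2"
    by (simp add: ennreal_power)
  then show ?thesis by (simp only: lp_norm_le_iff[OF zero_less_numeral])
qed

lemma nn_integral_M_half:
  assumes F: "F \<in> borel_measurable (borel \<Otimes>\<^sub>M borel \<Otimes>\<^sub>M borel \<Otimes>\<^sub>M \<Gamma>)"
  shows "(\<integral>\<^sup>+ w. F (zA w, fst (nn w), fst (snd (nn w)), om (nn w)) \<partial>M)
    = (\<integral>\<^sup>+ x. \<integral>\<^sup>+ v. \<integral>\<^sup>+ \<xi>1. \<integral>\<^sup>+ \<xi>2. \<integral>\<^sup>+ \<omega>. F ((x, v), \<xi>1, \<xi>2, \<omega>) \<partial>\<Gamma> \<partial>gauss \<partial>gauss \<partial>gauss \<partial>gibbs V)"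
proof -
  have n[measurable]: "snd \<in> measurable ((borel :: ((real ^ 'd) \<times> (real ^ 'd)) measure) \<Otimes>\<^sub>M noise) (borel \<Otimes>\<^sub>M borel \<Otimes>\<^sub>M borel \<Otimes>\<^sub>M borel \<Otimes>\<^sub>M \<Gamma>)"
    using measurable_snd by (simp only: measurable_cong_sets[OF refl sets_noise[symmetric]])
  have F': "(\<lambda>q. F (fst q, fst (snd q), fst (snd (snd q)), om (snd q))) \<in> borel_measurable (borel \<Otimes>\<^sub>M noise)"
    by (rule measurable_compose[OF _ F]) measurable
  have sec: "(\<lambda>n. F (z, fst n, fst (snd n), om n)) \<in> borel_measurable noise" for z
    using measurable_compose[OF measurable_Pair1' F', of z] by simp
  have inner: "(\<integral>\<^sup>+ n. F ((x, v), fst n, fst (snd n), om n) \<partial>noise)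
      = (\<integral>\<^sup>+ \<xi>1. \<integral>\<^sup>+ \<xi>2. \<integral>\<^sup>+ \<omega>. F ((x, v), \<xi>1, \<xi>2, \<omega>) \<partial>\<Gamma> \<partial>gauss \<partial>gauss)" for x v
    by (subst nn_integral_noise[OF sec]) (simp add: om_def std_gauss.emeasure_space_1[simplified])
  show ?thesis
    using nn_integral_M_first[OF F'] by (simp add: inner)
qed

lemma lp2_half: "lp_norm 2 M (\<lambda>w. ennreal (norm (gA (zA w) (nn w)))) \<le> ennreal (h / 2 * sqrt (CARD('d)))"
proof -
  have "(\<lambda>q. ennreal ((norm (half_gauss (snd (fst q)) (fst (snd q)) (fst (snd (snd q)))))\<^sup>2))
    \<in> borel_measurable ((borel :: ((real ^ 'd) \<times> (real ^ 'd)) measure) \<Otimes>\<^sub>M borel \<Otimes>\<^sub>M borel \<Otimes>\<^sub>M \<Gamma>)" by measurable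
  from nn_integral_M_half[OF this]
  have "(\<integral>\<^sup>+ w. ennreal ((norm (gA (zA w) (nn w)))\<^sup>2) \<partial>M)
    = (\<integral>\<^sup>+ x. \<integral>\<^sup>+ v. \<integral>\<^sup>+ \<xi>1. \<integral>\<^sup>+ \<xi>2. ennreal ((norm (half_gauss v \<xi>1 \<xi>2 :: real ^ 'd))\<^sup>2) \<partial>gauss \<partial>gauss \<partial>gauss \<partial>gibbs V)"
    by (simp add: gA_def \<Gamma>.emeasure_space_1)
  also have "\<dots> \<le> (\<integral>\<^sup>+ x. ennreal ((h / 2)\<^sup>2 * CARD('d)) \<partial>gibbs V)"
    by (intro nn_integral_mono nn_integral_half_gauss)
  also have "\<dots> = ennreal (h / 2 * sqrt (CARD('d))) ^ 2"
    using h by (simp add: pot.\<pi>.emeasure_space_1 ennreal_power power_mult_distrib power_divide)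
  finally have "(\<integral>\<^sup>+ w. ennreal (norm (gA (zA w) (nn w))) ^ 2 \<partial>M) \<le> ennreal (h / 2 * sqrt (CARD('d))) ^ 2"
    by (simp add: ennreal_power)
  then show ?thesis by (simp only: lp_norm_le_iff[OF zero_less_numeral])
qed

lemma lp_noise: "lp_norm p M (\<lambda>w. ennreal (norm (\<nu> (fst (zA w)) (om (nn w))))) = gradient_noise p V G \<Gamma>"
proof -
  have "(\<lambda>q. ennreal (norm (\<nu> (fst (fst q)) (snd (snd (snd q))))) ^ p)
    \<in> borel_measurable ((borel :: ((real ^ 'd) \<times> (real ^ 'd)) measure) \<Otimes>\<^sub>M (borel :: (real ^ 'd) measure) \<Otimes>\<^sub>M (borel :: (real ^ 'd) measure) \<Otimes>\<^sub>M \<Gamma>)" by measurable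
  from nn_integral_M_half[OF this]
  have "(\<integral>\<^sup>+ w. ennreal (norm (\<nu> (fst (zA w)) (om (nn w)))) ^ p \<partial>M) = (\<integral>\<^sup>+ x. \<integral>\<^sup>+ \<omega>. ennreal (norm (\<nu> x \<omega>)) ^ p \<partial>\<Gamma> \<partial>gibbs V)"
    by (simp add: std_gauss.emeasure_space_1[simplified])
  also have "\<dots> = (\<integral>\<^sup>+ (x, \<omega>). ennreal (norm (G x \<omega> - gradient V x) ^ p) \<partial>(target_marginal V \<Otimes>\<^sub>M \<Gamma>))"
    unfolding pot.target_marginal_eq
    by (subst nn_integral_pair[OF \<Gamma>.prob_space_axioms])
       (auto simp: case_prod_beta' \<nu>_def ennreal_power norm_minus_commute)
  finally show ?thesis by (simp add: lp_norm_def gradient_noise_def)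
qed

text \<open>The displaced point \<open>Y\<close> depends on the start and the first two Gaussians
  but not on \<omega>, so \<omega> can be integrated first, with both points fixed, where
  \<open>jacobian_variance_lipschitz\<close> applies.\<close>

lemma lp2_noise_diff:
  assumes Y[measurable]: "(\<lambda>q. Y (fst q) (fst (snd q)) (snd (snd q))) \<in> borel_measurable (borel \<Otimes>\<^sub>M borel \<Otimes>\<^sub>M borel)"
    and bound: "lp_norm 2 M (\<lambda>w. ennreal (norm (Y (zA w) (fst (nn w)) (fst (snd (nn w))) - fst (zA w)))) \<le> ennreal B" and B: "0 \<le> B"
  shows "lp_norm 2 M (\<lambda>w. ennreal (norm (\<nu> (Y (zA w) (fst (nn w)) (fst (snd (nn w)))) (om (nn w)) - \<nu> (fst (zA w)) (om (nn w)))))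
    \<le> ennreal (sqrt C * B)"
proof -
  have Ym[measurable]: "(\<lambda>q. Y (a q) (b q) (c q)) \<in> borel_measurable N"
    if [measurable]: "a \<in> borel_measurable N" "b \<in> borel_measurable N" "c \<in> borel_measurable N" for a b c and N :: "'z measure"
    using measurable_compose[OF measurable_Pair[OF that(1) measurable_Pair[OF that(2,3)]] Y] by simp
  have 1: "(\<lambda>q. ennreal ((norm (\<nu> (Y (fst q) (fst (snd q)) (fst (snd (snd q)))) (snd (snd (snd q))) - \<nu> (fst (fst q)) (snd (snd (snd q)))))\<^sup>2))
    \<in> borel_measurable (borel \<Otimes>\<^sub>M borel \<Otimes>\<^sub>M borel \<Otimes>\<^sub>M \<Gamma>)" by measurable
  have 2: "(\<lambda>q. ennreal (C * (norm (Y (fst q) (fst (snd q)) (fst (snd (snd q))) - fst (fst q)))\<^sup>2))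
    \<in> borel_measurable (borel \<Otimes>\<^sub>M borel \<Otimes>\<^sub>M borel \<Otimes>\<^sub>M \<Gamma>)" by measurable
  have "(\<integral>\<^sup>+ w. ennreal ((norm (\<nu> (Y (zA w) (fst (nn w)) (fst (snd (nn w)))) (om (nn w)) - \<nu> (fst (zA w)) (om (nn w))))\<^sup>2) \<partial>M)
    = (\<integral>\<^sup>+ x. \<integral>\<^sup>+ v. \<integral>\<^sup>+ \<xi>1. \<integral>\<^sup>+ \<xi>2. \<integral>\<^sup>+ \<omega>. ennreal ((norm (\<nu> (Y (x, v) \<xi>1 \<xi>2) \<omega> - \<nu> x \<omega>))\<^sup>2) \<partial>\<Gamma> \<partial>gauss \<partial>gauss \<partial>gauss \<partial>gibbs V)"
    using nn_integral_M_half[OF 1] by simp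
  also have "\<dots> \<le> (\<integral>\<^sup>+ x. \<integral>\<^sup>+ v. \<integral>\<^sup>+ \<xi>1. \<integral>\<^sup>+ \<xi>2. ennreal (C * (norm (Y (x, v) \<xi>1 \<xi>2 - x))\<^sup>2) \<partial>gauss \<partial>gauss \<partial>gauss \<partial>gibbs V)"
    unfolding \<nu>_def by (intro nn_integral_mono jacobian_variance_lipschitz[OF C2 sg C jac])
  also have "\<dots> = (\<integral>\<^sup>+ w. ennreal (C * (norm (Y (zA w) (fst (nn w)) (fst (snd (nn w))) - fst (zA w)))\<^sup>2) \<partial>M)"
    using nn_integral_M_half[OF 2] by (simp add: \<Gamma>.emeasure_space_1)
  also have "\<dots> = (\<integral>\<^sup>+ w. ennreal C * ennreal (norm (Y (zA w) (fst (nn w)) (fst (snd (nn w))) - fst (zA w))) ^ 2 \<partial>M)"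
    using C by (simp add: ennreal_power ennreal_mult)
  also have "\<dots> = ennreal C * (lp_norm 2 M (\<lambda>w. ennreal (norm (Y (zA w) (fst (nn w)) (fst (snd (nn w))) - fst (zA w)))))\<^sup>2"
  proof -
    have n[measurable]: "(\<lambda>w. nn w) \<in> measurable M (borel \<Otimes>\<^sub>M borel \<Otimes>\<^sub>M borel \<Otimes>\<^sub>M borel \<Otimes>\<^sub>M \<Gamma>)"
      using M_measurable(3) by (simp only: measurable_cong_sets[OF refl sets_noise])
    show ?thesis unfolding lp_norm_power[OF zero_less_numeral] by (rule nn_integral_cmult) measurable
  qed
  also have "\<dots> \<le> ennreal C * (ennreal B)\<^sup>2"
    using bound by (intro mult_left_mono power_mono) auto
  also have "\<dots> = ennreal (sqrt C * B) ^ 2"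
    using C B by (simp add: ennreal_power ennreal_mult[symmetric] power_mult_distrib)
  finally have "(\<integral>\<^sup>+ w. ennreal (norm (\<nu> (Y (zA w) (fst (nn w)) (fst (snd (nn w)))) (om (nn w)) - \<nu> (fst (zA w)) (om (nn w)))) ^ 2 \<partial>M) \<le> ennreal (sqrt C * B) ^ 2"
    by (simp add: ennreal_power)
  then show ?thesis by (simp only: lp_norm_le_iff[OF zero_less_numeral])
qed

lemma lp2_noise_half:
  "lp_norm 2 M (\<lambda>w. ennreal (norm (\<nu> (fst (zA w) + gA (zA w) (nn w)) (om (nn w)) - \<nu> (fst (zA w)) (om (nn w)))))
    \<le> ennreal (sqrt C * (h / 2 * sqrt (CARD('d))))"
proof -
  have "lp_norm 2 M (\<lambda>w. ennreal (norm (fst (zA w) + half_gauss (snd (zA w)) (fst (nn w)) (fst (snd (nn w))) - fst (zA w)))) \<le> ennreal (h / 2 * sqrt (CARD('d)))"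
    using lp2_half by (simp add: gA_def)
  from lp2_noise_diff[OF _ this] show ?thesis using h by (simp add: gA_def)
qed

lemma lp2_noise_cell:
  "lp_norm 2 M (\<lambda>w. ennreal (norm (\<nu> (xr (kx (fst (zA w)))) (om (nn w)) - \<nu> (fst (zA w)) (om (nn w)))))
    \<le> ennreal (sqrt C * \<delta>)"
proof -
  have "lp_norm 2 M (\<lambda>w. ennreal (norm (xr (kx (fst (zA w))) - fst (zA w)))) \<le> lp_norm 2 M (\<lambda>_. ennreal \<delta>)"
  proof (rule lp_norm_mono)
    fix w
    have "norm (xr (kx (fst (zA w))) - fst (zA w)) < \<delta>"
      using xr[of "fst (zA w)"] by (simp add: dist_norm norm_minus_commute)
    then show "ennreal (norm (xr (kx (fst (zA w))) - fst (zA w))) \<le> ennreal \<delta>"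
      by (intro ennreal_leI less_imp_le)
  qed simp
  then have b: "lp_norm 2 M (\<lambda>w. ennreal (norm (xr (kx (fst (zA w))) - fst (zA w)))) \<le> ennreal \<delta>"
    by (simp add: M.lp_norm_const)
  have "(\<lambda>q. xr (kx (fst (fst q)))) \<in> borel_measurable ((borel :: ((real ^ 'd) \<times> (real ^ 'd)) measure) \<Otimes>\<^sub>M (borel :: (real ^ 'd) measure) \<Otimes>\<^sub>M (borel :: (real ^ 'd) measure))"
    by measurable
  from lp2_noise_diff[of "\<lambda>z _ _. xr (kx (fst z))", OF this b] \<delta> show ?thesis by simp
qed

definition J where "J i = lp_norm p (cpl i) (\<lambda>z. ennreal (norm (fst z - snd z)))"

text \<open>Given the position, the pair of perturbed Gaussian and partner follows the cell kernel
  of the coupling chosen at the representative, so its cost is the coupling cost plus one cell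
  diameter.\<close>

lemma lp_partner:
  "lp_norm p M (\<lambda>w. ennreal (norm (S (zA w) (nn w) - Vs w))) \<le> lp_norm p (gibbs V) (\<lambda>x. ennreal \<delta> + J (kx x))"
proof -
  have "(\<lambda>q. ennreal (norm (fst (snd q) - fst (snd (snd q)))) ^ p) \<in> borel_measurable ((borel :: (real ^ 'd) measure) \<Otimes>\<^sub>M (borel :: (real ^ 'd) measure) \<Otimes>\<^sub>M borel \<Otimes>\<^sub>M (borel :: (real ^ 'd) measure))"
    by measurable
  from nn_integral_M_joint[OF this]
  have "(\<integral>\<^sup>+ w. ennreal (norm (S (zA w) (nn w) - Vs w)) ^ p \<partial>M)
    = (\<integral>\<^sup>+ x. \<integral>\<^sup>+ r. \<integral>\<^sup>+ s. \<integral>\<^sup>+ v. ennreal (norm (s - v)) ^ p \<partial>kern (kx x) (ks s) \<partial>perturbed (xr (kx x)) \<partial>gauss \<partial>gibbs V)"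
    by simp
  also have "\<dots> \<le> (\<integral>\<^sup>+ x. (ennreal \<delta> + J (kx x)) ^ p \<partial>gibbs V)"
  proof (rule nn_integral_mono)
    fix x
    let ?c = "cpl (kx x)"
    interpret c: cell_coupling "perturbed (xr (kx x))" gauss ?c ks \<delta> by (rule cell)
    have "(\<integral>\<^sup>+ s. \<integral>\<^sup>+ v. ennreal (norm (s - v)) ^ p \<partial>kern (kx x) (ks s) \<partial>perturbed (xr (kx x)))
      \<le> (\<integral>\<^sup>+ z. (ennreal \<delta> + ennreal (norm (fst z - snd z))) ^ p \<partial>?c)"
      by (rule c.kernel_cost[OF p_pos \<delta>])
    also have "\<dots> \<le> (ennreal \<delta> + J (kx x)) ^ p"
    proof -
      have "lp_norm p ?c (\<lambda>z. ennreal \<delta> + ennreal (norm (fst z - snd z))) \<le> ennreal \<delta> + J (kx x)"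
        unfolding J_def by (rule lp_norm_add_le[OF p]) (simp_all add: c.\<tau>.lp_norm_const p_pos measurable_cong_sets[OF c.sets_\<tau> refl])
      then show ?thesis by (simp only: lp_norm_le_iff[OF p_pos])
    qed
    finally show "(\<integral>\<^sup>+ r. \<integral>\<^sup>+ s. \<integral>\<^sup>+ v. ennreal (norm (s - v)) ^ p \<partial>kern (kx x) (ks s) \<partial>perturbed (xr (kx x)) \<partial>gauss) \<le> (ennreal \<delta> + J (kx x)) ^ p"
      by (simp add: std_gauss.emeasure_space_1[simplified])
  qed
  finally show ?thesis unfolding lp_norm_le_iff[OF p_pos] lp_norm_power[OF p_pos] .
qed

lemma grad_diff: 
  "m * (norm (y - y'))\<^sup>2 \<le> (gradient V y - gradient V y') \<bullet> (y - y')"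
  "(norm (gradient V y - gradient V y'))\<^sup>2 \<le> L * ((gradient V y - gradient V y') \<bullet> (y - y'))"
  by (rule pot.mono, rule pot.cocoercive)

text \<open>For fixed Gaussians the two half-step positions are fixed and only \<omega> is random,
  so \<open>contraction_noise\<close> applies. The resulting bound does not depend on the Gaussians,
  which then integrate to one; for p = 1 the inner integral is first compared with the mean
  square.\<close>

lemma lp_contraction:
  "lp_norm p M (\<lambda>w. ennreal (nab (step (zA w) (nn w) - step (zB w) (nn w))))
    \<le> ennreal (1 - rate C) * lp_norm p \<tau> (\<lambda>zz. ennreal (nab (fst zz - snd zz)))"
proof -
  have r: "0 \<le> 1 - rate C" using rate_le[OF C] by simp
  have F: "(\<lambda>q. ennreal (nab (step (fst (fst q)) (snd q) - step (snd (fst q)) (snd q))) ^ p)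
    \<in> borel_measurable ((borel :: (((real ^ 'd) \<times> (real ^ 'd)) \<times> (real ^ 'd) \<times> (real ^ 'd)) measure) \<Otimes>\<^sub>M noise)" by measurable
  have "(\<integral>\<^sup>+ w. ennreal (nab (step (zA w) (nn w) - step (zB w) (nn w))) ^ p \<partial>M)
    = (\<integral>\<^sup>+ zz. \<integral>\<^sup>+ n. ennreal (nab (step (fst zz) n - step (snd zz) n)) ^ p \<partial>noise \<partial>\<tau>)"
    using nn_integral_M_noise[OF F] by simp
  also have "\<dots> \<le> (\<integral>\<^sup>+ zz. (ennreal (1 - rate C) * ennreal (nab (fst zz - snd zz))) ^ p \<partial>\<tau>)"
  proof (rule nn_integral_mono)
    fix zz :: "((real ^ 'd) \<times> (real ^ 'd)) \<times> (real ^ 'd) \<times> (real ^ 'd)"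
    obtain x v x' v' where zz: "zz = ((x, v), (x', v'))" by (metis surj_pair)
    let ?R = "(ennreal (1 - rate C) * ennreal (nab ((x, v) - (x', v')))) ^ p"
    have m: "(\<lambda>n. ennreal (nab (step (x, v) n - step (x', v') n)) ^ p) \<in> borel_measurable noise" by measurable
    have "(\<integral>\<^sup>+ n. ennreal (nab (step (x, v) n - step (x', v') n)) ^ p \<partial>noise)
      = (\<integral>\<^sup>+ \<xi>1. \<integral>\<^sup>+ \<xi>2. \<integral>\<^sup>+ \<xi>3. \<integral>\<^sup>+ \<xi>4. \<integral>\<^sup>+ \<omega>. ennreal (nab (sg_ubu_step \<gamma> h G (x, v) \<xi>1 \<xi>2 \<xi>3 \<xi>4 \<omega> - sg_ubu_step \<gamma> h G (x', v') \<xi>1 \<xi>2 \<xi>3 \<xi>4 \<omega>)) ^ p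
        \<partial>\<Gamma> \<partial>gauss \<partial>gauss \<partial>gauss \<partial>gauss)"
      by (subst nn_integral_noise[OF m]) (simp add: step_def)
    also have "\<dots> \<le> (\<integral>\<^sup>+ \<xi>1. \<integral>\<^sup>+ \<xi>2. \<integral>\<^sup>+ \<xi>3. \<integral>\<^sup>+ \<xi>4. ?R \<partial>gauss \<partial>gauss \<partial>gauss \<partial>gauss)"
    proof (intro nn_integral_mono)
      fix \<xi>1 \<xi>2 \<xi>3 \<xi>4 :: "real ^ 'd"
      define Y where "Y = x + half_gauss v \<xi>1 \<xi>2"
      define Y' where "Y' = x' + half_gauss v' \<xi>1 \<xi>2"
      define D where "D \<omega> = G Y \<omega> - G Y' \<omega>" for \<omega>
      define q where "q = gradient V Y - gradient V Y'"
      note d = sg_ubu_step_diff[where x=x and x'=x' and v=v and v'=v' and ?\<xi>1.0=\<xi>1 and ?\<xi>2.0=\<xi>2, folded Y_def Y'_def]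
      have gi: "integrable \<Gamma> (G z)" "(\<integral>\<omega>. G z \<omega> \<partial>\<Gamma>) = gradient V z" for z
        using sg by (auto simp: stochastic_gradient_def)
      have D: "integrable \<Gamma> D" "(\<integral>\<omega>. D \<omega> \<partial>\<Gamma>) = q"
        unfolding D_def q_def using gi by (auto intro: Bochner_Integration.integrable_diff simp: Bochner_Integration.integral_diff)
      have var: "(\<integral>\<^sup>+ \<omega>. ennreal ((norm (D \<omega> - q))\<^sup>2) \<partial>\<Gamma>) \<le> ennreal (C * (norm (Y - Y'))\<^sup>2)"
      proof -
        have "norm (D \<omega> - q) = norm ((gradient V Y - G Y \<omega>) - (gradient V Y' - G Y' \<omega>))" for \<omega>
        proof -
          have "D \<omega> - q = - ((gradient V Y - G Y \<omega>) - (gradient V Y' - G Y' \<omega>))" by (simp add: D_def q_def)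
          then show ?thesis by (metis norm_minus_cancel)
        qed
        then show ?thesis using jacobian_variance_lipschitz[OF C2 sg C jac, of Y Y'] by simp
      qed
      have c: "(\<integral>\<^sup>+ \<omega>. ennreal ((nab (sg_ubu_step \<gamma> h G (x, v) \<xi>1 \<xi>2 \<xi>3 \<xi>4 \<omega> - sg_ubu_step \<gamma> h G (x', v') \<xi>1 \<xi>2 \<xi>3 \<xi>4 \<omega>))\<^sup>2) \<partial>\<Gamma>)
        \<le> ennreal (((1 - rate C) * nab (x - x', v - v'))\<^sup>2)"
        unfolding d(2) unfolding d(1) D_def[symmetric]
        by (rule contraction_noise[OF \<Gamma>.prob_space_axioms D _ C])
           (use var grad_diff[of Y Y'] in \<open>simp_all only: d(1) q_def\<close>)
      have mm: "(\<lambda>\<omega>. sg_ubu_step \<gamma> h G z \<xi>1 \<xi>2 \<xi>3 \<xi>4 \<omega>) \<in> borel_measurable \<Gamma>" for z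
        by (cases z) (simp add: sg_ubu_step_eq)
      have "lp_norm p \<Gamma> (\<lambda>\<omega>. ennreal (nab (sg_ubu_step \<gamma> h G (x, v) \<xi>1 \<xi>2 \<xi>3 \<xi>4 \<omega> - sg_ubu_step \<gamma> h G (x', v') \<xi>1 \<xi>2 \<xi>3 \<xi>4 \<omega>)))
        \<le> lp_norm 2 \<Gamma> (\<lambda>\<omega>. ennreal (nab (sg_ubu_step \<gamma> h G (x, v) \<xi>1 \<xi>2 \<xi>3 \<xi>4 \<omega> - sg_ubu_step \<gamma> h G (x', v') \<xi>1 \<xi>2 \<xi>3 \<xi>4 \<omega>)))"
        by (intro \<Gamma>.lp_norm_le_lp_norm_2[OF p] measurable_compose[OF _ measurable_ennreal]
            measurable_compose[OF _ nab_measurable] borel_measurable_diff mm)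
      also have "\<dots> \<le> ennreal (1 - rate C) * ennreal (nab ((x, v) - (x', v')))"
        unfolding lp_norm_le_iff[OF zero_less_numeral] using c r
        by (simp add: ennreal_power ennreal_mult[symmetric])
      finally show "(\<integral>\<^sup>+ \<omega>. ennreal (nab (sg_ubu_step \<gamma> h G (x, v) \<xi>1 \<xi>2 \<xi>3 \<xi>4 \<omega> - sg_ubu_step \<gamma> h G (x', v') \<xi>1 \<xi>2 \<xi>3 \<xi>4 \<omega>)) ^ p \<partial>\<Gamma>) \<le> ?R"
        by (simp only: lp_norm_le_iff[OF p_pos])
    qed
    also have "\<dots> = ?R" by (simp add: std_gauss.emeasure_space_1[simplified])
    finally show "(\<integral>\<^sup>+ n. ennreal (nab (step (fst zz) n - step (snd zz) n)) ^ p \<partial>noise) \<le> (ennreal (1 - rate C) * ennreal (nab (fst zz - snd zz))) ^ p"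
      by (simp only: zz fst_conv snd_conv)
  qed
  finally have "lp_norm p M (\<lambda>w. ennreal (nab (step (zA w) (nn w) - step (zB w) (nn w)))) \<le> lp_norm p \<tau> (\<lambda>zz. ennreal (1 - rate C) * ennreal (nab (fst zz - snd zz)))"
    unfolding lp_norm_le_iff[OF p_pos] lp_norm_power[OF p_pos] .
  also have "\<dots> = ennreal (1 - rate C) * lp_norm p \<tau> (\<lambda>zz. ennreal (nab (fst zz - snd zz)))"
    by (rule lp_norm_cmult[OF p_pos]) measurable
  finally show ?thesis .
qed

end

section \<open>Distance of the invariant measure to the target\<close>

lemma distr_eqI_nn_integral:
  assumes "sets N = sets borel" and X[measurable]: "X \<in> borel_measurable M"
    and int: "\<And>F. F \<in> borel_measurable borel \<Longrightarrow> (\<integral>\<^sup>+ w. F (X w) \<partial>M) = (\<integral>\<^sup>+ x. F x \<partial>N)"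
  shows "distr M borel X = N"
proof (rule measure_eqI)
  show "sets (distr M borel X) = sets N" using assms by simp
  fix A assume "A \<in> sets (distr M borel X)"
  then have A[measurable]: "A \<in> sets borel" by simp
  have "emeasure (distr M borel X) A = (\<integral>\<^sup>+ x. indicator A x \<partial>distr M borel X)" by simp
  also have "\<dots> = (\<integral>\<^sup>+ w. indicator A (X w) \<partial>M)" by (rule nn_integral_distr) measurable
  also have "\<dots> = (\<integral>\<^sup>+ x. indicator A x \<partial>N)" by (rule int) measurable
  also have "\<dots> = emeasure N A" using assms(1) by simp
  finally show "emeasure (distr M borel X) A = emeasure N A" .
qed

type_synonym ('v, 'w) sample = "(('v \<times> 'v) \<times> 'v \<times> 'v) \<times> ('v \<times> 'v \<times> 'v \<times> 'v \<times> 'w) \<times> (nat \<Rightarrow> 'v)"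

context sg_ubu
begin

text \<open>Weights in the local error of, respectively, the mismatch between the perturbed Gaussian and its
  partner, the cell diameter, the change of the gradient noise and of the position over a half step,
  the velocity, and the force.\<close>

definition wS where "wS = h + 1 / sqrt L"
definition wC where "wC = h\<^sup>2 + h / sqrt L"
definition wY where "wY = h\<^sup>2 / 2 + h / sqrt L"
definition wA where "wA = h\<^sup>2 / 2 * L + h * sqrt L"
definition wV where "wV = 64 / 63 * (h * (L * h\<^sup>2 / 2) + sqrt L * h\<^sup>2 / 2)"
definition wF where "wF = h\<^sup>2 / 12 + \<gamma> * h\<^sup>2 / 32 / sqrt L + wV * h"

lemma w_nonneg: "0 \<le> wS" "0 \<le> wC" "0 \<le> wY" "0 \<le> wF" "0 \<le> wA" "0 \<le> wV"
  using h L_pos \<gamma> by (simp_all add: wS_def wC_def wY_def wF_def wA_def wV_def)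

definition step_error where
  "step_error = wY * (sqrt C * (h / 2 * sqrt CARD('d))) + wF * (5 * sqrt L * sqrt CARD('d))
    + wA * (h / 2 * sqrt CARD('d)) + wV * sqrt CARD('d)"

lemma ennreal_step_error:
  "ennreal wY * ennreal (sqrt C * (h / 2 * sqrt CARD('d))) + (ennreal wF * ennreal (5 * sqrt L * sqrt CARD('d))
    + (ennreal wA * ennreal (h / 2 * sqrt CARD('d)) + ennreal wV * ennreal (sqrt CARD('d)))) = ennreal step_error"
proof -
  have B: "0 \<le> sqrt C * (h / 2 * sqrt CARD('d))" "0 \<le> 5 * sqrt L * sqrt CARD('d)"
    "0 \<le> h / 2 * sqrt CARD('d)" "0 \<le> sqrt CARD('d)"
    using h C L_pos by simp_all
  show ?thesis unfolding step_error_def add.assoc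
    by (simp only: ennreal_plus ennreal_mult mult_nonneg_nonneg add_nonneg_nonneg w_nonneg B)
qed

end

context sg_coupling
begin

text \<open>The new coupling pairs \<open>Z1\<close> with the step of the second component.
  Inserting the step of the first component with the same noise, pointwise inside the norm,
  separates the local error from the contraction.\<close>

lemma wasserstein_improvement:
  "wasserstein nab p (target V) \<pi>h
    \<le> ennreal wS * lp_norm p (gibbs V) (\<lambda>x. ennreal \<delta> + J (kx x)) + ennreal (h\<^sup>2 / 2) * gradient_noise p V G \<Gamma>
      + ennreal (wC * (sqrt C * \<delta>)) + ennreal step_error
      + ennreal (1 - rate C) * lp_norm p \<tau> (\<lambda>z. ennreal (nab (fst z - snd z)))"
proof -
  define f1 where "f1 w = norm (S (zA w) (nn w) - Vs w)" for w :: "(real ^ 'd, 'w) sample"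
  define f2 where "f2 w = norm (\<nu> (fst (zA w)) (om (nn w)))" for w :: "(real ^ 'd, 'w) sample"
  define f3 where "f3 w = norm (\<nu> (xr (kx (fst (zA w)))) (om (nn w)) - \<nu> (fst (zA w)) (om (nn w)))" for w :: "(real ^ 'd, 'w) sample"
  define f4 where "f4 w = norm (\<nu> (fst (zA w) + gA (zA w) (nn w)) (om (nn w)) - \<nu> (fst (zA w)) (om (nn w)))" for w :: "(real ^ 'd, 'w) sample"
  define f5 where "f5 w = norm (gradient V (fst (zA w)))" for w :: "(real ^ 'd, 'w) sample"
  define f6 where "f6 w = norm (gA (zA w) (nn w))" for w :: "(real ^ 'd, 'w) sample"
  define f7 where "f7 w = norm (Vp w)" for w :: "(real ^ 'd, 'w) sample"
  define f8 where "f8 w = nab (step (zA w) (nn w) - step (zB w) (nn w))" for w :: "(real ^ 'd, 'w) sample"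
  note f_defs = f1_def f2_def f3_def f4_def f5_def f6_def f7_def f8_def
  have f_nonneg: "0 \<le> f1 w" "0 \<le> f2 w" "0 \<le> f3 w" "0 \<le> f4 w" "0 \<le> f5 w" "0 \<le> f6 w" "0 \<le> f7 w" "0 \<le> f8 w" for w
    by (simp_all add: f_defs)
  have fm[measurable]: "f1 \<in> borel_measurable M" "f2 \<in> borel_measurable M" "f3 \<in> borel_measurable M" "f4 \<in> borel_measurable M"
    "f5 \<in> borel_measurable M" "f6 \<in> borel_measurable M" "f7 \<in> borel_measurable M" "f8 \<in> borel_measurable M"
    unfolding f_defs by measurable
  have Y1[measurable]: "(\<lambda>w. step (zB w) (nn w)) \<in> borel_measurable M" by measurable
  have pw: "ennreal (nab (Z1 w - step (zB w) (nn w))) \<le>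
      ennreal wS * ennreal (f1 w) + (ennreal (h\<^sup>2 / 2) * ennreal (f2 w) + (ennreal wC * ennreal (f3 w)
      + (ennreal wY * ennreal (f4 w) + (ennreal wF * ennreal (f5 w) + (ennreal wA * ennreal (f6 w)
      + (ennreal wV * ennreal (f7 w) + ennreal (f8 w)))))))" for w
  proof -
    have "nab (Z1 w - step (zB w) (nn w)) \<le> nab (Z1 w - step (zA w) (nn w)) + f8 w"
      using nab_triangle[of "Z1 w - step (zA w) (nn w)" "step (zA w) (nn w) - step (zB w) (nn w)"]
      by (simp add: f8_def)
    moreover have "nab (Z1 w - step (zA w) (nn w)) \<le> wS * f1 w + h\<^sup>2 / 2 * f2 w + wC * f3 w + wY * f4 w
        + (h\<^sup>2 / 12 + \<gamma> * h\<^sup>2 / 32 / sqrt L) * f5 w + wA * f6 w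
        + (h * (L * h\<^sup>2 / 2) + sqrt L * h\<^sup>2 / 2) * speed (fst (zA w)) (Vp w)"
      using local_error[of "fst (zA w)" "Vs w" "gR (zA w) (nn w)" "gS (zA w) (nn w)" "gA (zA w) (nn w)" "om (nn w)" "xr (kx (fst (zA w)))"]
      unfolding f_defs wS_def wC_def wY_def wA_def Z1_def step_rv[of "zA w"] S_def Vp_def .
    \<comment> \<open>The speed contains both the velocity and \<open>h\<close> times the force, so
      the flow remainder feeds two weights; this is the origin of the summand \<open>wV * h\<close>
      in \<open>wF\<close>.\<close>
    moreover have "(h * (L * h\<^sup>2 / 2) + sqrt L * h\<^sup>2 / 2) * speed (fst (zA w)) (Vp w) = wV * f7 w + wV * h * f5 w"
      by (simp add: speed_def wV_def f5_def f7_def field_simps)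
    ultimately have "nab (Z1 w - step (zB w) (nn w)) \<le> wS * f1 w + (h\<^sup>2 / 2 * f2 w + (wC * f3 w + (wY * f4 w
        + (wF * f5 w + (wA * f6 w + (wV * f7 w + f8 w))))))"
      by (simp add: wF_def distrib_right)
    then have "ennreal (nab (Z1 w - step (zB w) (nn w))) \<le> ennreal \<dots>" by (rule ennreal_leI)
    then show ?thesis using w_nonneg f_nonneg[of w]
      by (simp only: ennreal_plus ennreal_mult mult_nonneg_nonneg add_nonneg_nonneg zero_le_power2 divide_nonneg_nonneg zero_le_numeral)
  qed
  \<comment> \<open>The terms \<open>f3\<close> to \<open>f7\<close> are estimated in mean square;
    \<open>f1\<close> and \<open>f2\<close> keep the exponent \<open>p\<close> and become the
    Wasserstein and the noise term of the bound.\<close>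
  have l2: "lp_norm p M (\<lambda>w. ennreal (f w)) \<le> B" if "f \<in> borel_measurable M" "lp_norm 2 M (\<lambda>w. ennreal (f w)) \<le> B" for f B
  proof -
    have "(\<lambda>w. ennreal (f w)) \<in> borel_measurable M" using that by simp
    from M.lp_norm_le_lp_norm_2[OF p this] that show ?thesis by simp
  qed
  have "distr M (borel \<Otimes>\<^sub>M borel) (\<lambda>w. (Z1 w, step (zB w) (nn w))) \<in> couplings (target V) \<pi>h"
    by (intro distr_in_couplings distr_eqI_nn_integral nn_integral_Z1 nn_integral_M_second)
       (simp_all add: pot.sets_target \<pi>h)
  note W = wasserstein_le[where N=nab, OF nab_nonneg p_pos this]
  have nm: "(\<lambda>z. ennreal (nab (fst z - snd z))) \<in> borel_measurable ((borel :: ((real ^ 'd) \<times> (real ^ 'd)) measure) \<Otimes>\<^sub>M borel)"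
    by measurable
  have pm: "(\<lambda>w. (Z1 w, step (zB w) (nn w))) \<in> measurable M (borel \<Otimes>\<^sub>M borel)" by measurable
  have "wasserstein nab p (target V) \<pi>h \<le> lp_norm p M (\<lambda>w. ennreal (nab (Z1 w - step (zB w) (nn w))))"
    using W unfolding lp_norm_distr[OF pm nm] by simp
  also have "\<dots> \<le> lp_norm p M (\<lambda>w. ennreal wS * ennreal (f1 w) + (ennreal (h\<^sup>2 / 2) * ennreal (f2 w) + (ennreal wC * ennreal (f3 w)
      + (ennreal wY * ennreal (f4 w) + (ennreal wF * ennreal (f5 w) + (ennreal wA * ennreal (f6 w)
      + (ennreal wV * ennreal (f7 w) + ennreal (f8 w))))))))"
    by (rule lp_norm_mono[OF p_pos pw])
  also have "\<dots> \<le> ennreal wS * lp_norm p (gibbs V) (\<lambda>x. ennreal \<delta> + J (kx x)) + (ennreal (h\<^sup>2 / 2) * gradient_noise p V G \<Gamma>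
      + (ennreal wC * ennreal (sqrt C * \<delta>) + (ennreal wY * ennreal (sqrt C * (h / 2 * sqrt CARD('d)))
      + (ennreal wF * ennreal (5 * sqrt L * sqrt CARD('d)) + (ennreal wA * ennreal (h / 2 * sqrt CARD('d))
      + (ennreal wV * ennreal (sqrt CARD('d)) + ennreal (1 - rate C) * lp_norm p \<tau> (\<lambda>z. ennreal (nab (fst z - snd z)))))))))"
  proof (intro lp_norm_add_le[OF p] lp_norm_cmult_le[OF p])
    show "lp_norm p M (\<lambda>w. ennreal (f1 w)) \<le> lp_norm p (gibbs V) (\<lambda>x. ennreal \<delta> + J (kx x))"
      unfolding f1_def by (rule lp_partner)
    show "lp_norm p M (\<lambda>w. ennreal (f2 w)) \<le> gradient_noise p V G \<Gamma>"
      unfolding f2_def lp_noise ..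
    show "lp_norm p M (\<lambda>w. ennreal (f3 w)) \<le> ennreal (sqrt C * \<delta>)"
      by (rule l2[OF fm(3)]) (unfold f3_def, rule lp2_noise_cell)
    show "lp_norm p M (\<lambda>w. ennreal (f4 w)) \<le> ennreal (sqrt C * (h / 2 * sqrt CARD('d)))"
      by (rule l2[OF fm(4)]) (unfold f4_def, rule lp2_noise_half)
    show "lp_norm p M (\<lambda>w. ennreal (f5 w)) \<le> ennreal (5 * sqrt L * sqrt CARD('d))"
      by (rule l2[OF fm(5)]) (unfold f5_def, rule lp2_force)
    show "lp_norm p M (\<lambda>w. ennreal (f6 w)) \<le> ennreal (h / 2 * sqrt CARD('d))"
      by (rule l2[OF fm(6)]) (unfold f6_def, rule lp2_half)
    show "lp_norm p M (\<lambda>w. ennreal (f7 w)) \<le> ennreal (sqrt CARD('d))"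
      by (rule l2[OF fm(7)]) (unfold f7_def, rule lp2_Vp)
    show "lp_norm p M (\<lambda>w. ennreal (f8 w)) \<le> ennreal (1 - rate C) * lp_norm p \<tau> (\<lambda>z. ennreal (nab (fst z - snd z)))"
      unfolding f8_def by (rule lp_contraction)
  qed measurable
  finally show ?thesis
    using w_nonneg(2) unfolding ennreal_step_error[symmetric] by (simp add: ennreal_mult' add.assoc)
qed

end

section \<open>Removing the discretisation, finiteness, and constants\<close>

lemma exists_near_minimum:
  fixes f :: "'a \<Rightarrow> ennreal"
  assumes "S \<noteq> {}" "0 < \<delta>"
  obtains x where "x \<in> S" "\<And>y. y \<in> S \<Longrightarrow> f x \<le> f y + ennreal \<delta>"
proof (cases "(INF x\<in>S. f x) = \<infinity>")
  case True
  obtain x where "x \<in> S" using assms by blast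
  moreover have "f y = \<infinity>" if "y \<in> S" for y
    using INF_lower[OF that, of f] True by (simp add: top_unique)
  ultimately show ?thesis using that by auto
next
  case False
  then have "(INF x\<in>S. f x) < (INF x\<in>S. f x) + ennreal \<delta>"
    using assms(2) by (simp add: less_top)
  then obtain x where "x \<in> S" "f x < (INF x\<in>S. f x) + ennreal \<delta>" by (auto simp: INF_less_iff)
  moreover have "f x \<le> f y + ennreal \<delta>" if "y \<in> S" for y
    using calculation(2) INF_lower[OF that, of f] by (meson add_mono less_imp_le order.refl order_trans)
  ultimately show ?thesis using that by blast
qed

context sg_ubu
begin

definition W_noise :: "real ^ 'd \<Rightarrow> ennreal" where
  "W_noise x = wasserstein norm p (perturbed x) gauss"

lemma obtain_noise_coupling:
  assumes "0 < \<delta>"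
  obtains c where "c \<in> couplings (perturbed x) gauss"
    "lp_norm p c (\<lambda>z. ennreal (norm (fst z - snd z))) \<le> W_noise x + ennreal \<delta>"
proof (cases "W_noise x = \<infinity>")
  case True
  then show ?thesis
    using pair_measure_in_couplings[OF prob_space_perturbed prob_space_std_gaussian] by (intro that) auto
next
  case False
  then have "wasserstein norm p (perturbed x) gauss < W_noise x + ennreal \<delta>"
    unfolding W_noise_def using assms by (simp add: less_top)
  then show ?thesis
    by (rule wasserstein_less[OF norm_ge_zero p_pos]) (rule that, assumption, erule less_imp_le)
qed

text \<open>In every cell the representative nearly minimises \<open>W_noise\<close>. The coupling
  cost at the representative is then at most \<open>W_noise x + 2 * \<delta>\<close> for every
  \<open>x\<close> of the cell, a one-sided bound that takes the place of continuity in
  \<open>x\<close>.\<close>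

lemma wasserstein_step:
  assumes \<pi>h: "prob_space \<pi>h" "sets \<pi>h = sets borel" "invariant_measure (sg_ubu_kernel \<gamma> h G \<Gamma>) \<pi>h"
    and \<tau>: "\<tau> \<in> couplings (target V) \<pi>h" and \<epsilon>: "0 < \<epsilon>"
  shows "wasserstein nab p (target V) \<pi>h
    \<le> ennreal wS * lp_norm p (gibbs V) W_noise + ennreal (h\<^sup>2 / 2) * gradient_noise p V G \<Gamma> + ennreal step_error
      + ennreal \<epsilon> + ennreal (1 - rate C) * lp_norm p \<tau> (\<lambda>z. ennreal (nab (fst z - snd z)))"
proof -
  \<comment> \<open>Chosen so that all discretisation errors together stay below
    \<open>\<epsilon>\<close>: three cell diameters in the mismatch and one in the noise. The
    summand 1 keeps it positive.\<close>
  define D where "D = 3 * wS + wC * sqrt C + 1"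
  define \<delta> where "\<delta> = \<epsilon> / D"
  have D: "0 < D" using w_nonneg C by (simp add: D_def add_nonneg_pos)
  have \<delta>: "0 < \<delta>" using D \<epsilon> by (simp add: \<delta>_def)
  have \<delta>_\<epsilon>: "wS * (3 * \<delta>) + wC * (sqrt C * \<delta>) \<le> \<epsilon>"
  proof -
    have "\<epsilon> = D * \<delta>" using D by (simp add: \<delta>_def)
    then show ?thesis using \<delta> by (simp add: D_def algebra_simps)
  qed
  obtain k :: "real ^ 'd \<Rightarrow> nat" where k[measurable]: "k \<in> measurable borel (count_space UNIV)"
    and k_cell: "\<And>x y. k x = k y \<Longrightarrow> dist x y < \<delta>" by (rule obtain_cells[OF \<delta>]) (rule that, assumption, blast)
  have "\<forall>i. \<exists>x. \<forall>y. k y = i \<longrightarrow> k x = i \<and> W_noise x \<le> W_noise y + ennreal \<delta>"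
  proof
    fix i
    show "\<exists>x. \<forall>y. k y = i \<longrightarrow> k x = i \<and> W_noise x \<le> W_noise y + ennreal \<delta>"
    proof (cases "{y. k y = i} = {}")
      case False
      show ?thesis
        by (rule exists_near_minimum[OF False \<delta>, of W_noise]) blast
    qed auto
  qed
  from choice[OF this]
  obtain xr where "\<forall>i y. k y = i \<longrightarrow> k (xr i) = i \<and> W_noise (xr i) \<le> W_noise y + ennreal \<delta>" ..
  then have xr: "k (xr i) = i" "W_noise (xr i) \<le> W_noise y + ennreal \<delta>" if "k y = i" for i y
    using that by blast+
  have "\<forall>i. \<exists>c. c \<in> couplings (perturbed (xr i)) gauss \<and>
      lp_norm p c (\<lambda>z. ennreal (norm (fst z - snd z))) \<le> W_noise (xr i) + ennreal \<delta>"
    by (rule allI, rule obtain_noise_coupling[OF \<delta>]) blast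
  from choice[OF this] obtain cpl where "\<forall>i. cpl i \<in> couplings (perturbed (xr i)) gauss \<and>
      lp_norm p (cpl i) (\<lambda>z. ennreal (norm (fst z - snd z))) \<le> W_noise (xr i) + ennreal \<delta>" ..
  then have cpl: "cpl i \<in> couplings (perturbed (xr i)) gauss"
    "lp_norm p (cpl i) (\<lambda>z. ennreal (norm (fst z - snd z))) \<le> W_noise (xr i) + ennreal \<delta>" for i
    by blast+
  have xr_near: "dist x (xr (k x)) < \<delta>" for x using k_cell[OF xr(1)[OF refl, symmetric]] .
  \<comment> \<open>The same partition serves for the positions and for the perturbed
    Gaussians.\<close>
  interpret c: sg_coupling V m L \<gamma> h G \<Gamma> C p \<pi>h \<tau> \<delta> k k xr cpl
    by (rule sg_coupling.intro[OF sg_ubu_axioms sg_coupling_axioms.intro[OF \<pi>h \<tau> \<delta> k k k_cell xr_near cpl(1)]])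
  \<comment> \<open>Truncated subtraction gives a measurable minorant of \<open>W_noise\<close>.
    Minkowski's inequality is applied to this minorant, and \<open>W_noise\<close> itself enters
    only through monotonicity.\<close>
  have J: "c.J (k x) - ennreal (2 * \<delta>) \<le> W_noise x" for x
  proof -
    have "c.J (k x) \<le> W_noise (xr (k x)) + ennreal \<delta>" unfolding c.J_def by (rule cpl)
    also have "\<dots> \<le> W_noise x + ennreal \<delta> + ennreal \<delta>" by (rule add_right_mono[OF xr(2)[OF refl]])
    also have "\<dots> = W_noise x + ennreal (2 * \<delta>)" using \<delta> by (simp add: add.assoc ennreal_plus[symmetric] del: ennreal_plus)
    finally show ?thesis by (simp add: ennreal_minus_le_iff add.commute)
  qed
  have "lp_norm p (gibbs V) (\<lambda>x. ennreal \<delta> + c.J (k x))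
    \<le> lp_norm p (gibbs V) (\<lambda>x. ennreal (3 * \<delta>) + (c.J (k x) - ennreal (2 * \<delta>)))"
  proof (rule lp_norm_mono[OF p_pos])
    fix x
    have "c.J (k x) \<le> ennreal (2 * \<delta>) + (c.J (k x) - ennreal (2 * \<delta>))"
      by (rule ennreal_minus_le_iff[THEN iffD1, OF order.refl, THEN conjunct1])
    then have "ennreal \<delta> + c.J (k x) \<le> ennreal \<delta> + (ennreal (2 * \<delta>) + (c.J (k x) - ennreal (2 * \<delta>)))"
      by (rule add_left_mono)
    also have "\<dots> = ennreal (3 * \<delta>) + (c.J (k x) - ennreal (2 * \<delta>))"
      using \<delta> by (simp add: add.assoc[symmetric] ennreal_plus[symmetric] del: ennreal_plus)
    finally show "ennreal \<delta> + c.J (k x) \<le> ennreal (3 * \<delta>) + (c.J (k x) - ennreal (2 * \<delta>))" .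
  qed
  also have "\<dots> \<le> ennreal (3 * \<delta>) + lp_norm p (gibbs V) W_noise"
  proof (rule lp_norm_add_le[OF p])
    show "(\<lambda>x. c.J (k x) - ennreal (2 * \<delta>)) \<in> borel_measurable (gibbs V)"
      by (rule measurable_compose[where N="count_space UNIV"])
         (simp_all add: measurable_cong_sets[OF pot.sets_gibbs refl])
    show "lp_norm p (gibbs V) (\<lambda>x. c.J (k x) - ennreal (2 * \<delta>)) \<le> lp_norm p (gibbs V) W_noise"
      by (rule lp_norm_mono[OF p_pos J])
  qed (simp_all add: pot.\<pi>.lp_norm_const p_pos)
  finally have J_norm: "ennreal wS * lp_norm p (gibbs V) (\<lambda>x. ennreal \<delta> + c.J (k x))
      \<le> ennreal (wS * (3 * \<delta>)) + ennreal wS * lp_norm p (gibbs V) W_noise"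
    using w_nonneg(1) \<delta> by (simp add: ennreal_mult mult_left_mono flip: distrib_left)
  have close_\<epsilon>: "ennreal (wS * (3 * \<delta>)) + ennreal (wC * (sqrt C * \<delta>)) \<le> ennreal \<epsilon>"
    using \<delta>_\<epsilon> w_nonneg \<delta> C by (simp add: ennreal_plus[symmetric] ennreal_leI del: ennreal_plus)
  have "ennreal wS * lp_norm p (gibbs V) (\<lambda>x. ennreal \<delta> + c.J (k x)) + ennreal (wC * (sqrt C * \<delta>))
    \<le> (ennreal (wS * (3 * \<delta>)) + ennreal (wC * (sqrt C * \<delta>))) + ennreal wS * lp_norm p (gibbs V) W_noise"
    using add_right_mono[OF J_norm, of "ennreal (wC * (sqrt C * \<delta>))"] by (simp only: ac_simps)
  also have "\<dots> \<le> ennreal \<epsilon> + ennreal wS * lp_norm p (gibbs V) W_noise"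
    by (rule add_right_mono[OF close_\<epsilon>])
  finally have close: "ennreal wS * lp_norm p (gibbs V) (\<lambda>x. ennreal \<delta> + c.J (k x)) + ennreal (wC * (sqrt C * \<delta>))
    \<le> ennreal wS * lp_norm p (gibbs V) W_noise + ennreal \<epsilon>" by (simp only: ac_simps)
  let ?T = "ennreal (1 - rate C) * lp_norm p \<tau> (\<lambda>z. ennreal (nab (fst z - snd z)))"
  let ?N = "ennreal (h\<^sup>2 / 2) * gradient_noise p V G \<Gamma>"
  have "wasserstein nab p (target V) \<pi>h \<le> (ennreal wS * lp_norm p (gibbs V) (\<lambda>x. ennreal \<delta> + c.J (k x))
      + ennreal (wC * (sqrt C * \<delta>))) + (?N + ennreal step_error + ?T)"
    using c.wasserstein_improvement by (simp only: ac_simps)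
  also have "\<dots> \<le> (ennreal wS * lp_norm p (gibbs V) W_noise + ennreal \<epsilon>) + (?N + ennreal step_error + ?T)"
    by (rule add_right_mono[OF close])
  finally show ?thesis by (simp only: ac_simps)
qed

text \<open>The product coupling already has finite cost, by the second moments of both marginals.
  This supplies the finiteness required for the fixed-point argument.\<close>

lemma wasserstein_finite:
  assumes "\<pi>h \<in> P2"
  shows "wasserstein nab p (target V) \<pi>h < \<infinity>"
proof -
  have P: "prob_space (target V)" "prob_space \<pi>h" using pot.prob_space_target assms by (auto simp: P2_def)
  have s: "sets \<pi>h = sets borel" using assms by (simp add: P2_def)
  let ?\<tau> = "target V \<Otimes>\<^sub>M \<pi>h"
  have c: "?\<tau> \<in> couplings (target V) \<pi>h" by (rule pair_measure_in_couplings[OF P])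
  interpret \<tau>: prob_space ?\<tau> by (rule prob_space_couplings[OF c P(1)])
  have [measurable_cong]: "sets ?\<tau> = sets (borel \<Otimes>\<^sub>M borel)"
    using s pot.sets_target by (rule sets_pair_measure_cong[rotated])
  have \<tau>m: "(\<lambda>z. ennreal (norm (fst z))) \<in> borel_measurable ?\<tau>" "(\<lambda>z. ennreal (norm (snd z))) \<in> borel_measurable ?\<tau>"
    by measurable
  have fin: "lp_norm 2 \<mu> (\<lambda>z. ennreal (norm z)) < \<infinity>" if "\<mu> \<in> P2" for \<mu> :: "((real ^ 'd) \<times> (real ^ 'd)) measure"
  proof -
    have "lp_norm 2 \<mu> (\<lambda>z. ennreal (norm z)) ^ 2 < \<infinity>"
      using that by (simp add: lp_norm_power P2_def ennreal_power)
    then show ?thesis by (simp add: power_less_top_ennreal)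
  qed
  define K where "K = 1 + 1 / sqrt L"
  have K: "0 \<le> K" using L_pos by (simp add: K_def)
  have nab_K: "nab z \<le> K * norm z" for z :: "(real ^ 'd) \<times> (real ^ 'd)"
  proof -
    obtain x v where z: "z = (x, v)" by force
    have "nab z \<le> norm x + norm v / sqrt L" unfolding z by (rule nab_le)
    also have "\<dots> \<le> norm z + norm z / sqrt L"
      using norm_fst_le[of x v] norm_snd_le[of v x] L_pos by (intro add_mono divide_right_mono) (auto simp: z)
    finally show ?thesis by (simp add: K_def distrib_right)
  qed
  have "wasserstein nab p (target V) \<pi>h \<le> lp_norm p ?\<tau> (\<lambda>z. ennreal (nab (fst z - snd z)))"
    by (rule wasserstein_le[OF nab_nonneg p_pos c])
  also have "\<dots> \<le> lp_norm 2 ?\<tau> (\<lambda>z. ennreal (nab (fst z - snd z)))"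
    by (rule \<tau>.lp_norm_le_lp_norm_2[OF p]) measurable
  also have "\<dots> \<le> lp_norm 2 ?\<tau> (\<lambda>z. ennreal K * ennreal (norm (fst z)) + ennreal K * ennreal (norm (snd z)))"
  proof (rule lp_norm_mono)
    fix z :: "((real ^ 'd) \<times> (real ^ 'd)) \<times> (real ^ 'd) \<times> (real ^ 'd)"
    have "nab (fst z - snd z) \<le> K * (norm (fst z) + norm (snd z))"
      using nab_K[of "fst z - snd z"] mult_left_mono[OF norm_triangle_ineq4 K, of "fst z" "snd z"] by linarith
    then show "ennreal (nab (fst z - snd z)) \<le> ennreal K * ennreal (norm (fst z)) + ennreal K * ennreal (norm (snd z))"
      using K by (simp add: ennreal_mult[symmetric] ennreal_plus[symmetric] distrib_left ennreal_leI del: ennreal_plus)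
  qed simp
  also have "\<dots> \<le> ennreal K * lp_norm 2 (target V) (\<lambda>z. ennreal (norm z)) + ennreal K * lp_norm 2 \<pi>h (\<lambda>z. ennreal (norm z))"
  proof (intro lp_norm_add_le lp_norm_cmult_le)
    have m: "(\<lambda>z. ennreal (norm z) ^ 2) \<in> borel_measurable (target V)" "(\<lambda>z. ennreal (norm z) ^ 2) \<in> borel_measurable \<pi>h"
      by (simp_all add: measurable_cong_sets[OF s refl] measurable_cong_sets[OF pot.sets_target refl])
    show "lp_norm 2 ?\<tau> (\<lambda>z. ennreal (norm (fst z))) \<le> lp_norm 2 (target V) (\<lambda>z. ennreal (norm z))"
      "lp_norm 2 ?\<tau> (\<lambda>z. ennreal (norm (snd z))) \<le> lp_norm 2 \<pi>h (\<lambda>z. ennreal (norm z))"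
      unfolding lp_norm_def using nn_integral_couplings(1)[OF c m(1)] nn_integral_couplings(2)[OF c m(2)] by simp_all
  qed (simp_all add: \<tau>m)
  also have "\<dots> < \<infinity>" using fin[OF pot.target_P2] fin[OF assms] by (simp add: ennreal_mult_less_top)
  finally show ?thesis .
qed

text \<open>In units of \<open>h\<^sup>2 / 4\<close> the error is a sum of terms in
  \<open>sqrt L\<close> and \<open>\<gamma>\<close> with bounded factors in
  \<open>h * sqrt L\<close>. The constant 24/7 is 4 times the 6/7 reached below.\<close>

lemma step_error_le:
  "step_error * (4 / h\<^sup>2) \<le> 24 / 7 * sqrt CARD('d) * (sqrt L + \<gamma>) + 4 * sqrt C * sqrt CARD('d) / sqrt L"
proof -
  define s where "s = sqrt L"
  define q where "q = sqrt CARD('d)"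
  have s: "0 < s" "L = s\<^sup>2" "h * s \<le> 9 / 50" "s \<le> 9 / 25 * \<gamma>"
    using L_pos hL_bounds by (simp_all add: s_def)
  have q: "0 \<le> q" by (simp add: q_def)
  have hs: "0 < h * s" using h s by simp
  have e: "step_error * (4 / h\<^sup>2) = 4 * q * sqrt C * (h * s / 4 + 1 / 2) / s
      + 4 * q * (5 / 12 * s + 5 / 32 * \<gamma> + 64 / 63 * (s / 2 * (1 + h * s) * (5 * (h * s) + 1)) + s / 2 * (h * s / 2 + 1))"
    using h s(1) unfolding step_error_def wY_def wF_def wA_def wV_def
    unfolding q_def[symmetric] s_def[symmetric] unfolding s(2)
    by (simp add: field_simps power2_eq_square)
  have "4 * q * sqrt C * (h * s / 4 + 1 / 2) / s \<le> 4 * q * sqrt C * 1 / s"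
    using s q C by (intro divide_right_mono mult_left_mono) auto
  moreover have "4 * q * (5 / 12 * s + 5 / 32 * \<gamma> + 64 / 63 * (s / 2 * (1 + h * s) * (5 * (h * s) + 1)) + s / 2 * (h * s / 2 + 1))
      \<le> 4 * q * (6 / 7 * (s + \<gamma>))"
  proof (rule mult_left_mono)
    have sum: "5 / 12 * s + 5 / 32 * \<gamma> + 64 / 63 * X + Y \<le> 6 / 7 * (s + \<gamma>)"
      if "X \<le> 1121 / 1000 * s" "Y \<le> 109 / 200 * s" for X Y
      using that s(1,4) by simp
    have "(1 + h * s) * (5 * (h * s) + 1) \<le> (59 / 50) * (19 / 10)" using s(3) hs by (intro mult_mono) auto
    then have "s / 2 * ((1 + h * s) * (5 * (h * s) + 1)) \<le> s / 2 * ((59 / 50) * (19 / 10))"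
      using s(1) by (intro mult_left_mono) auto
    then have "s / 2 * (1 + h * s) * (5 * (h * s) + 1) \<le> 1121 / 1000 * s" by (simp add: mult.assoc)
    moreover have "s / 2 * (h * s / 2 + 1) \<le> 109 / 200 * s"
      using s mult_left_mono[of "h * s / 2 + 1" "109 / 100" "s / 2"] by simp
    ultimately show "5 / 12 * s + 5 / 32 * \<gamma> + 64 / 63 * (s / 2 * (1 + h * s) * (5 * (h * s) + 1)) + s / 2 * (h * s / 2 + 1)
        \<le> 6 / 7 * (s + \<gamma>)"
      by (rule sum)
  qed (use q in simp)
  ultimately have "step_error * (4 / h\<^sup>2) \<le> 4 * q * sqrt C * 1 / s + 4 * q * (6 / 7 * (s + \<gamma>))"
    unfolding e by (rule add_mono)
  then show ?thesis unfolding s_def[symmetric] q_def[symmetric] by (simp add: algebra_simps)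
qed

text \<open>Dividing the one-step error by the rate costs at most the factor
  \<open>Q * (4 / h\<^sup>2)\<close>. It cancels the \<open>h\<^sup>2\<close> of the local error and
  of the noise, whereas the Gaussian mismatch, whose weight \<open>wS\<close> does not vanish with
  \<open>h\<close>, keeps the inverse \<open>h\<^sup>2\<close>.\<close>

lemma invariant_measure_bound:
  assumes \<pi>h: "\<pi>h \<in> P2" "invariant_measure (sg_ubu_kernel \<gamma> h G \<Gamma>) \<pi>h"
    and stab: "0 < m * L - 32 / 7 * h * C * \<gamma>"
  shows "wasserstein nab p (target V) \<pi>h
    \<le> ennreal (\<gamma> * L * h / (m * L - 32 / 7 * h * C * \<gamma>)) *
      (ennreal (24 / 7 * sqrt CARD('d) * (sqrt L + \<gamma>)) + ennreal (4 * sqrt C * sqrt CARD('d) / sqrt L)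
       + 4 * gradient_noise p V G \<Gamma> + 9 * lp_norm p (gibbs V) W_noise / ennreal (h\<^sup>2 * sqrt L))"
proof -
  let ?W = "lp_norm p (gibbs V) W_noise" and ?\<sigma> = "gradient_noise p V G \<Gamma>"
  define E where "E = ennreal wS * ?W + ennreal (h\<^sup>2 / 2) * ?\<sigma> + ennreal step_error"
  define Q where "Q = \<gamma> * L * h / (m * L - 32 / 7 * h * C * \<gamma>)"
  have Q: "0 < Q" using \<gamma> h L_pos stab by (simp add: Q_def)
  \<comment> \<open>This differs from \<open>rate C\<close> only in the noise term, which is
    doubled; hence \<open>Q * (4 / h\<^sup>2)\<close> dominates the inverse of the rate.\<close>
  have "h\<^sup>2 / (4 * Q) = m * h / (4 * \<gamma>) - 8 / 7 * (h\<^sup>2 * C / L)"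
    using stab \<gamma> h L_pos by (simp add: Q_def field_simps power2_eq_square)
  also have "\<dots> \<le> rate C" using C L_pos by (simp add: rate_def divide_right_mono)
  finally have rate: "h\<^sup>2 / (4 * Q) \<le> rate C" .
  moreover have hQ: "0 < h\<^sup>2 / (4 * Q)" using h Q by simp
  ultimately have rate_pos: "0 < rate C" by linarith
  have "1 / rate C \<le> 1 / (h\<^sup>2 / (4 * Q))" using rate hQ by (intro frac_le) auto
  then have inv: "1 / rate C \<le> Q * (4 / h\<^sup>2)" by (simp add: mult.commute)
  have pr: "prob_space \<pi>h" "sets \<pi>h = sets borel" using \<pi>h by (auto simp: P2_def)
  have "wasserstein nab p (target V) \<pi>h \<le> E / ennreal (rate C)"
    using wasserstein_step[OF pr \<pi>h(2)] rate_le[OF C] unfolding E_def[symmetric]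
    by (intro wasserstein_le_of_improvement[OF nab_nonneg p_pos rate_pos _ wasserstein_finite[OF \<pi>h(1)]]) auto
  also have "\<dots> = E * ennreal (1 / rate C)"
    using rate_pos by (simp add: divide_ennreal_def inverse_ennreal divide_inverse)
  also have "\<dots> \<le> E * ennreal (Q * (4 / h\<^sup>2))" by (intro mult_left_mono ennreal_leI inv) auto
  also have "\<dots> = ennreal Q * (ennreal (4 / h\<^sup>2) * E)" 
  proof -
    have "ennreal (Q * (4 / h\<^sup>2)) = ennreal Q * ennreal (4 / h\<^sup>2)" using Q by (intro ennreal_mult) auto
    then show ?thesis by (simp only: mult_ac)
  qed
  also have "\<dots> \<le> ennreal Q * (ennreal (24 / 7 * sqrt CARD('d) * (sqrt L + \<gamma>)) + ennreal (4 * sqrt C * sqrt CARD('d) / sqrt L)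
       + 4 * ?\<sigma> + 9 * ?W / ennreal (h\<^sup>2 * sqrt L))"
  proof (rule mult_left_mono)
    \<comment> \<open>Over the common denominator this is
      \<open>4 * (h * sqrt L) + 4 <= 9\<close>.\<close>
    have "4 / h\<^sup>2 * wS \<le> 9 / (h\<^sup>2 * sqrt L)"
    proof -
      have "4 / h\<^sup>2 * wS = (4 * (h * sqrt L) + 4) / (h\<^sup>2 * sqrt L)"
        using h L_pos by (simp add: wS_def field_simps)
      also have "\<dots> \<le> 9 / (h\<^sup>2 * sqrt L)" using hL_bounds(1) h L_pos by (intro divide_right_mono) auto
      finally show ?thesis .
    qed
    then have "ennreal (4 / h\<^sup>2 * wS) * ?W \<le> ennreal (9 / (h\<^sup>2 * sqrt L)) * ?W"
      by (intro mult_right_mono ennreal_leI) auto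
    also have "\<dots> = 9 * ?W / ennreal (h\<^sup>2 * sqrt L)"
    proof -
      have "ennreal (9 / (h\<^sup>2 * sqrt L)) = 9 / ennreal (h\<^sup>2 * sqrt L)"
        using h L_pos divide_ennreal[of 9 "h\<^sup>2 * sqrt L"] by simp
      then show ?thesis by (simp add: divide_ennreal_def mult_ac)
    qed
    finally have a: "ennreal (4 / h\<^sup>2 * wS) * ?W \<le> 9 * ?W / ennreal (h\<^sup>2 * sqrt L)" .
    have "ennreal (4 / h\<^sup>2 * (h\<^sup>2 / 2)) * ?\<sigma> \<le> 4 * ?\<sigma>"
    proof (rule mult_right_mono)
      have "4 / h\<^sup>2 * (h\<^sup>2 / 2) \<le> 4" using h by simp
      then show "ennreal (4 / h\<^sup>2 * (h\<^sup>2 / 2)) \<le> 4" using ennreal_leI[of _ 4] by simp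
    qed simp
    moreover have "ennreal (4 / h\<^sup>2 * step_error)
      \<le> ennreal (24 / 7 * sqrt CARD('d) * (sqrt L + \<gamma>)) + ennreal (4 * sqrt C * sqrt CARD('d) / sqrt L)"
      using ennreal_leI[OF step_error_le] L_pos \<gamma> C by (simp add: mult.commute[of _ step_error] ennreal_plus)
    moreover have "ennreal (4 / h\<^sup>2) * E = ennreal (4 / h\<^sup>2 * step_error) + ennreal (4 / h\<^sup>2 * (h\<^sup>2 / 2)) * ?\<sigma> + ennreal (4 / h\<^sup>2 * wS) * ?W"
    proof -
      have "ennreal (4 / h\<^sup>2 * x) = ennreal (4 / h\<^sup>2) * ennreal x" for x by (rule ennreal_mult') simp
      then show ?thesis by (simp only: E_def distrib_left mult.assoc ac_simps)
    qed
    ultimately show "ennreal (4 / h\<^sup>2) * E \<le> ennreal (24 / 7 * sqrt CARD('d) * (sqrt L + \<gamma>)) + ennreal (4 * sqrt C * sqrt CARD('d) / sqrt L)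
       + 4 * ?\<sigma> + 9 * ?W / ennreal (h\<^sup>2 * sqrt L)"
      using a by (simp add: add_mono)
  qed simp
  finally show ?thesis unfolding Q_def .
qed

end

theorem theorem2p15:
  fixes V :: "real ^ 'd \<Rightarrow> real"
    and G :: "real ^ 'd \<Rightarrow> 'w::polish_space \<Rightarrow> real ^ 'd"
    and \<Gamma> :: "'w measure"
    and m L C\<^sub>G \<gamma> a b h :: real
    and p :: nat
    and \<pi>\<^sub>h :: "((real ^ 'd) \<times> (real ^ 'd)) measure"
  assumes "C2_function V"
    and "0 < m" and "m \<le> L"
    and "\<And>x. loewner_le (\<lambda>u. m *\<^sub>R u) (hessian V x)"
    and "\<And>x. loewner_le (hessian V x) (\<lambda>u. L *\<^sub>R u)"
    and "stochastic_gradient V G \<Gamma>"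
    and "0 \<le> C\<^sub>G" and "bounded_jacobian_variance V G \<Gamma> C\<^sub>G"
    and "\<gamma> \<ge> sqrt (8 * L)" and "a = 1 / L" and "b = 1 / \<gamma>"
    and "p \<in> {1, 2}" and "gradient_noise p V G \<Gamma> < \<infinity>"
    and "0 < h"
    and "h < (if C\<^sub>G = 0 then 1 / (2 * \<gamma>)
              else min (1 / (2 * \<gamma>)) (7 * m * L / (32 * C\<^sub>G * \<gamma>)))"
    and "\<pi>\<^sub>h \<in> P2" and "invariant_measure (sg_ubu_kernel \<gamma> h G \<Gamma>) \<pi>\<^sub>h"
  shows "wasserstein (norm_ab a b) p (target V) \<pi>\<^sub>h
    \<le> ennreal (\<gamma> * L * h / (m * L - 32 / 7 * h * C\<^sub>G * \<gamma>)) *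
      (ennreal (24 / 7 * sqrt CARD('d) * (sqrt L + \<gamma>))
       + ennreal (4 * sqrt C\<^sub>G * sqrt CARD('d) / sqrt L)
       + 4 * gradient_noise p V G \<Gamma>
       + 9 * ennreal_root p
           (\<integral>\<^sup>+ x. wasserstein norm p
               (convolution (scaled_noise_law \<gamma> h V G \<Gamma> x) std_gaussian) std_gaussian ^ p
             \<partial>target_marginal V)
         / ennreal (h\<^sup>2 * sqrt L))"
proof -
  have L: "0 < L" using assms(2,3) by simp
  have \<gamma>: "0 < \<gamma>" using assms(9) L by (meson less_le_trans mult_pos_pos real_sqrt_gt_zero zero_less_numeral)
  have "h < 1 / (2 * \<gamma>)" using assms(15) by (auto split: if_splits)
  then have h\<gamma>: "h * \<gamma> \<le> 1 / 2" using \<gamma> by (simp add: field_simps)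
  have "(sqrt (8 * L))\<^sup>2 \<le> \<gamma>\<^sup>2" using assms(9) L by (intro power_mono) auto
  then have friction: "8 * L \<le> \<gamma>\<^sup>2" using L by simp
  interpret convex_potential V "gradient V" m L
    by (rule convex_potential_of_C2) (use assms in auto)
  interpret gaussian_target V "gradient V" m L by unfold_locales
  interpret sg_ubu V m L \<gamma> h G \<Gamma> C\<^sub>G p
    by unfold_locales (use assms \<gamma> h\<gamma> friction in auto)
  \<comment> \<open>For positive \<open>C\<^sub>G\<close> the second upper bound on \<open>h\<close>
    is equivalent to positivity of this denominator; otherwise the denominator is
    \<open>m * L\<close>.\<close>
  have stab: "0 < m * L - 32 / 7 * h * C\<^sub>G * \<gamma>"
  proof (cases "C\<^sub>G = 0")
    case True
    then show ?thesis using assms(2) L by simp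
  next
    case False
    then have "h < 7 * m * L / (32 * C\<^sub>G * \<gamma>)" "0 < C\<^sub>G" using assms(7,15) by auto
    then show ?thesis using \<gamma> by (simp add: field_simps)
  qed
  show ?thesis
    using invariant_measure_bound[OF assms(16,17) stab]
    by (simp add: nab_def assms(10,11) target_marginal_eq lp_norm_def W_noise_def)
qed

end
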